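(* Let $\mathcal G$ be a locally compact étale groupoid such that either $\mathcal G$ is Hausdorff or $\mathcal G$ can be covered by countably many open bisections. Assume that the set $$X:=\{x\in\mathcal G^{(0)}\mid \mathcal G^x_x\ \text{is C}^*\text{-simple and}\ C^*_e(\mathcal G^x_x)=C^*_r(\mathcal G^x_x)\}$$ is dense in $\mathcal G^{(0)}$. Then $I\subset J_{\mathrm{sing}}$ for any ideal $I\subset C^*_r(\mathcal G)$ with $U(I)=\emptyset$, that is, with $C_0(\mathcal G^{(0)})\cap I=0$.
   Context: Groupoids. $\mathcal G$ is a groupoid with unit space $\mathcal G^{(0)}$, range $r(g)=gg^{-1}$ and source $s(g)=g^{-1}g$; $\mathcal G_x=s^{-1}(x)$, $\mathcal G^x=r^{-1}(x)$, and $\mathcal G^x_x=\mathcal G_x\cap\mathcal G^x$ is the isotropy group at $x$. A locally compact étale groupoid is a groupoid with a (not necessarily Hausdorff) topology such that the groupoid operations are continuous, $\mathcal G^{(0)}$ is a locally compact Hausdorff space in the relative topology, and $r$ is a local homeomorphism. A bisection is a subset $W\subset\mathcal G$ such that $r|_W\colon W\to r(W)$ and $s|_W\colon W\to s(W)$ are bijections. $C_c(\mathcal G)$ is the linear span of the functions $f$ on $\mathcal G$ that vanish outside some open Hausdorff subset $W\subset\mathcal G$ and whose restriction to $W$ is continuous and compactly supported; it is a $*$-algebra with $(f_1*f_2)(g)=\sum_{h\in\mathcal G^{r(g)}}f_1(h)f_2(h^{-1}g)$ and $f^*(g)=\overline{f(g^{-1})}$. For $x\in\mathcal G^{(0)}$,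 $\rho_x\colon C_c(\mathcal G)\to B(\ell^2(\mathcal G_x))$ is $\rho_x(f)\delta_g=\sum_{h\in\mathcal G_{r(g)}}f(h)\delta_{hg}$. $C^*_r(\mathcal G)$ is the completion of $C_c(\mathcal G)$ in the reduced norm $\|f\|_r=\sup_{x}\|\rho_x(f)\|$; each $\rho_x$ extends to $C^*_r(\mathcal G)$. Ideals are closed and two-sided. For an ideal $I\subset C^*_r(\mathcal G)$, $U(I)\subset\mathcal G^{(0)}$ is the open set with $C_0(\mathcal G^{(0)})\cap I=C_0(U(I))$. The group C$^*$-algebra $C^*_e(\mathcal G^x_x)$. For a unitary representation $\pi$ of $\mathcal G^x_x$ on $H$, $\mathrm{Ind}\,\pi$ is the representation of $C_c(\mathcal G)$ on the Hilbert space $\mathrm{Ind}\,H$ of functions $\xi\colon\mathcal G_x\to H$ with $\xi(gh)=\pi(h)^*\xi(g)$ ($g\in\mathcal G_x$, $h\in\mathcal G^x_x$) and $\sum_{g\in\mathcal G_x/\mathcal G^x_x}\|\xi(g)\|^2<\infty$, given by $((\mathrm{Ind}\,\pi)(f)\xi)(g)=\sum_{h\in\mathcal G^{r(g)}}f(h)\xi(h^{-1}g)$. For $a\in\mathbb C\mathcal G^x_x$ put $\|a\|_e=\sup_\pi\|\pi(a)\|$, where $\pi$ runs over the unitary representations of $\mathcal G^x_x$ such that $\mathrm{Ind}\,\pi$ extends to $C^*_r(\mathcal G)$. This is a C$^*$-norm dominating the reduced norm, and $C^*_e(\mathcal G^x_x)$ is the completion of $\mathbb C\mathcal G^x_x$;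 the equality $C^*_e(\mathcal G^x_x)=C^*_r(\mathcal G^x_x)$ means that $\|\cdot\|_e$ is the reduced norm. A discrete group is C$^*$-simple if its reduced group C$^*$-algebra is simple. The singular ideal is $J_{\mathrm{sing}}=\{a\in C^*_r(\mathcal G)\mid \text{the set of }x\in\mathcal G^{(0)}\text{ such that }\rho_x(a)\delta_x\ne0\text{ is meager}\}$ (it is $0$ if $\mathcal G$ is Hausdorff). A subset is meager if it is a countable union of nowhere dense sets. *)

theory Defs
  imports "HOL-Analysis.Analysis" "HOL-Algebra.Group"
begin

section \<open>The complex Hilbert space of square-summable functions\<close>

lemma ell2_add_summable:
  fixes f g :: "'a \<Rightarrow> complex"
  assumes "(\<lambda>k. (cmod (f k))\<^sup>2) summable_on UNIV" "(\<lambda>k. (cmod (g k))\<^sup>2) summable_on UNIV"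
  shows "(\<lambda>k. (cmod (f k + g k))\<^sup>2) summable_on UNIV"
proof -
  have "(\<lambda>k. 2 * (cmod (f k))\<^sup>2 + 2 * (cmod (g k))\<^sup>2) summable_on UNIV"
    by (intro summable_on_add summable_on_cmult_right assms)
  then show ?thesis
  proof (rule summable_on_comparison_test)
    fix k
    have "(cmod (f k + g k))\<^sup>2 \<le> (cmod (f k) + cmod (g k))\<^sup>2"
      by (intro power_mono norm_triangle_ineq) auto
    also have "\<dots> \<le> 2 * (cmod (f k))\<^sup>2 + 2 * (cmod (g k))\<^sup>2"
      using sum_squares_bound[of "cmod (f k)" "cmod (g k)"] by (simp add: power2_sum)
    finally show "(cmod (f k + g k))\<^sup>2 \<le> 2 * (cmod (f k))\<^sup>2 + 2 * (cmod (g k))\<^sup>2" .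
  qed auto
qed

lemma ell2_scale_summable:
  fixes f :: "'a \<Rightarrow> complex"
  assumes "(\<lambda>k. (cmod (f k))\<^sup>2) summable_on UNIV"
  shows "(\<lambda>k. (cmod (c * f k))\<^sup>2) summable_on UNIV"
  using summable_on_cmult_right[OF assms, of "(cmod c)\<^sup>2"]
  by (simp add: norm_mult power_mult_distrib)

typedef 'a ell2 = "{f :: 'a \<Rightarrow> complex. (\<lambda>k. (cmod (f k))\<^sup>2) summable_on UNIV}"
  by (rule exI[of _ "\<lambda>_. 0"]) simp

setup_lifting type_definition_ell2

lemma ell2_inner_summable:
  fixes f g :: "'a \<Rightarrow> complex"
  assumes "(\<lambda>k. (cmod (f k))\<^sup>2) summable_on UNIV" "(\<lambda>k. (cmod (g k))\<^sup>2) summable_on UNIV"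
  shows "(\<lambda>k. cnj (f k) * g k) summable_on UNIV"
proof -
  have "(\<lambda>k. norm (cnj (f k) * g k)) summable_on UNIV"
    by (rule abs_summable_product) (use assms in \<open>simp_all add: norm_mult power2_eq_square\<close>)
  then show ?thesis by (rule abs_summable_summable)
qed

lemma ell2_rinner_summable:
  fixes f g :: "'a \<Rightarrow> complex"
  assumes "(\<lambda>k. (cmod (f k))\<^sup>2) summable_on UNIV" "(\<lambda>k. (cmod (g k))\<^sup>2) summable_on UNIV"
  shows "(\<lambda>k. inner (f k) (g k)) summable_on UNIV"
  using summable_on_Re[OF ell2_inner_summable[OF assms]] by (simp add: inner_complex_def)

lift_definition cscale :: "complex \<Rightarrow> 'a ell2 \<Rightarrow> 'a ell2" is "\<lambda>c f k. c * f k"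
  by (simp add: ell2_scale_summable)

lift_definition cinner :: "'a ell2 \<Rightarrow> 'a ell2 \<Rightarrow> complex" is
  "\<lambda>f g. \<Sum>\<^sub>\<infinity>k. cnj (f k) * g k" .

lift_definition delta :: "'a \<Rightarrow> 'a ell2" is "\<lambda>i k. if k = i then 1 else 0"
proof -
  fix i :: 'a
  have "(\<lambda>k. (cmod (if k = i then 1 else 0))\<^sup>2) summable_on {i}" by simp
  then show "(\<lambda>k. (cmod (if k = i then 1 else 0))\<^sup>2) summable_on UNIV"
    by (rule summable_on_cong_neutral[THEN iffD1, rotated -1]) auto
qed

instantiation ell2 :: (type) real_inner
begin

lift_definition zero_ell2 :: "'a ell2" is "\<lambda>_. 0" by simp
lift_definition plus_ell2 :: "'a ell2 \<Rightarrow> 'a ell2 \<Rightarrow> 'a ell2" is "\<lambda>f g k. f k + g k"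
  by (simp add: ell2_add_summable)
lift_definition uminus_ell2 :: "'a ell2 \<Rightarrow> 'a ell2" is "\<lambda>f k. - f k" by simp
lift_definition minus_ell2 :: "'a ell2 \<Rightarrow> 'a ell2 \<Rightarrow> 'a ell2" is "\<lambda>f g k. f k - g k"
proof -
  fix f g :: "'a \<Rightarrow> complex"
  assume "(\<lambda>k. (cmod (f k))\<^sup>2) summable_on UNIV" "(\<lambda>k. (cmod (g k))\<^sup>2) summable_on UNIV"
  then show "(\<lambda>k. (cmod (f k - g k))\<^sup>2) summable_on UNIV"
    using ell2_add_summable[of f "\<lambda>k. - g k"] by simp
qed
lift_definition scaleR_ell2 :: "real \<Rightarrow> 'a ell2 \<Rightarrow> 'a ell2" is "\<lambda>c f k. c *\<^sub>R f k"
  by (simp add: scaleR_conv_of_real ell2_scale_summable)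
lift_definition inner_ell2 :: "'a ell2 \<Rightarrow> 'a ell2 \<Rightarrow> real" is "\<lambda>f g. \<Sum>\<^sub>\<infinity>k. inner (f k) (g k)" .

definition norm_ell2 :: "'a ell2 \<Rightarrow> real" where "norm_ell2 x = sqrt (inner x x)"
definition sgn_ell2 :: "'a ell2 \<Rightarrow> 'a ell2" where "sgn_ell2 x = inverse (norm x) *\<^sub>R x"
definition dist_ell2 :: "'a ell2 \<Rightarrow> 'a ell2 \<Rightarrow> real" where "dist_ell2 x y = norm (x - y)"
definition [code del]:
  "(uniformity :: ('a ell2 \<times> 'a ell2) filter) = (INF e\<in>{0 <..}. principal {(x, y). dist x y < e})"
definition [code del]:
  "open (U :: 'a ell2 set) = (\<forall>x\<in>U. \<forall>\<^sub>F (x', y) in uniformity. x' = x \<longrightarrow> y \<in> U)"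

instance
proof
  fix x y z :: "'a ell2" and a b r :: real
  show "x + y + z = x + (y + z)" by transfer (simp add: algebra_simps)
  show "x + y = y + x" by transfer (simp add: algebra_simps)
  show "0 + x = x" by transfer simp
  show "- x + x = 0" by transfer simp
  show "x - y = x + - y" by transfer simp
  show "a *\<^sub>R (x + y) = a *\<^sub>R x + a *\<^sub>R y" by transfer (simp add: algebra_simps)
  show "(a + b) *\<^sub>R x = a *\<^sub>R x + b *\<^sub>R x" by transfer (simp add: algebra_simps)
  show "a *\<^sub>R b *\<^sub>R x = (a * b) *\<^sub>R x" by transfer simp
  show "1 *\<^sub>R x = x" by transfer simp
  show "inner x y = inner y x" by transfer (simp add: inner_commute)
  show "inner (x + y) z = inner x z + inner y z"
    by transfer (simp add: inner_add_left infsum_add ell2_rinner_summable)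
  show "inner (r *\<^sub>R x) y = r * inner x y"
    by transfer (simp add: infsum_cmult_right ell2_rinner_summable)
  show "0 \<le> inner x x" by transfer (simp add: infsum_nonneg)
  show "inner x x = 0 \<longleftrightarrow> x = 0"
  proof transfer
    fix f :: "'a \<Rightarrow> complex"
    assume f: "(\<lambda>k. (cmod (f k))\<^sup>2) summable_on UNIV"
    show "(\<Sum>\<^sub>\<infinity>k. inner (f k) (f k)) = 0 \<longleftrightarrow> f = (\<lambda>_. 0)"
    proof
      assume "(\<Sum>\<^sub>\<infinity>k. inner (f k) (f k)) = 0"
      then have "inner (f k) (f k) = 0" for k
        by (rule nonneg_infsum_le_0D[OF eq_refl]) (simp_all add: ell2_rinner_summable[OF f f])
      then show "f = (\<lambda>_. 0)" by auto
    qed simp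
  qed
qed (simp_all add: norm_ell2_def sgn_ell2_def dist_ell2_def uniformity_ell2_def open_ell2_def)

end

lemma norm_ell2_sq: "(norm x)\<^sup>2 = (\<Sum>\<^sub>\<infinity>k. (cmod (Rep_ell2 x k))\<^sup>2)" for x :: "'a ell2"
  unfolding power2_norm_eq_inner by transfer (simp add: power2_norm_eq_inner)

lemma ell2_finite_sum_le:
  "finite F \<Longrightarrow> (\<Sum>k\<in>F. (cmod (Rep_ell2 x k))\<^sup>2) \<le> (norm x)\<^sup>2" for x :: "'a ell2"
  unfolding norm_ell2_sq using Rep_ell2[of x]
  by (intro finite_sum_le_infsum) auto

lemma ell2_coord_le: "cmod (Rep_ell2 x k) \<le> norm x" for x :: "'a ell2"
  by (rule power2_le_imp_le) (use ell2_finite_sum_le[of "{k}" x] in simp_all)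

instance ell2 :: (type) banach
proof
  fix X :: "nat \<Rightarrow> 'a ell2"
  assume C: "Cauchy X"
  have "Cauchy (\<lambda>n. Rep_ell2 (X n) k)" for k
  proof (rule metric_CauchyI)
    fix e :: real assume "e > 0"
    then obtain M where M: "\<And>m n. m \<ge> M \<Longrightarrow> n \<ge> M \<Longrightarrow> dist (X m) (X n) < e"
      using C unfolding Cauchy_def by metis
    have "dist (Rep_ell2 (X m) k) (Rep_ell2 (X n) k) \<le> dist (X m) (X n)" for m n
      using ell2_coord_le[of "X m - X n" k] by (simp add: dist_norm minus_ell2.rep_eq)
    then show "\<exists>M. \<forall>m\<ge>M. \<forall>n\<ge>M. dist (Rep_ell2 (X m) k) (Rep_ell2 (X n) k) < e"
      using M by (meson le_less_trans)
  qed
  then have "\<forall>k. \<exists>l. (\<lambda>n. Rep_ell2 (X n) k) \<longlonglongrightarrow> l"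
    by (simp add: Cauchy_convergent_iff convergent_def)
  then obtain l where l: "\<And>k. (\<lambda>n. Rep_ell2 (X n) k) \<longlonglongrightarrow> l k" by metis
  have fin: "(\<Sum>k\<in>F. (cmod (Rep_ell2 (X n) k - l k))\<^sup>2) \<le> e\<^sup>2"
    if "\<And>m n. m \<ge> M \<Longrightarrow> n \<ge> M \<Longrightarrow> dist (X m) (X n) < e" "n \<ge> M" "finite F" for M e n F
  proof (rule LIMSEQ_le_const2)
    show "(\<lambda>m. \<Sum>k\<in>F. (cmod (Rep_ell2 (X n) k - Rep_ell2 (X m) k))\<^sup>2)
            \<longlonglongrightarrow> (\<Sum>k\<in>F. (cmod (Rep_ell2 (X n) k - l k))\<^sup>2)"
      by (intro tendsto_intros l)
    show "\<exists>N. \<forall>m\<ge>N. (\<Sum>k\<in>F. (cmod (Rep_ell2 (X n) k - Rep_ell2 (X m) k))\<^sup>2) \<le> e\<^sup>2"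
    proof (intro exI allI impI)
      fix m assume "m \<ge> M"
      then have "(norm (X n - X m))\<^sup>2 \<le> e\<^sup>2"
        using that(1)[of n m] that(2) by (intro power_mono) (auto simp: dist_norm less_imp_le)
      then show "(\<Sum>k\<in>F. (cmod (Rep_ell2 (X n) k - Rep_ell2 (X m) k))\<^sup>2) \<le> e\<^sup>2"
        using ell2_finite_sum_le[OF that(3), of "X n - X m"] by (simp add: minus_ell2.rep_eq)
    qed
  qed
  have summ: "(\<lambda>k. (cmod (Rep_ell2 (X n) k - l k))\<^sup>2) summable_on UNIV"
    if "\<And>m n. m \<ge> M \<Longrightarrow> n \<ge> M \<Longrightarrow> dist (X m) (X n) < e" "n \<ge> M" for M e n
    using fin[OF that] by (intro nonneg_bdd_above_summable_on bdd_aboveI) auto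
  obtain M0 where M0: "\<And>m n. m \<ge> M0 \<Longrightarrow> n \<ge> M0 \<Longrightarrow> dist (X m) (X n) < 1"
    using C unfolding Cauchy_def by (metis zero_less_one)
  have "(\<lambda>k. (cmod (Rep_ell2 (X M0) k + - 1 * (Rep_ell2 (X M0) k - l k)))\<^sup>2) summable_on UNIV"
    using Rep_ell2[of "X M0"]
    by (intro ell2_add_summable ell2_scale_summable summ[OF M0]) auto
  then have ls: "(\<lambda>k. (cmod (l k))\<^sup>2) summable_on UNIV" by simp
  define L where "L = Abs_ell2 l"
  have RL: "Rep_ell2 L = l" unfolding L_def using ls by (simp add: Abs_ell2_inverse)
  have "X \<longlonglongrightarrow> L"
  proof (rule metric_LIMSEQ_I)
    fix e :: real assume "e > 0"
    then obtain M where M: "\<And>m n. m \<ge> M \<Longrightarrow> n \<ge> M \<Longrightarrow> dist (X m) (X n) < e / 2"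
      using C unfolding Cauchy_def by (meson half_gt_zero)
    have "dist (X n) L < e" if "n \<ge> M" for n
    proof -
      have "(norm (X n - L))\<^sup>2 \<le> (e / 2)\<^sup>2"
        unfolding norm_ell2_sq using fin[OF M that] summ[OF M that]
        by (intro infsum_le_finite_sums) (auto simp: minus_ell2.rep_eq RL)
      then have "norm (X n - L) \<le> e / 2"
        by (rule power2_le_imp_le) (use \<open>e > 0\<close> in simp)
      then show ?thesis using \<open>e > 0\<close> by (simp add: dist_norm)
    qed
    then show "\<exists>no. \<forall>n\<ge>no. dist (X n) L < e" by blast
  qed
  then show "convergent X" by (auto simp: convergent_def)
qed

section \<open>Bounded complex-linear operators\<close>

text \<open>The type of bounded operators used below is the one of bounded \<^emph>\<open>real\<close>-linear maps, hence
  the predicate for complex linearity.\<close>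

definition clinear_op :: "('a ell2 \<Rightarrow>\<^sub>L 'b ell2) \<Rightarrow> bool" where
  "clinear_op T \<longleftrightarrow> (\<forall>c \<xi>. T (cscale c \<xi>) = cscale c (T \<xi>))"

definition op_of_basis :: "('a \<Rightarrow> 'b ell2) \<Rightarrow> ('a ell2 \<Rightarrow>\<^sub>L 'b ell2)" where
  "op_of_basis v = (THE T. clinear_op T \<and> (\<forall>k. T (delta k) = v k))"

lemma Rep_ell2_sum: "Rep_ell2 (sum f F) k = (\<Sum>i\<in>F. Rep_ell2 (f i) k)"
  by (induction F rule: infinite_finite_induct) (simp_all add: zero_ell2.rep_eq plus_ell2.rep_eq)

lemma ell2_basis_expansion:
  fixes \<xi> :: "'a ell2"
  assumes "e > 0"
  shows "\<exists>F. finite F \<and> norm (\<xi> - (\<Sum>i\<in>F. cscale (Rep_ell2 \<xi> i) (delta i))) < e"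
proof -
  let ?q = "\<lambda>k. (cmod (Rep_ell2 \<xi> k))\<^sup>2"
  have q: "?q summable_on UNIV" using Rep_ell2[of \<xi>] by simp
  obtain F where F: "finite F" "dist (sum ?q F) (infsum ?q UNIV) < e\<^sup>2"
    using has_sum_finite_approximation[OF has_sum_infsum[OF q], of "e\<^sup>2 / 2"] assms
    by (metis (no_types, lifting) field_sum_of_halves half_gt_zero less_add_same_cancel1
        order_le_less_trans zero_less_power)
  let ?s = "\<Sum>i\<in>F. cscale (Rep_ell2 \<xi> i) (delta i)"
  have R: "Rep_ell2 (\<xi> - ?s) k = (if k \<in> F then 0 else Rep_ell2 \<xi> k)" for k
    using F(1)
    by (simp add: minus_ell2.rep_eq Rep_ell2_sum cscale.rep_eq delta.rep_eq
        if_distrib[of "\<lambda>z. _ * z"] cong: if_cong)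
  have "(norm (\<xi> - ?s))\<^sup>2 = infsum ?q (UNIV - F)"
    unfolding norm_ell2_sq R by (rule infsum_cong_neutral) auto
  also have "\<dots> = infsum ?q UNIV - infsum ?q F"
    by (rule infsum_Diff) (use q F(1) in auto)
  also have "\<dots> < e\<^sup>2" using F by (auto simp: dist_real_def)
  finally have "norm (\<xi> - ?s) < e" using assms by (simp add: power_less_imp_less_base)
  then show ?thesis using F(1) by blast
qed

lemma clinear_op_eqI:
  assumes "clinear_op S" "clinear_op T" "\<And>k. S (delta k) = T (delta k)"
  shows "S = T"
proof (rule blinfun_eqI)
  fix \<xi>
  let ?D = "S - T"
  have D: "blinfun_apply ?D (\<Sum>i\<in>F. cscale (c i) (delta i)) = 0" for F c
    using assms by (simp add: blinfun.sum_right blinfun.diff_left clinear_op_def)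
  have "norm (blinfun_apply ?D \<xi>) \<le> e" if "e > 0" for e :: real
  proof -
    have pos: "0 < norm ?D + 1" by (rule add_nonneg_pos) auto
    obtain F where F: "norm (\<xi> - (\<Sum>i\<in>F. cscale (Rep_ell2 \<xi> i) (delta i))) < e / (norm ?D + 1)"
      using ell2_basis_expansion[of "e / (norm ?D + 1)" \<xi>] divide_pos_pos[OF \<open>e > 0\<close> pos]
      by blast
    let ?s = "\<Sum>i\<in>F. cscale (Rep_ell2 \<xi> i) (delta i)"
    have "norm (blinfun_apply ?D \<xi>) = norm (blinfun_apply ?D (\<xi> - ?s))"
      by (simp only: blinfun.diff_right D diff_zero)
    also have "\<dots> \<le> norm ?D * norm (\<xi> - ?s)" by (rule norm_blinfun)
    also have "\<dots> \<le> norm ?D * (e / (norm ?D + 1))"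
      using F by (intro mult_left_mono) auto
    also have "\<dots> \<le> e" using that pos by (simp add: field_simps)
    finally show ?thesis .
  qed
  then have "norm (blinfun_apply ?D \<xi>) \<le> 0" by (rule field_le_epsilon[OF _, of _ 0, simplified])
  then show "blinfun_apply S \<xi> = blinfun_apply T \<xi>" by (simp add: blinfun.diff_left)
qed

lemma op_of_basis_eqI:
  assumes "clinear_op T" "\<And>k. T (delta k) = v k"
  shows "op_of_basis v = T"
  unfolding op_of_basis_def
  by (rule the_equality) (use assms in \<open>auto intro: clinear_op_eqI\<close>)

definition adjoint_pair :: "('a ell2 \<Rightarrow>\<^sub>L 'a ell2) \<Rightarrow> ('a ell2 \<Rightarrow>\<^sub>L 'a ell2) \<Rightarrow> bool" where
  "adjoint_pair S T \<longleftrightarrow> (\<forall>\<xi> \<eta>. cinner (S \<xi>) \<eta> = cinner \<xi> (T \<eta>))"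

definition op_scale :: "complex \<Rightarrow> ('a ell2 \<Rightarrow>\<^sub>L 'a ell2) \<Rightarrow> ('a ell2 \<Rightarrow>\<^sub>L 'a ell2)" where
  "op_scale c T = op_of_basis (\<lambda>k. cscale c (T (delta k)))"

definition closed_ideal :: "('a ell2 \<Rightarrow>\<^sub>L 'a ell2) set \<Rightarrow> ('a ell2 \<Rightarrow>\<^sub>L 'a ell2) set \<Rightarrow> bool" where
  "closed_ideal A I \<longleftrightarrow> I \<subseteq> A \<and> closed I \<and> 0 \<in> I \<and>
     (\<forall>S\<in>I. \<forall>T\<in>I. S + T \<in> I) \<and> (\<forall>c. \<forall>T\<in>I. op_scale c T \<in> I) \<and>
     (\<forall>S\<in>A. \<forall>T\<in>I. S o\<^sub>L T \<in> I \<and> T o\<^sub>L S \<in> I)"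

definition simple_algebra :: "('a ell2 \<Rightarrow>\<^sub>L 'a ell2) set \<Rightarrow> bool" where
  "simple_algebra A \<longleftrightarrow> A \<noteq> {0} \<and> (\<forall>I. closed_ideal A I \<longrightarrow> I = {0} \<or> I = A)"

section \<open>Discrete groups\<close>

definition group_algebra :: "('g, 'm) monoid_scheme \<Rightarrow> ('g \<Rightarrow> complex) set" where
  "group_algebra \<Gamma> = {a. finite {\<gamma>. a \<gamma> \<noteq> 0} \<and> {\<gamma>. a \<gamma> \<noteq> 0} \<subseteq> carrier \<Gamma>}"

text \<open>The Hilbert space of square-summable functions on the carrier is regarded as a subspace of
  that of the whole type; operators are extended by zero.\<close>

definition left_regular :: "('g, 'm) monoid_scheme \<Rightarrow> ('g \<Rightarrow> complex) \<Rightarrow> ('g ell2 \<Rightarrow>\<^sub>L 'g ell2)" where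
  "left_regular \<Gamma> a = op_of_basis (\<lambda>\<delta>. if \<delta> \<in> carrier \<Gamma>
     then \<Sum>\<gamma> | a \<gamma> \<noteq> 0. cscale (a \<gamma>) (delta (\<gamma> \<otimes>\<^bsub>\<Gamma>\<^esub> \<delta>)) else 0)"

definition reduced_group_Cstar :: "('g, 'm) monoid_scheme \<Rightarrow> ('g ell2 \<Rightarrow>\<^sub>L 'g ell2) set" where
  "reduced_group_Cstar \<Gamma> = closure (left_regular \<Gamma> ` group_algebra \<Gamma>)"

definition Cstar_simple :: "('g, 'm) monoid_scheme \<Rightarrow> bool" where
  "Cstar_simple \<Gamma> \<longleftrightarrow> simple_algebra (reduced_group_Cstar \<Gamma>)"

definition unitary_rep ::
  "('g, 'm) monoid_scheme \<Rightarrow> 'i ell2 set \<Rightarrow> ('g \<Rightarrow> 'i ell2 \<Rightarrow> 'i ell2) \<Rightarrow> bool" where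
  "unitary_rep \<Gamma> H \<pi> \<longleftrightarrow>
     closed H \<and> 0 \<in> H \<and> (\<forall>u\<in>H. \<forall>v\<in>H. u + v \<in> H) \<and> (\<forall>c. \<forall>u\<in>H. cscale c u \<in> H) \<and>
     (\<forall>\<gamma>\<in>carrier \<Gamma>. \<pi> \<gamma> ` H = H \<and>
        (\<forall>u\<in>H. \<forall>v\<in>H. \<pi> \<gamma> (u + v) = \<pi> \<gamma> u + \<pi> \<gamma> v) \<and>
        (\<forall>c. \<forall>u\<in>H. \<pi> \<gamma> (cscale c u) = cscale c (\<pi> \<gamma> u)) \<and>
        (\<forall>u\<in>H. norm (\<pi> \<gamma> u) = norm u)) \<and>
     (\<forall>\<gamma>\<in>carrier \<Gamma>. \<forall>\<delta>\<in>carrier \<Gamma>. \<forall>u\<in>H. \<pi> (\<gamma> \<otimes>\<^bsub>\<Gamma>\<^esub> \<delta>) u = \<pi> \<gamma> (\<pi> \<delta> u))"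

definition rep_norm :: "'i ell2 set \<Rightarrow> ('g \<Rightarrow> 'i ell2 \<Rightarrow> 'i ell2) \<Rightarrow> ('g \<Rightarrow> complex) \<Rightarrow> real" where
  "rep_norm H \<pi> a = Sup {norm (\<Sum>\<gamma> | a \<gamma> \<noteq> 0. cscale (a \<gamma>) (\<pi> \<gamma> v)) | v. v \<in> H \<and> norm v \<le> 1}"

section \<open>Meager sets\<close>

definition nowhere_dense_in :: "'a topology \<Rightarrow> 'a set \<Rightarrow> bool" where
  "nowhere_dense_in X S \<longleftrightarrow> S \<subseteq> topspace X \<and> X interior_of (X closure_of S) = {}"

definition meager_in :: "'a topology \<Rightarrow> 'a set \<Rightarrow> bool" where
  "meager_in X S \<longleftrightarrow> (\<exists>\<N>. countable \<N> \<and> (\<forall>N\<in>\<N>. nowhere_dense_in X N) \<and> S = \<Union>\<N>)"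

section \<open>Etale groupoids\<close>

text \<open>The set of arrows is the underlying set of the topology. The values of the product on pairs
  that are not composable are irrelevant.\<close>

record 'g top_groupoid =
  gtop :: "'g topology"
  gmul :: "'g \<Rightarrow> 'g \<Rightarrow> 'g"
  ginv :: "'g \<Rightarrow> 'g"

definition arrows :: "'g top_groupoid \<Rightarrow> 'g set" where
  "arrows G = topspace (gtop G)"

definition grange :: "'g top_groupoid \<Rightarrow> 'g \<Rightarrow> 'g" where
  "grange G g = gmul G g (ginv G g)"

definition gsource :: "'g top_groupoid \<Rightarrow> 'g \<Rightarrow> 'g" where
  "gsource G g = gmul G (ginv G g) g"

definition gunits :: "'g top_groupoid \<Rightarrow> 'g set" where
  "gunits G = grange G ` arrows G"

definition composable :: "'g top_groupoid \<Rightarrow> ('g \<times> 'g) set" where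
  "composable G = {(g, h). g \<in> arrows G \<and> h \<in> arrows G \<and> gsource G g = grange G h}"

definition groupoid :: "'g top_groupoid \<Rightarrow> bool" where
  "groupoid G \<longleftrightarrow>
     (\<forall>g\<in>arrows G. ginv G g \<in> arrows G \<and> ginv G (ginv G g) = g \<and>
        gmul G (grange G g) g = g \<and> gmul G g (gsource G g) = g) \<and>
     (\<forall>(g, h)\<in>composable G. gmul G g h \<in> arrows G \<and>
        grange G (gmul G g h) = grange G g \<and> gsource G (gmul G g h) = gsource G h) \<and>
     (\<forall>g h k. (g, h) \<in> composable G \<and> (h, k) \<in> composable G \<longrightarrow>
        gmul G (gmul G g h) k = gmul G g (gmul G h k))"

definition source_fibre :: "'g top_groupoid \<Rightarrow> 'g \<Rightarrow> 'g set" where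
  "source_fibre G x = {g \<in> arrows G. gsource G g = x}"

definition range_fibre :: "'g top_groupoid \<Rightarrow> 'g \<Rightarrow> 'g set" where
  "range_fibre G x = {g \<in> arrows G. grange G g = x}"

definition isotropy :: "'g top_groupoid \<Rightarrow> 'g \<Rightarrow> 'g monoid" where
  "isotropy G x = \<lparr>carrier = source_fibre G x \<inter> range_fibre G x, mult = gmul G, one = x\<rparr>"

definition unit_space :: "'g top_groupoid \<Rightarrow> 'g topology" where
  "unit_space G = subtopology (gtop G) (gunits G)"

definition local_homeomorphism :: "'a topology \<Rightarrow> 'b topology \<Rightarrow> ('a \<Rightarrow> 'b) \<Rightarrow> bool" where
  "local_homeomorphism X Y p \<longleftrightarrow>
     (\<forall>x\<in>topspace X. \<exists>U. openin X U \<and> x \<in> U \<and> openin Y (p ` U) \<and>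
        homeomorphic_map (subtopology X U) (subtopology Y (p ` U)) p)"

definition locally_compact_etale_groupoid :: "'g top_groupoid \<Rightarrow> bool" where
  "locally_compact_etale_groupoid G \<longleftrightarrow> groupoid G \<and>
     continuous_map (gtop G) (gtop G) (ginv G) \<and>
     continuous_map (subtopology (prod_topology (gtop G) (gtop G)) (composable G)) (gtop G)
       (\<lambda>(g, h). gmul G g h) \<and>
     locally_compact_space (unit_space G) \<and> Hausdorff_space (unit_space G) \<and>
     local_homeomorphism (gtop G) (unit_space G) (grange G)"

definition bisection :: "'g top_groupoid \<Rightarrow> 'g set \<Rightarrow> bool" where
  "bisection G W \<longleftrightarrow> W \<subseteq> arrows G \<and>
     bij_betw (grange G) W (grange G ` W) \<and> bij_betw (gsource G) W (gsource G ` W)"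

definition countable_open_bisection_cover :: "'g top_groupoid \<Rightarrow> bool" where
  "countable_open_bisection_cover G \<longleftrightarrow>
     (\<exists>\<W>. countable \<W> \<and> (\<forall>W\<in>\<W>. openin (gtop G) W \<and> bisection G W) \<and> \<Union>\<W> = arrows G)"

section \<open>The reduced C*-algebra of a groupoid\<close>

definition Cc_generators :: "'g top_groupoid \<Rightarrow> ('g \<Rightarrow> complex) set" where
  "Cc_generators G = {f. \<exists>W. openin (gtop G) W \<and> Hausdorff_space (subtopology (gtop G) W) \<and>
     (\<forall>g. g \<notin> W \<longrightarrow> f g = 0) \<and> continuous_map (subtopology (gtop G) W) euclidean f \<and>
     compactin (subtopology (gtop G) W) (subtopology (gtop G) W closure_of {g \<in> W. f g \<noteq> 0})}"

definition Cc :: "'g top_groupoid \<Rightarrow> ('g \<Rightarrow> complex) set" where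
  "Cc G = {f. \<exists>S c. finite S \<and> S \<subseteq> Cc_generators G \<and> f = (\<lambda>g. \<Sum>\<phi>\<in>S. c \<phi> * \<phi> g)}"

text \<open>Here and below, functions in \<^term>\<open>Cc G\<close> have finite support on every range or source
  fibre, so that restricting the sums to the support makes them finite. As for groups, the Hilbert
  space of the source fibre at a unit is a subspace of that of the whole type, and operators are
  extended by zero.\<close>

definition rho :: "'g top_groupoid \<Rightarrow> 'g \<Rightarrow> ('g \<Rightarrow> complex) \<Rightarrow> ('g ell2 \<Rightarrow>\<^sub>L 'g ell2)" where
  "rho G x f = op_of_basis (\<lambda>g. if g \<in> source_fibre G x
     then \<Sum>h | h \<in> source_fibre G (grange G g) \<and> f h \<noteq> 0. cscale (f h) (delta (gmul G h g))
     else 0)"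

text \<open>The direct sum of all the representations \<open>\<rho>\<^sub>x\<close>, which acts on the Hilbert space of
  square-summable functions on the set of arrows, the orthogonal direct sum of those of the source
  fibres. The norm of a direct sum of operators being the supremum of their norms, the operator norm
  of \<open>rho_sum G f\<close> is the reduced norm of \<open>f\<close>. Hence the completion of \<^term>\<open>Cc G\<close> in the
  reduced norm is the closure of its image in this Banach algebra of operators.\<close>

definition rho_sum :: "'g top_groupoid \<Rightarrow> ('g \<Rightarrow> complex) \<Rightarrow> ('g ell2 \<Rightarrow>\<^sub>L 'g ell2)" where
  "rho_sum G f = op_of_basis (\<lambda>g. if g \<in> arrows G then rho G (gsource G g) f (delta g) else 0)"

definition reduced_Cstar :: "'g top_groupoid \<Rightarrow> ('g ell2 \<Rightarrow>\<^sub>L 'g ell2) set" where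
  "reduced_Cstar G = closure (rho_sum G ` Cc G)"

text \<open>The extension of \<open>\<rho>\<^sub>x\<close> to the reduced C*-algebra: the block of \<open>a\<close> at \<open>x\<close>.\<close>

definition rho_ext ::
  "'g top_groupoid \<Rightarrow> 'g \<Rightarrow> ('g ell2 \<Rightarrow>\<^sub>L 'g ell2) \<Rightarrow> ('g ell2 \<Rightarrow>\<^sub>L 'g ell2)" where
  "rho_ext G x a = op_of_basis (\<lambda>g. if g \<in> source_fibre G x then a (delta g) else 0)"

definition C0 :: "'g topology \<Rightarrow> ('g \<Rightarrow> complex) set" where
  "C0 X = {\<phi>. (\<forall>x. x \<notin> topspace X \<longrightarrow> \<phi> x = 0) \<and> continuous_map X euclidean \<phi> \<and>
     (\<forall>e>0. compactin X {x \<in> topspace X. e \<le> cmod (\<phi> x)})}"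

text \<open>A function on the unit space, extended by zero, acts by multiplication with its composition
  with the range map; this is the formula for \<^const>\<open>rho_sum\<close>.\<close>

definition C0_units :: "'g top_groupoid \<Rightarrow> ('g ell2 \<Rightarrow>\<^sub>L 'g ell2) set" where
  "C0_units G = rho_sum G ` C0 (unit_space G)"

definition singular_ideal :: "'g top_groupoid \<Rightarrow> ('g ell2 \<Rightarrow>\<^sub>L 'g ell2) set" where
  "singular_ideal G = {a \<in> reduced_Cstar G.
     meager_in (unit_space G) {x \<in> gunits G. rho_ext G x a (delta x) \<noteq> 0}}"

section \<open>Induced representations and the exotic norm on the isotropy groups\<close>

definition isotropy_cosets :: "'g top_groupoid \<Rightarrow> 'g \<Rightarrow> 'g set set" where
  "isotropy_cosets G x =
     (\<lambda>g. (\<lambda>h. gmul G g h) ` carrier (isotropy G x)) ` source_fibre G x"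

text \<open>In the next two definitions \<open>\<xi>\<close> takes values of constant norm on every coset, and the inner
  product of the values of two such functions is constant as well, by unitarity of \<open>\<pi>\<close>, so that the
  choice of representatives is immaterial. Unitarity also gives that the adjoint of \<open>\<pi> h\<close> is
  \<open>\<pi> (ginv G h)\<close>.\<close>

definition ind_space ::
  "'g top_groupoid \<Rightarrow> 'g \<Rightarrow> 'i ell2 set \<Rightarrow> ('g \<Rightarrow> 'i ell2 \<Rightarrow> 'i ell2) \<Rightarrow> ('g \<Rightarrow> 'i ell2) set" where
  "ind_space G x H \<pi> = {\<xi>.
     (\<forall>g. g \<notin> source_fibre G x \<longrightarrow> \<xi> g = 0) \<and> (\<forall>g\<in>source_fibre G x. \<xi> g \<in> H) \<and>
     (\<forall>g\<in>source_fibre G x. \<forall>h\<in>carrier (isotropy G x). \<xi> (gmul G g h) = \<pi> (ginv G h) (\<xi> g)) \<and>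
     (\<lambda>C. (norm (\<xi> (SOME g. g \<in> C)))\<^sup>2) summable_on isotropy_cosets G x}"

definition ind_inner ::
  "'g top_groupoid \<Rightarrow> 'g \<Rightarrow> ('g \<Rightarrow> 'i ell2) \<Rightarrow> ('g \<Rightarrow> 'i ell2) \<Rightarrow> complex" where
  "ind_inner G x \<xi> \<eta> =
     (\<Sum>\<^sub>\<infinity>C\<in>isotropy_cosets G x. cinner (\<xi> (SOME g. g \<in> C)) (\<eta> (SOME g. g \<in> C)))"

definition ind_norm :: "'g top_groupoid \<Rightarrow> 'g \<Rightarrow> ('g \<Rightarrow> 'i ell2) \<Rightarrow> real" where
  "ind_norm G x \<xi> = sqrt (Re (ind_inner G x \<xi> \<xi>))"

definition ind_rep ::
  "'g top_groupoid \<Rightarrow> 'g \<Rightarrow> ('g \<Rightarrow> complex) \<Rightarrow> ('g \<Rightarrow> 'i ell2) \<Rightarrow> ('g \<Rightarrow> 'i ell2)" where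
  "ind_rep G x f \<xi> = (\<lambda>g. if g \<in> source_fibre G x
     then \<Sum>h | h \<in> range_fibre G (grange G g) \<and> f h \<noteq> 0. cscale (f h) (\<xi> (gmul G (ginv G h) g))
     else 0)"

definition ind_bounded_op ::
  "'g top_groupoid \<Rightarrow> 'g \<Rightarrow> 'i ell2 set \<Rightarrow> ('g \<Rightarrow> 'i ell2 \<Rightarrow> 'i ell2) \<Rightarrow>
     (('g \<Rightarrow> 'i ell2) \<Rightarrow> ('g \<Rightarrow> 'i ell2)) \<Rightarrow> bool" where
  "ind_bounded_op G x H \<pi> T \<longleftrightarrow>
     (\<forall>\<xi>\<in>ind_space G x H \<pi>. T \<xi> \<in> ind_space G x H \<pi>) \<and>
     (\<forall>\<xi>\<in>ind_space G x H \<pi>. \<forall>\<eta>\<in>ind_space G x H \<pi>.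
        T (\<lambda>g. \<xi> g + \<eta> g) = (\<lambda>g. T \<xi> g + T \<eta> g)) \<and>
     (\<forall>c. \<forall>\<xi>\<in>ind_space G x H \<pi>. T (\<lambda>g. cscale c (\<xi> g)) = (\<lambda>g. cscale c (T \<xi> g))) \<and>
     (\<exists>B. \<forall>\<xi>\<in>ind_space G x H \<pi>. ind_norm G x (T \<xi>) \<le> B * ind_norm G x \<xi>)"

text \<open>The induced representation of \<^term>\<open>Cc G\<close> is the restriction of a \<open>*\<close>-representation \<open>\<Phi>\<close> of
  the reduced C*-algebra.\<close>

definition ind_extends ::
  "'g top_groupoid \<Rightarrow> 'g \<Rightarrow> 'i ell2 set \<Rightarrow> ('g \<Rightarrow> 'i ell2 \<Rightarrow> 'i ell2) \<Rightarrow> bool" where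
  "ind_extends G x H \<pi> \<longleftrightarrow>
     (\<exists>\<Phi> :: ('g ell2 \<Rightarrow>\<^sub>L 'g ell2) \<Rightarrow> ('g \<Rightarrow> 'i ell2) \<Rightarrow> ('g \<Rightarrow> 'i ell2).
        (\<forall>a\<in>reduced_Cstar G. ind_bounded_op G x H \<pi> (\<Phi> a)) \<and>
        (\<forall>a\<in>reduced_Cstar G. \<forall>b\<in>reduced_Cstar G. \<forall>\<xi>\<in>ind_space G x H \<pi>.
           \<Phi> (a + b) \<xi> = (\<lambda>g. \<Phi> a \<xi> g + \<Phi> b \<xi> g) \<and> \<Phi> (a o\<^sub>L b) \<xi> = \<Phi> a (\<Phi> b \<xi>)) \<and>
        (\<forall>c. \<forall>a\<in>reduced_Cstar G. \<forall>\<xi>\<in>ind_space G x H \<pi>.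
           \<Phi> (op_scale c a) \<xi> = (\<lambda>g. cscale c (\<Phi> a \<xi> g))) \<and>
        (\<forall>a\<in>reduced_Cstar G. \<forall>b\<in>reduced_Cstar G. adjoint_pair a b \<longrightarrow>
           (\<forall>\<xi>\<in>ind_space G x H \<pi>. \<forall>\<eta>\<in>ind_space G x H \<pi>.
              ind_inner G x (\<Phi> a \<xi>) \<eta> = ind_inner G x \<xi> (\<Phi> b \<eta>))) \<and>
        (\<forall>f\<in>Cc G. \<forall>\<xi>\<in>ind_space G x H \<pi>. \<Phi> (rho_sum G f) \<xi> = ind_rep G x f \<xi>))"

text \<open>The supremum runs over the unitary representations on closed subspaces of
  \<^typ>\<open>('g \<times> nat) ell2\<close>, that is, up to unitary equivalence, over those on Hilbert spaces of
  dimension at most the cardinality of \<^typ>\<open>'g \<times> nat\<close>. This does not change the supremum over all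
  Hilbert spaces: a norm \<open>\<parallel>\<pi>(a)\<parallel>\<close> is the supremum of those for the cyclic subrepresentations, a
  cyclic representation of a group \<open>\<Gamma>\<close> has dimension at most the cardinality of \<open>\<Gamma>\<close>, and if the
  representation induced by \<open>\<pi>\<close> extends to the reduced C*-algebra, then so do those induced by its
  subrepresentations.\<close>

definition exotic_norm :: "'g top_groupoid \<Rightarrow> 'g \<Rightarrow> ('g \<Rightarrow> complex) \<Rightarrow> real" where
  "exotic_norm G x a = Sup {rep_norm H \<pi> a | (H :: ('g \<times> nat) ell2 set) \<pi>.
     unitary_rep (isotropy G x) H \<pi> \<and> ind_extends G x H \<pi>}"

definition exotic_eq_reduced :: "'g top_groupoid \<Rightarrow> 'g \<Rightarrow> bool" where
  "exotic_eq_reduced G x \<longleftrightarrow>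
     (\<forall>a\<in>group_algebra (isotropy G x). exotic_norm G x a = norm (left_regular (isotropy G x) a))"

end

theory Submission
  imports Defs
begin

text \<open>Let \<open>x\<close> be a unit such that the isotropy group \<open>\<Gamma>\<close> at \<open>x\<close> is C*-simple and its exotic norm is
  the reduced norm. Since \<open>I\<close> contains no non-zero function on the unit space, evaluation at \<open>x\<close>
  extends to a functional \<open>\<phi>\<close> of norm one on all bounded operators that vanishes on \<open>I\<close> and on
  operators that are small near \<open>x\<close> (Hahn--Banach). On compactly supported functions
  \<open>\<phi>(f) = \<Sum>\<^bsub>\<gamma> \<in> \<Gamma>\<^esub> f(\<gamma>) \<psi>(\<gamma>)\<close> with \<open>\<psi>\<close> positive definite, and the representation associated with \<open>\<phi>\<close>
  is induced from the representation \<open>\<pi>\<close> of \<open>\<Gamma>\<close> associated with \<open>\<psi>\<close>. Hence the induced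
  representation of \<open>\<pi>\<close> extends to the reduced C*-algebra, and \<open>\<phi>(f)\<close> is bounded by the exotic,
  that is, reduced norm of the restriction of \<open>f\<close> to \<open>\<Gamma>\<close>. If \<open>a \<delta>\<^sub>x \<noteq> 0\<close> for some \<open>a \<in> I\<close>, then the
  compression of \<open>I\<close> to \<open>\<Gamma>\<close> is dense in a non-zero ideal of the reduced group C*-algebra, hence
  comes close to the unit, where \<open>\<phi>\<close> is one; this contradicts \<open>\<phi> = 0\<close> on \<open>I\<close>. So \<open>a \<delta>\<^sub>x = 0\<close> for a
  dense set of units \<open>x\<close>, and a category argument on countably many bisections shows that \<open>a\<close> is
  singular.\<close>

text \<open>The functional lives on all bounded operators because locality at x is expressed by
  compressions to arrows with range near x, and the indicator functions behind them are in general
  outside the reduced algebra. Locality makes \<phi>(f) depend only on the restriction of f to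
  \<Gamma>: a compact set missing \<Gamma> has no arrow with both ends close to x, and on an open
  bisection the operator norm is at most the supremum norm. The induced representation is bounded by
  the reduced norm because \<phi> of (f b)* f b is at most |f|^2 times \<phi> of b* b. Since the
  exotic norm is a supremum over representations in one fixed Hilbert space type, the vectors with
  Gram kernel given by \<psi> must be built inside that type. Compression to \<Gamma> is not
  multiplicative, but it is so against functions that vanish on arrows with exactly one end at x,
  and these suffice to make compressed ideals ideals. The category argument works because functions
  are discontinuous only on frontiers of bisections, whose parts in a bisection have nowhere dense
  images under the source map.\<close>

section \<open>Square-summable functions\<close>

lemma Rep_ell2_cong: "(\<And>k. Rep_ell2 x k = Rep_ell2 y k) \<Longrightarrow> x = y"
  by (metis Rep_ell2_inject ext)

lemma Rep_ell2_summable: "(\<lambda>k. (cmod (Rep_ell2 x k))\<^sup>2) summable_on UNIV"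
  using Rep_ell2[of x] by simp

lemmas Rep_ell2_simps = zero_ell2.rep_eq plus_ell2.rep_eq minus_ell2.rep_eq uminus_ell2.rep_eq
  scaleR_ell2.rep_eq cscale.rep_eq delta.rep_eq Rep_ell2_sum

lemma cscale_add: "cscale c (x + y) = cscale c x + cscale c y"
  by (rule Rep_ell2_cong) (simp add: Rep_ell2_simps algebra_simps)

lemma cscale_add_left: "cscale (c + d) x = cscale c x + cscale d x"
  by (rule Rep_ell2_cong) (simp add: Rep_ell2_simps algebra_simps)

lemma cscale_diff: "cscale c (x - y) = cscale c x - cscale c y"
  by (rule Rep_ell2_cong) (simp add: Rep_ell2_simps algebra_simps)

lemma cscale_cscale [simp]: "cscale c (cscale d x) = cscale (c * d) x"
  by (rule Rep_ell2_cong) (simp add: Rep_ell2_simps)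

lemma cscale_simps [simp]:
  "cscale 0 x = 0" "cscale 1 x = x" "cscale c 0 = 0" "cscale (-1) x = - x"
  by (rule Rep_ell2_cong; simp add: Rep_ell2_simps)+

lemma cscale_of_real: "cscale (of_real r) x = r *\<^sub>R x"
  by (rule Rep_ell2_cong) (simp add: Rep_ell2_simps scaleR_conv_of_real)

lemma cscale_sum: "cscale c (\<Sum>i\<in>F. f i) = (\<Sum>i\<in>F. cscale c (f i))"
  by (rule Rep_ell2_cong) (simp add: Rep_ell2_simps sum_distrib_left)

lemma cscale_sum_left: "cscale (\<Sum>i\<in>F. f i) x = (\<Sum>i\<in>F. cscale (f i) x)"
  by (rule Rep_ell2_cong) (simp add: Rep_ell2_simps sum_distrib_right)

lemma norm_cscale [simp]: "norm (cscale c x) = cmod c * norm x"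
proof -
  have "(norm (cscale c x))\<^sup>2 = (cmod c * norm x)\<^sup>2"
    unfolding norm_ell2_sq power_mult_distrib
    by (simp add: Rep_ell2_simps norm_mult power_mult_distrib infsum_cmult_right Rep_ell2_summable)
  then show ?thesis by (simp add: power2_eq_iff_nonneg)
qed

lemma bounded_linear_cscale: "bounded_linear (cscale c)"
proof (rule bounded_linear_intro)
  show "cscale c (x + y) = cscale c x + cscale c y" for x y by (rule cscale_add)
  show "cscale c (r *\<^sub>R x) = r *\<^sub>R cscale c x" for r x
    by (rule Rep_ell2_cong) (simp add: Rep_ell2_simps)
  show "norm (cscale c x) \<le> norm x * cmod c" for x by simp
qed

lemmas tendsto_cscale = bounded_linear.tendsto[OF bounded_linear_cscale]

text \<open>\<open>cinner\<close> is conjugate-linear on the left, so its imaginary part is the real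
  part after multiplying the left argument by the imaginary unit. Additivity and continuity are thus
  inherited from the real inner product.\<close>

lemma cinner_conv_inner: "cinner x y = Complex (inner x y) (inner (cscale \<i> x) y)"
proof -
  let ?f = "Rep_ell2 x" and ?g = "Rep_ell2 y"
  have s: "(\<lambda>k. cnj (?f k) * ?g k) summable_on UNIV"
    by (rule ell2_inner_summable) (rule Rep_ell2_summable)+
  have "Re (cinner x y) = inner x y"
    unfolding cinner.rep_eq inner_ell2.rep_eq infsum_Re[OF s, symmetric]
    by (rule infsum_cong) (simp add: inner_complex_def)
  moreover have "Im (cinner x y) = inner (cscale \<i> x) y"
    unfolding cinner.rep_eq inner_ell2.rep_eq infsum_Im[OF s, symmetric]
    by (rule infsum_cong) (simp add: inner_complex_def Rep_ell2_simps)
  ultimately show ?thesis by (simp add: complex_eq_iff)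
qed

lemma Re_cinner: "Re (cinner x y) = inner x y"
  by (simp add: cinner_conv_inner)

lemma cinner_add_right: "cinner x (y + z) = cinner x y + cinner x z"
  by (simp add: cinner_conv_inner inner_add_right complex_eq_iff)

lemma cinner_diff_right: "cinner x (y - z) = cinner x y - cinner x z"
  by (simp add: cinner_conv_inner inner_diff_right complex_eq_iff)

lemma cinner_add_left: "cinner (x + y) z = cinner x z + cinner y z"
  by (simp add: cinner_conv_inner cscale_add inner_add_left complex_eq_iff)

lemma cinner_diff_left: "cinner (x - y) z = cinner x z - cinner y z"
  by (simp add: cinner_conv_inner cscale_diff inner_diff_left complex_eq_iff)

lemma cinner_cscale_right: "cinner x (cscale c y) = c * cinner x y"
proof -
  have "(\<lambda>k. cnj (Rep_ell2 x k) * Rep_ell2 y k) summable_on UNIV"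
    by (rule ell2_inner_summable) (rule Rep_ell2_summable)+
  then show ?thesis
    by (simp add: cinner.rep_eq Rep_ell2_simps mult.left_commute[of _ c] infsum_cmult_right)
qed

lemma cnj_cinner: "cnj (cinner x y) = cinner y x"
  by (simp add: cinner.rep_eq infsum_cnj[symmetric] mult.commute)

lemma cinner_cscale_left: "cinner (cscale c x) y = cnj c * cinner x y"
  by (metis cinner_cscale_right cnj_cinner complex_cnj_cnj complex_cnj_mult)

lemma cinner_zero [simp]: "cinner 0 y = 0" "cinner x 0 = 0"
  by (simp_all add: cinner.rep_eq Rep_ell2_simps)

lemma cinner_sum_right: "cinner x (\<Sum>i\<in>F. f i) = (\<Sum>i\<in>F. cinner x (f i))"
  by (induction F rule: infinite_finite_induct) (simp_all add: cinner_add_right)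

lemma cinner_sum_left: "cinner (\<Sum>i\<in>F. f i) x = (\<Sum>i\<in>F. cinner (f i) x)"
  by (induction F rule: infinite_finite_induct) (simp_all add: cinner_add_left)

lemma cinner_self: "cinner x x = of_real ((norm x)\<^sup>2)"
proof -
  have "cinner x x = of_real (Re (cinner x x))"
    using cnj_cinner[of x x] by (metis Reals_cnj_iff of_real_Re)
  then show ?thesis by (simp add: Re_cinner power2_norm_eq_inner)
qed

lemma cinner_delta_left: "cinner (delta k) x = Rep_ell2 x k"
proof -
  have "cinner (delta k) x = (\<Sum>\<^sub>\<infinity>j. if j = k then Rep_ell2 x j else 0)"
    unfolding cinner.rep_eq by (rule infsum_cong) (simp add: Rep_ell2_simps)
  also have "\<dots> = (\<Sum>\<^sub>\<infinity>j\<in>{k}. Rep_ell2 x j)"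
    by (rule infsum_cong_neutral) auto
  finally show ?thesis by simp
qed

lemma norm_delta [simp]: "norm (delta k) = 1"
  using cinner_self[of "delta k"]
  by (simp add: cinner_delta_left Rep_ell2_simps flip: of_real_power)
    (metis abs_norm_cancel abs_square_eq_1 of_real_eq_1_iff of_real_power)

lemma norm_cinner_le: "cmod (cinner x y) \<le> norm x * norm y"
proof (cases "cinner x y = 0")
  case False
  \<comment> \<open>The phase that rotates the inner product onto the non-negative reals; the bound
    becomes the real Cauchy-Schwarz inequality.\<close>
  define u where "u = cnj (cinner x y) / cmod (cinner x y)"
  have u: "cmod u = 1" "u * cinner x y = cmod (cinner x y)"
    using False by (simp_all add: u_def norm_divide complex_norm_square[symmetric] power2_eq_square
        mult.commute[of "cnj _"])
  have "cmod (cinner x y) = Re (cinner x (cscale u y))"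
    by (simp add: cinner_cscale_right u)
  also have "\<dots> \<le> norm x * norm (cscale u y)"
    unfolding Re_cinner by (rule norm_cauchy_schwarz)
  finally show ?thesis by (simp add: u)
qed simp

lemma tendsto_cinner:
  assumes "(f \<longlongrightarrow> x) F" "(g \<longlongrightarrow> y) F"
  shows "((\<lambda>n. cinner (f n) (g n)) \<longlongrightarrow> cinner x y) F"
  unfolding cinner_conv_inner
  by (intro tendsto_Complex tendsto_inner tendsto_cscale assms)

lemma tendsto_Rep_ell2:
  assumes "(f \<longlongrightarrow> x) F" shows "((\<lambda>n. Rep_ell2 (f n) k) \<longlongrightarrow> Rep_ell2 x k) F"
  using tendsto_cinner[OF tendsto_const assms, of "delta k"] by (simp add: cinner_delta_left)

lemma ell2_norm_le:
  assumes "0 \<le> B" "\<And>F. finite F \<Longrightarrow> (\<Sum>k\<in>F. (cmod (Rep_ell2 x k))\<^sup>2) \<le> B\<^sup>2"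
  shows "norm x \<le> B"
proof (rule power2_le_imp_le)
  show "(norm x)\<^sup>2 \<le> B\<^sup>2" unfolding norm_ell2_sq
    by (rule infsum_le_finite_sums) (use assms Rep_ell2_summable in auto)
qed (rule assms)

section \<open>Complex-linear operators\<close>

lemma clinear_op_cscale: "clinear_op T \<Longrightarrow> T (cscale c x) = cscale c (T x)"
  by (simp add: clinear_op_def)

lemma clinear_op_zero [simp]: "clinear_op 0"
  by (simp add: clinear_op_def)

lemma clinear_op_id [simp]: "clinear_op id_blinfun"
  by (simp add: clinear_op_def)

lemma clinear_op_add: "clinear_op S \<Longrightarrow> clinear_op T \<Longrightarrow> clinear_op (S + T)"
  by (simp add: clinear_op_def blinfun.add_left cscale_add)

lemma clinear_op_compose: "clinear_op S \<Longrightarrow> clinear_op T \<Longrightarrow> clinear_op (S o\<^sub>L T)"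
  by (simp add: clinear_op_def)

text \<open>\<open>op_scale\<close> is specified on basis vectors and controlled only for
  complex-linear operators. This pointwise version obeys the scalar laws on every bounded
  real-linear operator, the domain of the functionals below.\<close>

definition cmult :: "complex \<Rightarrow> ('a ell2 \<Rightarrow>\<^sub>L 'b ell2) \<Rightarrow> ('a ell2 \<Rightarrow>\<^sub>L 'b ell2)" where
  "cmult c T = Blinfun (\<lambda>x. cscale c (T x))"

lemma cmult_apply: "blinfun_apply (cmult c T) x = cscale c (T x)"
  unfolding cmult_def
  by (simp add: bounded_linear_Blinfun_apply
      bounded_linear_compose[OF bounded_linear_cscale blinfun.bounded_linear_right])

lemma clinear_op_cmult: "clinear_op T \<Longrightarrow> clinear_op (cmult c T)"
  by (simp add: clinear_op_def cmult_apply mult.commute)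

lemma op_scale_eq: "clinear_op T \<Longrightarrow> op_scale c T = cmult c T"
  unfolding op_scale_def
  by (rule op_of_basis_eqI) (simp_all add: clinear_op_cmult cmult_apply)

lemma cmult_simps [simp]: "cmult 0 T = 0" "cmult 1 T = T" "cmult (-1) T = - T" "cmult c 0 = 0"
  "cmult c (cmult d T) = cmult (c * d) T"
  by (rule blinfun_eqI; simp add: cmult_apply blinfun.minus_left)+

lemma cmult_add: "cmult c (S + T) = cmult c S + cmult c T"
  by (rule blinfun_eqI) (simp add: cmult_apply blinfun.add_left cscale_add)

lemma cmult_diff: "cmult c (S - T) = cmult c S - cmult c T"
  by (rule blinfun_eqI) (simp add: cmult_apply blinfun.diff_left cscale_diff)

lemma cmult_compose_left: "cmult c S o\<^sub>L T = cmult c (S o\<^sub>L T)"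
  by (rule blinfun_eqI) (simp add: cmult_apply)

lemma cmult_compose_right: "clinear_op S \<Longrightarrow> S o\<^sub>L cmult c T = cmult c (S o\<^sub>L T)"
  by (rule blinfun_eqI) (simp add: cmult_apply clinear_op_def)

lemma cmult_of_real: "cmult (of_real r) T = r *\<^sub>R T"
  by (rule blinfun_eqI) (simp add: cmult_apply blinfun.scaleR_left cscale_of_real)

lemma norm_cmult_le: "norm (cmult c T) \<le> cmod c * norm T"
proof (rule norm_blinfun_bound)
  show "norm (blinfun_apply (cmult c T) x) \<le> cmod c * norm T * norm x" for x
    using mult_left_mono[OF norm_blinfun[of T x], of "cmod c"] by (simp add: cmult_apply mult_ac)
qed simp

lemma blinfun_lim_apply:
  fixes T :: "'a::real_normed_vector \<Rightarrow>\<^sub>L 'b::real_normed_vector"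
  shows "S \<longlonglongrightarrow> T \<Longrightarrow> (\<lambda>n. blinfun_apply (S n) x) \<longlonglongrightarrow> T x"
  by (intro tendsto_intros)

lemma clinear_op_limit:
  assumes "\<And>n. clinear_op (S n)" "S \<longlonglongrightarrow> T"
  shows "clinear_op T"
  unfolding clinear_op_def
proof (intro allI)
  fix c x
  have "(\<lambda>n. blinfun_apply (S n) (cscale c x)) \<longlonglongrightarrow> T (cscale c x)"
    by (rule blinfun_lim_apply[OF assms(2)])
  moreover have "(\<lambda>n. blinfun_apply (S n) (cscale c x)) \<longlonglongrightarrow> cscale c (T x)"
    using tendsto_cscale[OF blinfun_lim_apply[OF assms(2)], of c x] assms(1)
    by (simp add: clinear_op_def)
  ultimately show "T (cscale c x) = cscale c (T x)" by (rule LIMSEQ_unique)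
qed

text \<open>On finite combinations of basis vectors the adjoint relation is the conjugate symmetry
  of the matrix entries; such combinations are dense and both sides are continuous.\<close>

lemma adjoint_pair_basisI:
  fixes S T :: "'a ell2 \<Rightarrow>\<^sub>L 'a ell2"
  assumes "clinear_op S" "clinear_op T"
    and m: "\<And>j k. Rep_ell2 (S (delta j)) k = cnj (Rep_ell2 (T (delta k)) j)"
  shows "adjoint_pair S T"
  unfolding adjoint_pair_def
proof (intro allI)
  fix x y :: "'a ell2"
  define E where "E F u = (\<Sum>i\<in>F. cscale (Rep_ell2 u i) (delta i))" for F and u :: "'a ell2"
  have basis: "cinner (S (E F x)) (E F' y) = cinner (E F x) (T (E F' y))" for F F'
  proof -
    have "cinner (S (delta i)) (delta j) = cinner (delta i) (T (delta j))" for i j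
      by (metis cinner_delta_left cnj_cinner complex_cnj_cnj m)
    then show ?thesis
      using assms(1,2)
      by (simp add: E_def blinfun.sum_right clinear_op_cscale cinner_sum_left cinner_sum_right
          cinner_cscale_left cinner_cscale_right)
  qed
  have "\<exists>F. \<forall>n. norm (u - E (F n) u) < 1 / Suc n" for u
    unfolding E_def using ell2_basis_expansion[of "1 / Suc n" u for n]
    by (metis of_nat_0_less_iff zero_less_Suc zero_less_divide_1_iff)
  then have "\<exists>F. (\<lambda>n. E (F n) u) \<longlonglongrightarrow> u" for u
  proof -
    assume "\<And>u. \<exists>F. \<forall>n. norm (u - E (F n) u) < 1 / Suc n"
    then obtain F where F: "\<And>n. norm (u - E (F n) u) < 1 / Suc n" by blast
    have "(\<lambda>n. E (F n) u - u) \<longlonglongrightarrow> 0"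
      by (rule Lim_null_comparison[OF _ LIMSEQ_inverse_real_of_nat])
        (use F in \<open>auto intro!: always_eventually less_imp_le simp: norm_minus_commute inverse_eq_divide\<close>)
    then show ?thesis using LIM_zero_iff by blast
  qed
  then obtain F F' where F: "(\<lambda>n. E (F n) x) \<longlonglongrightarrow> x" "(\<lambda>n. E (F' n) y) \<longlonglongrightarrow> y" by metis
  have "(\<lambda>n. cinner (S (E (F n) x)) (E (F' n) y)) \<longlonglongrightarrow> cinner (S x) y"
    by (intro tendsto_cinner F blinfun.tendsto tendsto_const)
  moreover have "(\<lambda>n. cinner (S (E (F n) x)) (E (F' n) y)) \<longlonglongrightarrow> cinner x (T y)"
    unfolding basis by (intro tendsto_cinner F blinfun.tendsto tendsto_const)
  ultimately show "cinner (S x) y = cinner x (T y)" by (rule LIMSEQ_unique)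
qed

text \<open>Where the weight is non-zero no coordinate of x is used twice, so the norm is at most
  the supremum of the weights. Restrictions to subsets, functions on bisections and the embedding of
  a single coset are all of this form.\<close>

lemma weighted_injection_op:
  fixes m :: "'b \<Rightarrow> complex" and \<sigma> :: "'b \<Rightarrow> 'a"
  assumes inj: "inj_on \<sigma> {k. m k \<noteq> 0}" and B: "\<And>k. cmod (m k) \<le> B"
  obtains T :: "'a ell2 \<Rightarrow>\<^sub>L 'b ell2" where "clinear_op T" "norm T \<le> B"
    "\<And>x k. Rep_ell2 (T x) k = m k * Rep_ell2 x (\<sigma> k)"
proof -
  have B0: "0 \<le> B" using B norm_ge_zero order_trans by blast
  have fin: "(\<Sum>k\<in>F. (cmod (m k * Rep_ell2 x (\<sigma> k)))\<^sup>2) \<le> (B * norm x)\<^sup>2" if "finite F" for F x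
  proof -
    let ?F = "{k\<in>F. m k \<noteq> 0}"
    have "(\<Sum>k\<in>F. (cmod (m k * Rep_ell2 x (\<sigma> k)))\<^sup>2) = (\<Sum>k\<in>?F. (cmod (m k * Rep_ell2 x (\<sigma> k)))\<^sup>2)"
      by (rule sum.mono_neutral_right) (use that in auto)
    also have "\<dots> \<le> (\<Sum>k\<in>?F. B\<^sup>2 * (cmod (Rep_ell2 x (\<sigma> k)))\<^sup>2)"
      by (intro sum_mono) (simp add: norm_mult power_mult_distrib mult_right_mono power_mono B)
    also have "\<dots> = B\<^sup>2 * (\<Sum>j\<in>\<sigma> ` ?F. (cmod (Rep_ell2 x j))\<^sup>2)"
    proof -
      have "inj_on \<sigma> ?F" using inj by (rule inj_on_subset) auto
      then show ?thesis by (simp add: sum.reindex sum_distrib_left)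
    qed
    also have "\<dots> \<le> B\<^sup>2 * (norm x)\<^sup>2"
      by (intro mult_left_mono ell2_finite_sum_le) (use that in auto)
    finally show ?thesis by (simp add: power_mult_distrib)
  qed
  define f where "f x = Abs_ell2 (\<lambda>k. m k * Rep_ell2 x (\<sigma> k))" for x :: "'a ell2"
  have Rf: "Rep_ell2 (f x) k = m k * Rep_ell2 x (\<sigma> k)" for x k
  proof -
    have "(\<lambda>k. (cmod (m k * Rep_ell2 x (\<sigma> k)))\<^sup>2) summable_on UNIV"
      using fin[of _ x] by (intro nonneg_bdd_above_summable_on bdd_aboveI) auto
    then show ?thesis by (simp add: f_def Abs_ell2_inverse)
  qed
  have bl: "bounded_linear f"
  proof (rule bounded_linear_intro)
    show "f (x + y) = f x + f y" for x y
      by (rule Rep_ell2_cong) (simp add: Rf Rep_ell2_simps algebra_simps)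
    show "f (r *\<^sub>R x) = r *\<^sub>R f x" for r x
      by (rule Rep_ell2_cong) (simp add: Rf Rep_ell2_simps)
    show "norm (f x) \<le> norm x * B" for x
      using ell2_norm_le[of "B * norm x" "f x"] fin[of _ x] B0 by (simp add: Rf mult.commute)
  qed
  show thesis
  proof
    show "clinear_op (Blinfun f)"
      unfolding clinear_op_def
      by (intro allI Rep_ell2_cong) (simp add: bounded_linear_Blinfun_apply[OF bl] Rf Rep_ell2_simps)
    show "norm (Blinfun f) \<le> B"
      using ell2_norm_le[of "B * norm x" "f x" for x] fin B0
      by (intro norm_blinfun_bound) (simp_all add: bounded_linear_Blinfun_apply[OF bl] Rf)
    show "Rep_ell2 (Blinfun f x) k = m k * Rep_ell2 x (\<sigma> k)" for x k
      by (simp add: bounded_linear_Blinfun_apply[OF bl] Rf)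
  qed
qed

definition restrict_op :: "'a set \<Rightarrow> ('a ell2 \<Rightarrow>\<^sub>L 'a ell2)" where
  "restrict_op A = (SOME T. clinear_op T \<and> norm T \<le> 1 \<and>
     (\<forall>x k. Rep_ell2 (T x) k = (if k \<in> A then Rep_ell2 x k else 0)))"

lemma
  shows clinear_op_restrict_op [simp]: "clinear_op (restrict_op A)"
    and norm_restrict_op: "norm (restrict_op A) \<le> 1"
    and Rep_restrict_op: "Rep_ell2 (restrict_op A x) k = (if k \<in> A then Rep_ell2 x k else 0)"
proof -
  obtain T :: "'a ell2 \<Rightarrow>\<^sub>L 'a ell2" where T: "clinear_op T" "norm T \<le> 1"
    "\<And>x k. Rep_ell2 (T x) k = (if k \<in> A then 1 else 0) * Rep_ell2 x k"
    by (rule weighted_injection_op[of "\<lambda>k. k" "\<lambda>k. if k \<in> A then 1 else 0" 1]) auto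
  then have "\<exists>T. clinear_op T \<and> norm T \<le> 1 \<and>
     (\<forall>x k. Rep_ell2 (T x) k = (if k \<in> A then Rep_ell2 x k else 0))"
    by (intro exI[of _ T]) auto
  from someI_ex[OF this] show "clinear_op (restrict_op A)" "norm (restrict_op A) \<le> 1"
    "Rep_ell2 (restrict_op A x) k = (if k \<in> A then Rep_ell2 x k else 0)"
    unfolding restrict_op_def by blast+
qed

lemma restrict_op_delta: "restrict_op A (delta k) = (if k \<in> A then delta k else 0)"
  by (rule Rep_ell2_cong) (auto simp: Rep_restrict_op Rep_ell2_simps)

lemma restrict_op_compose: "restrict_op A o\<^sub>L restrict_op B = restrict_op (A \<inter> B)"
  by (rule blinfun_eqI, rule Rep_ell2_cong) (auto simp: Rep_restrict_op)

lemma norm_compress_le: "norm (restrict_op A o\<^sub>L T o\<^sub>L restrict_op B) \<le> norm T"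
proof -
  have "norm (restrict_op A o\<^sub>L T o\<^sub>L restrict_op B) \<le> norm (restrict_op A) * norm T * norm (restrict_op B)"
    by (meson norm_blinfun_compose mult_right_mono norm_ge_zero order_trans)
  also have "\<dots> \<le> 1 * norm T * 1"
    by (intro mult_mono norm_restrict_op) auto
  finally show ?thesis by simp
qed

section \<open>The Hahn--Banach theorem\<close>

definition sublinear :: "('a::real_vector \<Rightarrow> real) \<Rightarrow> bool" where
  "sublinear p \<longleftrightarrow> (\<forall>x y. p (x + y) \<le> p x + p y) \<and> (\<forall>c x. 0 \<le> c \<longrightarrow> p (c *\<^sub>R x) = c * p x)"

lemma sublinearI:
  assumes "\<And>x y. p (x + y) \<le> p x + p y" "p 0 = 0" "\<And>c x. 0 < c \<Longrightarrow> p (c *\<^sub>R x) \<le> c * p x"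
  shows "sublinear p"
  unfolding sublinear_def
proof (intro conjI allI impI)
  fix c :: real and x assume "0 \<le> c"
  show "p (c *\<^sub>R x) = c * p x"
  proof (cases "c = 0")
    case False
    with \<open>0 \<le> c\<close> have "0 < c" by simp
    \<comment> \<open>The hypothesis for 1/c at the vector c x is the missing reverse
      inequality.\<close>
    then have "p (inverse c *\<^sub>R c *\<^sub>R x) \<le> inverse c * p (c *\<^sub>R x)" by (intro assms) simp
    then have "c * p x \<le> p (c *\<^sub>R x)" using \<open>0 < c\<close> by (simp add: field_simps)
    with assms(3)[OF \<open>0 < c\<close>] show ?thesis by (simp add: order_antisym)
  qed (simp add: assms)
qed (rule assms)

lemma sublinearD:
  assumes "sublinear p"
  shows "p (x + y) \<le> p x + p y" "0 \<le> c \<Longrightarrow> p (c *\<^sub>R x) = c * p x" "p 0 = 0" "- p (- x) \<le> p x"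
proof -
  show 1: "p (x + y) \<le> p x + p y" "0 \<le> c \<Longrightarrow> p (c *\<^sub>R x) = c * p x" for x y c
    using assms by (simp_all add: sublinear_def)
  show 0: "p 0 = 0" using 1(2)[of 0 0] by simp
  show "- p (- x) \<le> p x" using 1(1)[of x "- x"] 0 by simp
qed

text \<open>The shift lowers the value at -y to -p(y) and stays sublinear; the infimum is finite
  because t p(y) \<le> p(x + t y) + p(-x). A minimal sublinear functional coincides with its shift
  in every direction, which forces additivity.\<close>

lemma sublinear_shift:
  fixes p :: "'a::real_vector \<Rightarrow> real" and y :: 'a
  assumes p: "sublinear p"
  defines "q \<equiv> \<lambda>x. INF t\<in>{0..}. p (x + t *\<^sub>R y) - t * p y"
  shows "sublinear q" "q x \<le> p x" "q x \<le> p (x + y) - p y"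
proof -
  have bdd: "bdd_below ((\<lambda>t. p (x + t *\<^sub>R y) - t * p y) ` {0..})" for x
  proof (rule bdd_belowI2)
    fix t :: real assume "t \<in> {0..}"
    then have "t * p y = p ((x + t *\<^sub>R y) + - x)" using sublinearD(2)[OF p] by simp
    also have "\<dots> \<le> p (x + t *\<^sub>R y) + p (- x)" by (rule sublinearD(1)[OF p])
    finally show "- p (- x) \<le> p (x + t *\<^sub>R y) - t * p y" by simp
  qed
  have le: "q x \<le> p (x + t *\<^sub>R y) - t * p y" if "0 \<le> t" for x t
    unfolding q_def by (rule cINF_lower[OF bdd]) (use that in simp)
  have ge: "z \<le> q x" if "\<And>t. 0 \<le> t \<Longrightarrow> z \<le> p (x + t *\<^sub>R y) - t * p y" for x z
    unfolding q_def by (rule cINF_greatest) (use that in auto)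
  show "q x \<le> p x" using le[of 0] by simp
  show "q x \<le> p (x + y) - p y" using le[of 1] by simp
  show "sublinear q"
  proof (rule sublinearI)
    fix x1 x2
    have "q (x1 + x2) - (p (x2 + t2 *\<^sub>R y) - t2 * p y) \<le> p (x1 + t1 *\<^sub>R y) - t1 * p y"
      if "0 \<le> t1" "0 \<le> t2" for t1 t2
    proof -
      have "p (x1 + x2 + (t1 + t2) *\<^sub>R y) \<le> p (x1 + t1 *\<^sub>R y) + p (x2 + t2 *\<^sub>R y)"
        using sublinearD(1)[OF p, of "x1 + t1 *\<^sub>R y" "x2 + t2 *\<^sub>R y"] by (simp add: algebra_simps)
      with le[of "t1 + t2" "x1 + x2"] that show ?thesis by (simp add: algebra_simps)
    qed
    then have "q (x1 + x2) - (p (x2 + t2 *\<^sub>R y) - t2 * p y) \<le> q x1" if "0 \<le> t2" for t2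
      using that by (intro ge) auto
    then have "q (x1 + x2) - q x1 \<le> q x2" by (intro ge) (simp add: algebra_simps)
    then show "q (x1 + x2) \<le> q x1 + q x2" by simp
  next
    show "q 0 = 0"
    proof (rule antisym)
      show "q 0 \<le> 0" using le[of 0 0] sublinearD(3)[OF p] by simp
      show "0 \<le> q 0" by (rule ge) (simp add: sublinearD(2)[OF p])
    qed
  next
    fix c :: real and x assume c: "0 < c"
    have "q (c *\<^sub>R x) / c \<le> p (x + t *\<^sub>R y) - t * p y" if "0 \<le> t" for t
    proof -
      have "p (c *\<^sub>R x + (c * t) *\<^sub>R y) = c * p (x + t *\<^sub>R y)"
        using sublinearD(2)[OF p, of c "x + t *\<^sub>R y"] c by (simp add: scaleR_add_right)
      then show ?thesis using le[of "c * t" "c *\<^sub>R x"] c that by (simp add: field_simps)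
    qed
    then have "q (c *\<^sub>R x) / c \<le> q x" by (rule ge)
    then show "q (c *\<^sub>R x) \<le> c * q x" using c by (simp add: field_simps)
  qed
qed

text \<open>Zorn's lemma for the reversed order. The pointwise infimum of a chain stays finite
  because sublinearity bounds each member below by -p(-x).\<close>

lemma minimal_sublinear:
  fixes p :: "'a::real_vector \<Rightarrow> real"
  assumes p: "sublinear p"
  obtains q where "sublinear q" "\<And>x. q x \<le> p x"
    "\<And>q'. sublinear q' \<Longrightarrow> (\<And>x. q' x \<le> q x) \<Longrightarrow> q' = q"
proof -
  let ?A = "{q. sublinear q \<and> (\<forall>x. q x \<le> p x)}" and ?P = "\<lambda>q q'. \<forall>x. q' x \<le> q (x :: 'a) :: bool"
  have "\<exists>m\<in>?A. \<forall>a\<in>?A. ?P m a \<longrightarrow> a = m"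
  proof (rule predicate_Zorn)
    show "partial_order_on ?A (relation_of ?P ?A)"
      by (rule partial_order_on_relation_ofI) (auto intro: order_trans intro!: ext order.antisym)
    fix C assume C: "C \<in> Chains (relation_of ?P ?A)"
    then have CA: "C \<subseteq> ?A" and tot: "\<And>q r. q \<in> C \<Longrightarrow> r \<in> C \<Longrightarrow> ?P q r \<or> ?P r q"
      by (auto simp: Chains_def relation_of_def)
    show "\<exists>u\<in>?A. \<forall>a\<in>C. ?P a u"
    proof (cases "C = {}")
      case True then show ?thesis using p by auto
    next
      case False
      define u where "u x = (INF q\<in>C. q x)" for x
      have bdd: "bdd_below ((\<lambda>q. q x) ` C)" for x
      proof (rule bdd_belowI2)
        fix q assume "q \<in> C"
        with CA have "sublinear q" "q (- x) \<le> p (- x)" by auto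
        with sublinearD(4)[of q x] show "- p (- x) \<le> q x" by linarith
      qed
      have le: "u x \<le> q x" if "q \<in> C" for q x
        unfolding u_def by (rule cINF_lower[OF bdd that])
      have ge: "z \<le> u x" if "\<And>q. q \<in> C \<Longrightarrow> z \<le> q x" for z x
        unfolding u_def by (rule cINF_greatest[OF False that])
      have "sublinear u"
      proof (rule sublinearI)
        fix x y
        have "u (x + y) - r y \<le> q x" if qr: "q \<in> C" "r \<in> C" for q r
        proof -
          \<comment> \<open>Subadditivity of the infimum needs the chain property: the smaller of
            two members serves both arguments at once.\<close>
          from tot[OF qr] obtain s where s: "s \<in> C" "s x \<le> q x" "s y \<le> r y"
            using qr by (metis order_refl)
          have "u (x + y) \<le> s (x + y)" by (rule le[OF s(1)])
          also have "\<dots> \<le> s x + s y" using s(1) CA by (auto intro: sublinearD)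
          finally show ?thesis using s by linarith
        qed
        then have "u (x + y) - r y \<le> u x" if "r \<in> C" for r using that by (intro ge) auto
        then have "u (x + y) - u x \<le> u y" by (intro ge) (simp add: algebra_simps)
        then show "u (x + y) \<le> u x + u y" by simp
      next
        have "q 0 = 0" if "q \<in> C" for q using that CA by (auto intro: sublinearD)
        then have "u 0 = (INF q\<in>C. 0)" unfolding u_def by (intro INF_cong) auto
        then show "u 0 = 0" using False by simp
      next
        fix c :: real and x assume c: "0 < c"
        have "u (c *\<^sub>R x) / c \<le> q x" if "q \<in> C" for q
        proof -
          have "q (c *\<^sub>R x) = c * q x" using that CA c by (auto intro: sublinearD)
          with le[OF that, of "c *\<^sub>R x"] c show ?thesis by (simp add: field_simps)
        qed
        then have "u (c *\<^sub>R x) / c \<le> u x" by (rule ge)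
        then show "u (c *\<^sub>R x) \<le> c * u x" using c by (simp add: field_simps)
      qed
      moreover have "u x \<le> p x" for x
        using False CA le by (metis (mono_tags, lifting) all_not_in_conv mem_Collect_eq order_trans subsetD)
      ultimately show ?thesis using le by auto
    qed
  qed
  then obtain q where q: "sublinear q" "\<And>x. q x \<le> p x" "\<And>q'. q' \<in> ?A \<Longrightarrow> ?P q q' \<Longrightarrow> q' = q"
    by blast
  show thesis
  proof (rule that[OF q(1,2)])
    show "q' = q" if "sublinear q'" "\<And>x. q' x \<le> q x" for q'
      using that q(2) by (intro q(3)) (auto intro: order_trans)
  qed
qed

text \<open>Zorn's lemma starts from the shift of p in direction y rather than from p: whatever lies
  below that shift is at most -p(y) at -y. Minimality gives linearity, and a linear functional with
  this value at -y attains p at y.\<close>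

lemma hahn_banach:
  fixes p :: "'a::real_vector \<Rightarrow> real"
  assumes p: "sublinear p"
  obtains \<phi> where "linear \<phi>" "\<And>x. \<phi> x \<le> p x" "\<phi> y = p y"
proof -
  obtain q where q: "sublinear q" "\<And>x. q x \<le> (INF t\<in>{0..}. p (x + t *\<^sub>R y) - t * p y)"
    "\<And>q'. sublinear q' \<Longrightarrow> (\<And>x. q' x \<le> q x) \<Longrightarrow> q' = q"
    using minimal_sublinear[OF sublinear_shift(1)[OF p]] by blast
  have qp: "q x \<le> p x" for x
    by (rule order_trans[OF q(2) sublinear_shift(2)[OF p]])
  have "q x \<le> q (x + z) - q z" for x z
  proof -
    have "(\<lambda>x. INF t\<in>{0..}. q (x + t *\<^sub>R z) - t * q z) = q"
      by (rule q(3)[OF sublinear_shift(1)[OF q(1)] sublinear_shift(2)[OF q(1)]])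
    from fun_cong[OF this, of x] sublinear_shift(3)[OF q(1), where x = x and y = z]
    show ?thesis by linarith
  qed
  then have add: "q (x + z) = q x + q z" for x z
    using sublinearD(1)[OF q(1), of x z] by (simp add: algebra_simps antisym)
  have neg: "q (- x) = - q x" for x
    using add[of x "- x"] sublinearD(3)[OF q(1)] by simp
  have lin: "linear q"
  proof (rule linearI[OF add])
    fix c x
    show "q (c *\<^sub>R x) = c *\<^sub>R q x"
      using sublinearD(2)[OF q(1), of c x] sublinearD(2)[OF q(1), of "- c" x] neg[of "c *\<^sub>R x"]
      by (cases "0 \<le> c") simp_all
  qed
  have "q y = p y"
  proof (rule antisym[OF qp])
    have "q (- y) \<le> p (- y + y) - p y"
      by (rule order_trans[OF q(2) sublinear_shift(3)[OF p]])
    then show "p y \<le> q y" by (simp add: neg sublinearD(3)[OF p])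
  qed
  with that lin qp show thesis .
qed

text \<open>Since \<open>\<parallel>1 - tT\<parallel>\<^sup>2 \<le> 1 + t\<^sup>2\<parallel>T\<parallel>\<^sup>2\<close> for accretive \<open>T\<close>, a normalized functional of norm one is
  non-negative at \<open>T\<close>.\<close>

lemma accretive_nonneg:
  fixes \<phi> :: "('a ell2 \<Rightarrow>\<^sub>L 'a ell2) \<Rightarrow> real" and T :: "'a ell2 \<Rightarrow>\<^sub>L 'a ell2"
  assumes lin: "linear \<phi>" and le: "\<And>S. \<phi> S \<le> norm S" and one: "\<phi> id_blinfun = 1"
    and acc: "\<And>x. 0 \<le> inner x (T x)"
  shows "0 \<le> \<phi> T"
proof -
  \<comment> \<open>From 1 - t \<phi>(T) \<le> 1 + t^2 |T|^2, division by t leaves a bound that is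
    linear in t, and t tends to zero.\<close>
  have *: "- \<phi> T \<le> t * (norm T)\<^sup>2" if t: "0 < t" for t
  proof -
    have "norm (id_blinfun - t *\<^sub>R T) \<le> sqrt (1 + t\<^sup>2 * (norm T)\<^sup>2)"
    proof (rule norm_blinfun_bound)
      fix x
      have "(norm (x - t *\<^sub>R T x))\<^sup>2 = (norm x)\<^sup>2 - 2 * t * inner x (T x) + t\<^sup>2 * (norm (T x))\<^sup>2"
        unfolding power2_norm_eq_inner
        by (simp add: inner_diff inner_commute[of "T x" x] algebra_simps power2_eq_square)
      also have "\<dots> \<le> (norm x)\<^sup>2 + t\<^sup>2 * (norm T * norm x)\<^sup>2"
      proof -
        have "t\<^sup>2 * (norm (T x))\<^sup>2 \<le> t\<^sup>2 * (norm T * norm x)\<^sup>2"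
          by (intro mult_left_mono power_mono norm_blinfun) auto
        moreover have "0 \<le> 2 * t * inner x (T x)" using t acc[of x] by simp
        ultimately show ?thesis by linarith
      qed
      also have "\<dots> = (sqrt (1 + t\<^sup>2 * (norm T)\<^sup>2) * norm x)\<^sup>2"
        by (simp add: power_mult_distrib algebra_simps)
      finally have "norm (x - t *\<^sub>R T x) \<le> sqrt (1 + t\<^sup>2 * (norm T)\<^sup>2) * norm x"
        by (rule power2_le_imp_le) simp
      then show "norm (blinfun_apply (id_blinfun - t *\<^sub>R T) x) \<le> sqrt (1 + t\<^sup>2 * (norm T)\<^sup>2) * norm x"
        by (simp add: blinfun.diff_left blinfun.scaleR_left)
    qed simp
    also have "\<dots> \<le> 1 + t\<^sup>2 * (norm T)\<^sup>2"
    proof -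
      have "sqrt (1 + s) \<le> 1 + s" if "0 \<le> s" for s :: real
        using that by (intro real_le_lsqrt) (auto simp: power2_eq_square algebra_simps)
      then show ?thesis by simp
    qed
    finally have "\<phi> (id_blinfun - t *\<^sub>R T) \<le> 1 + t\<^sup>2 * (norm T)\<^sup>2"
      using le order_trans by blast
    then have "t * (- \<phi> T) \<le> t * (t * (norm T)\<^sup>2)"
      by (simp add: linear_diff[OF lin] linear_cmul[OF lin] one power2_eq_square)
    then show ?thesis using t by (rule mult_left_le_imp_le)
  qed
  have "- \<phi> T \<le> 0 + e" if "0 < e" for e
  proof -
    have "- \<phi> T \<le> e / ((norm T)\<^sup>2 + 1) * (norm T)\<^sup>2"
      by (rule *) (use that in \<open>simp add: add_nonneg_pos\<close>)
    also have "\<dots> \<le> e"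
    proof -
      have "0 < (norm T)\<^sup>2 + 1" by (simp add: add_nonneg_pos)
      then show ?thesis using that by (simp add: pos_divide_le_eq)
    qed
    finally show ?thesis by simp
  qed
  then have "- \<phi> T \<le> 0" by (rule field_le_epsilon)
  then show ?thesis by simp
qed

section \<open>Linear combinations and positive definite kernels\<close>

definition finitely_supported :: "'s set \<Rightarrow> ('s \<Rightarrow> complex) set" where
  "finitely_supported S = {c. finite {s. c s \<noteq> 0} \<and> {s. c s \<noteq> 0} \<subseteq> S}"

definition lincomb :: "('s \<Rightarrow> complex) \<Rightarrow> ('s \<Rightarrow> 'i ell2) \<Rightarrow> 'i ell2" where
  "lincomb c v = (\<Sum>s | c s \<noteq> 0. cscale (c s) (v s))"

lemma lincomb_superset:
  "finite F \<Longrightarrow> {s. c s \<noteq> 0} \<subseteq> F \<Longrightarrow> lincomb c v = (\<Sum>s\<in>F. cscale (c s) (v s))"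
  unfolding lincomb_def by (rule sum.mono_neutral_left) auto

lemma finitely_supported_add:
  assumes "c \<in> finitely_supported S" "d \<in> finitely_supported S"
  shows "(\<lambda>s. c s + d s) \<in> finitely_supported S"
proof -
  have "{s. c s + d s \<noteq> 0} \<subseteq> {s. c s \<noteq> 0} \<union> {s. d s \<noteq> 0}" by auto
  moreover from this have "finite {s. c s + d s \<noteq> 0}"
    by (rule finite_subset) (use assms in \<open>simp add: finitely_supported_def\<close>)
  ultimately show ?thesis
    using assms unfolding finitely_supported_def mem_Collect_eq by blast
qed

lemma finitely_supported_scale:
  assumes "c \<in> finitely_supported S" shows "(\<lambda>s. a * c s) \<in> finitely_supported S"
proof -
  have "{s. a * c s \<noteq> 0} \<subseteq> {s. c s \<noteq> 0}" by auto
  moreover from this have "finite {s. a * c s \<noteq> 0}"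
    by (rule finite_subset) (use assms in \<open>simp add: finitely_supported_def\<close>)
  ultimately show ?thesis
    using assms unfolding finitely_supported_def mem_Collect_eq by blast
qed

lemma finitely_supported_single: "s \<in> S \<Longrightarrow> (\<lambda>t. if t = s then a else 0) \<in> finitely_supported S"
  by (auto simp: finitely_supported_def intro: finite_subset[of _ "{s}"])

lemma finitely_supported_zero [simp]: "(\<lambda>s. 0) \<in> finitely_supported S"
  by (simp add: finitely_supported_def)

lemma lincomb_add:
  assumes "c \<in> finitely_supported S" "d \<in> finitely_supported S"
  shows "lincomb (\<lambda>s. c s + d s) v = lincomb c v + lincomb d v"
proof -
  let ?F = "{s. c s \<noteq> 0} \<union> {s. d s \<noteq> 0}"
  have "finite ?F" using assms by (simp add: finitely_supported_def)
  then show ?thesis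
    by (subst (1 2 3) lincomb_superset[of ?F]) (auto simp: cscale_add_left sum.distrib)
qed

lemma lincomb_scale:
  assumes "c \<in> finitely_supported S"
  shows "lincomb (\<lambda>s. a * c s) v = cscale a (lincomb c v)"
proof -
  have "finite {s. c s \<noteq> 0}" using assms by (simp add: finitely_supported_def)
  then show ?thesis
    by (subst (1 2) lincomb_superset[of "{s. c s \<noteq> 0}"]) (auto simp: cscale_sum)
qed

lemma lincomb_single: "lincomb (\<lambda>t. if t = s then a else 0) v = cscale a (v s)"
  by (subst lincomb_superset[of "{s}"]) auto

lemma lincomb_zero [simp]: "lincomb (\<lambda>s. 0) v = 0"
  by (simp add: lincomb_def)

lemma cinner_lincomb:
  "cinner (lincomb c v) (lincomb d w) = (\<Sum>s | c s \<noteq> 0. \<Sum>t | d t \<noteq> 0. cnj (c s) * d t * cinner (v s) (w t))"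
  unfolding lincomb_def cinner_sum_left
  by (simp add: cinner_sum_right cinner_cscale_left cinner_cscale_right sum_distrib_left mult_ac)

lemma norm_sq_cinner: "(norm x)\<^sup>2 = Re (cinner x x)"
  by (simp add: cinner_self)

section \<open>Closed spans and isometries between them\<close>

definition closed_cspan :: "'s set \<Rightarrow> ('s \<Rightarrow> 'i ell2) \<Rightarrow> 'i ell2 set" where
  "closed_cspan S v = closure ((\<lambda>c. lincomb c v) ` finitely_supported S)"

lemma lincomb_in_closed_cspan: "c \<in> finitely_supported S \<Longrightarrow> lincomb c v \<in> closed_cspan S v"
  unfolding closed_cspan_def by (rule subsetD[OF closure_subset imageI])

lemma closed_closed_cspan [simp]: "closed (closed_cspan S v)"
  by (simp add: closed_cspan_def)

lemma closed_cspan_zero [simp]: "0 \<in> closed_cspan S v"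
  using lincomb_in_closed_cspan[OF finitely_supported_zero] by (metis lincomb_zero)

lemma closed_cspan_base: "s \<in> S \<Longrightarrow> v s \<in> closed_cspan S v"
  using lincomb_in_closed_cspan[OF finitely_supported_single, of s S 1 v] by (simp add: lincomb_single)

text \<open>An induction principle for the closure: a closed condition on a continuous image is
  checked on linear combinations only. For sums of two vectors it is applied in one variable at a
  time.\<close>

lemma closed_cspan_closedI:
  assumes "continuous_on UNIV g" "closed T"
    and "\<And>c. c \<in> finitely_supported S \<Longrightarrow> g (lincomb c v) \<in> T" "x \<in> closed_cspan S v"
  shows "g x \<in> T"
proof -
  have "g ` closed_cspan S v \<subseteq> T"
    unfolding closed_cspan_def
    by (rule image_closure_subset) (use assms in \<open>auto intro: continuous_on_subset\<close>)
  then show ?thesis using assms(4) by blast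
qed

lemma closed_cspan_scale:
  assumes "x \<in> closed_cspan S v" shows "cscale a x \<in> closed_cspan S v"
proof (rule closed_cspan_closedI[OF _ closed_closed_cspan _ assms])
  fix c assume c: "c \<in> finitely_supported S"
  show "cscale a (lincomb c v) \<in> closed_cspan S v"
    using lincomb_in_closed_cspan[OF finitely_supported_scale[OF c], of a v]
    by (simp add: lincomb_scale[OF c])
qed (intro linear_continuous_on bounded_linear_cscale)

lemma closed_cspan_add:
  assumes "x \<in> closed_cspan S v" "y \<in> closed_cspan S v" shows "x + y \<in> closed_cspan S v"
proof (rule closed_cspan_closedI[OF _ closed_closed_cspan _ assms(2)])
  fix d assume d: "d \<in> finitely_supported S"
  show "x + lincomb d v \<in> closed_cspan S v"
  proof (rule closed_cspan_closedI[OF _ closed_closed_cspan _ assms(1)])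
    fix c assume c: "c \<in> finitely_supported S"
    show "lincomb c v + lincomb d v \<in> closed_cspan S v"
      using lincomb_in_closed_cspan[OF finitely_supported_add[OF c d], of v]
      by (simp add: lincomb_add[OF c d])
  qed (intro continuous_intros)
qed (intro continuous_intros)

lemma closed_cspan_diff:
  "x \<in> closed_cspan S v \<Longrightarrow> y \<in> closed_cspan S v \<Longrightarrow> x - y \<in> closed_cspan S v"
  using closed_cspan_add[of x S v "cscale (-1) y"] closed_cspan_scale[of y S v "-1"] by simp

lemma closure_sequenceE:
  fixes x :: "'a::first_countable_topology"
  assumes "x \<in> closure A"
  obtains f where "\<And>n. f n \<in> A" "f \<longlonglongrightarrow> x"
  using assms by (auto simp: closure_sequential)

text \<open>Families with equal Gram matrices are related by an isometry: the closure of the graph of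
  the correspondence between linear combinations is the graph of one.\<close>

lemma isometry_extension:
  fixes v w :: "'s \<Rightarrow> 'i ell2"
  assumes gram: "\<And>s t. s \<in> S \<Longrightarrow> t \<in> S \<Longrightarrow> cinner (v s) (v t) = cinner (w s) (w t)"
  obtains U where
    "\<And>x. x \<in> closed_cspan S v \<Longrightarrow> U x \<in> closed_cspan S w"
    "\<And>x. x \<in> closed_cspan S v \<Longrightarrow> norm (U x) = norm x"
    "\<And>x y. x \<in> closed_cspan S v \<Longrightarrow> y \<in> closed_cspan S v \<Longrightarrow> U (x + y) = U x + U y"
    "\<And>c x. x \<in> closed_cspan S v \<Longrightarrow> U (cscale c x) = cscale c (U x)"
    "\<And>s. s \<in> S \<Longrightarrow> U (v s) = w s"
proof -
  have isoc: "cinner (lincomb c v) (lincomb d v) = cinner (lincomb c w) (lincomb d w)"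
    if "c \<in> finitely_supported S" "d \<in> finitely_supported S" for c d
  proof -
    have "s \<in> S" "t \<in> S" if "c s \<noteq> 0" "d t \<noteq> 0" for s t
      using that \<open>c \<in> finitely_supported S\<close> \<open>d \<in> finitely_supported S\<close>
      by (auto simp: finitely_supported_def)
    then show ?thesis unfolding cinner_lincomb by (intro sum.cong refl) (simp add: gram)
  qed
  then have isoZ: "norm (lincomb c v) = norm (lincomb c w)" if "c \<in> finitely_supported S" for c
    using isoc[OF that that] by (simp add: cinner_self flip: of_real_power)
  define Z where "Z = (\<lambda>c. (lincomb c v, lincomb c w)) ` finitely_supported S"
  have seq: "\<exists>c. (\<forall>n. c n \<in> finitely_supported S) \<and> (\<lambda>n. lincomb (c n) v) \<longlonglongrightarrow> fst z \<and>
      (\<lambda>n. lincomb (c n) w) \<longlonglongrightarrow> snd z" if z: "z \<in> closure Z" for z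
  proof -
    obtain f where f: "\<And>n. f n \<in> Z" "f \<longlonglongrightarrow> z" by (rule closure_sequenceE[OF z]) (rule that)
    then have "\<forall>n. \<exists>c. c \<in> finitely_supported S \<and> f n = (lincomb c v, lincomb c w)"
      unfolding Z_def by auto
    from choice[OF this] obtain c
      where c: "\<forall>n. c n \<in> finitely_supported S \<and> f n = (lincomb (c n) v, lincomb (c n) w)" ..
    then have "f = (\<lambda>n. (lincomb (c n) v, lincomb (c n) w))" by auto
    with c show ?thesis
      using tendsto_fst[OF f(2)] tendsto_snd[OF f(2)] by (intro exI[of _ c]) simp
  qed
  have lim: "(x, y) \<in> closure Z"
    if "\<And>n. c n \<in> finitely_supported S" "(\<lambda>n. lincomb (c n) v) \<longlonglongrightarrow> x" "(\<lambda>n. lincomb (c n) w) \<longlonglongrightarrow> y"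
    for x y c
    unfolding closure_sequential
    by (rule exI[of _ "\<lambda>n. (lincomb (c n) v, lincomb (c n) w)"])
      (use that in \<open>auto simp: Z_def intro!: tendsto_Pair\<close>)
  have nrm: "norm (fst z) = norm (snd z)" if z: "z \<in> closure Z" for z
  proof -
    obtain c where "\<forall>n. c n \<in> finitely_supported S" "(\<lambda>n. lincomb (c n) v) \<longlonglongrightarrow> fst z"
      "(\<lambda>n. lincomb (c n) w) \<longlonglongrightarrow> snd z" using seq[OF z] by (elim exE conjE) (rule that)
    note c = this
    have "(\<lambda>n. norm (lincomb (c n) v)) = (\<lambda>n. norm (lincomb (c n) w))"
      using isoZ c(1) by auto
    with tendsto_norm[OF c(2)] tendsto_norm[OF c(3)] show ?thesis
      using LIMSEQ_unique by metis
  qed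
  have add: "(x + x', y + y') \<in> closure Z" if xy: "(x, y) \<in> closure Z" "(x', y') \<in> closure Z" for x y x' y'
  proof -
    obtain c c' where c: "\<forall>n. c n \<in> finitely_supported S" "(\<lambda>n. lincomb (c n) v) \<longlonglongrightarrow> x"
      "(\<lambda>n. lincomb (c n) w) \<longlonglongrightarrow> y" "\<forall>n. c' n \<in> finitely_supported S"
      "(\<lambda>n. lincomb (c' n) v) \<longlonglongrightarrow> x'" "(\<lambda>n. lincomb (c' n) w) \<longlonglongrightarrow> y'"
      using seq[OF xy(1)] seq[OF xy(2)] unfolding fst_conv snd_conv
      by (elim exE conjE) (rule that)
    have "(\<lambda>n. lincomb (\<lambda>s. c n s + c' n s) u) = (\<lambda>n. lincomb (c n) u + lincomb (c' n) u)"
      for u :: "'s \<Rightarrow> 'i ell2"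
      using lincomb_add[of _ S] c(1,4) by (intro ext) blast
    then show ?thesis
      using tendsto_add[OF c(2) c(5)] tendsto_add[OF c(3) c(6)] c(1,4)
      by (intro lim[of "\<lambda>n s. c n s + c' n s"]) (simp_all add: finitely_supported_add)
  qed
  have scale: "(cscale a x, cscale a y) \<in> closure Z" if xy: "(x, y) \<in> closure Z" for x y a
  proof -
    obtain c where c: "\<forall>n. c n \<in> finitely_supported S" "(\<lambda>n. lincomb (c n) v) \<longlonglongrightarrow> x"
      "(\<lambda>n. lincomb (c n) w) \<longlonglongrightarrow> y"
      using seq[OF xy(1)] unfolding fst_conv snd_conv by (elim exE conjE) (rule that)
    have "(\<lambda>n. lincomb (\<lambda>s. a * c n s) u) = (\<lambda>n. cscale a (lincomb (c n) u))"
      for u :: "'s \<Rightarrow> 'i ell2"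
      using lincomb_scale[of _ S] c(1) by (intro ext) blast
    then show ?thesis
      using tendsto_cscale[OF c(2)] tendsto_cscale[OF c(3)] c(1)
      by (intro lim[of "\<lambda>n s. a * c n s"]) (simp_all add: finitely_supported_scale)
  qed
  \<comment> \<open>The difference (0, y - y') again lies in the closure, where both components have
    the same norm.\<close>
  have uniq: "y = y'" if "(x, y) \<in> closure Z" "(x, y') \<in> closure Z" for x y y'
    using nrm[OF add[OF that(1) scale[OF that(2), of "-1"]]] by simp
  have ex: "\<exists>y. (x, y) \<in> closure Z" if x: "x \<in> closed_cspan S v" for x
  proof -
    obtain f where f: "\<And>n. f n \<in> (\<lambda>c. lincomb c v) ` finitely_supported S" "f \<longlonglongrightarrow> x"
      by (rule closure_sequenceE[OF x[unfolded closed_cspan_def]]) (rule that)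
    then have "\<forall>n. \<exists>c. c \<in> finitely_supported S \<and> f n = lincomb c v" by auto
    from choice[OF this] obtain c
      where c: "\<And>n. c n \<in> finitely_supported S" "\<And>n. f n = lincomb (c n) v" by auto
    have d: "dist (lincomb (c m) w) (lincomb (c n) w) = dist (f m) (f n)" for m n
    proof -
      have *: "lincomb (c m) u - lincomb (c n) u = lincomb (\<lambda>s. c m s + (-1) * c n s) u"
        for u :: "'s \<Rightarrow> 'i ell2"
        using lincomb_add[OF c(1) finitely_supported_scale[OF c(1)], of m "-1" n u]
          lincomb_scale[OF c(1), of "-1" n u] by simp
      show ?thesis
        unfolding dist_norm c(2) *
        by (intro isoZ[symmetric] finitely_supported_add finitely_supported_scale c)
    qed
    have "Cauchy f" using f(2) by (simp add: LIMSEQ_imp_Cauchy)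
    then have "Cauchy (\<lambda>n. lincomb (c n) w)" by (simp add: Cauchy_def d)
    then obtain y where y: "(\<lambda>n. lincomb (c n) w) \<longlonglongrightarrow> y"
      using Cauchy_convergent convergent_def by blast
    have fe: "f = (\<lambda>n. lincomb (c n) v)" using c(2) by auto
    from lim[of c, OF c(1) f(2)[unfolded fe] y] show ?thesis ..
  qed
  define U where "U x = (THE y. (x, y) \<in> closure Z)" for x
  have UI: "U x = y" if "(x, y) \<in> closure Z" for x y
    unfolding U_def using that uniq by blast
  have UD: "(x, U x) \<in> closure Z" if "x \<in> closed_cspan S v" for x
    using ex[OF that] UI by blast
  show thesis
  proof
    fix x y c assume x: "x \<in> closed_cspan S v"
    show "U x \<in> closed_cspan S w"
    proof -
      obtain c where "\<forall>n. c n \<in> finitely_supported S" "(\<lambda>n. lincomb (c n) w) \<longlonglongrightarrow> U x"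
        using seq[OF UD[OF x]] unfolding snd_conv by (elim exE conjE) (rule that)
      then show ?thesis
        using closed_sequentially[OF closed_closed_cspan, of "\<lambda>n. lincomb (c n) w" S w "U x"]
        by (simp add: lincomb_in_closed_cspan)
    qed
    show "norm (U x) = norm x" using nrm[OF UD[OF x]] by simp
    show "U (cscale c x) = cscale c (U x)" by (intro UI scale UD x)
    assume y: "y \<in> closed_cspan S v"
    show "U (x + y) = U x + U y" by (intro UI add UD x y)
  next
    fix s assume "s \<in> S"
    then have "(lincomb (\<lambda>t. if t = s then 1 else 0) v, lincomb (\<lambda>t. if t = s then 1 else 0) w) \<in> Z"
      unfolding Z_def by (intro imageI finitely_supported_single)
    then have "(v s, w s) \<in> Z" by (simp add: lincomb_single)
    then show "U (v s) = w s" by (intro UI subsetD[OF closure_subset])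
  qed
qed

section \<open>Vectors with a prescribed positive definite Gram kernel\<close>

lemma quadratic_linear_term_zero:
  fixes a b :: real
  assumes "\<And>t. 0 \<le> 2 * t * a + t\<^sup>2 * b" "0 \<le> b"
  shows "a = 0"
proof (rule ccontr)
  assume a: "a \<noteq> 0"
  \<comment> \<open>With b + 1 instead of b the quotient is defined also for b = 0, and the
    quadratic still takes the negative value -t^2 (b + 2).\<close>
  define t where "t = - a / (b + 1)"
  have b: "0 < b + 1" using assms(2) by simp
  have at: "a = - t * (b + 1)" using b by (simp add: t_def)
  have "0 < t\<^sup>2 * (b + 2)" using a b by (simp add: t_def)
  moreover have "2 * t * a + t\<^sup>2 * b = - (t\<^sup>2 * (b + 2))"
    unfolding at by (simp add: power2_eq_square algebra_simps)
  ultimately show False using assms(1)[of t] by simp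
qed

lemma cauchy_by_squares:
  fixes u :: "nat \<Rightarrow> 'a::real_normed_vector"
  assumes "\<And>N m n. N \<le> m \<Longrightarrow> N \<le> n \<Longrightarrow> (norm (u m - u n))\<^sup>2 \<le> C / real (Suc N)"
  shows "Cauchy u"
proof (rule CauchyI)
  fix e :: real assume e: "0 < e"
  obtain N where N: "C / e\<^sup>2 < real (Suc N)"
    using reals_Archimedean2[of "C / e\<^sup>2"] by (metis less_SucI of_nat_less_iff order_less_trans lessI)
  have "norm (u m - u n) < e" if "N \<le> m" "N \<le> n" for m n
  proof -
    have "(norm (u m - u n))\<^sup>2 \<le> C / real (Suc N)" by (rule assms[OF that])
    also have "\<dots> < e\<^sup>2" using N e by (simp add: field_simps)
    finally show ?thesis using e by (simp add: power_less_imp_less_base)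
  qed
  then show "\<exists>M. \<forall>m\<ge>M. \<forall>n\<ge>M. norm (u m - u n) < e" by blast
qed

text \<open>The vector \<open>w\<close> is the projection of the abstract vector with index \<open>s0\<close> onto the closed span
  of those already realized; it minimizes the distance \<open>Q\<close>.\<close>

lemma kernel_projection:
  fixes K :: "'s \<Rightarrow> 's \<Rightarrow> complex" and v :: "'s \<Rightarrow> 'i ell2"
  assumes herm: "\<And>s t. K t s = cnj (K s t)"
    and pos: "\<And>F c. finite F \<Longrightarrow> 0 \<le> Re (\<Sum>s\<in>F. \<Sum>t\<in>F. cnj (c s) * c t * K s t)"
    and v: "\<And>s t. s \<in> D \<Longrightarrow> t \<in> D \<Longrightarrow> cinner (v s) (v t) = K s t" and s0: "s0 \<notin> D"
  obtains w where "w \<in> closed_cspan D v" "\<And>s. s \<in> D \<Longrightarrow> cinner (v s) w = K s s0"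
    "(norm w)\<^sup>2 \<le> Re (K s0 s0)"
proof -
  \<comment> \<open>\<beta> c is the pairing of the abstract vector s0 with the combination c.
    Written as a linear combination in a one-dimensional Hilbert space, it inherits its linearity
    from \<open>lincomb\<close>.\<close>
  define \<beta> where "\<beta> c = Rep_ell2 (lincomb c (\<lambda>s. cscale (K s0 s) (delta ()))) ()" for c
  define Q where "Q c = (norm (lincomb c v))\<^sup>2 - 2 * Re (\<beta> c) + Re (K s0 s0)" for c
  let ?FS = "finitely_supported D"
  have \<beta>_sum: "\<beta> c = (\<Sum>s | c s \<noteq> 0. c s * K s0 s)" for c
    by (simp add: \<beta>_def lincomb_def Rep_ell2_simps)
  have \<beta>_add: "\<beta> (\<lambda>s. c s + d s) = \<beta> c + \<beta> d" if "c \<in> ?FS" "d \<in> ?FS" for c d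
    using that by (simp add: \<beta>_def lincomb_add[of c D d] Rep_ell2_simps)
  have \<beta>_scale: "\<beta> (\<lambda>s. a * c s) = a * \<beta> c" if "c \<in> ?FS" for a c
    using that by (simp add: \<beta>_def lincomb_scale[of c D] Rep_ell2_simps)
  have Q0: "0 \<le> Q c" if c: "c \<in> ?FS" for c
  proof -
    let ?S = "{s. c s \<noteq> 0}"
    have fin: "finite ?S" and sub: "?S \<subseteq> D" using c by (auto simp: finitely_supported_def)
    have s0S: "s0 \<notin> ?S" using sub s0 by blast
    \<comment> \<open>Q c is the kernel form at these coefficients, that is, the squared distance of
      the abstract vector s0 from the combination c.\<close>
    let ?d = "c(s0 := -1)"
    define f where "f s t = cnj (?d s) * ?d t * K s t" for s t
    have ne: "s \<noteq> s0" if "s \<in> ?S" for s using s0S that by blast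
    have f1: "(\<Sum>s\<in>?S. \<Sum>t\<in>?S. f s t) = cinner (lincomb c v) (lincomb c v)"
      unfolding cinner_lincomb
    proof (intro sum.cong refl)
      fix s t assume st: "s \<in> ?S" "t \<in> ?S"
      then have "s \<in> D" "t \<in> D" using sub by blast+
      then show "f s t = cnj (c s) * c t * cinner (v s) (v t)"
        using ne[OF st(1)] ne[OF st(2)] by (simp add: f_def v)
    qed
    have f2: "(\<Sum>t\<in>?S. f s0 t) = - \<beta> c"
      unfolding \<beta>_sum sum_negf[symmetric]
    proof (intro sum.cong refl)
      fix t assume "t \<in> ?S"
      from ne[OF this] show "f s0 t = - (c t * K s0 t)" by (simp add: f_def)
    qed
    have f3: "(\<Sum>s\<in>?S. f s s0) = - cnj (\<beta> c)"
      unfolding \<beta>_sum cnj_sum sum_negf[symmetric]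
    proof (intro sum.cong refl)
      fix s assume "s \<in> ?S"
      from ne[OF this] show "f s s0 = - cnj (c s * K s0 s)"
        by (simp add: f_def herm[of s0 s])
    qed
    have "(\<Sum>s\<in>insert s0 ?S. \<Sum>t\<in>insert s0 ?S. f s t)
        = f s0 s0 + (\<Sum>t\<in>?S. f s0 t) + ((\<Sum>s\<in>?S. f s s0) + (\<Sum>s\<in>?S. \<Sum>t\<in>?S. f s t))"
      using fin s0S by (simp add: sum.distrib)
    also have "\<dots> = K s0 s0 - \<beta> c - cnj (\<beta> c) + cinner (lincomb c v) (lincomb c v)"
      unfolding f1 f2 f3 by (simp add: f_def)
    finally show ?thesis
      using pos[of "insert s0 ?S" ?d] fin unfolding f_def
      by (simp add: Q_def norm_sq_cinner del: fun_upd_apply)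
  qed
  define m where "m = Inf (Q ` ?FS)"
  have mQ: "m \<le> Q c" if "c \<in> ?FS" for c
    unfolding m_def by (rule cINF_lower[OF _ that]) (auto intro!: bdd_belowI2[of _ 0] Q0)
  have ne: "?FS \<noteq> {}" using finitely_supported_zero by blast
  have "\<exists>c\<in>?FS. Q c < m + 1 / real (Suc n)" for n
  proof (rule ccontr)
    assume "\<not> ?thesis"
    then have "m + 1 / real (Suc n) \<le> m"
      unfolding m_def using ne by (intro cINF_greatest) (auto simp: not_less)
    then show False by (simp add: divide_le_0_iff)
  qed
  then obtain c where c: "\<And>n. c n \<in> ?FS" and Qc: "\<And>n. Q (c n) < m + 1 / real (Suc n)"
    by metis
  define u where "u n = lincomb (c n) v" for n
  \<comment> \<open>The midpoint of two near-minimizers has Q at least m, so the parallelogram law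
    forces them close together.\<close>
  have par: "(norm (u k - u n))\<^sup>2 \<le> 2 * (Q (c k) + Q (c n) - 2 * m)" for k n
  proof -
    let ?d = "\<lambda>s. 1/2 * (c k s + c n s)"
    have cc: "(\<lambda>s. c k s + c n s) \<in> ?FS" by (intro finitely_supported_add c)
    have "lincomb ?d v = cscale (1/2) (u k + u n)"
      unfolding u_def using lincomb_scale[OF cc, of "1/2" v] lincomb_add[OF c c, of k n v] by simp
    moreover have "Re (\<beta> ?d) = (Re (\<beta> (c k)) + Re (\<beta> (c n))) / 2"
      unfolding \<beta>_scale[OF cc, of "1/2"] \<beta>_add[OF c c, of k n] by simp
    moreover have "m \<le> Q ?d" by (intro mQ finitely_supported_scale cc)
    moreover have "(norm (u k - u n))\<^sup>2 + (norm (u k + u n))\<^sup>2 = 2 * (norm (u k))\<^sup>2 + 2 * (norm (u n))\<^sup>2"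
      unfolding power2_norm_eq_inner by (simp add: inner_simps inner_commute)
    ultimately show ?thesis
      by (simp add: Q_def u_def[symmetric] power_mult_distrib power_divide norm_divide)
  qed
  have "Cauchy u"
  proof (rule cauchy_by_squares)
    fix N k n :: nat assume "N \<le> k" "N \<le> n"
    then have "1 / real (Suc k) \<le> 1 / real (Suc N)" "1 / real (Suc n) \<le> 1 / real (Suc N)"
      by (auto intro!: divide_left_mono)
    with par[of k n] Qc[of k] Qc[of n] show "(norm (u k - u n))\<^sup>2 \<le> 4 / real (Suc N)" by simp
  qed
  then obtain w where w: "u \<longlonglongrightarrow> w" using Cauchy_convergent convergent_def by blast
  have Qlim: "(\<lambda>n. Q (c n)) \<longlonglongrightarrow> m"
  proof (rule tendsto_sandwich[of "\<lambda>_. m" _ _ "\<lambda>n. m + inverse (real (Suc n))"])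
    show "(\<lambda>n. m + inverse (real (Suc n))) \<longlonglongrightarrow> m"
      using tendsto_add[OF tendsto_const LIMSEQ_inverse_real_of_nat, of m] by simp
    show "\<forall>\<^sub>F n in sequentially. Q (c n) \<le> m + inverse (real (Suc n))"
      using Qc by (intro always_eventually) (auto simp: inverse_eq_divide intro: less_imp_le)
  qed (use mQ c in \<open>auto intro: always_eventually\<close>)
  \<comment> \<open>Varying the minimizing sequence by t d gives, in the limit, a quadratic in t
    that is never negative. This controls real parts only; the imaginary part is obtained later by
    testing an imaginary multiple of v s.\<close>
  have first_order: "inner w (lincomb d v) = Re (\<beta> d)" if d: "d \<in> ?FS" for d
  proof -
    let ?h = "lincomb d v"
    have "0 \<le> 2 * t * (inner w ?h - Re (\<beta> d)) + t\<^sup>2 * (norm ?h)\<^sup>2" for t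
    proof -
      have lim: "(\<lambda>n. Q (c n) + (2 * t * (inner (u n) ?h - Re (\<beta> d)) + t\<^sup>2 * (norm ?h)\<^sup>2))
          \<longlonglongrightarrow> m + (2 * t * (inner w ?h - Re (\<beta> d)) + t\<^sup>2 * (norm ?h)\<^sup>2)"
        by (intro tendsto_intros Qlim w)
      have "Q (\<lambda>s. c n s + of_real t * d s) = Q (c n) + (2 * t * (inner (u n) ?h - Re (\<beta> d)) + t\<^sup>2 * (norm ?h)\<^sup>2)"
        for n
      proof -
        have td: "(\<lambda>s. of_real t * d s) \<in> ?FS" by (intro finitely_supported_scale d)
        have "lincomb (\<lambda>s. c n s + of_real t * d s) v = u n + t *\<^sub>R ?h"
          unfolding u_def lincomb_add[OF c td] lincomb_scale[OF d] by (simp add: cscale_of_real)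
        moreover have "\<beta> (\<lambda>s. c n s + of_real t * d s) = \<beta> (c n) + of_real t * \<beta> d"
          unfolding \<beta>_add[OF c td] \<beta>_scale[OF d] ..
        ultimately show ?thesis
          unfolding Q_def power2_norm_eq_inner
          by (simp add: u_def[symmetric] inner_simps inner_commute[of ?h "u n"] algebra_simps power2_eq_square)
      qed
      moreover have "(\<lambda>s. c n s + of_real t * d s) \<in> ?FS" for n
        by (intro finitely_supported_add finitely_supported_scale c d)
      ultimately have "m \<le> Q (c n) + (2 * t * (inner (u n) ?h - Re (\<beta> d)) + t\<^sup>2 * (norm ?h)\<^sup>2)" for n
        using mQ by metis
      then have "m \<le> m + (2 * t * (inner w ?h - Re (\<beta> d)) + t\<^sup>2 * (norm ?h)\<^sup>2)"
        by (intro LIMSEQ_le_const[OF lim]) auto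
      then show ?thesis by simp
    qed
    from quadratic_linear_term_zero[OF this] show ?thesis by simp
  qed
  show thesis
  proof
    show "w \<in> closed_cspan D v"
      by (rule closed_sequentially[OF closed_closed_cspan _ w]) (simp add: u_def lincomb_in_closed_cspan c)
    show "cinner (v s) w = K s s0" if s: "s \<in> D" for s
    proof -
      have *: "inner w (cscale a (v s)) = Re (a * K s0 s)" for a
      proof -
        have fs: "(\<lambda>t. if t = s then a else 0) \<in> ?FS" by (rule finitely_supported_single[OF s])
        have "\<beta> (\<lambda>t. if t = s then a else 0) = a * K s0 s"
          by (simp add: \<beta>_def lincomb_single Rep_ell2_simps)
        then show ?thesis using first_order[OF fs] by (simp add: lincomb_single)
      qed
      have "cinner w (v s) = K s0 s"
      proof (rule complex_eqI)
        show "Re (cinner w (v s)) = Re (K s0 s)" using *[of 1] by (simp add: Re_cinner)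
        have "Re (cinner w (cscale \<i> (v s))) = Re (\<i> * K s0 s)" using *[of \<i>] by (simp only: Re_cinner)
        then show "Im (cinner w (v s)) = Im (K s0 s)" by (simp add: cinner_cscale_right)
      qed
      then show ?thesis by (metis cnj_cinner herm)
    qed
    \<comment> \<open>Along the minimizing sequence Q tends to K s0 s0 - |w|^2 by the first-order
      condition, and Q is never negative.\<close>
    have "(\<lambda>n. (norm (u n))\<^sup>2 - 2 * inner w (u n) + Re (K s0 s0)) \<longlonglongrightarrow> (norm w)\<^sup>2 - 2 * inner w w + Re (K s0 s0)"
      by (intro tendsto_intros w)
    moreover have "(norm (u n))\<^sup>2 - 2 * inner w (u n) + Re (K s0 s0) = Q (c n)" for n
      unfolding Q_def u_def using first_order[OF c] by simp
    ultimately have "0 \<le> (norm w)\<^sup>2 - 2 * inner w w + Re (K s0 s0)"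
      using Q0 c by (intro LIMSEQ_le_const) auto
    then show "(norm w)\<^sup>2 \<le> Re (K s0 s0)" by (simp add: power2_norm_eq_inner)
  qed
qed

text \<open>The target \<open>'i ell2\<close> is prescribed, so partial realizations are enlarged
  inside it by Zorn's lemma. A partial realization may use only the coordinates of the indices it
  has realized; a new index therefore brings a fresh coordinate for the component orthogonal to its
  projection.\<close>

theorem kolmogorov_decomposition:
  fixes K :: "'s \<Rightarrow> 's \<Rightarrow> complex" and \<iota> :: "'s \<Rightarrow> 'i"
  assumes inj: "inj \<iota>" and herm: "\<And>s t. K t s = cnj (K s t)"
    and pos: "\<And>F c. finite F \<Longrightarrow> 0 \<le> Re (\<Sum>s\<in>F. \<Sum>t\<in>F. cnj (c s) * c t * K s t)"
  obtains v :: "'s \<Rightarrow> 'i ell2" where "\<And>s t. cinner (v s) (v t) = K s t"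
proof -
  define \<A> where "\<A> = {M :: ('s \<times> 'i ell2) set.
      (\<forall>p\<in>M. \<forall>q\<in>M. cinner (snd p) (snd q) = K (fst p) (fst q)) \<and>
      (\<forall>p\<in>M. \<forall>i. Rep_ell2 (snd p) i \<noteq> 0 \<longrightarrow> i \<in> \<iota> ` fst ` M)}"
  have "\<exists>M\<in>\<A>. \<forall>X\<in>\<A>. M \<subseteq> X \<longrightarrow> X = M"
  proof (rule subset_Zorn')
    fix C assume C: "subset.chain \<A> C"
    then have CA: "C \<subseteq> \<A>" and tot: "\<And>X Y. X \<in> C \<Longrightarrow> Y \<in> C \<Longrightarrow> X \<subseteq> Y \<or> Y \<subseteq> X"
      by (auto simp: subset.chain_def)
    have "cinner (snd p) (snd q) = K (fst p) (fst q)" if pq: "p \<in> \<Union>C" "q \<in> \<Union>C" for p q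
    proof -
      obtain X Y where "X \<in> C" "p \<in> X" "Y \<in> C" "q \<in> Y" using pq by blast
      then obtain Z where "Z \<in> C" "p \<in> Z" "q \<in> Z" using tot[of X Y] by blast
      then show ?thesis using CA unfolding \<A>_def by blast
    qed
    moreover have "i \<in> \<iota> ` fst ` \<Union>C" if p: "p \<in> \<Union>C" "Rep_ell2 (snd p) i \<noteq> 0" for p i
    proof -
      obtain X where X: "X \<in> C" "p \<in> X" using p(1) by blast
      then have "i \<in> \<iota> ` fst ` X" using CA p(2) unfolding \<A>_def by blast
      then show ?thesis using X(1) by blast
    qed
    ultimately show "\<Union>C \<in> \<A>" unfolding \<A>_def by blast
  qed
  then obtain M where M: "M \<in> \<A>" and max: "\<And>X. X \<in> \<A> \<Longrightarrow> M \<subseteq> X \<Longrightarrow> X = M" by blast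
  have Mi: "cinner (snd p) (snd q) = K (fst p) (fst q)" if "p \<in> M" "q \<in> M" for p q
    using M that unfolding \<A>_def by blast
  have Ms: "i \<in> \<iota> ` fst ` M" if "p \<in> M" "Rep_ell2 (snd p) i \<noteq> 0" for p i
    using M that unfolding \<A>_def by blast
  define v where "v s = (SOME x. (s, x) \<in> M)" for s
  have vM: "(s, v s) \<in> M" if "s \<in> fst ` M" for s
  proof -
    have "\<exists>x. (s, x) \<in> M" using that by force
    then show ?thesis unfolding v_def by (rule someI_ex)
  qed
  \<comment> \<open>Two vectors realizing the same index have equal Gram entries, hence distance
    zero: the relation M is a function.\<close>
  have sv: "snd p = v (fst p)" if p: "p \<in> M" for p
  proof -
    have q: "(fst p, v (fst p)) \<in> M" by (rule vM) (use p in blast)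
    have "(norm (snd p - v (fst p)))\<^sup>2 = 0"
      unfolding norm_sq_cinner
      using Mi[OF p p] Mi[OF p q] Mi[OF q p] Mi[OF q q]
      by (simp add: cinner_diff_left cinner_diff_right)
    then show ?thesis by simp
  qed
  have "s0 \<in> fst ` M" for s0
  proof (rule ccontr)
    assume s0: "s0 \<notin> fst ` M"
    have vi: "cinner (v s) (v t) = K s t" if "s \<in> fst ` M" "t \<in> fst ` M" for s t
      using Mi[OF vM vM, OF that] by simp
    obtain w where w: "w \<in> closed_cspan (fst ` M) v" "\<And>s. s \<in> fst ` M \<Longrightarrow> cinner (v s) w = K s s0"
      "(norm w)\<^sup>2 \<le> Re (K s0 s0)"
      by (rule kernel_projection[of K "fst ` M" v s0, OF herm pos vi s0]) blast+
    have vz: "Rep_ell2 (v s) i = 0" if "s \<in> fst ` M" "i \<notin> \<iota> ` fst ` M" for s i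
      using Ms[OF vM[OF that(1)], of i] that(2) by auto
    have wz: "Rep_ell2 w i = 0" if i: "i \<notin> \<iota> ` fst ` M" for i
    proof -
      have "Rep_ell2 w i \<in> {0}"
      proof (rule closed_cspan_closedI[OF _ _ _ w(1)])
        show "continuous_on UNIV (\<lambda>x :: 'i ell2. Rep_ell2 x i)"
          unfolding continuous_on_def by (intro ballI tendsto_Rep_ell2 tendsto_ident_at)
        fix c assume c: "c \<in> finitely_supported (fst ` M)"
        have "Rep_ell2 (lincomb c v) i = (\<Sum>s | c s \<noteq> 0. c s * Rep_ell2 (v s) i)"
          by (simp add: lincomb_def Rep_ell2_simps)
        also have "\<dots> = 0"
        proof (rule sum.neutral, intro ballI)
          fix s assume "s \<in> {s. c s \<noteq> 0}"
          then have "s \<in> fst ` M" using c unfolding finitely_supported_def by blast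
          from vz[OF this i] show "c s * Rep_ell2 (v s) i = 0" by simp
        qed
        finally show "Rep_ell2 (lincomb c v) i \<in> {0}" by simp
      qed simp
      then show ?thesis by simp
    qed
    have \<iota>0: "\<iota> s0 \<notin> \<iota> ` fst ` M" using inj s0 by (auto dest: injD)
    \<comment> \<open>The length of the component of the new vector that is orthogonal to the
      earlier ones; it is placed on the fresh coordinate \<open>\<iota> s0\<close>.\<close>
    define c0 where "c0 = sqrt (Re (K s0 s0) - (norm w)\<^sup>2)"
    define x where "x = w + cscale (of_real c0) (delta (\<iota> s0))"
    have vx: "cinner (v s) x = K s s0" if "s \<in> fst ` M" for s
    proof -
      have "cinner (v s) (delta (\<iota> s0)) = 0"
        using vz[OF that \<iota>0] by (metis cinner_delta_left cnj_cinner complex_cnj_zero)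
      then show ?thesis by (simp add: x_def cinner_add_right cinner_cscale_right w(2)[OF that])
    qed
    have xv: "cinner x (v s) = K s0 s" if "s \<in> fst ` M" for s
      using vx[OF that] by (metis cnj_cinner herm)
    have xx: "cinner x x = K s0 s0"
    proof -
      have "cinner (delta (\<iota> s0)) w = 0" by (simp add: cinner_delta_left wz[OF \<iota>0])
      moreover from this have "cinner w (delta (\<iota> s0)) = 0" by (metis cnj_cinner complex_cnj_zero)
      ultimately have "cinner x x = of_real ((norm w)\<^sup>2 + c0\<^sup>2)"
        by (simp add: x_def cinner_add_right cinner_add_left cinner_cscale_right cinner_cscale_left
            cinner_self[of w] cinner_self[of "delta _"] power2_eq_square)
      also have "(norm w)\<^sup>2 + c0\<^sup>2 = Re (K s0 s0)" using w(3) by (simp add: c0_def)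
      also have "of_real (Re (K s0 s0)) = K s0 s0"
        using herm[of s0 s0] by (metis Reals_cnj_iff of_real_Re)
      finally show ?thesis .
    qed
    have "insert (s0, x) M \<in> \<A>"
      unfolding \<A>_def
    proof (intro CollectI conjI ballI allI impI)
      fix p q assume "p \<in> insert (s0, x) M" "q \<in> insert (s0, x) M"
      then show "cinner (snd p) (snd q) = K (fst p) (fst q)"
        by (elim insertE) (simp_all add: xx vx xv sv vi)
    next
      fix p i assume p: "p \<in> insert (s0, x) M" and nz: "Rep_ell2 (snd p) i \<noteq> 0"
      show "i \<in> \<iota> ` fst ` insert (s0, x) M"
      proof (cases "p \<in> M")
        case True then show ?thesis using Ms[OF _ nz] by auto
      next
        case False
        then have "Rep_ell2 x i \<noteq> 0" using p nz by simp
        then have "i = \<iota> s0 \<or> i \<in> \<iota> ` fst ` M"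
          using wz by (auto simp: x_def Rep_ell2_simps split: if_splits)
        then show ?thesis by auto
      qed
    qed
    from max[OF this] have "(s0, x) \<in> M" by blast
    then show False using s0 by force
  qed
  then have "cinner (v s) (v t) = K s t" for s t
    using Mi[OF vM vM] by simp
  then show thesis by (rule that)
qed

section \<open>Etale groupoids\<close>

locale etale_groupoid =
  fixes G :: "'g top_groupoid"
  assumes etale: "locally_compact_etale_groupoid G"
begin

abbreviation "Arr \<equiv> arrows G"
abbreviation "Obj \<equiv> gunits G"
abbreviation "rg \<equiv> grange G"
abbreviation "sc \<equiv> gsource G"
abbreviation "iv \<equiv> ginv G"
abbreviation mul (infixl "\<odot>" 70) where "g \<odot> h \<equiv> gmul G g h"
abbreviation "X \<equiv> gtop G"

lemma groupoid: "groupoid G"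
  using etale by (simp add: locally_compact_etale_groupoid_def)

lemma inv_mult: "iv g \<odot> g = sc g" "g \<odot> iv g = rg g"
  by (simp_all add: gsource_def grange_def)

lemma inv_closed [simp]: "g \<in> Arr \<Longrightarrow> iv g \<in> Arr"
  and inv_inv [simp]: "g \<in> Arr \<Longrightarrow> iv (iv g) = g"
  and range_mult [simp]: "g \<in> Arr \<Longrightarrow> rg g \<odot> g = g"
  and mult_source [simp]: "g \<in> Arr \<Longrightarrow> g \<odot> sc g = g"
  using groupoid by (simp_all add: groupoid_def)

lemma mult_closed [simp]: "g \<in> Arr \<Longrightarrow> h \<in> Arr \<Longrightarrow> sc g = rg h \<Longrightarrow> g \<odot> h \<in> Arr"
  and range_of_mult [simp]: "g \<in> Arr \<Longrightarrow> h \<in> Arr \<Longrightarrow> sc g = rg h \<Longrightarrow> rg (g \<odot> h) = rg g"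
  and source_of_mult [simp]: "g \<in> Arr \<Longrightarrow> h \<in> Arr \<Longrightarrow> sc g = rg h \<Longrightarrow> sc (g \<odot> h) = sc h"
  using groupoid by (auto simp: groupoid_def composable_def)

lemma mult_assoc:
  "g \<in> Arr \<Longrightarrow> h \<in> Arr \<Longrightarrow> k \<in> Arr \<Longrightarrow> sc g = rg h \<Longrightarrow> sc h = rg k \<Longrightarrow> g \<odot> h \<odot> k = g \<odot> (h \<odot> k)"
  using groupoid unfolding groupoid_def composable_def by blast

lemma range_inv [simp]: "g \<in> Arr \<Longrightarrow> rg (iv g) = sc g"
  and source_inv [simp]: "g \<in> Arr \<Longrightarrow> sc (iv g) = rg g"
  by (simp_all add: gsource_def grange_def)

lemma range_closed [simp]: "g \<in> Arr \<Longrightarrow> rg g \<in> Arr"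
  and range_range [simp]: "g \<in> Arr \<Longrightarrow> rg (rg g) = rg g"
  and source_range [simp]: "g \<in> Arr \<Longrightarrow> sc (rg g) = rg g"
  using mult_closed[of g "iv g"] range_of_mult[of g "iv g"] source_of_mult[of g "iv g"]
  by (simp_all add: inv_mult)

lemma source_closed [simp]: "g \<in> Arr \<Longrightarrow> sc g \<in> Arr"
  and range_source [simp]: "g \<in> Arr \<Longrightarrow> rg (sc g) = sc g"
  and source_source [simp]: "g \<in> Arr \<Longrightarrow> sc (sc g) = sc g"
  using range_closed[of "iv g"] range_range[of "iv g"] source_range[of "iv g"] by simp_all

lemma cancel [simp]:
  assumes "g \<in> Arr" "h \<in> Arr"
  shows "sc g = rg h \<Longrightarrow> iv g \<odot> (g \<odot> h) = h" "rg g = rg h \<Longrightarrow> g \<odot> (iv g \<odot> h) = h"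
    "sc g = rg h \<Longrightarrow> g \<odot> h \<odot> iv h = g" "sc g = sc h \<Longrightarrow> g \<odot> iv h \<odot> h = g"
proof -
  show "sc g = rg h \<Longrightarrow> iv g \<odot> (g \<odot> h) = h"
    using assms mult_assoc[of "iv g" g h] by (simp add: inv_mult)
  show "rg g = rg h \<Longrightarrow> g \<odot> (iv g \<odot> h) = h"
    using assms mult_assoc[of g "iv g" h] by (simp add: inv_mult)
  show "sc g = rg h \<Longrightarrow> g \<odot> h \<odot> iv h = g"
    using assms mult_assoc[of g h "iv h"] by (simp add: inv_mult) (metis mult_source)
  show "sc g = sc h \<Longrightarrow> g \<odot> iv h \<odot> h = g"
    using assms mult_assoc[of g "iv h" h] by (simp add: inv_mult) (metis mult_source)
qed

lemma inv_of_mult [simp]: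
  assumes "g \<in> Arr" "h \<in> Arr" "sc g = rg h"
  shows "iv (g \<odot> h) = iv h \<odot> iv g"
proof -
  let ?k = "g \<odot> h" and ?l = "iv h \<odot> iv g"
  have "?l \<odot> ?k = iv h \<odot> (iv g \<odot> (g \<odot> h))"
    by (rule mult_assoc) (use assms in simp_all)
  then have lk: "?l \<odot> ?k = sc ?k" using assms by (simp add: inv_mult)
  have "?l = ?l \<odot> ?k \<odot> iv ?k" using assms by simp
  also have "\<dots> = sc ?k \<odot> iv ?k" by (simp add: lk)
  also have "\<dots> = iv ?k" using range_mult[of "iv ?k"] assms by simp
  finally show ?thesis by simp
qed

lemma units_iff: "x \<in> Obj \<longleftrightarrow> x \<in> Arr \<and> rg x = x"
  by (auto simp: gunits_def) (metis image_eqI)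

lemma range_unit [simp]: "g \<in> Arr \<Longrightarrow> rg g \<in> Obj"
  and source_unit [simp]: "g \<in> Arr \<Longrightarrow> sc g \<in> Obj"
  by (simp_all add: units_iff)

lemma unit_arrow [simp]: "x \<in> Obj \<Longrightarrow> x \<in> Arr"
  and unit_range [simp]: "x \<in> Obj \<Longrightarrow> rg x = x"
  by (simp_all add: units_iff)

lemma unit_source [simp]: "x \<in> Obj \<Longrightarrow> sc x = x"
  using source_range[of x] by simp

lemma unit_inv [simp]: "x \<in> Obj \<Longrightarrow> iv x = x"
  using range_mult[of "iv x"] inv_mult(2)[of x] by simp

section \<open>Topology of arrows and units, open bisections\<close>

lemma topspace_X [simp]: "topspace X = Arr"
  by (simp add: arrows_def)

lemma Obj_subset: "Obj \<subseteq> Arr"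
  by auto

lemma topspace_unit_space [simp]: "topspace (unit_space G) = Obj"
  using Obj_subset by (auto simp: unit_space_def)

lemma openin_arrow: "openin X U \<Longrightarrow> g \<in> U \<Longrightarrow> g \<in> Arr"
  using openin_subset by fastforce

lemma continuous_inv: "continuous_map X X iv"
  using etale by (simp add: locally_compact_etale_groupoid_def)

lemma continuous_mult:
  assumes "continuous_map Y X f" "continuous_map Y X g"
    and "\<And>y. y \<in> topspace Y \<Longrightarrow> sc (f y) = rg (g y)"
  shows "continuous_map Y X (\<lambda>y. f y \<odot> g y)"
proof -
  have "continuous_map Y (prod_topology X X) (\<lambda>y. (f y, g y))"
    using assms(1,2) by (simp add: continuous_map_pairedI)
  moreover have "(\<lambda>y. (f y, g y)) ` topspace Y \<subseteq> composable G"
  proof -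
    have "f y \<in> Arr" "g y \<in> Arr" if "y \<in> topspace Y" for y
      using assms(1,2) that by (auto simp: continuous_map_def Pi_iff)
    then show ?thesis using assms(3) by (auto simp: composable_def)
  qed
  ultimately have "continuous_map Y (subtopology (prod_topology X X) (composable G)) (\<lambda>y. (f y, g y))"
    by (simp add: continuous_map_in_subtopology image_subset_iff)
  moreover have "continuous_map (subtopology (prod_topology X X) (composable G)) X (\<lambda>(g, h). g \<odot> h)"
    using etale by (simp add: locally_compact_etale_groupoid_def)
  ultimately have "continuous_map Y X ((\<lambda>(g, h). g \<odot> h) \<circ> (\<lambda>y. (f y, g y)))"
    by (rule continuous_map_compose)
  then show ?thesis by (simp add: o_def)
qed

lemma continuous_range: "continuous_map X X rg"
proof -
  have "continuous_map X X (\<lambda>g. g \<odot> iv g)"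
    by (intro continuous_mult continuous_inv continuous_map_id[unfolded id_def]) simp
  then show ?thesis by (simp add: inv_mult)
qed

lemma continuous_source: "continuous_map X X sc"
proof -
  have "continuous_map X X (rg \<circ> iv)"
    by (rule continuous_map_compose[OF continuous_inv continuous_range])
  then show ?thesis by (rule continuous_map_eq) simp
qed

lemma openin_range_preimage: "openin X V \<Longrightarrow> openin X {g \<in> Arr. rg g \<in> V}"
  using openin_continuous_map_preimage[OF continuous_range] by simp

lemma openin_source_preimage: "openin X V \<Longrightarrow> openin X {g \<in> Arr. sc g \<in> V}"
  using openin_continuous_map_preimage[OF continuous_source] by simp

lemma range_chart:
  assumes "g \<in> Arr"
  obtains U where "openin X U" "g \<in> U" "openin (unit_space G) (rg ` U)"
    "homeomorphic_map (subtopology X U) (subtopology (unit_space G) (rg ` U)) rg"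
  using etale assms
  unfolding locally_compact_etale_groupoid_def local_homeomorphism_def topspace_X by blast

text \<open>If \<open>rg\<close> is injective on a neighbourhood \<open>U\<close> of a unit, then \<open>g = rg g\<close> as soon as both \<open>g\<close>
  and \<open>rg g\<close> belong to \<open>U\<close>.\<close>

lemma openin_Obj: "openin X Obj"
proof (subst openin_subopen, intro ballI)
  fix x assume x: "x \<in> Obj"
  obtain U where U: "openin X U" "x \<in> U"
    "homeomorphic_map (subtopology X U) (subtopology (unit_space G) (rg ` U)) rg"
    using range_chart[OF unit_arrow[OF x]] by metis
  have inj: "inj_on rg U"
    using homeomorphic_imp_injective_map[OF U(3)] openin_subset[OF U(1)]
    by (simp add: inf.absorb2)
  let ?V = "U \<inter> {g \<in> Arr. rg g \<in> U}"
  have "openin X ?V" by (intro openin_Int U openin_range_preimage)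
  moreover have "x \<in> ?V" using x U(2) by simp
  moreover have "?V \<subseteq> Obj"
  proof
    fix g assume "g \<in> ?V"
    then have g: "g \<in> U" "g \<in> Arr" "rg g \<in> U" by auto
    then have "rg g = g" using inj_onD[OF inj, of "rg g" g] by simp
    with g show "g \<in> Obj" by (simp only: units_iff)
  qed
  ultimately show "\<exists>T. openin X T \<and> x \<in> T \<and> T \<subseteq> Obj" by blast
qed

lemma openin_unit_space: "openin (unit_space G) V \<longleftrightarrow> openin X V \<and> V \<subseteq> Obj"
  by (simp add: unit_space_def openin_open_subtopology openin_Obj)

lemma open_range:
  assumes "openin X U" shows "openin X (rg ` U)"
proof (subst openin_subopen, intro ballI)
  fix x assume "x \<in> rg ` U"
  then obtain g where g: "g \<in> U" "x = rg g" by blast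
  obtain V where V: "openin X V" "g \<in> V" "openin (unit_space G) (rg ` V)"
    "homeomorphic_map (subtopology X V) (subtopology (unit_space G) (rg ` V)) rg"
    using range_chart openin_arrow[OF assms g(1)] by metis
  have "openin (subtopology X V) (V \<inter> U)"
    by (simp add: openin_subtopology_Int2 assms)
  then have "openin (subtopology (unit_space G) (rg ` V)) (rg ` (V \<inter> U))"
    using homeomorphic_imp_open_map[OF V(4)] by (simp add: open_map_def)
  then have "openin (unit_space G) (rg ` (V \<inter> U))"
    using V(3) openin_trans_full by blast
  then show "\<exists>T. openin X T \<and> x \<in> T \<and> T \<subseteq> rg ` U"
    using g V(2) by (intro exI[of _ "rg ` (V \<inter> U)"]) (auto simp: openin_unit_space)
qed

lemma open_inv:
  assumes "openin X U" shows "openin X (iv ` U)"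
proof -
  have "iv ` U = {g \<in> Arr. iv g \<in> U}"
  proof (intro equalityI subsetI)
    fix g assume "g \<in> {g \<in> Arr. iv g \<in> U}"
    then show "g \<in> iv ` U" by (intro image_eqI[of _ _ "iv g"]) auto
  qed (use openin_arrow[OF assms] in auto)
  then show ?thesis
    using openin_continuous_map_preimage[OF continuous_inv assms] by simp
qed

lemma open_source:
  assumes "openin X U" shows "openin X (sc ` U)"
proof -
  have "sc ` U = rg ` iv ` U"
    unfolding image_image using openin_arrow[OF assms] by (intro image_cong) auto
  then show ?thesis by (simp add: open_range open_inv assms)
qed

definition open_bisection :: "'g set \<Rightarrow> bool" where
  "open_bisection U \<longleftrightarrow> openin X U \<and> inj_on rg U \<and> inj_on sc U"

lemma open_bisection_iff: "open_bisection U \<longleftrightarrow> openin X U \<and> bisection G U"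
  using openin_subset[of X U] by (auto simp: open_bisection_def bisection_def bij_betw_def)

lemma open_bisection_subset: "open_bisection U \<Longrightarrow> openin X V \<Longrightarrow> V \<subseteq> U \<Longrightarrow> open_bisection V"
  by (auto simp: open_bisection_def intro: inj_on_subset)

lemma open_bisection_Obj: "open_bisection Obj"
  by (auto simp: open_bisection_def openin_Obj inj_on_def)

lemma open_bisection_inv: "open_bisection U \<Longrightarrow> open_bisection (iv ` U)"
proof -
  assume U: "open_bisection U"
  have A: "g \<in> Arr" if "g \<in> U" for g
    using that U openin_arrow[of U g] by (simp add: open_bisection_def)
  have "inj_on rg (iv ` U)" "inj_on sc (iv ` U)"
    using U A by (auto simp: open_bisection_def inj_on_def)
  then show ?thesis using U by (simp add: open_bisection_def open_inv)
qed

text \<open>Only the range map is assumed to be a local homeomorphism. Injectivity of the source map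
  near g comes from a range chart at the inverse of g, carried over by inversion.\<close>

lemma open_bisection_exists:
  assumes "openin X W" "g \<in> W"
  obtains U where "open_bisection U" "g \<in> U" "U \<subseteq> W"
proof -
  have g: "g \<in> Arr" using assms openin_arrow by blast
  have "\<exists>U. openin X U \<and> h \<in> U \<and> inj_on rg U" if "h \<in> Arr" for h
  proof -
    obtain U where U: "openin X U" "h \<in> U"
      "homeomorphic_map (subtopology X U) (subtopology (unit_space G) (rg ` U)) rg"
      using range_chart[OF \<open>h \<in> Arr\<close>] by metis
    then show ?thesis
      using homeomorphic_imp_injective_map[OF U(3)] openin_subset[OF U(1)]
      by (intro exI[of _ U]) (simp add: inf.absorb2)
  qed
  then obtain U V where U: "openin X U" "g \<in> U" "inj_on rg U"
    and V: "openin X V" "iv g \<in> V" "inj_on rg V"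
    using g inv_closed[OF g] by metis
  let ?U = "U \<inter> iv ` V \<inter> W"
  have VA: "h \<in> Arr" if "h \<in> V" for h using that V(1) openin_arrow by blast
  have inj: "inj_on sc (iv ` V)"
    using V(3) VA by (auto simp: inj_on_def)
  then have "open_bisection ?U"
    unfolding open_bisection_def
    by (intro conjI openin_Int open_inv U V assms inj_on_subset[OF U(3)] inj_on_subset[OF inj]) blast+
  moreover have "g \<in> iv ` V" using V(2) g by (intro image_eqI[of _ _ "iv g"]) simp_all
  ultimately show thesis using that U(2) assms(2) by blast
qed

lemma Hausdorff_Obj: "Hausdorff_space (subtopology X Obj)"
  using etale by (simp add: locally_compact_etale_groupoid_def unit_space_def)

text \<open>The range map embeds a bisection injectively and continuously into the Hausdorff unit
  space. In a groupoid that is not Hausdorff, this makes open bisections admissible carriers of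
  continuous functions.\<close>

lemma Hausdorff_open_bisection:
  assumes "open_bisection U" shows "Hausdorff_space (subtopology X U)"
proof (rule Hausdorff_space_injective_preimage[OF Hausdorff_Obj])
  have UA: "U \<subseteq> Arr" using assms openin_subset[of X U] by (simp add: open_bisection_def)
  show "continuous_map (subtopology X U) (subtopology X Obj) rg"
    using UA continuous_map_from_subtopology[OF continuous_range, of U]
    by (auto simp: continuous_map_in_subtopology)
  show "inj_on rg (topspace (subtopology X U))"
    using assms UA by (simp add: open_bisection_def inf.absorb2)
qed

lemma separate_units:
  assumes "x \<in> Obj" "y \<in> Obj" "x \<noteq> y"
  obtains U V where "openin X U" "openin X V" "x \<in> U" "y \<in> V" "U \<inter> V = {}"
proof -
  have "\<exists>U V. openin (unit_space G) U \<and> openin (unit_space G) V \<and> x \<in> U \<and> y \<in> V \<and> disjnt U V"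
    using Hausdorff_Obj assms unfolding Hausdorff_space_def unit_space_def[symmetric] by simp
  then obtain U V where "openin (unit_space G) U" "openin (unit_space G) V" "x \<in> U" "y \<in> V" "disjnt U V"
    by blast
  then show thesis by (intro that[of U V]) (simp_all add: openin_unit_space disjnt_def)
qed

text \<open>Preimages under the inverse are images under the range map, and that map is
  open.\<close>

lemma continuous_local_inverse:
  assumes "open_bisection U"
  shows "continuous_map (subtopology X (rg ` U)) X (the_inv_into U rg)"
proof -
  have o: "openin X U" and inj: "inj_on rg U" using assms by (auto simp: open_bisection_def)
  have UA: "g \<in> Arr" if "g \<in> U" for g using o that openin_arrow by blast
  have rgo: "openin X (rg ` U)" by (rule open_range[OF o])
  have pre: "{y \<in> rg ` U. the_inv_into U rg y \<in> V} = rg ` (U \<inter> V)" for V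
    using the_inv_into_f_f[OF inj] by auto
  show ?thesis
    unfolding continuous_map_def
  proof (intro conjI allI impI)
    show "the_inv_into U rg \<in> topspace (subtopology X (rg ` U)) \<rightarrow> topspace X"
      using UA the_inv_into_f_f[OF inj] by auto
    fix V assume V: "openin X V"
    have "topspace (subtopology X (rg ` U)) = rg ` U" using UA by auto
    then show "openin (subtopology X (rg ` U)) {x \<in> topspace (subtopology X (rg ` U)). the_inv_into U rg x \<in> V}"
      using pre[of V] open_range[OF openin_Int[OF o V]] by (auto simp: openin_open_subtopology[OF rgo])
  qed
qed

lemma unit_bump:
  assumes "openin X W" "x \<in> W" "x \<in> Obj"
  obtains F :: "'g \<Rightarrow> real" and K N where
    "continuous_map (unit_space G) euclideanreal F" "compactin X K" "K \<subseteq> W \<inter> Obj"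
    "\<And>y. y \<notin> K \<Longrightarrow> F y = 0" "\<And>y. 0 \<le> F y" "\<And>y. F y \<le> 1"
    "openin X N" "x \<in> N" "N \<subseteq> W \<inter> Obj" "\<And>y. y \<in> N \<Longrightarrow> F y = 1"
proof -
  let ?Y = "unit_space G"
  have lc: "locally_compact_space ?Y" and H: "Hausdorff_space ?Y"
    using etale by (simp_all add: locally_compact_etale_groupoid_def)
  then have cr: "completely_regular_space ?Y"
    by (simp add: locally_compact_regular_imp_completely_regular_space)
  obtain U C where U: "openin ?Y U" "compactin ?Y C" "x \<in> U" "U \<subseteq> C"
    using lc assms(3) unfolding locally_compact_space_def topspace_unit_space by blast
  let ?O = "U \<inter> W"
  have O: "openin ?Y ?O" using U(1) assms(1) by (auto simp: openin_unit_space)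
  have OU: "?O \<subseteq> Obj" using O by (simp add: openin_unit_space)
  have "closedin ?Y (Obj - ?O)" "x \<in> topspace ?Y - (Obj - ?O)"
    using O assms U(3) closedin_diff[OF closedin_topspace O] by auto
  from cr[unfolded completely_regular_space_def, THEN spec, THEN spec, THEN mp, OF conjI[OF this]]
  obtain f where f: "continuous_map ?Y (top_of_set {0..1::real}) f" "f x = 0" "f ` (Obj - ?O) \<subseteq> {1}"
    by (elim exE conjE) (rule that)
  have fc: "continuous_map ?Y euclideanreal f"
    using f(1) continuous_map_into_fulltopology by blast
  \<comment> \<open>Rescaling and clamping f turns the values below 1/3 into a plateau at 1 and
    those above 2/3 into 0. So F is 1 on an open neighbourhood of x and vanishes off a closed subset
    of the compact set C.\<close>
  define F where "F y = (if y \<in> Obj then min 1 (max 0 (2 - 3 * f y)) else 0)" for y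
  define K where "K = {y \<in> topspace ?Y. f y \<in> {..2/3}}"
  define N where "N = {y \<in> topspace ?Y. f y \<in> {..<1/3}}"
  have KO: "K \<subseteq> ?O"
  proof
    fix y assume "y \<in> K"
    then have y: "y \<in> Obj" "f y \<le> 2/3" by (simp_all add: K_def)
    show "y \<in> ?O"
    proof (rule ccontr)
      assume "y \<notin> ?O"
      with y(1) have "f y \<in> f ` (Obj - ?O)" by (intro imageI) simp
      with f(3) have "f y = 1" by blast
      with y(2) show False by simp
    qed
  qed
  show thesis
  proof (rule that[of F K N])
    have "continuous_map ?Y euclideanreal (\<lambda>y. min 1 (max 0 (2 - 3 * f y)))"
      by (intro continuous_map_real_min continuous_map_real_max continuous_map_diff
          continuous_map_real_mult fc) auto
    then show "continuous_map ?Y euclideanreal F"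
      by (rule continuous_map_eq) (simp add: F_def)
    have "closedin ?Y K"
      unfolding K_def by (rule closedin_continuous_map_preimage[OF fc]) simp
    then have "compactin ?Y K"
      using closed_compactin[OF U(2)] KO U(4) by blast
    then show "compactin X K" by (simp add: unit_space_def compactin_subtopology)
    show "K \<subseteq> W \<inter> Obj" using KO OU by blast
    show "F y = 0" if "y \<notin> K" for y using that by (auto simp: F_def K_def)
    show "0 \<le> F y" "F y \<le> 1" for y by (auto simp: F_def)
    have "openin ?Y N"
      unfolding N_def by (rule openin_continuous_map_preimage[OF fc]) simp
    then show "openin X N" by (simp add: openin_unit_space)
    show "x \<in> N" using assms(3) f(2) by (simp add: N_def)
    have "N \<subseteq> K" by (auto simp: N_def K_def)
    then show "N \<subseteq> W \<inter> Obj" using KO OU by blast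
    show "F y = 1" if "y \<in> N" for y using that by (auto simp: F_def N_def)
  qed
qed

end

section \<open>Compactly supported functions\<close>

lemma continuous_map_mult_field:
  fixes f g :: "'a \<Rightarrow> 'b::real_normed_field"
  shows "continuous_map Y euclidean f \<Longrightarrow> continuous_map Y euclidean g \<Longrightarrow>
    continuous_map Y euclidean (\<lambda>x. f x * g x)"
  by (simp add: continuous_map_atin tendsto_mult)

lemma continuous_map_diff_field:
  fixes f g :: "'a \<Rightarrow> 'b::real_normed_field"
  shows "continuous_map Y euclidean f \<Longrightarrow> continuous_map Y euclidean g \<Longrightarrow>
    continuous_map Y euclidean (\<lambda>x. f x - g x)"
  by (simp add: continuous_map_atin tendsto_diff)

lemma continuous_map_cnj:
  "continuous_map Y euclidean f \<Longrightarrow> continuous_map Y euclidean (\<lambda>x. cnj (f x))"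
  by (simp add: continuous_map_atin tendsto_cnj)

lemma continuous_map_of_real_complex:
  "continuous_map Y euclideanreal f \<Longrightarrow> continuous_map Y euclidean (\<lambda>x. complex_of_real (f x))"
  by (simp add: continuous_map_atin tendsto_of_real)

context etale_groupoid
begin

text \<open>The support condition is witnessed by any compact subset of W off which f vanishes. This
  agrees with \<open>Cc_generators\<close> because such a set is closed in the Hausdorff space
  W.\<close>

definition cc_on :: "'g set \<Rightarrow> ('g \<Rightarrow> complex) \<Rightarrow> bool" where
  "cc_on W f \<longleftrightarrow> openin X W \<and> Hausdorff_space (subtopology X W) \<and>
     continuous_map (subtopology X W) euclidean f \<and>
     (\<exists>K. compactin X K \<and> K \<subseteq> W \<and> (\<forall>g. g \<notin> K \<longrightarrow> f g = 0))"

lemma cc_onE: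
  assumes "cc_on W f"
  obtains K where "openin X W" "Hausdorff_space (subtopology X W)"
    "continuous_map (subtopology X W) euclidean f" "compactin X K" "K \<subseteq> W" "\<And>g. g \<notin> K \<Longrightarrow> f g = 0"
  using assms unfolding cc_on_def by blast

lemma cc_on_subset: "cc_on W f \<Longrightarrow> f g \<noteq> 0 \<Longrightarrow> g \<in> W"
  by (auto simp: cc_on_def)

lemma compactin_closedin_open:
  assumes "Hausdorff_space (subtopology X W)" "compactin X K" "K \<subseteq> W"
  shows "closedin (subtopology X W) K"
  using assms by (intro compactin_imp_closedin) (simp_all add: compactin_subtopology)

lemma Cc_generators_iff: "f \<in> Cc_generators G \<longleftrightarrow> (\<exists>W. cc_on W f)"
proof
  assume "f \<in> Cc_generators G"
  then obtain W where W: "openin X W" "Hausdorff_space (subtopology X W)"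
    "\<forall>g. g \<notin> W \<longrightarrow> f g = 0" "continuous_map (subtopology X W) euclidean f"
    "compactin (subtopology X W) (subtopology X W closure_of {g \<in> W. f g \<noteq> 0})"
    unfolding Cc_generators_def mem_Collect_eq by (elim exE conjE) (rule that)
  let ?K = "subtopology X W closure_of {g \<in> W. f g \<noteq> 0}"
  have "{g \<in> W. f g \<noteq> 0} \<subseteq> ?K"
    by (rule closure_of_subset) (use openin_subset[OF W(1)] in auto)
  then have "f g = 0" if "g \<notin> ?K" for g using that W(3) by blast
  moreover have "compactin X ?K" "?K \<subseteq> W" using W(5) by (simp_all add: compactin_subtopology)
  ultimately have "cc_on W f" unfolding cc_on_def using W by blast
  then show "\<exists>W. cc_on W f" ..
next
  assume "\<exists>W. cc_on W f"
  then obtain W where f: "cc_on W f" ..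
  then obtain K where W: "openin X W" "Hausdorff_space (subtopology X W)"
    "continuous_map (subtopology X W) euclidean f" "compactin X K" "K \<subseteq> W" "\<And>g. g \<notin> K \<Longrightarrow> f g = 0"
    by (rule cc_onE) (rule that)
  let ?C = "subtopology X W closure_of {g \<in> W. f g \<noteq> 0}"
  have "?C \<subseteq> K"
    by (rule closure_of_minimal[OF _ compactin_closedin_open[OF W(2,4,5)]]) (use W(6) in blast)
  then have "compactin (subtopology X W) ?C"
    by (rule closed_compactin[of "subtopology X W" K, rotated])
      (simp_all add: compactin_subtopology W(4,5))
  moreover have "\<forall>g. g \<notin> W \<longrightarrow> f g = 0" using W(5,6) by blast
  ultimately show "f \<in> Cc_generators G" unfolding Cc_generators_def using W(1-3) by blast
qed

text \<open>The compact set K is closed in the larger Hausdorff set W, so f is zero on the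
  relatively open complement of K and no discontinuity arises at the frontier of V.\<close>

lemma cc_on_enlarge:
  assumes f: "cc_on V f" and VW: "V \<subseteq> W" and W: "openin X W" "Hausdorff_space (subtopology X W)"
  shows "cc_on W f"
proof -
  obtain K where V: "openin X V" "continuous_map (subtopology X V) euclidean f"
    "compactin X K" "K \<subseteq> V" "\<And>g. g \<notin> K \<Longrightarrow> f g = 0"
    using f by (rule cc_onE) (rule that)
  have KW: "K \<subseteq> W" using V(4) VW by blast
  have "closedin (subtopology X W) K" by (rule compactin_closedin_open[OF W(2) V(3) KW])
  then have "openin (subtopology X W) (W - K)"
    using openin_diff[of "subtopology X W" W K] openin_subset[OF W(1)]
    by (simp add: openin_subtopology_self W(1) openin_open_subtopology[OF W(1)])
  then have WK: "openin X (W - K)" using openin_open_subtopology[OF W(1)] by blast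
  have WA: "W \<subseteq> Arr" "V \<subseteq> Arr" using openin_subset[OF W(1)] openin_subset[OF V(1)] by auto
  have "continuous_map (subtopology X W) euclidean f"
    unfolding continuous_map_def
  proof (intro conjI allI impI)
    fix Z :: "complex set" assume "openin euclidean Z"
    then have "openin (subtopology X V) {g \<in> V. f g \<in> Z}"
      using openin_continuous_map_preimage[OF V(2), of Z] WA by (simp add: inf.absorb2)
    then have o: "openin X {g \<in> V. f g \<in> Z}" using openin_open_subtopology[OF V(1)] by blast
    have "openin X {g \<in> W. f g \<in> Z}"
    proof (cases "0 \<in> Z")
      case True
      then have "{g \<in> W. f g \<in> Z} = {g \<in> V. f g \<in> Z} \<union> (W - K)"
        using VW V(4,5) by auto
      then show ?thesis using openin_Un[OF o WK] by (simp only:)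
    next
      case False
      have "g \<in> V" if "f g \<in> Z" for g
        using that False V(4) V(5)[of g] by (cases "g \<in> K") auto
      then have "{g \<in> W. f g \<in> Z} = {g \<in> V. f g \<in> Z}"
        using VW by blast
      then show ?thesis using o by simp
    qed
    then show "openin (subtopology X W) {x \<in> topspace (subtopology X W). f x \<in> Z}"
      using WA by (simp add: inf.absorb2 openin_open_subtopology[OF W(1)])
  qed auto
  then show ?thesis unfolding cc_on_def using W V(3,5) KW by blast
qed

lemma cc_on_mult:
  assumes "cc_on W f" "continuous_map (subtopology X W) euclidean u"
  shows "cc_on W (\<lambda>g. f g * u g)"
proof -
  obtain K where "openin X W" "Hausdorff_space (subtopology X W)"
    "continuous_map (subtopology X W) euclidean f" "compactin X K" "K \<subseteq> W" "\<And>g. g \<notin> K \<Longrightarrow> f g = 0"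
    using assms(1) by (rule cc_onE) (rule that)
  then show ?thesis
    unfolding cc_on_def using assms(2)
    by (intro conjI exI[of _ K] continuous_map_mult_field) auto
qed

lemma cc_on_scale: "cc_on W f \<Longrightarrow> cc_on W (\<lambda>g. c * f g)"
  using cc_on_mult[of W f "\<lambda>_. c"] by (simp add: mult.commute)

text \<open>A bump function at the range of g is pulled back along the range map of a bisection; the
  local inverse carries its compact support back to an arrow set.\<close>

lemma arrow_bump:
  assumes "openin X W" "g \<in> W"
  obtains U u N where "open_bisection U" "g \<in> U" "U \<subseteq> W" "cc_on U u"
    "openin X N" "g \<in> N" "\<And>h. h \<in> N \<Longrightarrow> u h = 1"
proof -
  obtain U where U: "open_bisection U" "g \<in> U" "U \<subseteq> W"
    by (rule open_bisection_exists[OF assms]) (rule that)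
  then have Uo: "openin X U" and inj: "inj_on rg U" by (simp_all add: open_bisection_def)
  have UA: "U \<subseteq> Arr" using openin_subset[OF Uo] by simp
  have x: "rg g \<in> rg ` U" "rg g \<in> Obj" using U(2) UA by auto
  obtain F :: "'g \<Rightarrow> real" and K N where F:
    "continuous_map (unit_space G) euclideanreal F" "compactin X K" "K \<subseteq> rg ` U \<inter> Obj"
    "\<And>y. y \<notin> K \<Longrightarrow> F y = 0" "openin X N" "rg g \<in> N" "\<And>y. y \<in> N \<Longrightarrow> F y = 1"
    by (rule unit_bump[OF open_range[OF Uo] x]) (rule that)
  define u where "u h = (if h \<in> U then complex_of_real (F (rg h)) else 0)" for h
  let ?h = "the_inv_into U rg"
  have "compactin X (?h ` K)"
    by (rule image_compactin[OF _ continuous_local_inverse[OF U(1)]])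
      (use F(2,3) in \<open>simp add: compactin_subtopology\<close>)
  moreover have "?h ` K \<subseteq> U" using F(3) the_inv_into_into[OF inj _ subset_refl] by blast
  moreover have "u h = 0" if "h \<notin> ?h ` K" for h
  proof (cases "h \<in> U")
    case True
    then have "rg h \<notin> K" using that the_inv_into_f_f[OF inj True] by (metis image_eqI)
    then show ?thesis by (simp add: u_def F(4))
  qed (simp add: u_def)
  moreover have "continuous_map (subtopology X U) euclidean u"
  proof -
    have "continuous_map (subtopology X U) (unit_space G) rg"
      using UA continuous_map_from_subtopology[OF continuous_range, of U]
      by (auto simp: unit_space_def continuous_map_in_subtopology)
    then have "continuous_map (subtopology X U) euclideanreal (F \<circ> rg)"
      by (rule continuous_map_compose[OF _ F(1)])
    then have "continuous_map (subtopology X U) euclidean (\<lambda>h. complex_of_real ((F \<circ> rg) h))"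
      by (rule continuous_map_of_real_complex)
    then show ?thesis by (rule continuous_map_eq) (simp add: u_def)
  qed
  ultimately have "cc_on U u"
    unfolding cc_on_def using Uo Hausdorff_open_bisection[OF U(1)] by blast
  moreover have "openin X (U \<inter> {h \<in> Arr. rg h \<in> N})"
    by (intro openin_Int Uo openin_range_preimage F)
  moreover have "g \<in> U \<inter> {h \<in> Arr. rg h \<in> N}" using U(2) UA F(6) by auto
  ultimately show thesis
    using U by (rule_tac that[of U u "U \<inter> {h \<in> Arr. rg h \<in> N}"]) (auto simp: u_def F(7))
qed

lemma zero_in_Cc: "(\<lambda>_. 0) \<in> Cc G"
  unfolding Cc_def by (rule CollectI, rule exI[of _ "{}"]) simp

lemma Cc_add:
  assumes "f \<in> Cc G" "g \<in> Cc G" shows "(\<lambda>x. f x + g x) \<in> Cc G"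
proof -
  obtain S c where f: "finite S" "S \<subseteq> Cc_generators G" "f = (\<lambda>g. \<Sum>\<phi>\<in>S. c \<phi> * \<phi> g)"
    using assms(1) unfolding Cc_def by blast
  obtain T d where g: "finite T" "T \<subseteq> Cc_generators G" "g = (\<lambda>g. \<Sum>\<phi>\<in>T. d \<phi> * \<phi> g)"
    using assms(2) unfolding Cc_def by blast
  let ?e = "\<lambda>\<phi>. (if \<phi> \<in> S then c \<phi> else 0) + (if \<phi> \<in> T then d \<phi> else 0)"
  have "f x + g x = (\<Sum>\<phi>\<in>S \<union> T. ?e \<phi> * \<phi> x)" for x
  proof -
    have "f x = (\<Sum>\<phi>\<in>S \<union> T. (if \<phi> \<in> S then c \<phi> else 0) * \<phi> x)"
      unfolding f(3) by (rule sum.mono_neutral_cong_left) (use f(1) g(1) in auto)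
    moreover have "g x = (\<Sum>\<phi>\<in>S \<union> T. (if \<phi> \<in> T then d \<phi> else 0) * \<phi> x)"
      unfolding g(3) by (rule sum.mono_neutral_cong_left) (use f(1) g(1) in auto)
    ultimately show ?thesis by (simp only: distrib_right sum.distrib)
  qed
  then show ?thesis
    unfolding Cc_def using f(1,2) g(1,2)
    by (intro CollectI exI[of _ "S \<union> T"] exI[of _ ?e]) auto
qed

lemma cc_on_in_Cc: "cc_on W f \<Longrightarrow> f \<in> Cc G"
  unfolding Cc_def using Cc_generators_iff
  by (intro CollectI exI[of _ "{f}"] exI[of _ "\<lambda>_. 1"]) auto

text \<open>A bump function \<open>u\<close> on a bisection splits \<open>f\<close> into \<open>fu\<close> and \<open>f(1 - u)\<close>; finitely many bump
  functions suffice to annihilate \<open>f\<close>.\<close>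

lemma cc_on_decompose:
  assumes zero: "P (\<lambda>_. 0)" and add: "\<And>f g. P f \<Longrightarrow> P g \<Longrightarrow> P (\<lambda>x. f x + g x)"
    and bis: "\<And>U f. open_bisection U \<Longrightarrow> cc_on U f \<Longrightarrow> P f"
    and f: "cc_on W f"
  shows "P f"
proof -
  obtain K where W: "openin X W" "Hausdorff_space (subtopology X W)"
    "compactin X K" "K \<subseteq> W" "\<And>g. g \<notin> K \<Longrightarrow> f g = 0"
    using f by (rule cc_onE) (rule that)
  define B where "B = {(N, u). openin X N \<and> (\<exists>U. open_bisection U \<and> U \<subseteq> W \<and> cc_on U u) \<and> (\<forall>h\<in>N. u h = 1)}"
  have "\<exists>p\<in>B. g \<in> fst p" if "g \<in> K" for g
  proof -
    have "g \<in> W" using that W(4) by blast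
    then obtain U u N where "open_bisection U" "U \<subseteq> W" "cc_on U u" "openin X N" "g \<in> N" "\<And>h. h \<in> N \<Longrightarrow> u h = 1"
      using arrow_bump[OF W(1)] by metis
    then show ?thesis by (intro bexI[of _ "(N, u)"]) (auto simp: B_def)
  qed
  then have "K \<subseteq> \<Union>(fst ` B)" by blast
  moreover have "openin X N" if "N \<in> fst ` B" for N using that by (auto simp: B_def)
  ultimately obtain \<F> where "finite \<F>" "\<F> \<subseteq> fst ` B" "K \<subseteq> \<Union>\<F>"
    using W(3) unfolding compactin_def by (metis (no_types, lifting))
  then obtain C where C: "C \<subseteq> B" "finite C" "K \<subseteq> \<Union>(fst ` C)"
    by (metis finite_subset_image)
  \<comment> \<open>The invariant is that some remaining bump function equals 1 at each point where
    f is non-zero. The second alternative is needed at the end, since for empty D the existential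
    fails even when f vanishes.\<close>
  have main: "finite D \<Longrightarrow> D \<subseteq> B \<Longrightarrow> cc_on W f \<Longrightarrow> (\<forall>h. \<exists>p\<in>D. f h \<noteq> 0 \<longrightarrow> snd p h = 1) \<or> f = (\<lambda>_. 0) \<Longrightarrow> P f"
    for D f
  proof (induction D arbitrary: f rule: finite_induct)
    case empty
    then show ?case using zero by auto
  next
    case (insert p D)
    obtain N u where p: "p = (N, u)" by (cases p)
    obtain U where U: "open_bisection U" "U \<subseteq> W" "cc_on U u"
      using insert.prems(1) unfolding p B_def by auto
    have uW: "cc_on W u"
      using U W(1,2) by (intro cc_on_enlarge[OF U(3)])
    have uc: "continuous_map (subtopology X W) euclidean u" using uW by (simp add: cc_on_def)
    have "continuous_map (subtopology X U) euclidean f"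
      using insert.prems(2) continuous_map_from_subtopology_mono[OF _ U(2)] by (auto simp: cc_on_def)
    then have "cc_on U (\<lambda>g. u g * f g)" by (rule cc_on_mult[OF U(3)])
    then have 1: "P (\<lambda>g. u g * f g)" by (rule bis[OF U(1)])
    have 2: "P (\<lambda>g. f g * (1 - u g))"
    proof (rule insert.IH)
      show "cc_on W (\<lambda>g. f g * (1 - u g))"
        by (intro cc_on_mult insert.prems continuous_map_diff_field uc) simp
      show "(\<forall>h. \<exists>p\<in>D. f h * (1 - u h) \<noteq> 0 \<longrightarrow> snd p h = 1) \<or> (\<lambda>g. f g * (1 - u g)) = (\<lambda>_. 0)"
      proof (cases "D = {}")
        case True
        then show ?thesis using insert.prems(3) by (intro disjI2 ext) (auto simp: p)
      next
        case False
        have "\<exists>q\<in>D. f h * (1 - u h) \<noteq> 0 \<longrightarrow> snd q h = 1" for h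
        proof (cases "f h * (1 - u h) = 0")
          case True
          then show ?thesis using False by auto
        next
          case False
          then have "f h \<noteq> 0" "u h \<noteq> 1" by auto
          then show ?thesis using insert.prems(3) by (auto simp: p)
        qed
        then show ?thesis by blast
      qed
    qed (use insert.prems in auto)
    have "P (\<lambda>g. u g * f g + f g * (1 - u g))" by (rule add[OF 1 2])
    then show ?case by (simp add: algebra_simps)
  qed
  show ?thesis
  proof (rule main[OF C(2,1) f])
    have "\<exists>p\<in>C. snd p h = 1" if "f h \<noteq> 0" for h
    proof -
      have "h \<in> K" using that W(5) by blast
      then obtain p where "p \<in> C" "h \<in> fst p" using C(3) by auto
      then show ?thesis using C(1) by (intro bexI[of _ p]) (auto simp: B_def)
    qed
    then show "(\<forall>h. \<exists>p\<in>C. f h \<noteq> 0 \<longrightarrow> snd p h = 1) \<or> f = (\<lambda>_. 0)" by blast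
  qed
qed

text \<open>Reduces additive statements on \<open>Cc G\<close> to functions on a single open
  bisection, where every fibre sum has at most one term. Scalars are absorbed into the bisection
  case.\<close>

lemma Cc_induct [consumes 1, case_names zero add bisection]:
  assumes f: "f \<in> Cc G"
    and zero: "P (\<lambda>_. 0)"
    and add: "\<And>f g. f \<in> Cc G \<Longrightarrow> g \<in> Cc G \<Longrightarrow> P f \<Longrightarrow> P g \<Longrightarrow> P (\<lambda>x. f x + g x)"
    and bis: "\<And>U f. open_bisection U \<Longrightarrow> cc_on U f \<Longrightarrow> P f"
  shows "P f"
proof -
  let ?Q = "\<lambda>f. f \<in> Cc G \<and> P f"
  have gen: "?Q \<phi>" if "cc_on W \<phi>" for W \<phi>
  proof (rule cc_on_decompose[of ?Q, OF _ _ _ that])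
    show "?Q (\<lambda>_. 0)" using zero zero_in_Cc by blast
    show "?Q (\<lambda>x. f x + g x)" if "?Q f" "?Q g" for f g using that Cc_add add by blast
    show "?Q \<phi>" if "open_bisection U" "cc_on U \<phi>" for U \<phi> using that bis cc_on_in_Cc by blast
  qed
  obtain S c where S: "finite S" "S \<subseteq> Cc_generators G" "f = (\<lambda>g. \<Sum>\<phi>\<in>S. c \<phi> * \<phi> g)"
    using f unfolding Cc_def by blast
  have "?Q (\<lambda>g. \<Sum>\<phi>\<in>T. c \<phi> * \<phi> g)" if "T \<subseteq> S" for T
    using finite_subset[OF that S(1)] that
  proof (induction T rule: finite_induct)
    case empty
    then show ?case using zero zero_in_Cc by simp
  next
    case (insert \<phi> T)
    obtain W where "cc_on W \<phi>" using insert.prems S(2) Cc_generators_iff by blast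
    then have 1: "?Q (\<lambda>g. c \<phi> * \<phi> g)" by (intro gen cc_on_scale)
    have 2: "?Q (\<lambda>g. \<Sum>\<phi>\<in>T. c \<phi> * \<phi> g)" using insert by simp
    have "?Q (\<lambda>g. c \<phi> * \<phi> g + (\<Sum>\<phi>\<in>T. c \<phi> * \<phi> g))" using 1 2 Cc_add add by blast
    then show ?case using insert.hyps by simp
  qed
  from this[of S] show ?thesis using S(3) by simp
qed

lemma Cc_scale: "f \<in> Cc G \<Longrightarrow> (\<lambda>g. c * f g) \<in> Cc G"
proof (induction rule: Cc_induct)
  case (add f g)
  then show ?case using Cc_add[of "\<lambda>x. c * f x" "\<lambda>x. c * g x"] by (simp add: distrib_left)
next
  case (bisection U f)
  then show ?case by (intro cc_on_in_Cc cc_on_scale)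
qed (simp add: zero_in_Cc)

text \<open>An open bisection meets each source fibre and each range fibre in at most one
  arrow.\<close>

lemma Cc_finite_source: "f \<in> Cc G \<Longrightarrow> finite {h \<in> source_fibre G x. f h \<noteq> 0}"
  and Cc_finite_range: "f \<in> Cc G \<Longrightarrow> finite {h \<in> range_fibre G x. f h \<noteq> 0}"
proof -
  have *: "finite {h \<in> A. f h \<noteq> 0}" if f: "f \<in> Cc G" and A: "\<And>U. open_bisection U \<Longrightarrow> \<exists>z. A \<inter> U \<subseteq> {z}" for A f
    using f
  proof (induction rule: Cc_induct)
    case (add f g)
    show ?case
      by (rule finite_subset[OF _ finite_UnI[OF add(3,4)]]) auto
  next
    case (bisection U f)
    obtain z where z: "A \<inter> U \<subseteq> {z}" using A[OF bisection(1)] ..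
    have "{h \<in> A. f h \<noteq> 0} \<subseteq> {z}" using cc_on_subset[OF bisection(2)] z by blast
    then show ?case by (rule finite_subset) simp
  qed simp
  have "\<exists>z. source_fibre G x \<inter> U \<subseteq> {z}" "\<exists>z. range_fibre G x \<inter> U \<subseteq> {z}" if "open_bisection U" for U
  proof -
    have "inj_on sc U" "inj_on rg U" using that by (auto simp: open_bisection_def)
    then have "\<forall>a\<in>source_fibre G x \<inter> U. \<forall>b\<in>source_fibre G x \<inter> U. a = b"
      "\<forall>a\<in>range_fibre G x \<inter> U. \<forall>b\<in>range_fibre G x \<inter> U. a = b"
      by (auto simp: source_fibre_def range_fibre_def inj_on_def)
    then show "\<exists>z. source_fibre G x \<inter> U \<subseteq> {z}" "\<exists>z. range_fibre G x \<inter> U \<subseteq> {z}" by blast+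
  qed
  note 1 = this
  show "finite {h \<in> source_fibre G x. f h \<noteq> 0}" if "f \<in> Cc G"
    by (rule *[OF that 1(1)])
  show "finite {h \<in> range_fibre G x. f h \<noteq> 0}" if "f \<in> Cc G"
    by (rule *[OF that 1(2)])
qed

section \<open>Involution and convolution\<close>

definition star :: "('g \<Rightarrow> complex) \<Rightarrow> 'g \<Rightarrow> complex" where
  "star f g = (if g \<in> Arr then cnj (f (iv g)) else 0)"

lemma cc_on_star:
  assumes U: "open_bisection U" and f: "cc_on U f"
  shows "open_bisection (iv ` U)" "cc_on (iv ` U) (star f)"
proof -
  show V: "open_bisection (iv ` U)" by (rule open_bisection_inv[OF U])
  obtain K where K: "openin X U" "continuous_map (subtopology X U) euclidean f"
    "compactin X K" "K \<subseteq> U" "\<And>g. g \<notin> K \<Longrightarrow> f g = 0"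
    using f by (rule cc_onE) (rule that)
  have UA: "g \<in> Arr" if "g \<in> U" for g using openin_arrow[OF K(1) that] .
  have "compactin X (iv ` K)" by (rule image_compactin[OF K(3) continuous_inv])
  moreover have "star f g = 0" if "g \<notin> iv ` K" for g
  proof (cases "g \<in> Arr")
    case True
    then have "iv g \<notin> K" using that by (metis image_eqI inv_inv)
    then show ?thesis by (simp add: star_def K(5))
  qed (simp add: star_def)
  moreover have "continuous_map (subtopology X (iv ` U)) euclidean (star f)"
  proof -
    have "continuous_map (subtopology X (iv ` U)) (subtopology X U) iv"
      using continuous_map_from_subtopology[OF continuous_inv] UA
      by (auto simp: continuous_map_in_subtopology)
    then have "continuous_map (subtopology X (iv ` U)) euclidean (f \<circ> iv)"
      by (rule continuous_map_compose[OF _ K(2)])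
    then have "continuous_map (subtopology X (iv ` U)) euclidean (\<lambda>x. cnj ((f \<circ> iv) x))"
      by (rule continuous_map_cnj)
    then show ?thesis by (rule continuous_map_eq) (use UA in \<open>auto simp: star_def\<close>)
  qed
  ultimately show "cc_on (iv ` U) (star f)"
    unfolding cc_on_def using open_inv[OF K(1)] Hausdorff_open_bisection[OF V] K(4) by blast
qed

lemma star_Cc: "f \<in> Cc G \<Longrightarrow> star f \<in> Cc G"
proof (induction rule: Cc_induct)
  case zero
  have "star (\<lambda>_. 0) = (\<lambda>_. 0)" by (auto simp: star_def)
  then show ?case by (simp add: zero_in_Cc)
next
  case (add f g)
  have "star (\<lambda>x. f x + g x) = (\<lambda>x. star f x + star g x)" by (auto simp: star_def)
  then show ?case using Cc_add[OF add(3,4)] by simp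
next
  case (bisection U f)
  then show ?case using cc_on_star cc_on_in_Cc by blast
qed

text \<open>The usual convolution sum over arrows k in the range fibre, after the substitution h =
  k^{-1} g. In this form the summands match matrix products, and finiteness comes from the right
  factor alone.\<close>

definition conv :: "('g \<Rightarrow> complex) \<Rightarrow> ('g \<Rightarrow> complex) \<Rightarrow> 'g \<Rightarrow> complex" where
  "conv f f' g = (if g \<in> Arr
     then \<Sum>h | h \<in> source_fibre G (sc g) \<and> f' h \<noteq> 0. f (g \<odot> iv h) * f' h else 0)"

lemma conv_add_left: "conv (\<lambda>x. f x + g x) f' = (\<lambda>x. conv f f' x + conv g f' x)"
  by (auto simp: conv_def distrib_right sum.distrib)

lemma conv_superset:
  assumes "finite F" "{h \<in> source_fibre G (sc g). f' h \<noteq> 0} \<subseteq> F" "F \<subseteq> source_fibre G (sc g)" "g \<in> Arr"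
  shows "conv f f' g = (\<Sum>h\<in>F. f (g \<odot> iv h) * f' h)"
  unfolding conv_def using assms by (simp, intro sum.mono_neutral_left) auto

lemma conv_add_right:
  assumes "f1 \<in> Cc G" "f2 \<in> Cc G"
  shows "conv f (\<lambda>x. f1 x + f2 x) = (\<lambda>x. conv f f1 x + conv f f2 x)"
proof
  fix g
  show "conv f (\<lambda>x. f1 x + f2 x) g = conv f f1 g + conv f f2 g"
  proof (cases "g \<in> Arr")
    case True
    let ?F = "{h \<in> source_fibre G (sc g). f1 h \<noteq> 0} \<union> {h \<in> source_fibre G (sc g). f2 h \<noteq> 0}"
    have "finite ?F" using Cc_finite_source assms by auto
    then show ?thesis
      by (subst (1 2 3) conv_superset[of ?F])
        (auto simp: True distrib_left sum.distrib)
  qed (simp add: conv_def)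
qed

text \<open>An arrow of the product set of U and V factors uniquely as l g times k g with factors in
  U and V. On this set the convolution is thus the ordinary product of f1 at l g and f2 at k g, and
  both factors depend continuously on g.\<close>

lemma conv_bisection:
  assumes U: "open_bisection U" "cc_on U f1" and V: "open_bisection V" "cc_on V f2"
  obtains W where "open_bisection W" "cc_on W (conv f1 f2)"
proof -
  obtain K1 where K1: "openin X U" "continuous_map (subtopology X U) euclidean f1"
    "compactin X K1" "K1 \<subseteq> U" "\<And>g. g \<notin> K1 \<Longrightarrow> f1 g = 0"
    using U(2) by (rule cc_onE) (rule that)
  obtain K2 where K2: "openin X V" "continuous_map (subtopology X V) euclidean f2"
    "compactin X K2" "K2 \<subseteq> V" "\<And>g. g \<notin> K2 \<Longrightarrow> f2 g = 0"
    using V(2) by (rule cc_onE) (rule that)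
  have injU: "inj_on rg U" "inj_on sc U" and injV: "inj_on rg V" "inj_on sc V"
    using U(1) V(1) by (simp_all add: open_bisection_def)
  have UA: "g \<in> Arr" if "g \<in> U" for g using openin_arrow[OF K1(1) that] .
  have VA: "g \<in> Arr" if "g \<in> V" for g using openin_arrow[OF K2(1) that] .
  define A where "A = {g \<in> Arr. rg g \<in> rg ` U}"
  define l where "l g = the_inv_into U rg (rg g)" for g
  define k where "k g = iv (l g) \<odot> g" for g
  define W where "W = {g \<in> A. k g \<in> V}"
  have Ao: "openin X A" unfolding A_def by (intro openin_range_preimage open_range K1)
  have lU: "l g \<in> U" and rl: "rg (l g) = rg g" if "g \<in> A" for g
    using that the_inv_into_into[OF injU(1) _ subset_refl] f_the_inv_into_f[OF injU(1)]
    by (auto simp: A_def l_def)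
  have AA: "g \<in> Arr" if "g \<in> A" for g using that by (simp add: A_def)
  have lA: "l g \<in> Arr" if "g \<in> A" for g using lU[OF that] by (rule UA)
  have kA: "k g \<in> Arr" and rk: "rg (k g) = sc (l g)" and sk: "sc (k g) = sc g" and lk: "l g \<odot> k g = g"
    if "g \<in> A" for g
    using that lA rl AA by (simp_all add: k_def)
  have l_eq: "l (a \<odot> b) = a" and k_eq: "k (a \<odot> b) = b" and ab_A: "a \<odot> b \<in> A"
    if "a \<in> U" "b \<in> Arr" "sc a = rg b" for a b
    using that UA by (simp_all add: l_def k_def A_def the_inv_into_f_f[OF injU(1)])
  have tA: "topspace (subtopology X A) = A" using AA by auto
  have lc: "continuous_map (subtopology X A) X l"
  proof -
    have "continuous_map (subtopology X A) (subtopology X (rg ` U)) rg"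
      using continuous_map_from_subtopology[OF continuous_range]
      by (auto simp: continuous_map_in_subtopology A_def)
    then have "continuous_map (subtopology X A) X (the_inv_into U rg \<circ> rg)"
      by (rule continuous_map_compose[OF _ continuous_local_inverse[OF U(1)]])
    moreover have "l = the_inv_into U rg \<circ> rg" by (auto simp: l_def)
    ultimately show ?thesis by simp
  qed
  have kc: "continuous_map (subtopology X A) X k"
  proof -
    have 1: "continuous_map (subtopology X A) X (\<lambda>g. iv (l g))"
      using continuous_map_compose[OF lc continuous_inv] by (simp add: o_def)
    have 2: "continuous_map (subtopology X A) X (\<lambda>g. g)"
      by (rule continuous_map_from_subtopology[OF continuous_map_id[unfolded id_def]])
    have "continuous_map (subtopology X A) X (\<lambda>g. iv (l g) \<odot> g)"
      using lA rl AA by (intro continuous_mult[OF 1 2]) auto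
    moreover have "k = (\<lambda>g. iv (l g) \<odot> g)" by (auto simp: k_def)
    ultimately show ?thesis by simp
  qed
  have Wo: "openin X W"
  proof -
    have "openin (subtopology X A) {g \<in> topspace (subtopology X A). k g \<in> V}"
      by (rule openin_continuous_map_preimage[OF kc K2(1)])
    then show ?thesis unfolding tA W_def[symmetric] using openin_open_subtopology[OF Ao] by blast
  qed
  have WA: "g \<in> A" and kV: "k g \<in> V" if "g \<in> W" for g using that by (auto simp: W_def)
  have W: "open_bisection W"
    unfolding open_bisection_def
  proof (intro conjI Wo inj_onI)
    fix g g' assume g: "g \<in> W" "g' \<in> W"
    note A = WA[OF g(1)] WA[OF g(2)]
    {
      assume "rg g = rg g'"
      then have l: "l g = l g'" by (simp add: l_def)
      then have "k g = k g'" using inj_onD[OF injV(1) _ kV[OF g(1)] kV[OF g(2)]] rk[OF A(1)] rk[OF A(2)] by simp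
      then show "g = g'" using l lk[OF A(1)] lk[OF A(2)] by metis
    next
      assume "sc g = sc g'"
      then have k: "k g = k g'"
        using inj_onD[OF injV(2) _ kV[OF g(1)] kV[OF g(2)]] sk[OF A(1)] sk[OF A(2)] by simp
      then have "l g = l g'"
        using inj_onD[OF injU(2) _ lU[OF A(1)] lU[OF A(2)]] rk[OF A(1)] rk[OF A(2)] by simp
      then show "g = g'" using k lk[OF A(1)] lk[OF A(2)] by metis
    }
  qed
  have conv_W: "conv f1 f2 g = f1 (l g) * f2 (k g)" if g: "g \<in> W" for g
  proof -
    note A = WA[OF g]
    have "{h \<in> source_fibre G (sc g). f2 h \<noteq> 0} \<subseteq> {k g}"
    proof
      fix h assume "h \<in> {h \<in> source_fibre G (sc g). f2 h \<noteq> 0}"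
      then have h: "sc h = sc g" "h \<in> V" using cc_on_subset[OF V(2)] by (auto simp: source_fibre_def)
      then show "h \<in> {k g}" using inj_onD[OF injV(2) _ h(2) kV[OF g]] sk[OF A] by simp
    qed
    then have "conv f1 f2 g = (\<Sum>h\<in>{k g}. f1 (g \<odot> iv h) * f2 h)"
      by (intro conv_superset) (use kA[OF A] sk[OF A] AA[OF A] in \<open>auto simp: source_fibre_def\<close>)
    moreover have "g \<odot> iv (k g) = l g"
      using cancel(3)[OF lA[OF A] kA[OF A]] rk[OF A] lk[OF A] by simp
    ultimately show ?thesis by simp
  qed
  have conv_supp: "\<exists>a\<in>K1. \<exists>b\<in>K2. sc a = rg b \<and> g = a \<odot> b" if "conv f1 f2 g \<noteq> 0" for g
  proof -
    have g: "g \<in> Arr" using that by (auto simp: conv_def split: if_splits)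
    with that have "(\<Sum>h | h \<in> source_fibre G (sc g) \<and> f2 h \<noteq> 0. f1 (g \<odot> iv h) * f2 h) \<noteq> 0"
      by (simp add: conv_def)
    then obtain h where h: "h \<in> Arr" "sc h = sc g" "f1 (g \<odot> iv h) * f2 h \<noteq> 0"
      by (rule sum.not_neutral_contains_not_neutral) (auto simp: source_fibre_def)
    then have "g \<odot> iv h \<in> K1" "h \<in> K2" using K1(5) K2(5) by auto
    moreover have "sc (g \<odot> iv h) = rg h" "g = g \<odot> iv h \<odot> h" using g h by simp_all
    ultimately show ?thesis by blast
  qed
  \<comment> \<open>Compactness survives the restriction to composable pairs because equality of
    source and range is a closed condition: the unit space is Hausdorff.\<close>
  define K where "K = (\<lambda>(a, b). a \<odot> b) ` (K1 \<times> K2 \<inter> {p \<in> topspace (prod_topology X X). sc (fst p) = rg (snd p)})"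
  have "compactin X K"
    unfolding K_def
  proof (rule image_compactin)
    have fs: "continuous_map (prod_topology X X) (unit_space G) (\<lambda>p. sc (fst p))"
      and rs: "continuous_map (prod_topology X X) (unit_space G) (\<lambda>p. rg (snd p))"
      using continuous_map_compose[OF continuous_map_fst continuous_source, of X]
        continuous_map_compose[OF continuous_map_snd continuous_range, of X]
      by (auto simp: unit_space_def continuous_map_in_subtopology o_def)
    have "closedin (prod_topology X X) {p \<in> topspace (prod_topology X X). sc (fst p) = rg (snd p)}"
      by (rule closedin_continuous_maps_eq[OF _ fs rs])
        (use Hausdorff_Obj in \<open>simp add: unit_space_def\<close>)
    then have "compactin (prod_topology X X) (K1 \<times> K2 \<inter> {p \<in> topspace (prod_topology X X). sc (fst p) = rg (snd p)})"
      by (intro compact_Int_closedin) (simp_all add: compactin_Times K1(3) K2(3))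
    then show "compactin (subtopology (prod_topology X X) (composable G))
        (K1 \<times> K2 \<inter> {p \<in> topspace (prod_topology X X). sc (fst p) = rg (snd p)})"
      by (auto simp: compactin_subtopology composable_def)
    show "continuous_map (subtopology (prod_topology X X) (composable G)) X (\<lambda>(g, h). g \<odot> h)"
      using etale by (simp add: locally_compact_etale_groupoid_def)
  qed
  moreover have "K \<subseteq> W"
  proof
    fix g assume "g \<in> K"
    then obtain a b where ab: "a \<in> K1" "b \<in> K2" "sc a = rg b" "g = a \<odot> b" by (auto simp: K_def)
    then have "a \<in> U" "b \<in> V" using K1(4) K2(4) by auto
    then show "g \<in> W" using ab(3,4) ab_A k_eq VA by (simp add: W_def)
  qed
  moreover have "conv f1 f2 g = 0" if "g \<notin> K" for g
  proof (rule ccontr)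
    assume "conv f1 f2 g \<noteq> 0"
    from conv_supp[OF this] obtain a b where ab: "a \<in> K1" "b \<in> K2" "sc a = rg b" "g = a \<odot> b" by blast
    then have "(a, b) \<in> K1 \<times> K2 \<inter> {p \<in> topspace (prod_topology X X). sc (fst p) = rg (snd p)}"
      using K1(4) K2(4) UA VA by auto
    then have "g \<in> K" unfolding K_def ab(4) by (rule rev_image_eqI) simp
    with that show False by blast
  qed
  moreover have "continuous_map (subtopology X W) euclidean (conv f1 f2)"
  proof -
    have "W \<subseteq> A" using WA by blast
    have "continuous_map (subtopology X W) (subtopology X U) l" "continuous_map (subtopology X W) (subtopology X V) k"
      using continuous_map_from_subtopology_mono[OF lc \<open>W \<subseteq> A\<close>]
        continuous_map_from_subtopology_mono[OF kc \<open>W \<subseteq> A\<close>] lU WA kV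
      by (auto simp: continuous_map_in_subtopology)
    then have "continuous_map (subtopology X W) euclidean (f1 \<circ> l)" "continuous_map (subtopology X W) euclidean (f2 \<circ> k)"
      using continuous_map_compose K1(2) K2(2) by blast+
    then have "continuous_map (subtopology X W) euclidean (\<lambda>g. (f1 \<circ> l) g * (f2 \<circ> k) g)"
      by (rule continuous_map_mult_field)
    then show ?thesis by (rule continuous_map_eq) (simp add: conv_W)
  qed
  ultimately have "cc_on W (conv f1 f2)"
    unfolding cc_on_def using Wo Hausdorff_open_bisection[OF W] by blast
  with W show thesis by (rule that)
qed

lemma conv_Cc:
  assumes "f \<in> Cc G" "f' \<in> Cc G" shows "conv f f' \<in> Cc G"
  using assms(1)
proof (induction rule: Cc_induct)
  case zero
  have "conv (\<lambda>_. 0) f' = (\<lambda>_. 0)" by (auto simp: conv_def)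
  then show ?case by (simp add: zero_in_Cc)
next
  case (add f g)
  then show ?case by (simp add: conv_add_left Cc_add)
next
  case (bisection U f)
  show ?case using assms(2)
  proof (induction rule: Cc_induct)
    case zero
    have "conv f (\<lambda>_. 0) = (\<lambda>_. 0)" by (auto simp: conv_def)
    then show ?case by (simp add: zero_in_Cc)
  next
    case (add f1 f2)
    then show ?case by (simp add: conv_add_right Cc_add)
  next
    case (bisection V f2)
    obtain W where "cc_on W (conv f f2)"
      by (rule conv_bisection[OF \<open>open_bisection U\<close> \<open>cc_on U f\<close> bisection]) (rule that)
    then show ?case by (rule cc_on_in_Cc)
  qed
qed

end

section \<open>The reduced C*-algebra\<close>

context etale_groupoid
begin

text \<open>The matrix of the left action of f, block diagonal over the source fibres.
  \<open>rho\<close> and \<open>rho_sum\<close> are definite descriptions through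
  \<open>op_of_basis\<close>, so a bounded operator with this matrix must be exhibited before
  anything can be said about them.\<close>

definition has_kernel :: "('g \<Rightarrow> complex) \<Rightarrow> ('g ell2 \<Rightarrow>\<^sub>L 'g ell2) \<Rightarrow> bool" where
  "has_kernel f T \<longleftrightarrow> clinear_op T \<and> (\<forall>g k. Rep_ell2 (T (delta g)) k =
     (if g \<in> Arr \<and> k \<in> Arr \<and> sc k = sc g then f (k \<odot> iv g) else 0))"

lemma has_kernel_clinear: "has_kernel f T \<Longrightarrow> clinear_op T"
  by (simp add: has_kernel_def)

lemma has_kernel_apply: "has_kernel f T \<Longrightarrow> Rep_ell2 (T (delta g)) k =
     (if g \<in> Arr \<and> k \<in> Arr \<and> sc k = sc g then f (k \<odot> iv g) else 0)"
  by (simp add: has_kernel_def)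

lemma has_kernel_unique: "has_kernel f S \<Longrightarrow> has_kernel f T \<Longrightarrow> S = T"
  by (rule clinear_op_eqI) (auto intro!: Rep_ell2_cong simp: has_kernel_def)

lemma has_kernel_zero: "has_kernel (\<lambda>_. 0) 0"
  by (simp add: has_kernel_def Rep_ell2_simps)

lemma has_kernel_add: "has_kernel f S \<Longrightarrow> has_kernel g T \<Longrightarrow> has_kernel (\<lambda>x. f x + g x) (S + T)"
  by (simp add: has_kernel_def clinear_op_add blinfun.add_left Rep_ell2_simps)

lemma has_kernel_cmult: "has_kernel f S \<Longrightarrow> has_kernel (\<lambda>x. c * f x) (cmult c S)"
  by (simp add: has_kernel_def clinear_op_cmult cmult_apply Rep_ell2_simps)

text \<open>A row k has at most one non-zero entry: the only arrow of U with the range of k is l k,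
  which determines the column l(k)^{-1} k. The operator is a weighted partial permutation, and its
  norm is bounded by the supremum of f.\<close>

lemma bisection_operator:
  assumes U: "U \<subseteq> Arr" "inj_on rg U" "inj_on sc U"
    and f: "\<And>g. f g \<noteq> 0 \<Longrightarrow> g \<in> U" "\<And>g. cmod (f g) \<le> B"
  obtains T where "has_kernel f T" "norm T \<le> B"
proof -
  define l where "l k = the_inv_into U rg (rg k)" for k
  define m where "m k = (if k \<in> Arr \<and> rg k \<in> rg ` U then f (l k) else 0)" for k
  define \<sigma> where "\<sigma> k = iv (l k) \<odot> k" for k
  have B0: "0 \<le> B" using f(2) norm_ge_zero order_trans by blast
  have l: "l k \<in> U" "rg (l k) = rg k" if "rg k \<in> rg ` U" for k
    using that the_inv_into_into[OF U(2) _ subset_refl] f_the_inv_into_f[OF U(2)] by (auto simp: l_def)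
  have lA: "l k \<in> Arr" if "rg k \<in> rg ` U" for k using l(1)[OF that] U(1) by blast
  have \<sigma>: "\<sigma> k \<in> Arr" "rg (\<sigma> k) = sc (l k)" "sc (\<sigma> k) = sc k" "l k \<odot> \<sigma> k = k"
    if "k \<in> Arr" "rg k \<in> rg ` U" for k
    using that lA l by (simp_all add: \<sigma>_def)
  have "inj_on \<sigma> {k. m k \<noteq> 0}"
  proof (rule inj_onI)
    fix k k' assume kk: "k \<in> {k. m k \<noteq> 0}" "k' \<in> {k. m k \<noteq> 0}" and eq: "\<sigma> k = \<sigma> k'"
    then have k: "k \<in> Arr" "rg k \<in> rg ` U" and k': "k' \<in> Arr" "rg k' \<in> rg ` U"
      by (auto simp: m_def split: if_splits)
    have "sc (l k) = sc (l k')" using eq \<sigma>(2)[OF k] \<sigma>(2)[OF k'] by simp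
    then have "l k = l k'" using inj_onD[OF U(3)] l(1)[OF k(2)] l(1)[OF k'(2)] by blast
    then show "k = k'" using eq \<sigma>(4)[OF k] \<sigma>(4)[OF k'] by metis
  qed
  moreover have "cmod (m k) \<le> B" for k using f(2) B0 by (simp add: m_def)
  ultimately obtain T :: "'g ell2 \<Rightarrow>\<^sub>L 'g ell2" where T: "clinear_op T" "norm T \<le> B"
    "\<And>x k. Rep_ell2 (T x) k = m k * Rep_ell2 x (\<sigma> k)"
    by (rule weighted_injection_op) (rule that)
  have "Rep_ell2 (T (delta g)) k = (if g \<in> Arr \<and> k \<in> Arr \<and> sc k = sc g then f (k \<odot> iv g) else 0)" for g k
  proof (cases "g \<in> Arr \<and> k \<in> Arr \<and> sc k = sc g \<and> f (k \<odot> iv g) \<noteq> 0")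
    case True
    then have u: "k \<odot> iv g \<in> U" using f(1) by blast
    have "rg (k \<odot> iv g) = rg k" using True by simp
    with u have r: "rg k \<in> rg ` U" by (metis image_eqI)
    have lk: "l k = k \<odot> iv g"
      unfolding l_def \<open>rg (k \<odot> iv g) = rg k\<close>[symmetric] by (rule the_inv_into_f_f[OF U(2) u])
    have "k \<odot> iv g \<odot> g = k" using True by simp
    then have "\<sigma> k = g"
      unfolding \<sigma>_def lk using True cancel(1)[of "k \<odot> iv g" g] by simp
    then show ?thesis using True r by (simp add: T(3) m_def lk Rep_ell2_simps)
  next
    case False
    have "m k * (if \<sigma> k = g then 1 else 0) = 0"
    proof (rule ccontr)
      assume "\<not> ?thesis"
      then have k: "k \<in> Arr" "rg k \<in> rg ` U" and g: "\<sigma> k = g" and nz: "f (l k) \<noteq> 0"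
        by (auto simp: m_def split: if_splits)
      have "k \<odot> iv g = l k"
        using cancel(3)[OF lA[OF k(2)] \<sigma>(1)[OF k]] \<sigma>(2,4)[OF k] g by simp
      with False \<sigma>[OF k] g k nz show False by simp
    qed
    with False show ?thesis by (auto simp: T(3) Rep_ell2_simps)
  qed
  then have "has_kernel f T" using T(1) by (simp add: has_kernel_def)
  then show thesis using T(2) by (rule that)
qed

lemma cc_on_bounded:
  assumes "cc_on U f" obtains B where "\<And>g. cmod (f g) \<le> B"
proof -
  obtain K where K: "continuous_map (subtopology X U) euclidean f"
    "compactin X K" "K \<subseteq> U" "\<And>g. g \<notin> K \<Longrightarrow> f g = 0"
    using assms by (rule cc_onE) (rule that)
  have "compactin (subtopology X U) K" using K(2,3) by (simp add: compactin_subtopology)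
  then have "compact (f ` K)" using image_compactin[OF _ K(1)] by simp
  then obtain B where "\<forall>z\<in>f ` K. norm z \<le> B" using compact_imp_bounded bounded_iff by metis
  then have "cmod (f g) \<le> max B 0" for g using K(4)[of g] by (cases "g \<in> K") auto
  then show thesis by (rule that)
qed

lemma open_bisection_operator:
  assumes "open_bisection U" "\<And>g. f g \<noteq> 0 \<Longrightarrow> g \<in> U" "\<And>g. cmod (f g) \<le> B"
  obtains T where "has_kernel f T" "norm T \<le> B"
proof -
  have "U \<subseteq> Arr" "inj_on rg U" "inj_on sc U"
    using assms(1) openin_subset[of X U] by (simp_all add: open_bisection_def)
  note U = this
  from bisection_operator[of U f B, OF U assms(2,3)] that show thesis by metis
qed

lemma Cc_operator: "f \<in> Cc G \<Longrightarrow> \<exists>T. has_kernel f T"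
proof (induction rule: Cc_induct)
  case zero
  then show ?case using has_kernel_zero by blast
next
  case (add f g)
  then show ?case using has_kernel_add by blast
next
  case (bisection U f)
  obtain B where "\<And>g. cmod (f g) \<le> B" by (rule cc_on_bounded[OF bisection(2)]) (rule that)
  then have "\<And>g. cmod (f g) \<le> B" .
  from open_bisection_operator[of U f B, OF bisection(1) cc_on_subset[OF bisection(2)] this]
  show ?case by metis
qed

lemma kernel_delta:
  assumes T: "has_kernel f T" and f: "f \<in> Cc G" and g: "g \<in> Arr"
  shows "T (delta g) = (\<Sum>h | h \<in> source_fibre G (rg g) \<and> f h \<noteq> 0. cscale (f h) (delta (h \<odot> g)))"
proof (rule Rep_ell2_cong)
  fix k
  let ?S = "{h. h \<in> source_fibre G (rg g) \<and> f h \<noteq> 0}"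
  have fin: "finite ?S" using Cc_finite_source[OF f] by simp
  have S: "h \<in> Arr" "sc h = rg g" if "h \<in> ?S" for h using that by (auto simp: source_fibre_def)
  have "Rep_ell2 (\<Sum>h\<in>?S. cscale (f h) (delta (h \<odot> g))) k = (\<Sum>h\<in>?S. f h * (if k = h \<odot> g then 1 else 0))"
    by (simp add: Rep_ell2_simps)
  also have "\<dots> = (if k \<in> Arr \<and> sc k = sc g then f (k \<odot> iv g) else 0)"
  proof (cases "k \<in> Arr \<and> sc k = sc g")
    case True
    have "(\<Sum>h\<in>?S. f h * (if k = h \<odot> g then 1 else 0)) = (\<Sum>h\<in>?S. if h = k \<odot> iv g then f h else 0)"
    proof (intro sum.cong refl)
      fix h assume "h \<in> ?S"
      then have "k = h \<odot> g \<longleftrightarrow> h = k \<odot> iv g" using True S[of h] g by auto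
      then show "f h * (if k = h \<odot> g then 1 else 0) = (if h = k \<odot> iv g then f h else 0)" by simp
    qed
    also have "\<dots> = f (k \<odot> iv g)"
    proof -
      have "k \<odot> iv g \<in> source_fibre G (rg g)" using True g by (simp add: source_fibre_def)
      then show ?thesis using fin by simp
    qed
    finally show ?thesis using True by simp
  next
    case False
    have "k \<noteq> h \<odot> g" if "h \<in> ?S" for h using False S[OF that] g by auto
    then have "(\<Sum>h\<in>?S. f h * (if k = h \<odot> g then 1 else 0)) = 0" by (intro sum.neutral) auto
    then show ?thesis by (simp only: False if_False)
  qed
  finally show "Rep_ell2 (T (delta g)) k = Rep_ell2 (\<Sum>h\<in>?S. cscale (f h) (delta (h \<odot> g))) k"
    using g by (simp add: has_kernel_apply[OF T])
qed

lemma rho_eq: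
  assumes T: "has_kernel f T" and f: "f \<in> Cc G"
  shows "rho G x f = T o\<^sub>L restrict_op (source_fibre G x)"
  unfolding rho_def
proof (rule op_of_basis_eqI)
  show "clinear_op (T o\<^sub>L restrict_op (source_fibre G x))"
    by (intro clinear_op_compose has_kernel_clinear[OF T] clinear_op_restrict_op)
  show "(T o\<^sub>L restrict_op (source_fibre G x)) (delta k) = (if k \<in> source_fibre G x
     then \<Sum>h | h \<in> source_fibre G (rg k) \<and> f h \<noteq> 0. cscale (f h) (delta (h \<odot> k)) else 0)" for k
    using kernel_delta[OF T f, of k] by (simp add: restrict_op_delta source_fibre_def)
qed

lemma rho_sum_eq:
  assumes T: "has_kernel f T" and f: "f \<in> Cc G"
  shows "rho_sum G f = T"
  unfolding rho_sum_def
proof (rule op_of_basis_eqI[OF has_kernel_clinear[OF T]])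
  fix g
  show "T (delta g) = (if g \<in> Arr then rho G (sc g) f (delta g) else 0)"
  proof (cases "g \<in> Arr")
    case True
    then show ?thesis by (simp add: rho_eq[OF T f] restrict_op_delta source_fibre_def)
  next
    case False
    then show ?thesis by (intro Rep_ell2_cong) (simp add: has_kernel_apply[OF T] Rep_ell2_simps)
  qed
qed

lemma rho_sum_kernel: "f \<in> Cc G \<Longrightarrow> has_kernel f (rho_sum G f)"
  using Cc_operator rho_sum_eq by metis

lemma clinear_op_rho_sum: "f \<in> Cc G \<Longrightarrow> clinear_op (rho_sum G f)"
  by (rule has_kernel_clinear[OF rho_sum_kernel])

lemma rho_sum_zero: "rho_sum G (\<lambda>_. 0) = 0"
  by (rule rho_sum_eq[OF has_kernel_zero zero_in_Cc])

lemma rho_sum_add: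
  "f \<in> Cc G \<Longrightarrow> g \<in> Cc G \<Longrightarrow> rho_sum G (\<lambda>x. f x + g x) = rho_sum G f + rho_sum G g"
  by (intro rho_sum_eq has_kernel_add rho_sum_kernel Cc_add)

lemma rho_sum_scale: "f \<in> Cc G \<Longrightarrow> rho_sum G (\<lambda>x. c * f x) = cmult c (rho_sum G f)"
  by (intro rho_sum_eq has_kernel_cmult rho_sum_kernel Cc_scale)

lemma Cc_diff: "f \<in> Cc G \<Longrightarrow> g \<in> Cc G \<Longrightarrow> (\<lambda>x. f x - g x) \<in> Cc G"
  using Cc_add[OF _ Cc_scale[of g "-1"], of f] by simp

lemma rho_sum_diff:
  "f \<in> Cc G \<Longrightarrow> g \<in> Cc G \<Longrightarrow> rho_sum G (\<lambda>x. f x - g x) = rho_sum G f - rho_sum G g"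
  using rho_sum_add[OF _ Cc_scale[of g "-1"], of f] rho_sum_scale[of g "-1"] by simp

lemma norm_rho_sum_le:
  assumes "open_bisection U" "cc_on U f" "\<And>g. cmod (f g) \<le> B"
  shows "norm (rho_sum G f) \<le> B"
proof -
  from open_bisection_operator[of U f B, OF assms(1) cc_on_subset[OF assms(2)] assms(3)]
  obtain T where "has_kernel f T" "norm T \<le> B" by metis
  then show ?thesis using rho_sum_eq cc_on_in_Cc[OF assms(2)] by metis
qed

lemma rho_sum_conv:
  assumes f: "f \<in> Cc G" and f': "f' \<in> Cc G"
  shows "rho_sum G (conv f f') = rho_sum G f o\<^sub>L rho_sum G f'"
proof (rule rho_sum_eq[OF _ conv_Cc[OF f f']])
  note T = rho_sum_kernel[OF f] and T' = rho_sum_kernel[OF f']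
  have "Rep_ell2 (rho_sum G f (rho_sum G f' (delta g))) k =
      (if g \<in> Arr \<and> k \<in> Arr \<and> sc k = sc g then conv f f' (k \<odot> iv g) else 0)" for g k
  proof (cases "g \<in> Arr")
    case True
    let ?S = "{h. h \<in> source_fibre G (rg g) \<and> f' h \<noteq> 0}"
    have S: "h \<in> Arr" "sc h = rg g" if "h \<in> ?S" for h using that by (auto simp: source_fibre_def)
    have "Rep_ell2 (rho_sum G f (rho_sum G f' (delta g))) k
        = (\<Sum>h\<in>?S. f' h * Rep_ell2 (rho_sum G f (delta (h \<odot> g))) k)"
      unfolding kernel_delta[OF T' f' True]
      by (simp add: blinfun.sum_right clinear_op_cscale[OF clinear_op_rho_sum[OF f]] Rep_ell2_simps)
    also have "\<dots> = (\<Sum>h\<in>?S. if k \<in> Arr \<and> sc k = sc g then f (k \<odot> iv g \<odot> iv h) * f' h else 0)"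
    proof (intro sum.cong refl)
      fix h assume "h \<in> ?S"
      note S = S[OF this]
      have "k \<odot> iv g \<odot> iv h = k \<odot> iv (h \<odot> g)" if "k \<in> Arr" "sc k = sc g"
        using that S True mult_assoc[of k "iv g" "iv h"] by simp
      then show "f' h * Rep_ell2 (rho_sum G f (delta (h \<odot> g))) k =
          (if k \<in> Arr \<and> sc k = sc g then f (k \<odot> iv g \<odot> iv h) * f' h else 0)"
        using S True by (simp add: has_kernel_apply[OF T])
    qed
    also have "\<dots> = (if k \<in> Arr \<and> sc k = sc g then conv f f' (k \<odot> iv g) else 0)"
    proof (cases "k \<in> Arr \<and> sc k = sc g")
      case T': True
      then have "k \<odot> iv g \<in> Arr" "sc (k \<odot> iv g) = rg g" using True by simp_all
      then show ?thesis by (simp only: T' if_True conv_def simp_thms)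
    next
      case False
      show ?thesis by (simp only: False if_False sum.neutral_const)
    qed
    finally show ?thesis using True by simp
  next
    case False
    then have "rho_sum G f' (delta g) = 0"
      by (intro Rep_ell2_cong) (simp add: has_kernel_apply[OF T'] Rep_ell2_simps)
    then show ?thesis using False by (simp add: Rep_ell2_simps)
  qed
  then show "has_kernel (conv f f') (rho_sum G f o\<^sub>L rho_sum G f')"
    unfolding has_kernel_def by (simp add: clinear_op_compose clinear_op_rho_sum f f')
qed

lemma adjoint_rho_sum:
  assumes f: "f \<in> Cc G" shows "adjoint_pair (rho_sum G f) (rho_sum G (star f))"
proof (rule adjoint_pair_basisI)
  show "Rep_ell2 (rho_sum G f (delta j)) k = cnj (Rep_ell2 (rho_sum G (star f) (delta k)) j)" for j k
    by (simp add: has_kernel_apply[OF rho_sum_kernel[OF f]] star_def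
        has_kernel_apply[OF rho_sum_kernel[OF star_Cc[OF f]]])
qed (simp_all add: clinear_op_rho_sum f star_Cc)

text \<open>The entry at (k, g) is the value at k g^{-1}, whose range is that of k and whose source
  is the range of g. Restricting both ranges to N therefore keeps the arrows with both ends in
  N.\<close>

lemma kernel_compress:
  assumes T: "has_kernel f T"
  shows "has_kernel (\<lambda>g. if rg g \<in> N \<and> sc g \<in> N then f g else 0)
    (restrict_op {k \<in> Arr. rg k \<in> N} o\<^sub>L T o\<^sub>L restrict_op {k \<in> Arr. rg k \<in> N})"
  unfolding has_kernel_def
proof (intro conjI allI)
  show "clinear_op (restrict_op {k \<in> Arr. rg k \<in> N} o\<^sub>L T o\<^sub>L restrict_op {k \<in> Arr. rg k \<in> N})"
    by (intro clinear_op_compose clinear_op_restrict_op has_kernel_clinear[OF T])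
qed (auto simp: restrict_op_delta Rep_restrict_op has_kernel_apply[OF T] Rep_ell2_simps)

subsection \<open>Limits of compactly supported functions\<close>

abbreviation "\<A> \<equiv> reduced_Cstar G"

lemma reduced_Cstar_sequence:
  assumes "a \<in> \<A>"
  obtains f where "\<And>n. f n \<in> Cc G" "(\<lambda>n. rho_sum G (f n)) \<longlonglongrightarrow> a"
proof -
  obtain T where T: "\<And>n. T n \<in> rho_sum G ` Cc G" "T \<longlonglongrightarrow> a"
    using assms unfolding reduced_Cstar_def by (rule closure_sequenceE) (rule that)
  from T(1) have "\<forall>n. \<exists>f. f \<in> Cc G \<and> T n = rho_sum G f" by auto
  from choice[OF this] obtain f where f: "\<forall>n. f n \<in> Cc G \<and> T n = rho_sum G (f n)" ..
  then have "T = (\<lambda>n. rho_sum G (f n))" by auto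
  then show thesis using that[of f] f T(2) by simp
qed

lemma reduced_Cstar_limit:
  assumes "\<And>n. f n \<in> Cc G" "(\<lambda>n. rho_sum G (f n)) \<longlonglongrightarrow> a" shows "a \<in> \<A>"
  unfolding reduced_Cstar_def closure_sequential
  using assms by (intro exI[of _ "\<lambda>n. rho_sum G (f n)"]) auto

lemma rho_sum_in_reduced: "f \<in> Cc G \<Longrightarrow> rho_sum G f \<in> \<A>"
  unfolding reduced_Cstar_def by (rule subsetD[OF closure_subset imageI])

lemma reduced_Cstar_approx:
  assumes "a \<in> \<A>" "0 < e" obtains f where "f \<in> Cc G" "norm (a - rho_sum G f) < e"
proof -
  obtain T where "T \<in> rho_sum G ` Cc G" "dist T a < e"
    using assms unfolding reduced_Cstar_def closure_approachable by blast
  then show thesis using that by (auto simp: dist_norm norm_minus_commute)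
qed

lemma reduced_Cstar_clinear: "a \<in> \<A> \<Longrightarrow> clinear_op a"
proof -
  assume "a \<in> \<A>"
  then obtain f where f: "\<And>n. f n \<in> Cc G" "(\<lambda>n. rho_sum G (f n)) \<longlonglongrightarrow> a"
    by (rule reduced_Cstar_sequence) (rule that)
  show ?thesis by (rule clinear_op_limit[OF clinear_op_rho_sum[OF f(1)] f(2)])
qed

lemma reduced_Cstar_add: "a \<in> \<A> \<Longrightarrow> b \<in> \<A> \<Longrightarrow> a + b \<in> \<A>"
proof -
  assume "a \<in> \<A>" "b \<in> \<A>"
  obtain f where f: "\<And>n. f n \<in> Cc G" "(\<lambda>n. rho_sum G (f n)) \<longlonglongrightarrow> a"
    by (rule reduced_Cstar_sequence[OF \<open>a \<in> \<A>\<close>]) (rule that)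
  obtain g where g: "\<And>n. g n \<in> Cc G" "(\<lambda>n. rho_sum G (g n)) \<longlonglongrightarrow> b"
    by (rule reduced_Cstar_sequence[OF \<open>b \<in> \<A>\<close>]) (rule that)
  show ?thesis
    by (rule reduced_Cstar_limit[of "\<lambda>n x. f n x + g n x"])
      (use tendsto_add[OF f(2) g(2)] f(1) g(1) in \<open>simp_all add: Cc_add rho_sum_add\<close>)
qed

lemma tendsto_cmult:
  assumes "T \<longlonglongrightarrow> a" shows "(\<lambda>n. cmult c (T n)) \<longlonglongrightarrow> cmult c a"
proof (rule LIM_zero_cancel, rule Lim_null_comparison)
  show "\<forall>\<^sub>F n in sequentially. norm (cmult c (T n) - cmult c a) \<le> cmod c * norm (T n - a)"
    unfolding cmult_diff[symmetric] by (intro always_eventually allI norm_cmult_le)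
  show "(\<lambda>n. cmod c * norm (T n - a)) \<longlonglongrightarrow> 0"
    using tendsto_mult_right_zero[OF tendsto_norm_zero[OF LIM_zero[OF assms]]] .
qed

lemma reduced_Cstar_cmult: "a \<in> \<A> \<Longrightarrow> cmult c a \<in> \<A>"
proof -
  assume "a \<in> \<A>"
  then obtain f where f: "\<And>n. f n \<in> Cc G" "(\<lambda>n. rho_sum G (f n)) \<longlonglongrightarrow> a"
    by (rule reduced_Cstar_sequence) (rule that)
  show ?thesis
    by (rule reduced_Cstar_limit[of "\<lambda>n x. c * f n x"])
      (use tendsto_cmult[OF f(2)] f(1) in \<open>simp_all add: Cc_scale rho_sum_scale\<close>)
qed

lemma tendsto_blinfun_compose:
  fixes S :: "nat \<Rightarrow> 'b::real_normed_vector \<Rightarrow>\<^sub>L 'c::real_normed_vector"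
    and T :: "nat \<Rightarrow> 'a::real_normed_vector \<Rightarrow>\<^sub>L 'b"
  assumes "S \<longlonglongrightarrow> a" "T \<longlonglongrightarrow> b" shows "(\<lambda>n. S n o\<^sub>L T n) \<longlonglongrightarrow> (a o\<^sub>L b)"
  by (rule bounded_bilinear.tendsto[OF bounded_bilinear_blinfun_compose assms])

lemma reduced_Cstar_compose: "a \<in> \<A> \<Longrightarrow> b \<in> \<A> \<Longrightarrow> a o\<^sub>L b \<in> \<A>"
proof -
  assume "a \<in> \<A>" "b \<in> \<A>"
  obtain f where f: "\<And>n. f n \<in> Cc G" "(\<lambda>n. rho_sum G (f n)) \<longlonglongrightarrow> a"
    by (rule reduced_Cstar_sequence[OF \<open>a \<in> \<A>\<close>]) (rule that)
  obtain g where g: "\<And>n. g n \<in> Cc G" "(\<lambda>n. rho_sum G (g n)) \<longlonglongrightarrow> b"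
    by (rule reduced_Cstar_sequence[OF \<open>b \<in> \<A>\<close>]) (rule that)
  show ?thesis
    by (rule reduced_Cstar_limit[of "\<lambda>n. conv (f n) (g n)"])
      (use tendsto_blinfun_compose[OF f(2) g(2)] f(1) g(1) in \<open>simp_all add: conv_Cc rho_sum_conv\<close>)
qed

lemma reduced_Cstar_support:
  assumes a: "a \<in> \<A>" and nz: "Rep_ell2 (a (delta g)) k \<noteq> 0"
  shows "g \<in> Arr" "k \<in> Arr" "sc k = sc g"
proof -
  obtain f where f: "\<And>n. f n \<in> Cc G" "(\<lambda>n. rho_sum G (f n)) \<longlonglongrightarrow> a"
    by (rule reduced_Cstar_sequence[OF a]) (rule that)
  have "(\<lambda>n. Rep_ell2 (rho_sum G (f n) (delta g)) k) \<longlonglongrightarrow> Rep_ell2 (a (delta g)) k"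
    by (rule tendsto_Rep_ell2[OF blinfun_lim_apply[OF f(2)]])
  then have "g \<in> Arr \<and> k \<in> Arr \<and> sc k = sc g"
  proof (rule contrapos_pp)
    assume "\<not> (g \<in> Arr \<and> k \<in> Arr \<and> sc k = sc g)"
    then have "Rep_ell2 (rho_sum G (f n) (delta g)) k = 0" for n
      using has_kernel_apply[OF rho_sum_kernel[OF f(1)]] by auto
    then show "\<not> (\<lambda>n. Rep_ell2 (rho_sum G (f n) (delta g)) k) \<longlonglongrightarrow> Rep_ell2 (a (delta g)) k"
      using nz by (simp add: LIMSEQ_const_iff)
  qed
  then show "g \<in> Arr" "k \<in> Arr" "sc k = sc g" by auto
qed

lemma rho_ext_unit:
  assumes a: "a \<in> \<A>" and x: "x \<in> Obj"
  shows "rho_ext G x a (delta x) = a (delta x)"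
proof -
  have "rho_ext G x a = a o\<^sub>L restrict_op (source_fibre G x)"
    unfolding rho_ext_def
  proof (rule op_of_basis_eqI)
    show "clinear_op (a o\<^sub>L restrict_op (source_fibre G x))"
      by (intro clinear_op_compose reduced_Cstar_clinear[OF a] clinear_op_restrict_op)
  qed (simp add: restrict_op_delta)
  then show ?thesis using x by (simp add: restrict_op_delta source_fibre_def)
qed

text \<open>Reads the function off its operator. The same coordinates, taken for a limit of such
  operators, serve as its values on arrows.\<close>

lemma rho_sum_delta_unit:
  assumes "f \<in> Cc G" "g \<in> Arr"
  shows "Rep_ell2 (rho_sum G f (delta (sc g))) g = f g"
  using assms unit_inv[of "sc g"] by (simp add: has_kernel_apply[OF rho_sum_kernel])

definition bump :: "'g \<Rightarrow> 'g \<Rightarrow> complex" where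
  "bump g = (SOME u. u g = 1 \<and> (\<exists>U. open_bisection U \<and> g \<in> U \<and> cc_on U u))"

lemma bump:
  assumes "g \<in> Arr"
  shows "bump g g = 1" "\<exists>U. open_bisection U \<and> g \<in> U \<and> cc_on U (bump g)"
proof -
  have "openin X Arr" using openin_topspace[of X] by simp
  then obtain U u N where "open_bisection U" "g \<in> U" "cc_on U u" "g \<in> N" "\<And>h. h \<in> N \<Longrightarrow> u h = 1"
    using assms by (rule arrow_bump) (rule that)
  then have "\<exists>u. u g = 1 \<and> (\<exists>U. open_bisection U \<and> g \<in> U \<and> cc_on U u)" by blast
  from someI_ex[OF this] show "bump g g = 1" "\<exists>U. open_bisection U \<and> g \<in> U \<and> cc_on U (bump g)"
    unfolding bump_def by blast+
qed

lemma bump_Cc: "g \<in> Arr \<Longrightarrow> bump g \<in> Cc G"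
  using bump(2) cc_on_in_Cc by blast

text \<open>The carrier of \<open>bump g\<close> is a bisection, so g is its only arrow with the
  source of g, and likewise for the range. Sums of bump functions can therefore interpolate
  prescribed values on a fibre.\<close>

lemma bump_source:
  assumes "g \<in> Arr" "sc h = sc g \<or> rg h = rg g"
  shows "bump g h = (if h = g then 1 else 0)"
proof (cases "bump g h = 0")
  case True
  then show ?thesis using bump(1)[OF assms(1)] by auto
next
  case False
  obtain U where U: "open_bisection U" "g \<in> U" "cc_on U (bump g)" using bump(2)[OF assms(1)] by blast
  have "h \<in> U" using cc_on_subset[OF U(3) False] .
  then have "h = g" using U(1,2) assms(2) by (auto simp: open_bisection_def inj_on_def)
  then show ?thesis using bump(1)[OF assms(1)] by simp
qed

subsection \<open>Compression to isotropy groups\<close>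

abbreviation "\<Gamma> x \<equiv> carrier (isotropy G x)"

lemma isotropy_iff: "g \<in> \<Gamma> x \<longleftrightarrow> g \<in> Arr \<and> sc g = x \<and> rg g = x"
  by (auto simp: isotropy_def source_fibre_def range_fibre_def)

lemma isotropyD: "g \<in> \<Gamma> x \<Longrightarrow> g \<in> Arr" "g \<in> \<Gamma> x \<Longrightarrow> sc g = x" "g \<in> \<Gamma> x \<Longrightarrow> rg g = x"
  by (simp_all add: isotropy_iff)

lemma isotropy_mult [simp]: "mult (isotropy G x) = gmul G"
  by (simp add: isotropy_def)

lemma isotropy_one: "x \<in> Obj \<Longrightarrow> x \<in> \<Gamma> x"
  by (simp add: isotropy_iff)

lemma isotropy_closed: "g \<in> \<Gamma> x \<Longrightarrow> h \<in> \<Gamma> x \<Longrightarrow> g \<odot> h \<in> \<Gamma> x" "g \<in> \<Gamma> x \<Longrightarrow> iv g \<in> \<Gamma> x"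
  by (simp_all add: isotropy_iff)

lemma group_algebra_eq: "group_algebra (isotropy G x) = finitely_supported (\<Gamma> x)"
  by (simp add: group_algebra_def finitely_supported_def)

lemma Cc_restrict_isotropy:
  assumes "f \<in> Cc G"
  shows "(\<lambda>g. if g \<in> \<Gamma> x then f g else 0) \<in> finitely_supported (\<Gamma> x)"
proof -
  have "{g. (if g \<in> \<Gamma> x then f g else 0) \<noteq> 0} \<subseteq> {h \<in> source_fibre G x. f h \<noteq> 0}"
    by (auto simp: isotropy_iff source_fibre_def)
  then have "finite {g. (if g \<in> \<Gamma> x then f g else 0) \<noteq> 0}"
    by (rule finite_subset) (rule Cc_finite_source[OF assms])
  then show ?thesis by (auto simp: finitely_supported_def)
qed

definition compress :: "'g \<Rightarrow> ('g ell2 \<Rightarrow>\<^sub>L 'g ell2) \<Rightarrow> ('g ell2 \<Rightarrow>\<^sub>L 'g ell2)" where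
  "compress x a = restrict_op (\<Gamma> x) o\<^sub>L a o\<^sub>L restrict_op (\<Gamma> x)"

lemma compress_simps:
  "compress x (a + b) = compress x a + compress x b"
  "compress x (a - b) = compress x a - compress x b"
  "compress x (cmult c a) = cmult c (compress x a)" "compress x 0 = 0"
  by (rule blinfun_eqI; simp add: compress_def blinfun.add_left blinfun.diff_left blinfun.add_right
      blinfun.diff_right cmult_apply clinear_op_cscale[OF clinear_op_restrict_op])+

lemma norm_compress: "norm (compress x a) \<le> norm a"
  unfolding compress_def by (rule norm_compress_le)

lemma clinear_op_compress: "clinear_op a \<Longrightarrow> clinear_op (compress x a)"
  unfolding compress_def by (intro clinear_op_compose clinear_op_restrict_op)

lemma Rep_compress_delta:
  "Rep_ell2 (compress x a (delta g)) k = (if g \<in> \<Gamma> x \<and> k \<in> \<Gamma> x then Rep_ell2 (a (delta g)) k else 0)"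
  by (simp add: compress_def restrict_op_delta Rep_restrict_op Rep_ell2_simps)

lemma left_regular_eq:
  assumes "c \<in> finitely_supported (\<Gamma> x)" "clinear_op T"
    and T: "\<And>g k. Rep_ell2 (T (delta g)) k = (if g \<in> \<Gamma> x \<and> k \<in> \<Gamma> x then c (k \<odot> iv g) else 0)"
  shows "left_regular (isotropy G x) c = T"
  unfolding left_regular_def
proof (rule op_of_basis_eqI[OF assms(2)])
  fix g
  show "T (delta g) = (if g \<in> \<Gamma> x
     then \<Sum>\<gamma> | c \<gamma> \<noteq> 0. cscale (c \<gamma>) (delta (\<gamma> \<otimes>\<^bsub>isotropy G x\<^esub> g)) else 0)"
  proof (cases "g \<in> \<Gamma> x")
    case True
    have fin: "finite {\<gamma>. c \<gamma> \<noteq> 0}" and sub: "{\<gamma>. c \<gamma> \<noteq> 0} \<subseteq> \<Gamma> x"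
      using assms(1) by (simp_all add: finitely_supported_def)
    have "Rep_ell2 (\<Sum>\<gamma> | c \<gamma> \<noteq> 0. cscale (c \<gamma>) (delta (\<gamma> \<odot> g))) k
        = (if k \<in> \<Gamma> x then c (k \<odot> iv g) else 0)" for k
    proof -
      have "Rep_ell2 (\<Sum>\<gamma> | c \<gamma> \<noteq> 0. cscale (c \<gamma>) (delta (\<gamma> \<odot> g))) k
          = (\<Sum>\<gamma> | c \<gamma> \<noteq> 0. c \<gamma> * (if k = \<gamma> \<odot> g then 1 else 0))"
        by (simp add: Rep_ell2_simps)
      also have "\<dots> = (\<Sum>\<gamma> | c \<gamma> \<noteq> 0. if \<gamma> = k \<odot> iv g then if k \<in> \<Gamma> x then c \<gamma> else 0 else 0)"
      proof (intro sum.cong refl)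
        fix \<gamma> assume "\<gamma> \<in> {\<gamma>. c \<gamma> \<noteq> 0}"
        then have \<gamma>: "\<gamma> \<in> \<Gamma> x" using sub by blast
        show "c \<gamma> * (if k = \<gamma> \<odot> g then 1 else 0) = (if \<gamma> = k \<odot> iv g then if k \<in> \<Gamma> x then c \<gamma> else 0 else 0)"
        proof (cases "k \<in> \<Gamma> x")
          case True
          then have "k = \<gamma> \<odot> g \<longleftrightarrow> \<gamma> = k \<odot> iv g"
          proof -
            have "\<gamma> \<odot> g \<odot> iv g = \<gamma>" "k \<odot> iv g \<odot> g = k"
              using \<gamma> \<open>g \<in> \<Gamma> x\<close> True by (simp_all add: isotropyD)
            then show ?thesis by metis
          qed
          then show ?thesis using True by simp
        next
          case False
          then have "k \<noteq> \<gamma> \<odot> g" using isotropy_closed(1)[OF \<gamma> \<open>g \<in> \<Gamma> x\<close>] by blast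
          then show ?thesis using False by simp
        qed
      qed
      also have "\<dots> = (if k \<in> \<Gamma> x then c (k \<odot> iv g) else 0)"
        using fin by simp
      finally show ?thesis .
    qed
    then show ?thesis using True by (intro Rep_ell2_cong) (simp add: T)
  next
    case False
    then show ?thesis by (intro Rep_ell2_cong) (simp add: T Rep_ell2_simps)
  qed
qed

text \<open>For g and k in the isotropy group, k g^{-1} is in it as well; the matrix of the
  compression sees only the restriction of f.\<close>

lemma compress_rho_sum:
  assumes f: "f \<in> Cc G"
  shows "left_regular (isotropy G x) (\<lambda>g. if g \<in> \<Gamma> x then f g else 0) = compress x (rho_sum G f)"
proof (rule left_regular_eq[OF Cc_restrict_isotropy[OF f] clinear_op_compress[OF clinear_op_rho_sum[OF f]]])
  show "Rep_ell2 (compress x (rho_sum G f) (delta g)) k =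
      (if g \<in> \<Gamma> x \<and> k \<in> \<Gamma> x then if k \<odot> iv g \<in> \<Gamma> x then f (k \<odot> iv g) else 0 else 0)" for g k
  proof (cases "g \<in> \<Gamma> x \<and> k \<in> \<Gamma> x")
    case True
    then have "sc k = sc g" "k \<odot> iv g \<in> \<Gamma> x" "g \<in> Arr" "k \<in> Arr"
      using isotropyD(1)[of k x] isotropyD(1)[of g x] isotropyD(2)[of k x] isotropyD(2)[of g x] by (auto simp: isotropy_closed)
    with True show ?thesis
      by (simp add: Rep_compress_delta has_kernel_apply[OF rho_sum_kernel[OF f]] isotropyD)
  next
    case False
    then show ?thesis by (simp only: Rep_compress_delta if_False)
  qed
qed

text \<open>Each support point contributes a multiple of its bump function; on the source fibre at x
  no other bump function is non-zero there.\<close>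

lemma finitely_supported_extend:
  assumes "c \<in> finitely_supported (source_fibre G x)"
  obtains f where "f \<in> Cc G" "\<And>g. g \<in> source_fibre G x \<Longrightarrow> f g = c g"
proof -
  let ?S = "{g. c g \<noteq> 0}"
  have fin: "finite ?S" and sub: "?S \<subseteq> source_fibre G x" using assms by (auto simp: finitely_supported_def)
  have SA: "g \<in> Arr" "sc g = x" if "g \<in> ?S" for g using that sub by (auto simp: source_fibre_def)
  have "(\<lambda>h. \<Sum>g\<in>T. c g * bump g h) \<in> Cc G" if "T \<subseteq> ?S" for T
    using finite_subset[OF that fin] that
  proof (induction T rule: finite_induct)
    case (insert g T)
    then show ?case using SA by (simp add: Cc_add Cc_scale bump_Cc)
  qed (simp add: zero_in_Cc)
  then have "(\<lambda>h. \<Sum>g\<in>?S. c g * bump g h) \<in> Cc G" by blast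
  moreover have "(\<Sum>g\<in>?S. c g * bump g h) = c h" if h: "h \<in> source_fibre G x" for h
  proof -
    have "(\<Sum>g\<in>?S. c g * bump g h) = (\<Sum>g\<in>?S. if g = h then c g else 0)"
    proof (intro sum.cong refl)
      fix g assume "g \<in> ?S"
      then have "bump g h = (if h = g then 1 else 0)"
        using SA h by (intro bump_source) (auto simp: source_fibre_def)
      then show "c g * bump g h = (if g = h then c g else 0)" by auto
    qed
    then show ?thesis using fin by simp
  qed
  ultimately show thesis by (rule that)
qed

end

section \<open>The singular ideal\<close>

lemma nowhere_dense_in_subset:
  "nowhere_dense_in Y S \<Longrightarrow> T \<subseteq> S \<Longrightarrow> nowhere_dense_in Y T"
proof -
  assume S: "nowhere_dense_in Y S" and "T \<subseteq> S"
  have "Y interior_of (Y closure_of T) \<subseteq> Y interior_of (Y closure_of S)"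
    by (intro interior_of_mono closure_of_mono \<open>T \<subseteq> S\<close>)
  then show ?thesis using S \<open>T \<subseteq> S\<close> by (auto simp: nowhere_dense_in_def)
qed

context etale_groupoid
begin

section \<open>Discontinuities of compactly supported functions\<close>

definition cont_at :: "('g \<Rightarrow> complex) \<Rightarrow> 'g \<Rightarrow> bool" where
  "cont_at f g \<longleftrightarrow> (\<forall>e>0. \<exists>N. openin X N \<and> g \<in> N \<and> (\<forall>h\<in>N. cmod (f h - f g) < e))"

definition disc :: "('g \<Rightarrow> complex) \<Rightarrow> 'g set" where
  "disc f = {g \<in> Arr. \<not> cont_at f g}"

lemma cont_atE:
  assumes "cont_at f g" "0 < e"
  obtains N where "openin X N" "g \<in> N" "\<And>h. h \<in> N \<Longrightarrow> cmod (f h - f g) < e"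
proof -
  from assms obtain N where "openin X N \<and> g \<in> N \<and> (\<forall>h\<in>N. cmod (f h - f g) < e)"
    unfolding cont_at_def by (elim allE impE exE) (assumption, rule that)
  then show thesis by (intro that[of N]) simp_all
qed

lemma cont_at_const: "g \<in> Arr \<Longrightarrow> cont_at (\<lambda>_. c) g"
  unfolding cont_at_def using openin_topspace[of X] by (intro allI impI exI[of _ Arr]) simp

lemma closure_of_meets:
  "x \<in> Y closure_of S \<Longrightarrow> openin Y V \<Longrightarrow> x \<in> V \<Longrightarrow> \<exists>y\<in>S. y \<in> V"
  by (auto simp: in_closure_of)

lemma disc_add: "disc (\<lambda>x. f x + f' x) \<subseteq> disc f \<union> disc f'"
proof
  fix g assume g: "g \<in> disc (\<lambda>x. f x + f' x)"
  then have gA: "g \<in> Arr" and n: "\<not> cont_at (\<lambda>x. f x + f' x) g" by (simp_all add: disc_def)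
  have "cont_at (\<lambda>x. f x + f' x) g" if c: "cont_at f g" "cont_at f' g"
    unfolding cont_at_def
  proof (intro allI impI)
    fix e :: real assume e: "0 < e"
    then have e2: "0 < e / 2" by simp
    obtain N where N: "openin X N" "g \<in> N" "\<And>h. h \<in> N \<Longrightarrow> cmod (f h - f g) < e / 2"
      by (rule cont_atE[OF c(1) e2]) (rule that)
    obtain N' where N': "openin X N'" "g \<in> N'" "\<And>h. h \<in> N' \<Longrightarrow> cmod (f' h - f' g) < e / 2"
      by (rule cont_atE[OF c(2) e2]) (rule that)
    have *: "cmod (f h + f' h - (f g + f' g)) < e" if "h \<in> N \<inter> N'" for h
      using norm_diff_triangle_ineq[of "f h" "f' h" "f g" "f' g"] N(3)[of h] N'(3)[of h] that by simp
    show "\<exists>N. openin X N \<and> g \<in> N \<and> (\<forall>h\<in>N. cmod (f h + f' h - (f g + f' g)) < e)"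
      by (intro exI[of _ "N \<inter> N'"] conjI openin_Int N(1,2) N'(1,2) IntI ballI) (rule *)
  qed
  with n gA show "g \<in> disc f \<union> disc f'" by (auto simp: disc_def)
qed

lemma continuous_not_disc:
  assumes "openin X U" "continuous_map (subtopology X U) euclidean f" "g \<in> U"
  shows "g \<notin> disc f"
proof -
  have UA: "U \<subseteq> Arr" using openin_subset[OF assms(1)] by simp
  have "\<exists>N. openin X N \<and> g \<in> N \<and> (\<forall>h\<in>N. cmod (f h - f g) < e)" if "0 < e" for e
  proof -
    have "openin (subtopology X U) {h \<in> topspace (subtopology X U). f h \<in> ball (f g) e}"
      by (rule openin_continuous_map_preimage[OF assms(2)]) simp
    then have "openin X {h \<in> U. f h \<in> ball (f g) e}"
      using UA openin_open_subtopology[OF assms(1)] by (simp add: inf.absorb2)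
    then show ?thesis
      using assms(3) that by (intro exI[of _ "{h \<in> U. f h \<in> ball (f g) e}"]) (auto simp: dist_norm norm_minus_commute)
  qed
  then have "cont_at f g" unfolding cont_at_def by blast
  then show ?thesis by (simp add: disc_def)
qed

text \<open>On U the function is continuous and off the closure of U it vanishes locally. At a
  frontier point it may jump, since the extension by zero need not be continuous in a groupoid that
  is not Hausdorff.\<close>

lemma cc_on_disc:
  assumes "cc_on U f" shows "disc f \<subseteq> X closure_of U - U"
proof
  fix g assume g: "g \<in> disc f"
  then have gA: "g \<in> Arr" by (simp add: disc_def)
  have U: "openin X U" "continuous_map (subtopology X U) euclidean f" using assms by (auto simp: cc_on_def)
  have "g \<notin> U" using continuous_not_disc[OF U] g by blast
  moreover have "g \<in> X closure_of U"
  proof (rule ccontr)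
    assume g': "g \<notin> X closure_of U"
    let ?N = "Arr - X closure_of U"
    have o: "openin X ?N" using openin_diff[OF openin_topspace closedin_closure_of, of X U] by simp
    have "f h = 0" if "h \<in> ?N" for h
      using that cc_on_subset[OF assms, of h] closure_of_subset[of U X] openin_subset[OF U(1)] by blast
    then have "\<exists>N. openin X N \<and> g \<in> N \<and> (\<forall>h\<in>N. cmod (f h - f g) < e)" if "0 < e" for e
      using that o g' gA by (intro exI[of _ ?N]) simp
    then have "cont_at f g" unfolding cont_at_def by blast
    then show False using g by (simp add: disc_def)
  qed
  ultimately show "g \<in> X closure_of U - U" by blast
qed

lemma disc_Hausdorff:
  assumes "Hausdorff_space X" "f \<in> Cc G" shows "disc f = {}"
  using assms(2)
proof (induction rule: Cc_induct)
  case zero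
  show ?case by (auto simp: disc_def cont_at_const)
next
  case (add f g)
  then show ?case using disc_add[of f g] by simp
next
  case (bisection U f)
  have A: "openin X Arr" using openin_topspace[of X] by simp
  have "cc_on Arr f"
    by (rule cc_on_enlarge[OF bisection(2)])
      (use openin_subset[of X U] bisection(1) A assms(1) subtopology_topspace[of X] in \<open>auto simp: open_bisection_def\<close>)
  then have "g \<notin> disc f" if "g \<in> Arr" for g
    using continuous_not_disc[OF A _ that] by (simp add: cc_on_def)
  then show ?case by (auto simp: disc_def)
qed

text \<open>The source map is injective and open on W. An open set V inside the closure of the image
  would contain the source of an arrow of W in U; near it lies the source of a frontier arrow of W,
  and by injectivity that arrow would be in U as well as outside it.\<close>

lemma frontier_nowhere_dense:
  assumes W: "open_bisection W" and U: "openin X U"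
  shows "nowhere_dense_in (unit_space G) (sc ` (W \<inter> (X closure_of U - U)))"
proof -
  let ?S = "sc ` (W \<inter> (X closure_of U - U))" and ?Y = "unit_space G"
  have Wo: "openin X W" and inj: "inj_on sc W" using W by (simp_all add: open_bisection_def)
  have WA: "g \<in> Arr" if "g \<in> W" for g using openin_arrow[OF Wo that] .
  have "False" if O: "openin ?Y V" "V \<subseteq> ?Y closure_of ?S" "x \<in> V" for V x
  proof -
    have VX: "openin X V" using O(1) by (simp add: openin_unit_space)
    have "x \<in> ?Y closure_of ?S" using O by blast
    then obtain y where y: "y \<in> ?S" "y \<in> V" using closure_of_meets[OF _ O(1,3)] by blast
    then obtain g where g: "g \<in> W" "g \<in> X closure_of U" "y = sc g" by blast
    let ?T = "W \<inter> {h \<in> Arr. sc h \<in> V}"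
    have To: "openin X ?T" by (intro openin_Int Wo openin_source_preimage VX)
    have gT: "g \<in> ?T" using g y WA by simp
    obtain b where b: "b \<in> U" "b \<in> ?T"
      using closure_of_meets[OF g(2) To gT] by (elim bexE) (rule that)
    have "openin X (sc ` (?T \<inter> U))" by (intro open_source openin_Int To U)
    then have o: "openin ?Y (sc ` (?T \<inter> U))" using WA by (auto simp: openin_unit_space)
    have 1: "sc b \<in> ?Y closure_of ?S" using b O(2) by blast
    have 2: "sc b \<in> sc ` (?T \<inter> U)" by (intro imageI IntI b)
    obtain z where z: "z \<in> ?S" "z \<in> sc ` (?T \<inter> U)"
      using closure_of_meets[OF 1 o 2] by (elim bexE) (rule that)
    obtain g' where g': "g' \<in> W" "g' \<notin> U" "z = sc g'" using z(1) by blast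
    obtain b' where b': "b' \<in> W" "b' \<in> U" "z = sc b'" using z(2) by blast
    have "g' = b'" using inj_onD[OF inj _ g'(1) b'(1)] g'(3) b'(3) by simp
    then show False using g'(2) b'(2) by simp
  qed
  then have "?Y interior_of (?Y closure_of ?S) = {}"
    unfolding interior_of_def by blast
  moreover have "?S \<subseteq> topspace ?Y" using WA by auto
  ultimately show ?thesis by (simp add: nowhere_dense_in_def)
qed

lemma disc_nowhere_dense:
  assumes W: "open_bisection W" and f: "f \<in> Cc G"
  shows "\<exists>\<N>. finite \<N> \<and> (\<forall>N\<in>\<N>. nowhere_dense_in (unit_space G) N) \<and> sc ` (W \<inter> disc f) \<subseteq> \<Union>\<N>"
  using f
proof (induction rule: Cc_induct)
  case zero
  have "disc (\<lambda>_. 0) = {}" by (auto simp: disc_def cont_at_const)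
  then show ?case by (intro exI[of _ "{}"]) simp
next
  case (add f g)
  obtain \<M> \<N> where "finite \<M>" "\<forall>N\<in>\<M>. nowhere_dense_in (unit_space G) N" "sc ` (W \<inter> disc f) \<subseteq> \<Union>\<M>"
    "finite \<N>" "\<forall>N\<in>\<N>. nowhere_dense_in (unit_space G) N" "sc ` (W \<inter> disc g) \<subseteq> \<Union>\<N>"
    using add(3,4) by (elim exE conjE) (rule that)
  note MN = this
  have "sc ` (W \<inter> disc (\<lambda>x. f x + g x)) \<subseteq> sc ` (W \<inter> disc f) \<union> sc ` (W \<inter> disc g)"
    using disc_add[of f g] by blast
  also have "\<dots> \<subseteq> \<Union>(\<M> \<union> \<N>)"
    unfolding Union_Un_distrib by (intro Un_mono MN)
  finally show ?case
    by (intro exI[of _ "\<M> \<union> \<N>"] conjI ballI) (use MN(1,2,4,5) in auto)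
next
  case (bisection U f)
  have "openin X U" using bisection(1) by (simp add: open_bisection_def)
  note nd = frontier_nowhere_dense[OF W this]
  have "W \<inter> disc f \<subseteq> W \<inter> (X closure_of U - U)" using cc_on_disc[OF bisection(2)] by blast
  then have "sc ` (W \<inter> disc f) \<subseteq> \<Union>{sc ` (W \<inter> (X closure_of U - U))}" by (simp add: image_mono)
  with nd show ?case
    by (intro exI[of _ "{sc ` (W \<inter> (X closure_of U - U))}"]) simp
qed

text \<open>If an approximant of a were continuous at g, then near g there would be an arrow h with
  source in the dense set D. There the coefficient of a is zero, so the approximant is small at h,
  by continuity at g, and the coefficient at g cannot be the given non-zero value.\<close>

lemma nonzero_subset_disc:
  assumes a: "(\<lambda>n. rho_sum G (f n)) \<longlonglongrightarrow> a" and f: "\<And>n. f n \<in> Cc G"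
    and D: "unit_space G closure_of D = Obj" "\<And>x. x \<in> D \<Longrightarrow> a (delta x) = 0"
    and g: "g \<in> Arr" and nz: "Rep_ell2 (a (delta (sc g))) g \<noteq> 0"
  shows "\<exists>n. g \<in> disc (f n)"
proof (rule ccontr)
  assume nd: "\<not> ?thesis"
  define J where "J h = Rep_ell2 (a (delta (sc h))) h" for h
  \<comment> \<open>Three errors below e add up: the approximant against a at h, its variation from
    h to g, and the approximant against a at g.\<close>
  define e where "e = cmod (J g) / 3"
  have e: "0 < e" using nz by (simp add: e_def J_def)
  obtain n where n: "norm (rho_sum G (f n) - a) < e"
    using LIMSEQ_D[OF a e] by blast
  have close: "cmod (f n h - J h) < e" if "h \<in> Arr" for h
  proof -
    have "f n h - J h = Rep_ell2 ((rho_sum G (f n) - a) (delta (sc h))) h"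
      by (simp add: J_def rho_sum_delta_unit[OF f that] blinfun.diff_left Rep_ell2_simps)
    then have "cmod (f n h - J h) \<le> norm ((rho_sum G (f n) - a) (delta (sc h)))"
      using ell2_coord_le by metis
    also have "\<dots> \<le> norm (rho_sum G (f n) - a)"
      using norm_blinfun[of "rho_sum G (f n) - a" "delta (sc h)"] by simp
    finally show ?thesis using n by simp
  qed
  have c: "cont_at (f n) g" using nd g by (simp add: disc_def)
  obtain N where N: "openin X N" "g \<in> N" "\<And>h. h \<in> N \<Longrightarrow> cmod (f n h - f n g) < e"
    by (rule cont_atE[OF c e]) (rule that)
  have NA: "h \<in> Arr" if "h \<in> N" for h using openin_arrow[OF N(1) that] .
  have "openin (unit_space G) (sc ` N)"
    using open_source[OF N(1)] NA by (auto simp: openin_unit_space)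
  from closure_of_meets[OF _ this, of "sc g" D] obtain x where "x \<in> D" "x \<in> sc ` N"
    using D(1) g N(2) by auto
  then obtain h where h: "h \<in> N" "sc h \<in> D" by blast
  have "J h = 0" using D(2)[OF h(2)] by (simp add: J_def Rep_ell2_simps)
  then have "cmod (f n h) < e" using close[OF NA[OF h(1)]] by simp
  moreover have "cmod (f n h - f n g) < e" by (rule N(3)[OF h(1)])
  moreover have "cmod (f n g - J g) < e" by (rule close[OF g])
  moreover have "cmod (J g) \<le> cmod (f n h) + cmod (f n h - f n g) + cmod (f n g - J g)"
  proof -
    have "J g = f n h - (f n h - f n g) - (f n g - J g)" by simp
    then show ?thesis
      using norm_triangle_ineq4[of "f n h - (f n h - f n g)" "f n g - J g"]
        norm_triangle_ineq4[of "f n h" "f n h - f n g"] by simp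
  qed
  ultimately show False by (simp add: e_def)
qed

text \<open>Wherever a has a non-zero coefficient, some approximant is discontinuous. In the
  Hausdorff case there are no such arrows; otherwise countably many bisections and countably many
  approximants leave a countable union of nowhere dense sets of sources.\<close>

theorem singular_ideal_criterion:
  assumes cover: "Hausdorff_space X \<or> countable_open_bisection_cover G"
    and a: "a \<in> \<A>"
    and D: "unit_space G closure_of D = Obj" "\<And>x. x \<in> D \<Longrightarrow> a (delta x) = 0"
  shows "a \<in> singular_ideal G"
proof -
  obtain f where f: "\<And>n. f n \<in> Cc G" "(\<lambda>n. rho_sum G (f n)) \<longlonglongrightarrow> a"
    by (rule reduced_Cstar_sequence[OF a]) (rule that)
  define Z where "Z = {x \<in> Obj. rho_ext G x a (delta x) \<noteq> 0}"
  have Z: "\<exists>g n. g \<in> Arr \<and> x = sc g \<and> g \<in> disc (f n)" if "x \<in> Z" for x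
  proof -
    have x: "x \<in> Obj" "a (delta x) \<noteq> 0" using that rho_ext_unit[OF a] by (auto simp: Z_def)
    then obtain g where g: "Rep_ell2 (a (delta x)) g \<noteq> 0"
      by (metis Rep_ell2_cong zero_ell2.rep_eq)
    then have "g \<in> Arr" "sc g = x" using reduced_Cstar_support[OF a g] x(1) by simp_all
    then show ?thesis using nonzero_subset_disc[OF f(2,1) D \<open>g \<in> Arr\<close>] g by metis
  qed
  have "meager_in (unit_space G) Z"
    using cover
  proof
    assume "Hausdorff_space X"
    then have "Z = {}" using Z disc_Hausdorff f(1) by blast
    then show ?thesis unfolding meager_in_def by (intro exI[of _ "{}"]) simp
  next
    assume "countable_open_bisection_cover G"
    then obtain \<W> where W0: "countable \<W>" "\<forall>W\<in>\<W>. openin X W \<and> bisection G W" "\<Union>\<W> = Arr"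
      unfolding countable_open_bisection_cover_def by (elim exE conjE) (rule that)
    then have W: "countable \<W>" "\<And>W. W \<in> \<W> \<Longrightarrow> open_bisection W" "\<Union>\<W> = Arr"
      by (simp_all add: open_bisection_iff)
    define P where "P W n \<N> \<longleftrightarrow> finite \<N> \<and> (\<forall>N\<in>\<N>. nowhere_dense_in (unit_space G) N) \<and>
      sc ` (W \<inter> disc (f n)) \<subseteq> \<Union>\<N>" for W n \<N>
    define \<N> where "\<N> W n = (SOME \<N>. P W n \<N>)" for W n
    have PN: "P W n (\<N> W n)" if "W \<in> \<W>" for W n
    proof -
      have "\<exists>\<N>. P W n \<N>" unfolding P_def by (rule disc_nowhere_dense[OF W(2)[OF that] f(1)])
      then show ?thesis unfolding \<N>_def by (rule someI_ex)
    qed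
    have \<N>: "\<And>W n. W \<in> \<W> \<Longrightarrow> finite (\<N> W n)"
      "\<And>W n N. W \<in> \<W> \<Longrightarrow> N \<in> \<N> W n \<Longrightarrow> nowhere_dense_in (unit_space G) N"
      "\<And>W n. W \<in> \<W> \<Longrightarrow> sc ` (W \<inter> disc (f n)) \<subseteq> \<Union>(\<N> W n)"
      using PN by (simp_all add: P_def)
    \<comment> \<open>\<open>meager_in\<close> asks for equality with the union, so the nowhere
      dense sets are cut down to Z.\<close>
    define \<M> where "\<M> = (\<lambda>N. N \<inter> Z) ` (\<Union>W\<in>\<W>. \<Union>n. \<N> W n)"
    have "countable \<M>"
      unfolding \<M>_def using W(1) \<N>(1) by (intro countable_image countable_UN) (auto intro: countable_finite)
    moreover have "nowhere_dense_in (unit_space G) M" if MM: "M \<in> \<M>" for M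
    proof -
      obtain W n N where M: "W \<in> \<W>" "N \<in> \<N> W n" "M = N \<inter> Z" using MM by (auto simp: \<M>_def)
      show ?thesis unfolding M(3) by (rule nowhere_dense_in_subset[OF \<N>(2)[OF M(1,2)] Int_lower1])
    qed
    moreover have "Z = \<Union>\<M>"
    proof
      show "\<Union>\<M> \<subseteq> Z" by (auto simp: \<M>_def)
      show "Z \<subseteq> \<Union>\<M>"
      proof
        fix x assume x: "x \<in> Z"
        obtain g n where g: "g \<in> Arr" "x = sc g" "g \<in> disc (f n)"
          using Z[OF x] by (elim exE conjE) (rule that)
        obtain W where W': "W \<in> \<W>" "g \<in> W" using W(3) g(1) by blast
        have "x \<in> sc ` (W \<inter> disc (f n))" unfolding g(2) by (intro imageI IntI W' g(3))
        then have "x \<in> \<Union>(\<N> W n)" using \<N>(3)[OF W'(1)] by blast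
        then obtain N where N: "N \<in> \<N> W n" "x \<in> N" by blast
        then have "N \<inter> Z \<in> \<M>" using W'(1) unfolding \<M>_def by blast
        then show "x \<in> \<Union>\<M>" using x N(2) by blast
      qed
    qed
    ultimately show ?thesis unfolding meager_in_def by (intro exI[of _ \<M>]) simp
  qed
  then show ?thesis using a by (simp add: singular_ideal_def Z_def)
qed

end

section \<open>Functionals concentrated at a unit\<close>

context etale_groupoid
begin

text \<open>Multiplication by the indicator function of N composed with the range map. It is in
  general outside the reduced algebra, as the indicator need not be continuous.\<close>

abbreviation proj :: "'g set \<Rightarrow> ('g ell2 \<Rightarrow>\<^sub>L 'g ell2)" where
  "proj N \<equiv> restrict_op {k \<in> Arr. rg k \<in> N}"

abbreviation corner :: "'g set \<Rightarrow> ('g ell2 \<Rightarrow>\<^sub>L 'g ell2) \<Rightarrow> ('g ell2 \<Rightarrow>\<^sub>L 'g ell2)" where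
  "corner N T \<equiv> proj N o\<^sub>L T o\<^sub>L proj N"

lemma corner_linear:
  "corner N (S + T) = corner N S + corner N T" "corner N (S - T) = corner N S - corner N T"
  "corner N (r *\<^sub>R T) = r *\<^sub>R corner N T"
  by (rule blinfun_eqI; simp add: blinfun.add_left blinfun.add_right blinfun.diff_left
      blinfun.diff_right blinfun.scaleR_left blinfun.scaleR_right)+

lemma corner_mono:
  assumes "N \<subseteq> M" shows "norm (corner N T) \<le> norm (corner M T)"
proof -
  have "{k \<in> Arr. rg k \<in> N} \<inter> {k \<in> Arr. rg k \<in> M} = {k \<in> Arr. rg k \<in> N}"
    "{k \<in> Arr. rg k \<in> M} \<inter> {k \<in> Arr. rg k \<in> N} = {k \<in> Arr. rg k \<in> N}"
    using assms by blast+
  then have *: "proj N o\<^sub>L proj M = proj N" "proj M o\<^sub>L proj N = proj N"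
    by (simp_all only: restrict_op_compose)
  have eq: "corner N T = corner N (corner M T)"
  proof -
  have "corner N T = (proj N o\<^sub>L proj M) o\<^sub>L T o\<^sub>L (proj M o\<^sub>L proj N)"
    by (simp only: *)
  also have "\<dots> = corner N (corner M T)"
    by (rule blinfun_eqI) simp
  finally show ?thesis .
  qed
  show ?thesis by (subst eq) (rule norm_compress_le)
qed

text \<open>An arrow outside the isotropy group has an end different from x, which Hausdorffness of
  the units separates from x. Compactness of C turns the local separations into one
  neighbourhood.\<close>

lemma separate_from_isotropy:
  assumes C: "compactin X C" "C \<inter> \<Gamma> x = {}" and x: "x \<in> Obj"
  obtains N where "openin X N" "x \<in> N" "\<And>g. g \<in> C \<Longrightarrow> rg g \<in> N \<Longrightarrow> sc g \<in> N \<Longrightarrow> False"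
proof -
  define B where "B = {(V, M). openin X V \<and> openin X M \<and> x \<in> M \<and> (\<forall>g\<in>V. \<not> (rg g \<in> M \<and> sc g \<in> M))}"
  have CA: "C \<subseteq> Arr" using compactin_subset_topspace[OF C(1)] by simp
  have "\<exists>p\<in>B. g \<in> fst p" if g: "g \<in> C" for g
  proof -
    have gA: "g \<in> Arr" using g CA by blast
    have "g \<notin> \<Gamma> x" using g C(2) by blast
    then have "rg g \<noteq> x \<or> sc g \<noteq> x" using gA by (auto simp: isotropy_iff)
    then show ?thesis
    proof
      assume "rg g \<noteq> x"
      then obtain V M where "openin X V" "openin X M" "rg g \<in> V" "x \<in> M" "V \<inter> M = {}"
        using separate_units[of "rg g" x] gA x range_unit by metis
      then show ?thesis
        using gA openin_range_preimage[of V]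
        by (intro bexI[of _ "({g \<in> Arr. rg g \<in> V}, M)"]) (auto simp: B_def)
    next
      assume "sc g \<noteq> x"
      then obtain V M where "openin X V" "openin X M" "sc g \<in> V" "x \<in> M" "V \<inter> M = {}"
        using separate_units[of "sc g" x] gA x source_unit by metis
      then show ?thesis
        using gA openin_source_preimage[of V]
        by (intro bexI[of _ "({g \<in> Arr. sc g \<in> V}, M)"]) (auto simp: B_def)
    qed
  qed
  then have "C \<subseteq> \<Union>(fst ` B)" by blast
  moreover have "openin X V" if "V \<in> fst ` B" for V using that by (auto simp: B_def)
  ultimately obtain \<F> where "finite \<F>" "\<F> \<subseteq> fst ` B" "C \<subseteq> \<Union>\<F>"
    using C(1) unfolding compactin_def by (metis (no_types, lifting))
  then obtain D where D: "D \<subseteq> B" "finite D" "C \<subseteq> \<Union>(fst ` D)"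
    by (metis finite_subset_image)
  \<comment> \<open>Intersecting with \<open>Obj\<close> keeps the set open when D is empty.\<close>
  let ?N = "Obj \<inter> \<Inter>(snd ` D)"
  have "openin X M" "x \<in> M" if "M \<in> snd ` D" for M using that D(1) by (auto simp: B_def)
  then have "openin X ?N" "x \<in> ?N"
    using D(2) x openin_Obj by (auto intro!: openin_Int_Inter)
  moreover have False if g: "g \<in> C" "rg g \<in> ?N" "sc g \<in> ?N" for g
  proof -
    obtain p where p: "p \<in> D" "g \<in> fst p" using D(3) g(1) by auto
    obtain V M where VM: "p = (V, M)" by (cases p)
    have "(V, M) \<in> B" using p(1) D(1) VM by blast
    then have "\<not> (rg g \<in> M \<and> sc g \<in> M)" using p(2) by (simp add: B_def VM)
    moreover have "M \<in> snd ` D" using p(1) VM by force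
    ultimately show False using g(2,3) by blast
  qed
  ultimately show thesis by (rule that)
qed

text \<open>Outside V the carrier K misses the isotropy group, so compression to a small
  neighbourhood of x removes that part. What remains lives on the bisection V, where the norm is at
  most the supremum e.\<close>

lemma small_corner:
  assumes V: "open_bisection V" and K: "compactin X K" "K \<inter> \<Gamma> x \<subseteq> V"
    and h: "\<And>g. h g \<noteq> 0 \<Longrightarrow> g \<in> K" "\<And>g. g \<in> V \<Longrightarrow> cmod (h g) \<le> e" and e: "0 \<le> e"
    and T: "has_kernel h T" and x: "x \<in> Obj"
  obtains N where "openin X N" "x \<in> N" "norm (corner N T) \<le> e"
proof -
  have Vo: "openin X V" using V by (simp add: open_bisection_def)
  have "closedin X (Arr - V)" using closedin_diff[OF closedin_topspace Vo] by simp
  then have C: "compactin X (K \<inter> (Arr - V))" by (rule compact_Int_closedin[OF K(1)])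
  have "K \<inter> (Arr - V) \<inter> \<Gamma> x = {}" using K(2) by blast
  then obtain N where N: "openin X N" "x \<in> N"
    "\<And>g. g \<in> K \<inter> (Arr - V) \<Longrightarrow> rg g \<in> N \<Longrightarrow> sc g \<in> N \<Longrightarrow> False"
    by (rule separate_from_isotropy[OF C _ x]) (rule that)
  let ?h = "\<lambda>g. if rg g \<in> N \<and> sc g \<in> N then h g else 0"
  have KA: "K \<subseteq> Arr" using compactin_subset_topspace[OF K(1)] by simp
  have hV: "g \<in> V" if "?h g \<noteq> 0" for g
  proof (rule ccontr)
    assume "g \<notin> V"
    have "rg g \<in> N" "sc g \<in> N" "h g \<noteq> 0" using that by (auto split: if_splits)
    moreover from this have "g \<in> K \<inter> (Arr - V)" using h(1)[of g] KA \<open>g \<notin> V\<close> by blast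
    ultimately show False using N(3) by blast
  qed
  have "cmod (?h g) \<le> e" for g
    using hV[of g] h(2)[of g] e by (cases "?h g = 0") auto
  from open_bisection_operator[of V ?h e, OF V hV this]
  obtain S where S: "has_kernel ?h S" "norm S \<le> e" by metis
  have "corner N T = S" by (rule has_kernel_unique[OF kernel_compress[OF T] S(1)])
  then show thesis using N(1,2) S(2) by (intro that[of N]) simp_all
qed

lemma unit_function:
  assumes F: "continuous_map (unit_space G) euclideanreal F" "compactin X K" "K \<subseteq> Obj"
    "\<And>y. y \<notin> K \<Longrightarrow> F y = 0"
  shows "(\<lambda>y. complex_of_real (F y)) \<in> C0 (unit_space G)" "cc_on Obj (\<lambda>y. complex_of_real (F y))"
proof -
  have c: "continuous_map (unit_space G) euclidean (\<lambda>y. complex_of_real (F y))"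
    by (rule continuous_map_of_real_complex[OF F(1)])
  show "cc_on Obj (\<lambda>y. complex_of_real (F y))"
    unfolding cc_on_def using c F(2-4) openin_Obj Hausdorff_Obj
    by (intro conjI exI[of _ K]) (simp_all add: unit_space_def)
  have "compactin (unit_space G) {y \<in> Obj. e \<le> cmod (complex_of_real (F y))}" if e: "0 < e" for e
  proof -
    have "closedin (unit_space G) {y \<in> topspace (unit_space G). complex_of_real (F y) \<in> - ball 0 e}"
      by (rule closedin_continuous_map_preimage[OF c]) (simp add: closed_Compl)
    then have cl: "closedin (unit_space G) {y \<in> Obj. e \<le> cmod (complex_of_real (F y))}"
      by (simp add: not_less)
    have sub: "{y \<in> Obj. e \<le> cmod (complex_of_real (F y))} \<subseteq> K"
      using F(4) e by force
    have "compactin (unit_space G) K" using F(2,3) by (simp add: unit_space_def compactin_subtopology)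
    then show ?thesis by (rule closed_compactin[OF _ sub cl])
  qed
  moreover have "complex_of_real (F y) = 0" if "y \<notin> Obj" for y using that F(3,4) by auto
  ultimately show "(\<lambda>y. complex_of_real (F y)) \<in> C0 (unit_space G)"
    unfolding C0_def topspace_unit_space using c by blast
qed

lemma unit_operator_delta:
  assumes f: "cc_on Obj f"
  shows "rho_sum G f (delta g) = (if g \<in> Arr then cscale (f (rg g)) (delta g) else 0)"
proof (rule Rep_ell2_cong)
  fix k
  note T = rho_sum_kernel[OF cc_on_in_Cc[OF f]]
  have "k = g" if "g \<in> Arr" "k \<in> Arr" "sc k = sc g" "f (k \<odot> iv g) \<noteq> 0"
  proof -
    have u: "k \<odot> iv g \<in> Obj" by (rule cc_on_subset[OF f that(4)])
    have "k \<odot> iv g = rg g" using unit_source[OF u] that(1-3) by simp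
    then show ?thesis using cancel(4)[OF that(2,1,3)] that(1) by simp
  qed
  then show "Rep_ell2 (rho_sum G f (delta g)) k =
      Rep_ell2 (if g \<in> Arr then cscale (f (rg g)) (delta g) else 0) k"
    unfolding has_kernel_apply[OF T]
    by (cases "k = g") (auto simp: Rep_ell2_simps inv_mult)
qed

lemma unit_operator_proj:
  assumes f: "cc_on Obj f" "\<And>y. f y \<noteq> 0 \<Longrightarrow> y \<in> N"
  shows "rho_sum G f o\<^sub>L proj N = rho_sum G f" "proj N o\<^sub>L rho_sum G f = rho_sum G f"
proof -
  note c = clinear_op_rho_sum[OF cc_on_in_Cc[OF f(1)]]
  have f0: "f y = 0" if "y \<notin> N" for y using f(2) that by blast
  show "rho_sum G f o\<^sub>L proj N = rho_sum G f"
    by (intro clinear_op_eqI clinear_op_compose c clinear_op_restrict_op)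
      (auto simp: restrict_op_delta unit_operator_delta[OF f(1)] f0)
  show "proj N o\<^sub>L rho_sum G f = rho_sum G f"
    by (intro clinear_op_eqI clinear_op_compose c clinear_op_restrict_op)
      (auto simp: restrict_op_delta unit_operator_delta[OF f(1)] f0
        clinear_op_cscale[OF clinear_op_restrict_op])
qed

lemma unit_operator_mult:
  assumes f: "cc_on Obj f" "cc_on Obj k" "\<And>y. k y \<noteq> 0 \<Longrightarrow> f y = 1"
  shows "rho_sum G k o\<^sub>L rho_sum G f = rho_sum G k"
proof -
  note c = clinear_op_rho_sum[OF cc_on_in_Cc[OF f(1)]] clinear_op_rho_sum[OF cc_on_in_Cc[OF f(2)]]
  have fk: "f y * k y = k y" for y using f(3)[of y] by (cases "k y = 0") auto
  show ?thesis
    by (intro clinear_op_eqI clinear_op_compose c)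
      (simp add: unit_operator_delta[OF f(1)] unit_operator_delta[OF f(2)] clinear_op_cscale[OF c(2)] fk)
qed

lemma ideal_cmult: "closed_ideal \<A> I \<Longrightarrow> a \<in> I \<Longrightarrow> cmult c a \<in> I"
  using op_scale_eq[OF reduced_Cstar_clinear, of a c] unfolding closed_ideal_def by (metis subsetD)

lemma ideal_scaleR: "closed_ideal \<A> I \<Longrightarrow> a \<in> I \<Longrightarrow> r *\<^sub>R a \<in> I"
  using ideal_cmult[of I a "of_real r"] by (simp add: cmult_of_real)

lemma ideal_diff: "closed_ideal \<A> I \<Longrightarrow> a \<in> I \<Longrightarrow> b \<in> I \<Longrightarrow> a - b \<in> I"
  using ideal_scaleR[of I b "-1"] unfolding closed_ideal_def by (metis scaleR_minus1_left uminus_add_conv_diff add.commute)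

text \<open>If \<open>F\<^sup>2\<close> had distance less than one from \<open>I\<close>, where \<open>F = 1\<close> near \<open>x\<close>, then every function
  \<open>k = k F\<^sup>2\<close> supported near \<open>x\<close> would be a limit of elements of \<open>I\<close>: if \<open>c, d \<in> I\<close> then
  \<open>(k - d)(F\<^sup>2 - c)\<close> is \<open>k\<close> up to an element of \<open>I\<close>.\<close>

lemma corner_distance:
  assumes I: "closed_ideal \<A> I" "C0_units G \<inter> I = {0}" and x: "x \<in> Obj"
    and N: "openin X N" "x \<in> N" and c: "c \<in> I"
  shows "1 \<le> norm (corner N (id_blinfun - c))"
proof (rule ccontr)
  assume "\<not> ?thesis"
  then have q: "norm (corner N (id_blinfun - c)) < 1" by simp
  define q where "q = norm (corner N (id_blinfun - c))"
  obtain F :: "'g \<Rightarrow> real" and K N1 where F: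
    "continuous_map (unit_space G) euclideanreal F" "compactin X K" "K \<subseteq> N \<inter> Obj"
    "\<And>y. y \<notin> K \<Longrightarrow> F y = 0" "\<And>y. 0 \<le> F y" "\<And>y. F y \<le> 1"
    "openin X N1" "x \<in> N1" "N1 \<subseteq> N \<inter> Obj" "\<And>y. y \<in> N1 \<Longrightarrow> F y = 1"
    by (rule unit_bump[OF N x]) (rule that)
  obtain F' :: "'g \<Rightarrow> real" and K' N2 where F':
    "continuous_map (unit_space G) euclideanreal F'" "compactin X K'" "K' \<subseteq> N1 \<inter> Obj"
    "\<And>y. y \<notin> K' \<Longrightarrow> F' y = 0" "x \<in> N2" "\<And>y. y \<in> N2 \<Longrightarrow> F' y = 1"
    by (rule unit_bump[OF F(7,8) x]) (rule that)
  define f where "f y = complex_of_real (F y)" for y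
  define k where "k y = complex_of_real (F' y)" for y
  have f: "cc_on Obj f" unfolding f_def using F(3) by (intro unit_function(2)[OF F(1,2) _ F(4)]) auto
  have k: "cc_on Obj k" "k \<in> C0 (unit_space G)"
    unfolding k_def using F'(3) by (intro unit_function[OF F'(1,2) _ F'(4)]; auto)+
  let ?F = "rho_sum G f" and ?k = "rho_sum G k"
  have FA: "?F \<in> \<A>" and kA: "?k \<in> \<A>" by (intro rho_sum_in_reduced cc_on_in_Cc[OF f] cc_on_in_Cc[OF k(1)])+
  have fN: "f y \<noteq> 0 \<Longrightarrow> y \<in> N" for y using F(3,4) by (auto simp: f_def)
  have kf: "k y \<noteq> 0 \<Longrightarrow> f y = 1" for y using F'(3,4) F(10) by (auto simp: f_def k_def)
  have nF: "norm ?F \<le> 1"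
    by (rule norm_rho_sum_le[OF open_bisection_Obj f]) (use F(5,6) in \<open>simp add: f_def\<close>)
  have Im: "a o\<^sub>L b \<in> I" "b o\<^sub>L a \<in> I" if "a \<in> \<A>" "b \<in> I" for a b
    using I(1) that by (auto simp: closed_ideal_def)
  have Ia: "a + b \<in> I" if "a \<in> I" "b \<in> I" for a b using I(1) that by (auto simp: closed_ideal_def)
  have IA: "a \<in> \<A>" if "a \<in> I" for a using I(1) that by (auto simp: closed_ideal_def)
  define c1 where "c1 = ?F o\<^sub>L c o\<^sub>L ?F"
  have c1: "c1 \<in> I" unfolding c1_def by (intro Im FA c)
  \<comment> \<open>F is supported in N and absorbs the projection on either side; so F^2 - c1 is
    the corner of 1 - c between two contractions.\<close>
  have nq: "norm ((?F o\<^sub>L ?F) - c1) \<le> q"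
  proof -
    have FP: "?F (proj N u) = ?F u" and PF: "proj N (?F u) = ?F u" for u
      using arg_cong[OF unit_operator_proj(1)[OF f fN], of "\<lambda>T. blinfun_apply T u"]
        arg_cong[OF unit_operator_proj(2)[OF f fN], of "\<lambda>T. blinfun_apply T u"] by simp_all
    have "(?F o\<^sub>L ?F) - c1 = ?F o\<^sub>L corner N (id_blinfun - c) o\<^sub>L ?F"
      unfolding c1_def
      by (rule blinfun_eqI) (simp add: FP PF blinfun.diff_left blinfun.diff_right)
    also have "norm \<dots> \<le> norm ?F * q * norm ?F"
      unfolding q_def
      by (rule order_trans[OF norm_blinfun_compose])
        (intro mult_right_mono norm_blinfun_compose norm_ge_zero)
    also have "\<dots> \<le> 1 * q * 1"
      using nF by (intro mult_mono) (auto simp: q_def)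
    finally show ?thesis by simp
  qed
  have kF: "?k o\<^sub>L (?F o\<^sub>L ?F) = ?k"
  proof -
    have "?k (?F u) = ?k u" for u
      using arg_cong[OF unit_operator_mult[OF f k(1) kf], of "\<lambda>T. blinfun_apply T u"] by simp
    then show ?thesis by (intro blinfun_eqI) simp
  qed
  have "\<exists>d\<in>I. norm (?k - d) \<le> norm ?k * q ^ n" for n
  proof (induction n)
    case 0
    show ?case using I(1) by (intro bexI[of _ 0]) (auto simp: closed_ideal_def)
  next
    case (Suc n)
    then obtain d where d: "d \<in> I" "norm (?k - d) \<le> norm ?k * q ^ n" by blast
    \<comment> \<open>Because k F^2 = k, the new error is (k - d)(F^2 - c1): each round gains a
      factor q < 1, and k becomes a limit of elements of I.\<close>
    let ?d = "(?k o\<^sub>L c1) + ((d o\<^sub>L (?F o\<^sub>L ?F)) - (d o\<^sub>L c1))"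
    have "?d \<in> I"
      by (intro Ia ideal_diff[OF I(1)] Im kA c1 d IA reduced_Cstar_compose FA)
    moreover have "?k - ?d = (?k - d) o\<^sub>L ((?F o\<^sub>L ?F) - c1)"
    proof -
      have "(?k - d) o\<^sub>L ((?F o\<^sub>L ?F) - c1) = (?k o\<^sub>L (?F o\<^sub>L ?F)) - (?k o\<^sub>L c1) - ((d o\<^sub>L (?F o\<^sub>L ?F)) - (d o\<^sub>L c1))"
        by (rule blinfun_eqI) (simp add: blinfun.diff_left blinfun.diff_right)
      then show ?thesis unfolding kF by (simp add: algebra_simps)
    qed
    moreover have "norm ((?k - d) o\<^sub>L ((?F o\<^sub>L ?F) - c1)) \<le> norm ?k * q ^ Suc n"
    proof -
      have "norm ((?k - d) o\<^sub>L ((?F o\<^sub>L ?F) - c1)) \<le> norm (?k - d) * norm ((?F o\<^sub>L ?F) - c1)"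
        by (rule norm_blinfun_compose)
      also have "\<dots> \<le> (norm ?k * q ^ n) * q"
        using d(2) nq by (intro mult_mono) (auto simp: q_def)
      finally show ?thesis by (simp add: mult_ac)
    qed
    ultimately show ?case by metis
  qed
  then have "\<forall>n. \<exists>d. d \<in> I \<and> norm (?k - d) \<le> norm ?k * q ^ n" by blast
  from choice[OF this] obtain d where d: "\<And>n. d n \<in> I" "\<And>n. norm (?k - d n) \<le> norm ?k * q ^ n"
    by blast
  have "(\<lambda>n. norm ?k * q ^ n) \<longlonglongrightarrow> 0"
    using q by (intro tendsto_mult_right_zero LIMSEQ_power_zero) (simp add: q_def)
  then have "(\<lambda>n. ?k - d n) \<longlonglongrightarrow> 0"
    by (rule Lim_null_comparison[rotated]) (use d(2) in simp)
  then have "d \<longlonglongrightarrow> ?k"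
    using tendsto_diff[OF tendsto_const[of ?k]] by fastforce
  then have "?k \<in> I"
    using I(1) d(1) closed_sequentially[of I d ?k] by (simp add: closed_ideal_def)
  moreover have "?k \<in> C0_units G" using k(2) by (simp add: C0_units_def)
  ultimately have "?k = 0" using I(2) by blast
  then have "cscale (k x) (delta x) = 0"
    using unit_operator_delta[OF k(1), of x] x by simp
  then have "Rep_ell2 (cscale (k x) (delta x)) x = 0" by (simp add: Rep_ell2_simps)
  then show False using F'(5,6) by (simp add: Rep_ell2_simps k_def)
qed

text \<open>The gauge p is the distance from I measured in ever smaller corners around x. By
  \<open>corner_distance\<close> it is 1 at the identity, and there the Hahn--Banach functional
  attains it. Operators with p zero at T and at -T are annihilated: this covers I and everything
  that becomes small near x.\<close>

theorem local_state:
  assumes I: "closed_ideal \<A> I" "C0_units G \<inter> I = {0}" and x: "x \<in> Obj"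
  obtains \<phi> :: "('g ell2 \<Rightarrow>\<^sub>L 'g ell2) \<Rightarrow> real" where "linear \<phi>" "\<And>T. \<phi> T \<le> norm T" "\<phi> id_blinfun = 1"
    "\<And>a. a \<in> I \<Longrightarrow> \<phi> a = 0"
    "\<And>T. (\<And>e. 0 < e \<Longrightarrow> \<exists>N. openin X N \<and> x \<in> N \<and> norm (corner N T) \<le> e) \<Longrightarrow> \<phi> T = 0"
proof -
  define S where "S = {N. openin X N \<and> x \<in> N} \<times> I"
  define p where "p T = (INF s\<in>S. norm (corner (fst s) (T - snd s)))" for T
  have I0: "0 \<in> I" and Ia: "\<And>a b. a \<in> I \<Longrightarrow> b \<in> I \<Longrightarrow> a + b \<in> I"
    using I(1) by (simp_all add: closed_ideal_def)
  have AS: "(Arr, c) \<in> S" if "c \<in> I" for c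
    using that x openin_topspace[of X] by (simp add: S_def)
  have S0: "S \<noteq> {}" using AS[OF I0] by blast
  have le: "p T \<le> norm (corner N (T - c))" if "openin X N" "x \<in> N" "c \<in> I" for T N c
    unfolding p_def using that
    by (intro cINF_lower2[of _ _ "(N, c)"]) (auto simp: S_def intro!: bdd_belowI2[of _ 0])
  have ge: "z \<le> p T" if "\<And>N c. openin X N \<Longrightarrow> x \<in> N \<Longrightarrow> c \<in> I \<Longrightarrow> z \<le> norm (corner N (T - c))" for z T
    unfolding p_def using that by (intro cINF_greatest[OF S0]) (auto simp: S_def)
  have A: "openin X Arr" "x \<in> Arr" using x openin_topspace[of X] by auto
  have pI: "p c \<le> 0" if "c \<in> I" for c
    using le[OF A that, of c] by simp
  have pnorm: "p T \<le> norm T" for T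
    using order_trans[OF le[OF A I0, of T] norm_compress_le] by simp
  have p0: "p 0 = 0"
    by (rule antisym[OF pI[OF I0] ge]) simp
  have sub: "sublinear p"
  proof (rule sublinearI[of p, OF _ p0])
    fix T1 T2
    have "p (T1 + T2) - norm (corner N2 (T2 - c2)) \<le> norm (corner N1 (T1 - c1))"
      if 1: "openin X N1" "x \<in> N1" "c1 \<in> I" and 2: "openin X N2" "x \<in> N2" "c2 \<in> I" for N1 c1 N2 c2
    proof -
      \<comment> \<open>The infimum is over a directed family: neighbourhoods are intersected,
        elements of I are added, and corners only shrink.\<close>
      let ?N = "N1 \<inter> N2"
      have "p (T1 + T2) \<le> norm (corner ?N ((T1 + T2) - (c1 + c2)))"
        by (intro le Ia openin_Int) (use 1 2 in auto)
      also have "(T1 + T2) - (c1 + c2) = (T1 - c1) + (T2 - c2)" by simp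
      also have "norm (corner ?N ((T1 - c1) + (T2 - c2))) \<le> norm (corner ?N (T1 - c1)) + norm (corner ?N (T2 - c2))"
        unfolding corner_linear(1) by (rule norm_triangle_ineq)
      also have "\<dots> \<le> norm (corner N1 (T1 - c1)) + norm (corner N2 (T2 - c2))"
        by (intro add_mono corner_mono) auto
      finally show ?thesis by simp
    qed
    then have "p (T1 + T2) - norm (corner N2 (T2 - c2)) \<le> p T1"
      if "openin X N2" "x \<in> N2" "c2 \<in> I" for N2 c2 using that by (intro ge) auto
    then have "p (T1 + T2) - p T1 \<le> p T2" by (intro ge) (simp add: algebra_simps)
    then show "p (T1 + T2) \<le> p T1 + p T2" by simp
  next
    fix r :: real and T assume r: "0 < r"
    have "p (r *\<^sub>R T) / r \<le> norm (corner N (T - c))" if N: "openin X N" "x \<in> N" "c \<in> I" for N c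
    proof -
      have "p (r *\<^sub>R T) \<le> norm (corner N (r *\<^sub>R T - r *\<^sub>R c))"
        by (intro le N ideal_scaleR[OF I(1)])
      also have "\<dots> = r * norm (corner N (T - c))"
        unfolding scaleR_diff_right[symmetric] corner_linear(3) using r by simp
      finally show ?thesis using r by (simp add: field_simps)
    qed
    then have "p (r *\<^sub>R T) / r \<le> p T" by (rule ge)
    then show "p (r *\<^sub>R T) \<le> r * p T" using r by (simp add: field_simps)
  qed
  obtain \<phi> where \<phi>: "linear \<phi>" "\<And>T. \<phi> T \<le> p T" "\<phi> id_blinfun = p id_blinfun"
    by (rule hahn_banach[OF sub]) (rule that)
  have zero: "\<phi> T = 0" if "p T \<le> 0" "p (- T) \<le> 0" for T
    using order_trans[OF \<phi>(2) that(1)] order_trans[OF \<phi>(2) that(2)] by (simp add: linear_neg[OF \<phi>(1)])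
  show thesis
  proof (rule that[OF \<phi>(1)])
    show "\<phi> T \<le> norm T" for T by (rule order_trans[OF \<phi>(2) pnorm])
    have "1 \<le> p id_blinfun" by (rule ge) (rule corner_distance[OF I x])
    moreover have "p id_blinfun \<le> 1" by (rule order_trans[OF pnorm norm_blinfun_id_le])
    ultimately show "\<phi> id_blinfun = 1" using \<phi>(3) by simp
    show "\<phi> a = 0" if "a \<in> I" for a
      using that ideal_scaleR[OF I(1) that, of "-1"] by (intro zero pI) simp_all
    fix T assume T: "\<And>e. 0 < e \<Longrightarrow> \<exists>N. openin X N \<and> x \<in> N \<and> norm (corner N T) \<le> e"
    have "p T \<le> 0 + e" "p (- T) \<le> 0 + e" if e: "0 < e" for e
    proof -
      obtain N where N: "openin X N" "x \<in> N" "norm (corner N T) \<le> e" using T[OF e] by blast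
      show "p T \<le> 0 + e" using le[OF N(1,2) I0, of T] N(3) by simp
      have "corner N (- T) = - corner N T" using corner_linear(3)[of N "-1" T] by simp
      then show "p (- T) \<le> 0 + e" using le[OF N(1,2) I0, of "- T"] N(3) by simp
    qed
    note pT = this
    have "p T \<le> 0" by (rule field_le_epsilon) (rule pT(1))
    moreover have "p (- T) \<le> 0" by (rule field_le_epsilon) (rule pT(2))
    ultimately show "\<phi> T = 0" by (rule zero)
  qed
qed

end

section \<open>Adjoints, and states that are local at a unit\<close>

lemma adjoint_pairD: "adjoint_pair S T \<Longrightarrow> cinner (S u) w = cinner u (T w)"
  by (simp add: adjoint_pair_def)

lemma adjoint_pair_norm_le:
  assumes "adjoint_pair S T" shows "norm T \<le> norm S"
proof (rule norm_blinfun_bound)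
  fix u
  have "(norm (T u))\<^sup>2 = cmod (cinner (S (T u)) u)"
    using adjoint_pairD[OF assms, of "T u" u] by (simp add: cinner_self norm_mult power2_eq_square)
  also have "\<dots> \<le> norm S * norm (T u) * norm u"
    by (rule order_trans[OF norm_cinner_le]) (intro mult_right_mono norm_blinfun norm_ge_zero)
  finally have *: "norm (T u) * norm (T u) \<le> norm (T u) * (norm S * norm u)"
    by (simp add: power2_eq_square mult_ac)
  show "norm (T u) \<le> norm S * norm u"
  proof (cases "T u = 0")
    case False
    then have "0 < norm (T u)" by simp
    then show ?thesis using * by simp
  qed simp
qed simp

lemma adjoint_pair_unique:
  assumes "adjoint_pair S T" "adjoint_pair S T'" shows "T = T'"
proof (rule blinfun_eqI, rule Rep_ell2_cong)
  fix u k
  show "Rep_ell2 (T u) k = Rep_ell2 (T' u) k"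
    using adjoint_pairD[OF assms(1), of "delta k" u] adjoint_pairD[OF assms(2), of "delta k" u]
    by (simp add: cinner_delta_left)
qed

lemma adjoint_pair_compose:
  "adjoint_pair S S' \<Longrightarrow> adjoint_pair T T' \<Longrightarrow> adjoint_pair (S o\<^sub>L T) (T' o\<^sub>L S')"
  by (simp add: adjoint_pair_def)

lemma adjoint_pair_diff:
  "adjoint_pair S S' \<Longrightarrow> adjoint_pair T T' \<Longrightarrow> adjoint_pair (S - T) (S' - T')"
  by (simp add: adjoint_pair_def blinfun.diff_left cinner_diff_left cinner_diff_right)

text \<open>Normalization, domination by the norm and locality are what the representation is built
  from; the ideal returns only in \<open>ideal_vanishes\<close>.\<close>

locale unit_state = etale_groupoid G for G :: "'g top_groupoid" +
  fixes x :: 'g and \<phi> :: "('g ell2 \<Rightarrow>\<^sub>L 'g ell2) \<Rightarrow> real"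
  assumes x: "x \<in> gunits G" and lin: "linear \<phi>" and \<phi>_le: "\<phi> T \<le> norm T"
    and \<phi>_id: "\<phi> id_blinfun = 1"
    and \<phi>_local: "(\<And>e. 0 < e \<Longrightarrow> \<exists>N. openin X N \<and> x \<in> N \<and> norm (corner N T) \<le> e) \<Longrightarrow> \<phi> T = 0"
begin

definition \<Phi> :: "('g ell2 \<Rightarrow>\<^sub>L 'g ell2) \<Rightarrow> complex" where
  "\<Phi> T = Complex (\<phi> T) (- \<phi> (cmult \<i> T))"

lemma Re_\<Phi> [simp]: "Re (\<Phi> T) = \<phi> T"
  by (simp add: \<Phi>_def)

lemma \<Phi>_add: "\<Phi> (S + T) = \<Phi> S + \<Phi> T"
  by (simp add: \<Phi>_def complex_eq_iff cmult_add linear_add[OF lin])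

lemma \<Phi>_cmult: "\<Phi> (cmult c T) = c * \<Phi> T"
proof -
  have *: "\<phi> (cmult d T) = Re d * \<phi> T + Im d * \<phi> (cmult \<i> T)" for d
  proof -
    have "cmult d T = Re d *\<^sub>R T + Im d *\<^sub>R cmult \<i> T"
    proof (rule blinfun_eqI)
      fix u
      have "cscale d (T u) = cscale (of_real (Re d) + of_real (Im d) * \<i>) (T u)"
        by (rule arg_cong[of _ _ "\<lambda>z. cscale z (T u)"]) (simp add: complex_eq_iff)
      then show "cmult d T u = (Re d *\<^sub>R T + Im d *\<^sub>R cmult \<i> T) u"
        by (simp add: cmult_apply blinfun.add_left blinfun.scaleR_left cscale_add_left
            cscale_of_real[symmetric])
    qed
    then show ?thesis by (simp add: linear_add[OF lin] linear_cmul[OF lin])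
  qed
  show ?thesis by (simp add: \<Phi>_def complex_eq_iff *[of c] *[of "\<i> * c"] algebra_simps)
qed

lemma \<Phi>_zero: "\<Phi> 0 = 0"
  using \<Phi>_cmult[of 0 0] by simp

lemma \<Phi>_diff: "\<Phi> (S - T) = \<Phi> S - \<Phi> T"
  using \<Phi>_add[of S "cmult (-1) T"] \<Phi>_cmult[of "-1" T] by simp

lemma \<phi>_accretive: "(\<And>u. 0 \<le> inner u (blinfun_apply T u)) \<Longrightarrow> 0 \<le> \<phi> T"
  by (rule accretive_nonneg[OF lin \<phi>_le \<phi>_id])

lemma \<phi>_skew: "(\<And>u. inner u (blinfun_apply T u) = 0) \<Longrightarrow> \<phi> T = 0"
  using \<phi>_accretive[of T] \<phi>_accretive[of "- T"]
  by (simp add: blinfun.minus_left linear_neg[OF lin])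

text \<open>For adjoint operators S and T, the quadratic forms of S - T and of i (S + T) are purely
  imaginary. Accretivity of an operator with such a form, and of its negative, makes \<phi> vanish
  there.\<close>

lemma \<Phi>_adjoint:
  assumes "adjoint_pair S T" shows "\<Phi> T = cnj (\<Phi> S)"
proof -
  have *: "cinner u (T u) = cnj (cinner u (S u))" for u
    using adjoint_pairD[OF assms, of u u] by (simp add: cnj_cinner)
  have "\<phi> (S - T) = 0"
    by (rule \<phi>_skew) (simp add: Re_cinner[symmetric] blinfun.diff_left cinner_diff_right *)
  moreover have "\<phi> (cmult \<i> (S + T)) = 0"
    by (rule \<phi>_skew) (simp add: Re_cinner[symmetric] cmult_apply blinfun.add_left cinner_cscale_right
        cinner_add_right *)
  ultimately show ?thesis
    by (simp add: \<Phi>_def complex_eq_iff linear_diff[OF lin] linear_add[OF lin] cmult_add)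
qed

lemma \<Phi>_local:
  assumes "\<And>e. 0 < e \<Longrightarrow> \<exists>N. openin X N \<and> x \<in> N \<and> norm (corner N T) \<le> e"
  shows "\<Phi> T = 0"
proof -
  have "norm (corner N (cmult \<i> T)) \<le> norm (corner N T)" for N
  proof -
    have "corner N (cmult \<i> T) = cmult \<i> (corner N T)"
      by (simp only: cmult_compose_right[OF clinear_op_restrict_op] cmult_compose_left)
    then show ?thesis using norm_cmult_le[of \<i> "corner N T"] by simp
  qed
  then have "\<phi> (cmult \<i> T) = 0"
    using assms by (intro \<phi>_local) (meson order_trans)
  then show ?thesis using \<phi>_local[OF assms] by (simp add: \<Phi>_def complex_eq_iff)
qed

definition \<psi> :: "'g \<Rightarrow> complex" where
  "\<psi> g = \<Phi> (rho_sum G (bump g))"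

text \<open>A bisection contains at most one isotropy arrow \<gamma> at x. Subtracting f(\<gamma>)
  times its bump function leaves a function that vanishes at \<gamma>, hence is small on a
  neighbourhood, and locality annihilates it. In particular \<psi>(\<gamma>) does not depend on the
  chosen bump function.\<close>

lemma \<Phi>_bisection:
  assumes U: "open_bisection U" and f: "cc_on U f"
  shows "\<Phi> (rho_sum G f) = (\<Sum>\<gamma> | \<gamma> \<in> \<Gamma> x \<and> f \<gamma> \<noteq> 0. f \<gamma> * \<psi> \<gamma>)"
proof (cases "\<exists>\<gamma>. \<gamma> \<in> U \<inter> \<Gamma> x")
  case False
  obtain K where K: "compactin X K" "K \<subseteq> U" "\<And>g. g \<notin> K \<Longrightarrow> f g = 0" using f by (rule cc_onE) (rule that)
  have "\<Phi> (rho_sum G f) = 0"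
  proof (rule \<Phi>_local)
    fix e :: real assume e: "0 < e"
    have V: "open_bisection {}" by (simp add: open_bisection_def)
    have fK: "g \<in> K" if "f g \<noteq> 0" for g using K(3) that by blast
    have KV: "K \<inter> \<Gamma> x \<subseteq> {}" using False K(2) by blast
    obtain N where "openin X N" "x \<in> N" "norm (corner N (rho_sum G f)) \<le> e"
      by (rule small_corner[OF V K(1) KV fK _ _ rho_sum_kernel[OF cc_on_in_Cc[OF f]] x, of e])
        (use e that in auto)
    then show "\<exists>N. openin X N \<and> x \<in> N \<and> norm (corner N (rho_sum G f)) \<le> e" by blast
  qed
  moreover have "{\<gamma>. \<gamma> \<in> \<Gamma> x \<and> f \<gamma> \<noteq> 0} = {}" using False cc_on_subset[OF f] by blast
  ultimately show ?thesis by (simp only: sum.empty)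
next
  case True
  then obtain \<gamma> where \<gamma>: "\<gamma> \<in> U" "\<gamma> \<in> \<Gamma> x" by blast
  have \<gamma>A: "\<gamma> \<in> Arr" "sc \<gamma> = x" using \<gamma>(2) by (simp_all add: isotropyD)
  obtain U' where U': "open_bisection U'" "\<gamma> \<in> U'" "cc_on U' (bump \<gamma>)" using bump(2)[OF \<gamma>A(1)] by blast
  obtain K where K: "openin X U" "continuous_map (subtopology X U) euclidean f" "compactin X K" "K \<subseteq> U"
    "\<And>g. g \<notin> K \<Longrightarrow> f g = 0"
    using f by (rule cc_onE) (rule that)
  obtain K' where K': "openin X U'" "continuous_map (subtopology X U') euclidean (bump \<gamma>)" "compactin X K'" "K' \<subseteq> U'"
    "\<And>g. g \<notin> K' \<Longrightarrow> bump \<gamma> g = 0"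
    using U'(3) by (rule cc_onE) (rule that)
  have inj: "inj_on sc U" "inj_on sc U'" using U U'(1) by (simp_all add: open_bisection_def)
  define h where "h g = f g - f \<gamma> * bump \<gamma> g" for g
  have bC: "bump \<gamma> \<in> Cc G" by (rule bump_Cc[OF \<gamma>A(1)])
  have sC: "(\<lambda>g. f \<gamma> * bump \<gamma> g) \<in> Cc G" by (rule Cc_scale[OF bC])
  have hC: "h \<in> Cc G" unfolding h_def by (rule Cc_diff[OF cc_on_in_Cc[OF f] sC])
  have rh: "rho_sum G h = rho_sum G f - cmult (f \<gamma>) (rho_sum G (bump \<gamma>))"
    unfolding h_def rho_sum_diff[OF cc_on_in_Cc[OF f] sC] rho_sum_scale[OF bC] ..
  have h\<gamma>: "h \<gamma> = 0" by (simp add: h_def bump(1)[OF \<gamma>A(1)])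
  let ?W = "U \<inter> U'"
  have Wo: "openin X ?W" by (intro openin_Int K K')
  have hc: "continuous_map (subtopology X ?W) euclidean h"
    unfolding h_def
    by (intro continuous_map_diff_field continuous_map_mult_field
        continuous_map_from_subtopology_mono[OF K(2)] continuous_map_from_subtopology_mono[OF K'(2)]) auto
  have "\<Phi> (rho_sum G h) = 0"
  proof (rule \<Phi>_local)
    fix e :: real assume e: "0 < e"
    \<comment> \<open>Both bisections have \<gamma> as their only isotropy arrow at x, so this
      neighbourhood of \<gamma>, where the difference is below e, contains every isotropy arrow of
      the two compact carriers.\<close>
    let ?V = "{g \<in> topspace (subtopology X ?W). h g \<in> ball 0 e}"
    have "openin (subtopology X ?W) ?V"
      by (rule openin_continuous_map_preimage[OF hc]) simp
    then have Vo: "openin X ?V" using openin_open_subtopology[OF Wo] by blast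
    have VU: "?V \<subseteq> U" by auto
    have V: "open_bisection ?V" by (rule open_bisection_subset[OF U Vo VU])
    have KK: "compactin X (K \<union> K')" by (rule compactin_Un[OF K(3) K'(3)])
    have sub: "(K \<union> K') \<inter> \<Gamma> x \<subseteq> ?V"
    proof
      fix g assume g: "g \<in> (K \<union> K') \<inter> \<Gamma> x"
      then have "sc g = sc \<gamma>" using isotropyD(2)[of g x] \<gamma>A(2) by simp
      moreover have "g \<in> U \<or> g \<in> U'" using g K(4) K'(4) by blast
      ultimately have "g = \<gamma>" using inj \<gamma>(1) U'(2) by (auto simp: inj_on_def)
      then show "g \<in> ?V" using \<gamma>(1) U'(2) \<gamma>A(1) h\<gamma> e by simp
    qed
    have hK: "g \<in> K \<union> K'" if "h g \<noteq> 0" for g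
    proof (rule ccontr)
      assume "g \<notin> K \<union> K'"
      then have "h g = 0" using K(5)[of g] K'(5)[of g] by (simp add: h_def)
      with that show False by simp
    qed
    obtain N where "openin X N" "x \<in> N" "norm (corner N (rho_sum G h)) \<le> e"
      by (rule small_corner[OF V KK sub hK _ _ rho_sum_kernel[OF hC] x, of e])
        (use e that in \<open>auto simp: less_imp_le\<close>)
    then show "\<exists>N. openin X N \<and> x \<in> N \<and> norm (corner N (rho_sum G h)) \<le> e" by blast
  qed
  then have "\<Phi> (rho_sum G f) = f \<gamma> * \<psi> \<gamma>"
    by (simp add: rh \<Phi>_diff \<Phi>_cmult \<psi>_def)
  moreover have "{\<gamma>'. \<gamma>' \<in> \<Gamma> x \<and> f \<gamma>' \<noteq> 0} = (if f \<gamma> = 0 then {} else {\<gamma>})"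
  proof -
    have uniq: "\<gamma>' = \<gamma>" if "\<gamma>' \<in> \<Gamma> x" "f \<gamma>' \<noteq> 0" for \<gamma>'
    proof -
      have "sc \<gamma>' = sc \<gamma>" using isotropyD(2)[OF that(1)] \<gamma>A(2) by simp
      then show ?thesis using inj_onD[OF inj(1) _ cc_on_subset[OF f that(2)] \<gamma>(1)] by blast
    qed
    show ?thesis
    proof (cases "f \<gamma> = 0")
      case True
      have "{\<gamma>'. \<gamma>' \<in> \<Gamma> x \<and> f \<gamma>' \<noteq> 0} = {}" using uniq True by blast
      then show ?thesis using True by simp
    next
      case False
      have "{\<gamma>'. \<gamma>' \<in> \<Gamma> x \<and> f \<gamma>' \<noteq> 0} = {\<gamma>}" using uniq False \<gamma>(2) by blast
      then show ?thesis using False by simp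
    qed
  qed
  ultimately show ?thesis by (cases "f \<gamma> = 0") simp_all
qed

lemma finite_iso_supp: "f \<in> Cc G \<Longrightarrow> finite {\<gamma>. \<gamma> \<in> \<Gamma> x \<and> f \<gamma> \<noteq> 0}"
  by (rule finite_subset[OF _ Cc_finite_source[of f x]]) (auto simp: isotropy_iff source_fibre_def)

lemma \<Phi>_Cc:
  "f \<in> Cc G \<Longrightarrow> \<Phi> (rho_sum G f) = (\<Sum>\<gamma> | \<gamma> \<in> \<Gamma> x \<and> f \<gamma> \<noteq> 0. f \<gamma> * \<psi> \<gamma>)"
proof (induction rule: Cc_induct)
  case zero
  show ?case by (simp add: rho_sum_zero \<Phi>_zero)
next
  case (add f g)
  let ?F = "{\<gamma>. \<gamma> \<in> \<Gamma> x \<and> f \<gamma> \<noteq> 0} \<union> {\<gamma>. \<gamma> \<in> \<Gamma> x \<and> g \<gamma> \<noteq> 0}"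
  have fin: "finite ?F" by (intro finite_UnI finite_iso_supp add)
  have "(\<Sum>\<gamma> | \<gamma> \<in> \<Gamma> x \<and> h \<gamma> \<noteq> 0. h \<gamma> * \<psi> \<gamma>) = (\<Sum>\<gamma>\<in>?F. h \<gamma> * \<psi> \<gamma>)"
    if "{\<gamma>. \<gamma> \<in> \<Gamma> x \<and> h \<gamma> \<noteq> 0} \<subseteq> ?F" for h
    by (rule sum.mono_neutral_left[OF fin that]) auto
  note F = this[of f] this[of g] this[of "\<lambda>x. f x + g x"]
  have "\<Phi> (rho_sum G (\<lambda>x. f x + g x)) = (\<Sum>\<gamma>\<in>?F. f \<gamma> * \<psi> \<gamma>) + (\<Sum>\<gamma>\<in>?F. g \<gamma> * \<psi> \<gamma>)"
    unfolding rho_sum_add[OF add(1,2)] \<Phi>_add add(3,4) using F(1,2) by auto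
  also have "\<dots> = (\<Sum>\<gamma>\<in>?F. (f \<gamma> + g \<gamma>) * \<psi> \<gamma>)"
    by (simp add: sum.distrib distrib_right)
  also have "\<dots> = (\<Sum>\<gamma> | \<gamma> \<in> \<Gamma> x \<and> f \<gamma> + g \<gamma> \<noteq> 0. (f \<gamma> + g \<gamma>) * \<psi> \<gamma>)"
    by (rule F(3)[symmetric]) auto
  finally show ?case .
next
  case (bisection U f)
  then show ?case by (rule \<Phi>_bisection)
qed

lemma \<psi>_inv:
  assumes \<gamma>: "\<gamma> \<in> \<Gamma> x" shows "\<psi> (iv \<gamma>) = cnj (\<psi> \<gamma>)"
proof -
  have \<gamma>A: "\<gamma> \<in> Arr" "sc \<gamma> = x" "rg \<gamma> = x" using \<gamma> by (simp_all add: isotropyD)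
  have s: "star (bump \<gamma>) \<delta> = (if \<delta> = iv \<gamma> then 1 else 0)" if "\<delta> \<in> \<Gamma> x" for \<delta>
  proof -
    have \<delta>: "\<delta> \<in> Arr" "rg \<delta> = x" using that by (simp_all add: isotropyD)
    then have "bump \<gamma> (iv \<delta>) = (if iv \<delta> = \<gamma> then 1 else 0)"
      using \<gamma>A by (intro bump_source) simp_all
    moreover have "iv \<delta> = \<gamma> \<longleftrightarrow> \<delta> = iv \<gamma>" using \<delta> \<gamma>A by auto
    ultimately show ?thesis using \<delta> by (simp add: star_def)
  qed
  have "cnj (\<psi> \<gamma>) = \<Phi> (rho_sum G (star (bump \<gamma>)))"
    unfolding \<psi>_def by (rule \<Phi>_adjoint[symmetric, OF adjoint_rho_sum[OF bump_Cc[OF \<gamma>A(1)]]])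
  also have "\<dots> = (\<Sum>\<delta> | \<delta> \<in> \<Gamma> x \<and> star (bump \<gamma>) \<delta> \<noteq> 0. star (bump \<gamma>) \<delta> * \<psi> \<delta>)"
    by (rule \<Phi>_Cc[OF star_Cc[OF bump_Cc[OF \<gamma>A(1)]]])
  also have "{\<delta>. \<delta> \<in> \<Gamma> x \<and> star (bump \<gamma>) \<delta> \<noteq> 0} = {iv \<gamma>}"
    using s isotropy_closed(2)[OF \<gamma>] by (auto split: if_splits)
  finally show ?thesis using s[OF isotropy_closed(2)[OF \<gamma>]] by simp
qed

text \<open>The kernel \<psi> induced from the isotropy group to the source fibre: arrows with
  different ranges are orthogonal, those with equal ranges are compared by an isotropy
  element.\<close>

definition \<kappa> :: "'g \<Rightarrow> 'g \<Rightarrow> complex" where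
  "\<kappa> k l = (if rg k = rg l then \<psi> (iv k \<odot> l) else 0)"

text \<open>A pair k, l with equal range contributes to star b convolved with b' at the isotropy
  arrow k^{-1} l. The finite set D of these arrows carries the sum for \<Phi>, so the two summations
  can be interchanged and reindexed by k.\<close>

lemma \<Phi>_star_conv:
  assumes b: "b \<in> Cc G" and b': "b' \<in> Cc G"
  shows "\<Phi> (rho_sum G (star b) o\<^sub>L rho_sum G b') =
    (\<Sum>k | k \<in> source_fibre G x \<and> b k \<noteq> 0. \<Sum>l | l \<in> source_fibre G x \<and> b' l \<noteq> 0. cnj (b k) * b' l * \<kappa> k l)"
proof -
  let ?S = "{k. k \<in> source_fibre G x \<and> b k \<noteq> 0}" and ?S' = "{l. l \<in> source_fibre G x \<and> b' l \<noteq> 0}"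
  let ?F = "conv (star b) b'"
  define D where "D = (\<lambda>(k, l). iv k \<odot> l) ` {(k, l) \<in> ?S \<times> ?S'. rg k = rg l}"
  have fin: "finite ?S" "finite ?S'" using Cc_finite_source b b' by auto
  then have finD: "finite D" unfolding D_def by (intro finite_imageI) (rule finite_subset[of _ "?S \<times> ?S'"], auto)
  have SA: "k \<in> Arr" "sc k = x" if "k \<in> ?S" for k using that by (simp_all add: source_fibre_def)
  have SA': "k \<in> Arr" "sc k = x" if "k \<in> ?S'" for k using that by (simp_all add: source_fibre_def)
  have D\<Gamma>: "D \<subseteq> \<Gamma> x"
  proof
    fix \<delta> assume "\<delta> \<in> D"
    then obtain k l where kl: "k \<in> ?S" "l \<in> ?S'" "rg k = rg l" "\<delta> = iv k \<odot> l" by (auto simp: D_def)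
    show "\<delta> \<in> \<Gamma> x"
      unfolding kl(4) isotropy_iff using SA[OF kl(1)] SA'[OF kl(2)] kl(3) by simp
  qed
  have Fd: "?F \<delta> = (\<Sum>h\<in>?S'. cnj (b (h \<odot> iv \<delta>)) * b' h)" if \<delta>: "\<delta> \<in> \<Gamma> x" for \<delta>
  proof -
    have \<delta>A: "\<delta> \<in> Arr" "sc \<delta> = x" "rg \<delta> = x" using \<delta> by (simp_all add: isotropyD)
    have "?F \<delta> = (\<Sum>h\<in>?S'. star b (\<delta> \<odot> iv h) * b' h)"
      using \<delta>A by (simp add: conv_def)
    also have "\<dots> = (\<Sum>h\<in>?S'. cnj (b (h \<odot> iv \<delta>)) * b' h)"
      by (intro sum.cong refl) (use \<delta>A SA' in \<open>simp add: star_def\<close>)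
    finally show ?thesis .
  qed
  have FD: "{\<gamma>. \<gamma> \<in> \<Gamma> x \<and> ?F \<gamma> \<noteq> 0} \<subseteq> D"
  proof
    fix \<delta> assume "\<delta> \<in> {\<gamma>. \<gamma> \<in> \<Gamma> x \<and> ?F \<gamma> \<noteq> 0}"
    then have \<delta>: "\<delta> \<in> \<Gamma> x" "?F \<delta> \<noteq> 0" by auto
    have \<delta>A: "\<delta> \<in> Arr" "sc \<delta> = x" "rg \<delta> = x" using \<delta>(1) by (simp_all add: isotropyD)
    have "(\<Sum>h\<in>?S'. cnj (b (h \<odot> iv \<delta>)) * b' h) \<noteq> 0" using \<delta> Fd by simp
    then obtain h where h: "h \<in> ?S'" "b (h \<odot> iv \<delta>) \<noteq> 0"
      by (rule sum.not_neutral_contains_not_neutral) auto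
    let ?k = "h \<odot> iv \<delta>"
    have "?k \<in> ?S" "rg ?k = rg h" using h \<delta>A SA'[OF h(1)] by (simp_all add: source_fibre_def)
    moreover have "iv ?k \<odot> h = \<delta>"
      using \<delta>A SA'[OF h(1)] by simp
    ultimately show "\<delta> \<in> D" unfolding D_def using h(1) by (intro image_eqI[of _ _ "(?k, h)"]) auto
  qed
  have inner: "(\<Sum>\<delta>\<in>D. cnj (b (h \<odot> iv \<delta>)) * \<psi> \<delta>) = (\<Sum>k\<in>?S. cnj (b k) * \<kappa> k h)" if h: "h \<in> ?S'" for h
  proof -
    note hA = SA'[OF h]
    have "(\<Sum>\<delta>\<in>D. cnj (b (h \<odot> iv \<delta>)) * \<psi> \<delta>) = (\<Sum>\<delta>\<in>{\<delta> \<in> D. b (h \<odot> iv \<delta>) \<noteq> 0}. cnj (b (h \<odot> iv \<delta>)) * \<psi> \<delta>)"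
      by (rule sum.mono_neutral_right) (use finD in auto)
    also have "\<dots> = (\<Sum>k\<in>{k \<in> ?S. rg k = rg h}. cnj (b k) * \<psi> (iv k \<odot> h))"
    proof (rule sum.reindex_bij_witness[of _ "\<lambda>k. iv k \<odot> h" "\<lambda>\<delta>. h \<odot> iv \<delta>"])
      fix \<delta> assume d: "\<delta> \<in> {\<delta> \<in> D. b (h \<odot> iv \<delta>) \<noteq> 0}"
      then have \<delta>A: "\<delta> \<in> Arr" "sc \<delta> = x" "rg \<delta> = x" using D\<Gamma> by (auto dest: isotropyD)
      show e: "iv (h \<odot> iv \<delta>) \<odot> h = \<delta>" using \<delta>A hA by simp
      show "h \<odot> iv \<delta> \<in> {k \<in> ?S. rg k = rg h}" using d \<delta>A hA by (simp add: source_fibre_def)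
      show "cnj (b (h \<odot> iv \<delta>)) * \<psi> (iv (h \<odot> iv \<delta>) \<odot> h) = cnj (b (h \<odot> iv \<delta>)) * \<psi> \<delta>" by (simp only: e)
    next
      fix k assume k: "k \<in> {k \<in> ?S. rg k = rg h}"
      then have kA: "k \<in> Arr" "sc k = x" "rg k = rg h" using SA by auto
      show e: "h \<odot> iv (iv k \<odot> h) = k" using kA hA by simp
      have "iv k \<odot> h \<in> D" unfolding D_def using k h by (intro image_eqI[of _ _ "(k, h)"]) auto
      then show "iv k \<odot> h \<in> {\<delta> \<in> D. b (h \<odot> iv \<delta>) \<noteq> 0}" using k e by simp
    qed
    also have "\<dots> = (\<Sum>k\<in>{k \<in> ?S. rg k = rg h}. cnj (b k) * \<kappa> k h)"
      by (intro sum.cong refl) (simp add: \<kappa>_def)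
    also have "\<dots> = (\<Sum>k\<in>?S. cnj (b k) * \<kappa> k h)"
      by (rule sum.mono_neutral_left) (use fin(1) in \<open>auto simp: \<kappa>_def\<close>)
    finally show ?thesis .
  qed
  have "\<Phi> (rho_sum G (star b) o\<^sub>L rho_sum G b') = \<Phi> (rho_sum G ?F)"
    by (simp only: rho_sum_conv[OF star_Cc[OF b] b'])
  also have "\<dots> = (\<Sum>\<gamma> | \<gamma> \<in> \<Gamma> x \<and> ?F \<gamma> \<noteq> 0. ?F \<gamma> * \<psi> \<gamma>)"
    by (rule \<Phi>_Cc[OF conv_Cc[OF star_Cc[OF b] b']])
  also have "\<dots> = (\<Sum>\<delta>\<in>D. ?F \<delta> * \<psi> \<delta>)"
    by (rule sum.mono_neutral_left[OF finD FD]) (use D\<Gamma> in auto)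
  also have "\<dots> = (\<Sum>\<delta>\<in>D. \<Sum>h\<in>?S'. b' h * (cnj (b (h \<odot> iv \<delta>)) * \<psi> \<delta>))"
  proof (intro sum.cong refl)
    fix \<delta> assume "\<delta> \<in> D"
    then have "\<delta> \<in> \<Gamma> x" using D\<Gamma> by blast
    from Fd[OF this] show "?F \<delta> * \<psi> \<delta> = (\<Sum>h\<in>?S'. b' h * (cnj (b (h \<odot> iv \<delta>)) * \<psi> \<delta>))"
      unfolding sum_distrib_right by (simp add: sum_distrib_left mult_ac)
  qed
  also have "\<dots> = (\<Sum>h\<in>?S'. b' h * (\<Sum>\<delta>\<in>D. cnj (b (h \<odot> iv \<delta>)) * \<psi> \<delta>))"
    by (subst sum.swap) (simp add: sum_distrib_left)
  also have "\<dots> = (\<Sum>h\<in>?S'. b' h * (\<Sum>k\<in>?S. cnj (b k) * \<kappa> k h))"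
    by (intro sum.cong refl arg_cong2[of _ _ _ _ "(*)"] inner)
  also have "\<dots> = (\<Sum>k\<in>?S. \<Sum>h\<in>?S'. cnj (b k) * b' h * \<kappa> k h)"
    by (subst sum.swap) (simp add: sum_distrib_left mult_ac)
  finally show ?thesis .
qed

lemma \<phi>_star_conv_nonneg:
  assumes b: "b \<in> Cc G" shows "0 \<le> \<phi> (rho_sum G (star b) o\<^sub>L rho_sum G b)"
proof (rule \<phi>_accretive)
  fix u
  have "inner u ((rho_sum G (star b) o\<^sub>L rho_sum G b) u) = Re (cinner (rho_sum G b u) (rho_sum G b u))"
    by (simp add: Re_cinner[symmetric] adjoint_pairD[OF adjoint_rho_sum[OF b]])
  then show "0 \<le> inner u ((rho_sum G (star b) o\<^sub>L rho_sum G b) u)" by (simp add: cinner_self)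
qed

text \<open>Extended by zero off the isotropy group, since \<open>kolmogorov_decomposition\<close>
  takes kernels on a whole type.\<close>

definition kern :: "'g \<Rightarrow> 'g \<Rightarrow> complex" where
  "kern s t = (if s \<in> \<Gamma> x \<and> t \<in> \<Gamma> x then \<psi> (iv s \<odot> t) else 0)"

lemma kern_hermitian: "kern t s = cnj (kern s t)"
proof (cases "s \<in> \<Gamma> x \<and> t \<in> \<Gamma> x")
  case True
  then have "iv s \<odot> t \<in> \<Gamma> x" by (simp add: isotropy_closed)
  moreover have "iv (iv s \<odot> t) = iv t \<odot> s"
    using True isotropyD[of s x] isotropyD[of t x] by simp
  ultimately show ?thesis using True \<psi>_inv by (metis kern_def)
next
  case False
  then show ?thesis by (auto simp: kern_def)
qed

text \<open>The coefficients, extended by zero to the source fibre, are interpolated by a function b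
  in \<open>Cc G\<close>. The form is then \<Phi> at star b times b, and this operator is
  accretive.\<close>

lemma kern_positive:
  assumes "finite F"
  shows "0 \<le> Re (\<Sum>s\<in>F. \<Sum>t\<in>F. cnj (c s) * c t * kern s t)"
proof -
  define d where "d g = (if g \<in> F \<inter> \<Gamma> x then c g else 0)" for g
  have sub: "{g. d g \<noteq> 0} \<subseteq> F" by (auto simp: d_def)
  have "d \<in> finitely_supported (source_fibre G x)"
    using finite_subset[OF sub assms]
    by (auto simp: finitely_supported_def d_def isotropy_iff source_fibre_def)
  then obtain b where b: "b \<in> Cc G" "\<And>g. g \<in> source_fibre G x \<Longrightarrow> b g = d g"
    by (rule finitely_supported_extend) (rule that)
  let ?S = "{k. k \<in> source_fibre G x \<and> b k \<noteq> 0}"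
  have S: "?S = {g. d g \<noteq> 0}"
    using b(2) by (auto simp: d_def isotropy_iff source_fibre_def split: if_splits)
  have "\<Phi> (rho_sum G (star b) o\<^sub>L rho_sum G b) = (\<Sum>k\<in>?S. \<Sum>l\<in>?S. cnj (b k) * b l * \<kappa> k l)"
    by (rule \<Phi>_star_conv[OF b(1) b(1)])
  also have "\<dots> = (\<Sum>k\<in>?S. \<Sum>l\<in>?S. cnj (c k) * c l * kern k l)"
  proof (intro sum.cong refl)
    fix k l assume kl: "k \<in> ?S" "l \<in> ?S"
    then have "d k \<noteq> 0" "d l \<noteq> 0" using S by blast+
    then have "k \<in> \<Gamma> x" "l \<in> \<Gamma> x" "d k = c k" "d l = c l" by (auto simp: d_def split: if_splits)
    moreover have "b k = d k" "b l = d l" using kl b(2) by auto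
    ultimately show "cnj (b k) * b l * \<kappa> k l = cnj (c k) * c l * kern k l"
      using isotropyD[of k x] isotropyD[of l x] by (simp add: \<kappa>_def kern_def)
  qed
  also have "\<dots> = (\<Sum>s\<in>F. \<Sum>t\<in>F. cnj (c s) * c t * kern s t)"
  proof -
    have z: "cnj (c s) * c t * kern s t = 0" if "s \<in> F" "t \<in> F" "s \<notin> ?S \<or> t \<notin> ?S" for s t
      using that unfolding S by (auto simp: d_def kern_def)
    have SF: "?S \<subseteq> F" unfolding S by (rule sub)
    have "(\<Sum>k\<in>?S. \<Sum>l\<in>?S. cnj (c k) * c l * kern k l) = (\<Sum>k\<in>?S. \<Sum>l\<in>F. cnj (c k) * c l * kern k l)"
    proof (rule sum.cong[OF refl])
      fix k assume k: "k \<in> ?S"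
      show "(\<Sum>l\<in>?S. cnj (c k) * c l * kern k l) = (\<Sum>l\<in>F. cnj (c k) * c l * kern k l)"
      proof (rule sum.mono_neutral_left[OF assms SF], intro ballI)
        fix l assume l: "l \<in> F - ?S"
        show "cnj (c k) * c l * kern k l = 0" by (rule z[OF subsetD[OF SF k]]) (use l in auto)
      qed
    qed
    also have "\<dots> = (\<Sum>k\<in>F. \<Sum>l\<in>F. cnj (c k) * c l * kern k l)"
    proof (rule sum.mono_neutral_left[OF assms SF], intro ballI sum.neutral)
      fix k l assume k: "k \<in> F - ?S" and l: "l \<in> F"
      show "cnj (c k) * c l * kern k l = 0" by (rule z[OF _ l]) (use k in auto)
    qed
    finally show ?thesis .
  qed
  finally show ?thesis
    using \<phi>_star_conv_nonneg[OF b(1)] by (metis Re_\<Phi>)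
qed

subsection \<open>The representation of the isotropy group\<close>

definition v :: "'g \<Rightarrow> ('g \<times> nat) ell2" where
  "v = (SOME v. \<forall>s t. cinner (v s) (v t) = kern s t)"

lemma cinner_v: "cinner (v s) (v t) = kern s t"
proof -
  have "\<exists>w :: 'g \<Rightarrow> ('g \<times> nat) ell2. \<forall>s t. cinner (w s) (w t) = kern s t"
  \<comment> \<open>The target is the type over which \<open>exotic_norm\<close> takes its supremum;
    the arrow g is given the coordinate (g, 0).\<close>
  proof (rule kolmogorov_decomposition[of "\<lambda>g. (g, 0)" kern])
    show "inj (\<lambda>g :: 'g. (g, 0 :: nat))" by (simp add: inj_on_def)
    show "kern t s = cnj (kern s t)" for s t by (rule kern_hermitian)
    show "0 \<le> Re (\<Sum>s\<in>F. \<Sum>t\<in>F. cnj (c s) * c t * kern s t)" if "finite F" for F c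
      by (rule kern_positive[OF that])
  qed blast
  from someI_ex[OF this] show ?thesis unfolding v_def by blast
qed

definition H :: "('g \<times> nat) ell2 set" where
  "H = closed_cspan (\<Gamma> x) v"

definition isometry_on_H :: "(('g \<times> nat) ell2 \<Rightarrow> ('g \<times> nat) ell2) \<Rightarrow> bool" where
  "isometry_on_H U \<longleftrightarrow> (\<forall>u\<in>H. U u \<in> H \<and> norm (U u) = norm u \<and>
     (\<forall>c. U (cscale c u) = cscale c (U u)) \<and> (\<forall>w\<in>H. U (u + w) = U u + U w))"

lemma H_closed: "closed H" "0 \<in> H" "u \<in> H \<Longrightarrow> w \<in> H \<Longrightarrow> u + w \<in> H" "u \<in> H \<Longrightarrow> cscale c u \<in> H"
    "u \<in> H \<Longrightarrow> w \<in> H \<Longrightarrow> u - w \<in> H" "s \<in> \<Gamma> x \<Longrightarrow> v s \<in> H"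
  by (simp_all add: H_def closed_cspan_add closed_cspan_scale closed_cspan_diff closed_cspan_base)

lemma lincomb_in_H:
  assumes "c \<in> finitely_supported (\<Gamma> x)" "\<And>s. s \<in> \<Gamma> x \<Longrightarrow> w s \<in> H"
  shows "lincomb c w \<in> H"
proof -
  have fin: "finite {s. c s \<noteq> 0}" and sub: "{s. c s \<noteq> 0} \<subseteq> \<Gamma> x"
    using assms(1) by (simp_all add: finitely_supported_def)
  have "(\<Sum>s\<in>T. cscale (c s) (w s)) \<in> H" if "T \<subseteq> {s. c s \<noteq> 0}" for T
    using finite_subset[OF that fin] that
  proof (induction T rule: finite_induct)
    case (insert s T)
    then have "s \<in> \<Gamma> x" using sub by blast
    with insert show ?case by (simp add: H_closed assms(2))
  qed (simp add: H_closed)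
  then show ?thesis by (simp add: lincomb_def)
qed

lemma isometry_on_H_diff:
  assumes "isometry_on_H U" "u \<in> H" "w \<in> H" shows "U (u - w) = U u - U w"
proof -
  have "U (u + cscale (-1) w) = U u + cscale (-1) (U w)"
    using assms H_closed(4) unfolding isometry_on_H_def by metis
  then show ?thesis by simp
qed

lemma isometry_on_H_tendsto:
  assumes U: "isometry_on_H U" and f: "\<And>n. f n \<in> H" "f \<longlonglongrightarrow> u"
  shows "(\<lambda>n. U (f n)) \<longlonglongrightarrow> U u"
proof -
  have u: "u \<in> H" by (rule closed_sequentially[OF H_closed(1) f])
  have "norm (U (f n) - U u) = norm (f n - u)" for n
    using isometry_on_H_diff[OF U f(1) u] U H_closed(5)[OF f(1) u] unfolding isometry_on_H_def by metis
  then have "(\<lambda>n. norm (U (f n) - U u)) \<longlonglongrightarrow> 0"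
    using tendsto_norm_zero[OF LIM_zero[OF f(2)]] by simp
  then show ?thesis by (rule LIM_zero_cancel[OF tendsto_norm_zero_cancel])
qed

lemma isometry_on_H_lincomb:
  assumes U: "isometry_on_H U" and c: "c \<in> finitely_supported (\<Gamma> x)"
  shows "U (lincomb c v) = lincomb c (\<lambda>s. U (v s))"
proof -
  have fin: "finite {s. c s \<noteq> 0}" and sub: "{s. c s \<noteq> 0} \<subseteq> \<Gamma> x"
    using c by (simp_all add: finitely_supported_def)
  have U0: "U 0 = 0" using U H_closed(2) unfolding isometry_on_H_def by (metis norm_eq_zero)
  have "(\<Sum>s\<in>T. cscale (c s) (v s)) \<in> H \<and> U (\<Sum>s\<in>T. cscale (c s) (v s)) = (\<Sum>s\<in>T. cscale (c s) (U (v s)))"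
    if "T \<subseteq> {s. c s \<noteq> 0}" for T
    using finite_subset[OF that fin] that
  proof (induction T rule: finite_induct)
    case (insert s T)
    then have s: "v s \<in> H" using sub by (intro H_closed(6)) blast
    have IH: "(\<Sum>s\<in>T. cscale (c s) (v s)) \<in> H" "U (\<Sum>s\<in>T. cscale (c s) (v s)) = (\<Sum>s\<in>T. cscale (c s) (U (v s)))"
      using insert by auto
    have "U (cscale (c s) (v s) + (\<Sum>s\<in>T. cscale (c s) (v s))) = U (cscale (c s) (v s)) + U (\<Sum>s\<in>T. cscale (c s) (v s))"
      using U IH(1) H_closed(4)[OF s] unfolding isometry_on_H_def by blast
    moreover have "U (cscale (c s) (v s)) = cscale (c s) (U (v s))"
      using U s unfolding isometry_on_H_def by blast
    ultimately show ?case using insert.hyps IH H_closed(3)[OF H_closed(4)[OF s] IH(1)] by simp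
  qed (simp add: U0 H_closed)
  then show ?thesis by (simp add: lincomb_def)
qed

lemma isometry_on_H_unique:
  assumes U: "isometry_on_H U" and U': "isometry_on_H U'" and eq: "\<And>s. s \<in> \<Gamma> x \<Longrightarrow> U (v s) = U' (v s)"
    and u: "u \<in> H"
  shows "U u = U' u"
proof -
  obtain f where f: "\<And>n. f n \<in> (\<lambda>c. lincomb c v) ` finitely_supported (\<Gamma> x)" "f \<longlonglongrightarrow> u"
    by (rule closure_sequenceE[OF u[unfolded H_def closed_cspan_def]]) (rule that)
  have "f n \<in> H \<and> U (f n) = U' (f n)" for n
  proof -
    obtain c where c: "c \<in> finitely_supported (\<Gamma> x)" "f n = lincomb c v" using f(1)[of n] by blast
    have "lincomb c (\<lambda>s. U (v s)) = lincomb c (\<lambda>s. U' (v s))"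
      unfolding lincomb_def
      by (intro sum.cong refl) (use c(1) eq in \<open>auto simp: finitely_supported_def\<close>)
    then show ?thesis
      using isometry_on_H_lincomb[OF U c(1)] isometry_on_H_lincomb[OF U' c(1)] c
      by (simp add: H_def lincomb_in_closed_cspan)
  qed
  then have "(\<lambda>n. U (f n)) \<longlonglongrightarrow> U u" "(\<lambda>n. U (f n)) \<longlonglongrightarrow> U' u"
    using isometry_on_H_tendsto[OF U _ f(2)] isometry_on_H_tendsto[OF U' _ f(2)] by auto
  then show ?thesis by (rule LIMSEQ_unique)
qed

definition \<pi> :: "'g \<Rightarrow> ('g \<times> nat) ell2 \<Rightarrow> ('g \<times> nat) ell2" where
  "\<pi> \<gamma> = (SOME U. isometry_on_H U \<and> (\<forall>s\<in>\<Gamma> x. U (v s) = v (\<gamma> \<odot> s)))"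

text \<open>Left translation by \<gamma> preserves the Gram kernel, because (\<gamma> s)^{-1}
  (\<gamma> t) = s^{-1} t, and so extends to an isometry. This is the representation with cyclic
  vector v x whose coefficient is \<psi>.\<close>

lemma \<pi>:
  assumes \<gamma>: "\<gamma> \<in> \<Gamma> x"
  shows "isometry_on_H (\<pi> \<gamma>)" "s \<in> \<Gamma> x \<Longrightarrow> \<pi> \<gamma> (v s) = v (\<gamma> \<odot> s)"
proof -
  have gram: "cinner (v s) (v t) = cinner (v (\<gamma> \<odot> s)) (v (\<gamma> \<odot> t))" if st: "s \<in> \<Gamma> x" "t \<in> \<Gamma> x" for s t
  proof -
    note A = isotropyD[OF \<gamma>] isotropyD[OF st(1)] isotropyD[OF st(2)]
    have "iv (\<gamma> \<odot> s) \<odot> (\<gamma> \<odot> t) = iv s \<odot> t"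
      using A mult_assoc[of "iv s" "iv \<gamma>" "\<gamma> \<odot> t"] by simp
    then show ?thesis using st by (simp add: cinner_v kern_def isotropy_closed[OF \<gamma>])
  qed
  obtain U where U0: "\<And>u. u \<in> closed_cspan (\<Gamma> x) v \<Longrightarrow> U u \<in> closed_cspan (\<Gamma> x) (\<lambda>s. v (\<gamma> \<odot> s))"
    "\<And>u. u \<in> closed_cspan (\<Gamma> x) v \<Longrightarrow> norm (U u) = norm u"
    "\<And>u w. u \<in> closed_cspan (\<Gamma> x) v \<Longrightarrow> w \<in> closed_cspan (\<Gamma> x) v \<Longrightarrow> U (u + w) = U u + U w"
    "\<And>c u. u \<in> closed_cspan (\<Gamma> x) v \<Longrightarrow> U (cscale c u) = cscale c (U u)"
    "\<And>s. s \<in> \<Gamma> x \<Longrightarrow> U (v s) = v (\<gamma> \<odot> s)"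
    by (rule isometry_extension[of "\<Gamma> x" v "\<lambda>s. v (\<gamma> \<odot> s)", OF gram]) (assumption | rule that)+
  note U = U0[folded H_def]
  have "closed_cspan (\<Gamma> x) (\<lambda>s. v (\<gamma> \<odot> s)) \<subseteq> H"
    unfolding closed_cspan_def
    by (rule closure_minimal[OF _ H_closed(1)])
      (auto intro!: lincomb_in_H H_closed(6) isotropy_closed \<gamma>)
  then have "isometry_on_H U" unfolding isometry_on_H_def using U(1-4) by blast
  then have "\<exists>U. isometry_on_H U \<and> (\<forall>s\<in>\<Gamma> x. U (v s) = v (\<gamma> \<odot> s))" using U(5) by blast
  from someI_ex[OF this] show "isometry_on_H (\<pi> \<gamma>)" "s \<in> \<Gamma> x \<Longrightarrow> \<pi> \<gamma> (v s) = v (\<gamma> \<odot> s)"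
    unfolding \<pi>_def by blast+
qed

lemma \<pi>_simps:
  assumes "\<gamma> \<in> \<Gamma> x" "u \<in> H"
  shows "\<pi> \<gamma> u \<in> H" "norm (\<pi> \<gamma> u) = norm u" "\<pi> \<gamma> (cscale c u) = cscale c (\<pi> \<gamma> u)"
    "w \<in> H \<Longrightarrow> \<pi> \<gamma> (u + w) = \<pi> \<gamma> u + \<pi> \<gamma> w"
  using \<pi>(1)[OF assms(1)] assms(2) unfolding isometry_on_H_def by blast+

lemma \<pi>_mult:
  assumes \<gamma>: "\<gamma> \<in> \<Gamma> x" "\<delta> \<in> \<Gamma> x" and u: "u \<in> H"
  shows "\<pi> (\<gamma> \<odot> \<delta>) u = \<pi> \<gamma> (\<pi> \<delta> u)"
proof (rule isometry_on_H_unique[of "\<pi> (\<gamma> \<odot> \<delta>)" "\<lambda>u. \<pi> \<gamma> (\<pi> \<delta> u)", OF \<pi>(1)[OF isotropy_closed(1)[OF \<gamma>]] _ _ u])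
  show "isometry_on_H (\<lambda>u. \<pi> \<gamma> (\<pi> \<delta> u))"
    unfolding isometry_on_H_def by (simp add: \<pi>_simps \<gamma>)
  fix s assume s: "s \<in> \<Gamma> x"
  have "\<gamma> \<odot> \<delta> \<odot> s = \<gamma> \<odot> (\<delta> \<odot> s)"
    using isotropyD[OF \<gamma>(1)] isotropyD[OF \<gamma>(2)] isotropyD[OF s] by (intro mult_assoc) simp_all
  then show "\<pi> (\<gamma> \<odot> \<delta>) (v s) = \<pi> \<gamma> (\<pi> \<delta> (v s))"
    using \<pi>(2)[OF isotropy_closed(1)[OF \<gamma>] s] \<pi>(2)[OF \<gamma>(2) s] \<pi>(2)[OF \<gamma>(1) isotropy_closed(1)[OF \<gamma>(2) s]]
    by simp
qed

lemma \<pi>_one: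
  assumes u: "u \<in> H" shows "\<pi> x u = u"
proof (rule isometry_on_H_unique[OF \<pi>(1)[OF isotropy_one[OF x]] _ _ u, of "\<lambda>u. u"])
  show "isometry_on_H (\<lambda>u. u)" by (simp add: isometry_on_H_def)
  fix s assume s: "s \<in> \<Gamma> x"
  have "x \<odot> s = s" using range_mult[of s] isotropyD[OF s] by simp
  then show "\<pi> x (v s) = v s" using \<pi>(2)[OF isotropy_one[OF x] s] by simp
qed

lemma unitary_rep_\<pi>: "unitary_rep (isotropy G x) H \<pi>"
proof -
  have "H \<subseteq> \<pi> \<gamma> ` H" if \<gamma>: "\<gamma> \<in> \<Gamma> x" for \<gamma>
  proof
    fix u assume u: "u \<in> H"
    have "\<gamma> \<odot> iv \<gamma> = x" using isotropyD[OF \<gamma>] by (simp add: inv_mult)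
    then have "u = \<pi> \<gamma> (\<pi> (iv \<gamma>) u)"
      using \<pi>_mult[OF \<gamma> isotropy_closed(2)[OF \<gamma>] u] \<pi>_one[OF u] by simp
    then show "u \<in> \<pi> \<gamma> ` H" using \<pi>_simps(1)[OF isotropy_closed(2)[OF \<gamma>] u] by blast
  qed
  then have "\<pi> \<gamma> ` H = H" if "\<gamma> \<in> \<Gamma> x" for \<gamma> using \<pi>_simps(1) that by blast
  then show ?thesis
    unfolding unitary_rep_def by (simp add: H_closed \<pi>_simps \<pi>_mult)
qed

end

section \<open>The induced representation\<close>

lemma closed_cspan_sum:
  "finite F \<Longrightarrow> (\<And>i. i \<in> F \<Longrightarrow> f i \<in> closed_cspan S v) \<Longrightarrow> (\<Sum>i\<in>F. f i) \<in> closed_cspan S v"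
  by (induction F rule: finite_induct) (simp_all add: closed_cspan_add)

context unit_state
begin

abbreviation "Gx \<equiv> source_fibre G x"
abbreviation "cosets \<equiv> isotropy_cosets G x"
abbreviation "IS \<equiv> ind_space G x H \<pi>"
abbreviation rep :: "'g set \<Rightarrow> 'g" where "rep C \<equiv> (SOME g. g \<in> C)"

lemma GxD: "g \<in> Gx \<Longrightarrow> g \<in> Arr" "g \<in> Gx \<Longrightarrow> sc g = x"
  by (simp_all add: source_fibre_def)

lemma GxI: "g \<in> Arr \<Longrightarrow> sc g = x \<Longrightarrow> g \<in> Gx"
  by (simp add: source_fibre_def)

lemma Gx_mult: "g \<in> Gx \<Longrightarrow> h \<in> \<Gamma> x \<Longrightarrow> g \<odot> h \<in> Gx" "g \<in> Gx \<Longrightarrow> h \<in> \<Gamma> x \<Longrightarrow> rg (g \<odot> h) = rg g"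
  using isotropyD[of h x] by (simp_all add: source_fibre_def)

lemma Gx_quot: "g \<in> Gx \<Longrightarrow> k \<in> Gx \<Longrightarrow> rg g = rg k \<Longrightarrow> iv g \<odot> k \<in> \<Gamma> x"
  by (simp add: source_fibre_def isotropy_iff)

text \<open>For arrows with source x, lying in the same coset and having the same range are the same
  thing. Cosets are handled through ranges from here on.\<close>

lemma coset_eq:
  assumes "g \<in> Gx" shows "(\<lambda>h. g \<odot> h) ` \<Gamma> x = {k \<in> Gx. rg k = rg g}"
proof
  show "(\<lambda>h. g \<odot> h) ` \<Gamma> x \<subseteq> {k \<in> Gx. rg k = rg g}" using assms Gx_mult by blast
  show "{k \<in> Gx. rg k = rg g} \<subseteq> (\<lambda>h. g \<odot> h) ` \<Gamma> x"
  proof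
    fix k assume k: "k \<in> {k \<in> Gx. rg k = rg g}"
    then have "iv g \<odot> k \<in> \<Gamma> x" "k = g \<odot> (iv g \<odot> k)"
      using assms Gx_quot by (auto simp: source_fibre_def)
    then show "k \<in> (\<lambda>h. g \<odot> h) ` \<Gamma> x" by blast
  qed
qed

lemma cosets_iff: "C \<in> cosets \<longleftrightarrow> (\<exists>g\<in>Gx. C = {k \<in> Gx. rg k = rg g})"
  unfolding isotropy_cosets_def using coset_eq by auto

lemma coset_rep:
  assumes "C \<in> cosets"
  shows "rep C \<in> C" "rep C \<in> Gx" "C = {k \<in> Gx. rg k = rg (rep C)}"
proof -
  obtain g where g: "g \<in> Gx" "C = {k \<in> Gx. rg k = rg g}" using assms cosets_iff by blast
  then have "g \<in> C" by simp
  then show r: "rep C \<in> C" by (rule someI)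
  show "rep C \<in> Gx" using r g(2) by blast
  have "rg (rep C) = rg g" using r g(2) by blast
  then show "C = {k \<in> Gx. rg k = rg (rep C)}" using g(2) by simp
qed

lemma coset_of:
  assumes "g \<in> Gx"
  shows "{k \<in> Gx. rg k = rg g} \<in> cosets" "rg (rep {k \<in> Gx. rg k = rg g}) = rg g"
proof -
  show C: "{k \<in> Gx. rg k = rg g} \<in> cosets" using cosets_iff assms by blast
  show "rg (rep {k \<in> Gx. rg k = rg g}) = rg g" using coset_rep(1)[OF C] by blast
qed

definition sqs :: "('g \<Rightarrow> ('g \<times> nat) ell2) \<Rightarrow> bool" where
  "sqs \<xi> \<longleftrightarrow> (\<lambda>C. (norm (\<xi> (rep C)))\<^sup>2) summable_on cosets"

text \<open>\<open>J\<close> identifies the space of the induced representation with a closed subspace of a Hilbert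
  space of square-summable functions.\<close>

definition J :: "('g \<Rightarrow> ('g \<times> nat) ell2) \<Rightarrow> ('g set \<times> 'g \<times> nat) ell2" where
  "J \<xi> = Abs_ell2 (\<lambda>(C, i). if C \<in> cosets then Rep_ell2 (\<xi> (rep C)) i else 0)"

lemma Rep_J:
  assumes "sqs \<xi>"
  shows "Rep_ell2 (J \<xi>) (C, i) = (if C \<in> cosets then Rep_ell2 (\<xi> (rep C)) i else 0)"
proof -
  let ?f = "\<lambda>(C, i). if C \<in> cosets then Rep_ell2 (\<xi> (rep C)) i else 0"
  let ?S = "infsum (\<lambda>C. (norm (\<xi> (rep C)))\<^sup>2) cosets"
  have "(\<Sum>p\<in>F. (cmod (?f p))\<^sup>2) \<le> ?S" if F: "finite F" for F
  proof -
    let ?A = "fst ` F \<inter> cosets" and ?B = "snd ` F"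
    \<comment> \<open>The finite set of pairs is enlarged to a rectangle, so that the sum can be
      bounded coset by coset.\<close>
    have "(\<Sum>p\<in>F. (cmod (?f p))\<^sup>2) \<le> (\<Sum>p\<in>fst ` F \<times> ?B. (cmod (?f p))\<^sup>2)"
      by (rule sum_mono2) (use F in \<open>force+\<close>)
    also have "\<dots> = (\<Sum>C\<in>fst ` F. \<Sum>i\<in>?B. (cmod (?f (C, i)))\<^sup>2)"
      by (simp only: sum.cartesian_product case_prod_unfold prod.collapse fst_conv snd_conv)
    also have "\<dots> = (\<Sum>C\<in>?A. \<Sum>i\<in>?B. (cmod (?f (C, i)))\<^sup>2)"
      by (rule sum.mono_neutral_right) (use F in auto)
    also have "\<dots> \<le> (\<Sum>C\<in>?A. (norm (\<xi> (rep C)))\<^sup>2)"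
    proof (rule sum_mono)
      fix C assume "C \<in> ?A"
      then have "(\<Sum>i\<in>?B. (cmod (?f (C, i)))\<^sup>2) = (\<Sum>i\<in>?B. (cmod (Rep_ell2 (\<xi> (rep C)) i))\<^sup>2)" by simp
      then show "(\<Sum>i\<in>?B. (cmod (?f (C, i)))\<^sup>2) \<le> (norm (\<xi> (rep C)))\<^sup>2"
        using ell2_finite_sum_le[of ?B "\<xi> (rep C)"] F by simp
    qed
    also have "\<dots> \<le> ?S"
      using assms F by (intro finite_sum_le_infsum) (auto simp: sqs_def)
    finally show ?thesis .
  qed
  then have "(\<lambda>p. (cmod (?f p))\<^sup>2) summable_on UNIV"
    by (intro nonneg_bdd_above_summable_on bdd_aboveI) auto
  then show ?thesis by (simp add: J_def Abs_ell2_inverse)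
qed

lemma J_inner:
  assumes "sqs \<xi>" "sqs \<eta>"
  shows "cinner (J \<xi>) (J \<eta>) = ind_inner G x \<xi> \<eta>"
proof -
  let ?f = "\<lambda>C i. cnj (Rep_ell2 (J \<xi>) (C, i)) * Rep_ell2 (J \<eta>) (C, i)"
  have "(\<lambda>p. cnj (Rep_ell2 (J \<xi>) p) * Rep_ell2 (J \<eta>) p) summable_on UNIV"
    by (intro ell2_inner_summable Rep_ell2_summable)
  then have s: "(\<lambda>(C, i). ?f C i) summable_on UNIV \<times> UNIV" by (simp add: case_prod_unfold)
  have "cinner (J \<xi>) (J \<eta>) = infsum (\<lambda>(C, i). ?f C i) (UNIV \<times> UNIV)"
    by (simp add: cinner.rep_eq case_prod_unfold)
  also have "\<dots> = (\<Sum>\<^sub>\<infinity>C. \<Sum>\<^sub>\<infinity>i. ?f C i)"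
    by (rule infsum_Sigma'_banach[OF s, symmetric])
  also have "\<dots> = (\<Sum>\<^sub>\<infinity>C. if C \<in> cosets then cinner (\<xi> (rep C)) (\<eta> (rep C)) else 0)"
    by (intro infsum_cong) (simp add: Rep_J assms cinner.rep_eq)
  also have "\<dots> = ind_inner G x \<xi> \<eta>"
    unfolding ind_inner_def by (rule infsum_cong_neutral) auto
  finally show ?thesis .
qed

lemma ind_norm_J: "sqs \<xi> \<Longrightarrow> ind_norm G x \<xi> = norm (J \<xi>)"
  unfolding ind_norm_def by (simp add: J_inner[symmetric] cinner_self)

lemma norm_J_sq:
  assumes "sqs \<xi>"
  shows "(norm (J \<xi>))\<^sup>2 = (\<Sum>\<^sub>\<infinity>C\<in>cosets. (norm (\<xi> (rep C)))\<^sup>2)"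
proof -
  have "of_real ((norm (J \<xi>))\<^sup>2) = (\<Sum>\<^sub>\<infinity>C\<in>cosets. complex_of_real ((norm (\<xi> (rep C)))\<^sup>2))"
    unfolding cinner_self[symmetric] J_inner[OF assms assms] ind_inner_def ..
  also have "\<dots> = of_real (\<Sum>\<^sub>\<infinity>C\<in>cosets. (norm (\<xi> (rep C)))\<^sup>2)"
    by (rule infsumI[OF has_sum_of_real[OF has_sum_infsum]]) (use assms in \<open>simp add: sqs_def\<close>)
  finally show ?thesis by (simp only: of_real_eq_iff)
qed

lemma norm_J_le:
  assumes "0 \<le> B" "\<And>F. finite F \<Longrightarrow> F \<subseteq> cosets \<Longrightarrow> (\<Sum>C\<in>F. (norm (\<xi> (rep C)))\<^sup>2) \<le> B\<^sup>2"
  shows "sqs \<xi>" "norm (J \<xi>) \<le> B"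
proof -
  show s: "sqs \<xi>"
    unfolding sqs_def using assms(2) by (intro nonneg_bdd_above_summable_on bdd_aboveI[of _ "B\<^sup>2"]) auto
  have "(norm (J \<xi>))\<^sup>2 \<le> B\<^sup>2"
    unfolding norm_J_sq[OF s]
    by (rule infsum_le_finite_sums) (use s assms(2) in \<open>auto simp: sqs_def\<close>)
  then show "norm (J \<xi>) \<le> B" using assms(1) by (rule power2_le_imp_le)
qed

lemma norm_J_finite:
  assumes "sqs \<xi>" "finite F" "F \<subseteq> cosets"
  shows "(\<Sum>C\<in>F. (norm (\<xi> (rep C)))\<^sup>2) \<le> (norm (J \<xi>))\<^sup>2"
  unfolding norm_J_sq[OF assms(1)]
  using assms by (intro finite_sum_le_infsum) (auto simp: sqs_def)

lemma IS_iff: "\<xi> \<in> IS \<longleftrightarrow> (\<forall>g. g \<notin> Gx \<longrightarrow> \<xi> g = 0) \<and> (\<forall>g\<in>Gx. \<xi> g \<in> H) \<and>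
     (\<forall>g\<in>Gx. \<forall>h\<in>\<Gamma> x. \<xi> (g \<odot> h) = \<pi> (iv h) (\<xi> g)) \<and> sqs \<xi>"
  by (simp add: ind_space_def sqs_def)

lemma ISD:
  assumes "\<xi> \<in> IS"
  shows "g \<notin> Gx \<Longrightarrow> \<xi> g = 0" "\<xi> g \<in> H" "g \<in> Gx \<Longrightarrow> h \<in> \<Gamma> x \<Longrightarrow> \<xi> (g \<odot> h) = \<pi> (iv h) (\<xi> g)" "sqs \<xi>"
proof -
  show "g \<notin> Gx \<Longrightarrow> \<xi> g = 0" "g \<in> Gx \<Longrightarrow> h \<in> \<Gamma> x \<Longrightarrow> \<xi> (g \<odot> h) = \<pi> (iv h) (\<xi> g)" "sqs \<xi>"
    using assms unfolding IS_iff by auto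
  show "\<xi> g \<in> H" using assms H_closed(2) unfolding IS_iff by (cases "g \<in> Gx") simp_all
qed

text \<open>By unitarity the norm of \<xi> is constant on cosets, and one coset is a part of the
  whole sum. Convergence in norm therefore implies convergence at each arrow.\<close>

lemma IS_pointwise:
  assumes \<xi>: "\<xi> \<in> IS" shows "norm (\<xi> g) \<le> norm (J \<xi>)"
proof (cases "g \<in> Gx")
  case True
  let ?C = "{k \<in> Gx. rg k = rg g}"
  have C: "?C \<in> cosets" by (rule coset_of[OF True])
  have "rep ?C \<in> (\<lambda>h. g \<odot> h) ` \<Gamma> x" using coset_rep(1)[OF C] coset_eq[OF True] by simp
  then obtain h where h: "h \<in> \<Gamma> x" "rep ?C = g \<odot> h" by blast
  have "norm (\<xi> (rep ?C)) = norm (\<xi> g)"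
    unfolding h(2) ISD(3)[OF \<xi> True h(1)]
    by (rule \<pi>_simps(2)[OF isotropy_closed(2)[OF h(1)] ISD(2)[OF \<xi>]])
  moreover have "(norm (\<xi> (rep ?C)))\<^sup>2 \<le> (norm (J \<xi>))\<^sup>2"
    using norm_J_finite[OF ISD(4)[OF \<xi>], of "{?C}"] C by simp
  ultimately show ?thesis by (metis norm_ge_zero power2_le_imp_le)
next
  case False
  then show ?thesis by (simp add: ISD(1)[OF \<xi>])
qed

lemma sqs_add: "sqs \<xi> \<Longrightarrow> sqs \<eta> \<Longrightarrow> sqs (\<lambda>g. \<xi> g + \<eta> g)"
  and sqs_scale: "sqs \<xi> \<Longrightarrow> sqs (\<lambda>g. cscale c (\<xi> g))"
proof -
  assume a: "sqs \<xi>" "sqs \<eta>"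
  have "(\<lambda>C. 2 * (norm (\<xi> (rep C)))\<^sup>2 + 2 * (norm (\<eta> (rep C)))\<^sup>2) summable_on cosets"
    using a unfolding sqs_def by (intro summable_on_add summable_on_cmult_right)
  then show "sqs (\<lambda>g. \<xi> g + \<eta> g)"
    unfolding sqs_def
  proof (rule summable_on_comparison_test)
    fix C
    have "(norm (\<xi> (rep C) + \<eta> (rep C)))\<^sup>2 \<le> (norm (\<xi> (rep C)) + norm (\<eta> (rep C)))\<^sup>2"
      by (intro power_mono norm_triangle_ineq) auto
    also have "\<dots> \<le> 2 * (norm (\<xi> (rep C)))\<^sup>2 + 2 * (norm (\<eta> (rep C)))\<^sup>2"
      using sum_squares_bound[of "norm (\<xi> (rep C))" "norm (\<eta> (rep C))"] by (simp add: power2_sum)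
    finally show "(norm (\<xi> (rep C) + \<eta> (rep C)))\<^sup>2 \<le> 2 * (norm (\<xi> (rep C)))\<^sup>2 + 2 * (norm (\<eta> (rep C)))\<^sup>2" .
  qed auto
next
  assume "sqs \<xi>"
  then show "sqs (\<lambda>g. cscale c (\<xi> g))"
    using summable_on_cmult_right[of "\<lambda>C. (norm (\<xi> (rep C)))\<^sup>2" cosets "(cmod c)\<^sup>2"]
    by (simp add: sqs_def power_mult_distrib)
qed

lemma J_add: "sqs \<xi> \<Longrightarrow> sqs \<eta> \<Longrightarrow> J (\<lambda>g. \<xi> g + \<eta> g) = J \<xi> + J \<eta>"
  by (rule Rep_ell2_cong) (auto simp: Rep_J sqs_add Rep_ell2_simps split: prod.splits)

lemma J_scale: "sqs \<xi> \<Longrightarrow> J (\<lambda>g. cscale c (\<xi> g)) = cscale c (J \<xi>)"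
  by (rule Rep_ell2_cong) (auto simp: Rep_J sqs_scale Rep_ell2_simps split: prod.splits)

lemma IS_add:
  assumes "\<xi> \<in> IS" "\<eta> \<in> IS" shows "(\<lambda>g. \<xi> g + \<eta> g) \<in> IS"
  unfolding IS_iff
  by (intro conjI allI impI ballI sqs_add ISD(4) assms H_closed(3) ISD(2))
    (simp_all add: ISD[OF assms(1)] ISD[OF assms(2)] \<pi>_simps(4) isotropy_closed(2))

lemma IS_scale:
  assumes "\<xi> \<in> IS" shows "(\<lambda>g. cscale c (\<xi> g)) \<in> IS"
  unfolding IS_iff
  by (intro conjI allI impI ballI sqs_scale ISD(4) assms H_closed(4) ISD(2))
    (simp_all add: ISD[OF assms(1)] \<pi>_simps(3) isotropy_closed(2))

lemma IS_diff: "\<xi> \<in> IS \<Longrightarrow> \<eta> \<in> IS \<Longrightarrow> (\<lambda>g. \<xi> g - \<eta> g) \<in> IS"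
  using IS_add[OF _ IS_scale[of \<eta> "-1"], of \<xi>] by simp

lemma J_diff: "\<xi> \<in> IS \<Longrightarrow> \<eta> \<in> IS \<Longrightarrow> J (\<lambda>g. \<xi> g - \<eta> g) = J \<xi> - J \<eta>"
  using J_add[OF ISD(4) sqs_scale[OF ISD(4)], of \<xi> \<eta> "-1"] J_scale[OF ISD(4), of \<eta> "-1"] by simp

lemma IS_zero: "(\<lambda>_. 0) \<in> IS" "J (\<lambda>_. 0) = 0"
proof -
  have s: "sqs (\<lambda>_. 0)" by (simp add: sqs_def)
  have "\<pi> \<gamma> 0 = 0" if "\<gamma> \<in> \<Gamma> x" for \<gamma> using \<pi>_simps(2)[OF that H_closed(2)] by simp
  then show "(\<lambda>_. 0) \<in> IS" using s by (simp add: IS_iff H_closed isotropy_closed(2))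
  show "J (\<lambda>_. 0) = 0" using J_scale[OF s, of 0] by simp
qed

text \<open>A Fatou argument: on finitely many cosets the norm passes to the pointwise limit, and
  the finite sums determine square summability and the norm. It transfers statements from dense
  vectors without constructing limits in the induced space.\<close>

lemma IS_limit:
  assumes IS: "\<And>n. \<xi> n \<in> IS" and lim: "\<And>g. (\<lambda>n. \<xi> n g) \<longlonglongrightarrow> \<eta> g"
    and B: "\<And>n. norm (J (\<xi> n)) \<le> B n" "B \<longlonglongrightarrow> \<beta>"
  shows "\<eta> \<in> IS" "norm (J \<eta>) \<le> \<beta>"
proof -
  have B0: "0 \<le> B n" for n using B(1) norm_ge_zero order_trans by blast
  have \<beta>0: "0 \<le> \<beta>" by (rule LIMSEQ_le_const[OF B(2)]) (use B0 in auto)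
  have fin: "(\<Sum>C\<in>F. (norm (\<eta> (rep C)))\<^sup>2) \<le> \<beta>\<^sup>2" if F: "finite F" "F \<subseteq> cosets" for F
  proof (rule LIMSEQ_le)
    show "(\<lambda>n. \<Sum>C\<in>F. (norm (\<xi> n (rep C)))\<^sup>2) \<longlonglongrightarrow> (\<Sum>C\<in>F. (norm (\<eta> (rep C)))\<^sup>2)"
      by (intro tendsto_intros lim)
    show "(\<lambda>n. (B n)\<^sup>2) \<longlonglongrightarrow> \<beta>\<^sup>2" by (intro tendsto_intros B)
    have "(\<Sum>C\<in>F. (norm (\<xi> n (rep C)))\<^sup>2) \<le> (B n)\<^sup>2" for n
      by (rule order_trans[OF norm_J_finite[OF ISD(4)[OF IS] F]]) (simp add: power_mono B)
    then show "\<exists>N. \<forall>n\<ge>N. (\<Sum>C\<in>F. (norm (\<xi> n (rep C)))\<^sup>2) \<le> (B n)\<^sup>2" by blast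
  qed
  note s = norm_J_le[OF \<beta>0 fin]
  show "norm (J \<eta>) \<le> \<beta>" using s(2) by blast
  have H: "\<eta> g \<in> H" for g by (rule closed_sequentially[OF H_closed(1) ISD(2)[OF IS] lim])
  have "\<eta> g = 0" if "g \<notin> Gx" for g
    using LIMSEQ_unique[OF lim[of g], of 0] ISD(1)[OF IS that] by simp
  moreover have "\<eta> (g \<odot> h) = \<pi> (iv h) (\<eta> g)" if g: "g \<in> Gx" "h \<in> \<Gamma> x" for g h
  proof -
    have "(\<lambda>n. \<pi> (iv h) (\<xi> n g)) \<longlonglongrightarrow> \<pi> (iv h) (\<eta> g)"
      by (rule isometry_on_H_tendsto[OF \<pi>(1)[OF isotropy_closed(2)[OF g(2)]] ISD(2)[OF IS] lim])
    moreover have "(\<lambda>n. \<pi> (iv h) (\<xi> n g)) \<longlonglongrightarrow> \<eta> (g \<odot> h)"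
      using lim[of "g \<odot> h"] ISD(3)[OF IS g] by simp
    ultimately show ?thesis by (rule LIMSEQ_unique[symmetric])
  qed
  ultimately show "\<eta> \<in> IS" using s(1) H by (simp add: IS_iff)
qed

text \<open>The induced counterpart of the basis vector at k: it lives on the coset of k, with the
  value v x translated by g^{-1} k at an arrow g of that coset. The Gram kernel of these vectors is
  \<kappa>, as \<open>cinner_J_w\<close> shows.\<close>

definition w :: "'g \<Rightarrow> 'g \<Rightarrow> ('g \<times> nat) ell2" where
  "w k g = (if k \<in> Gx \<and> g \<in> Gx \<and> rg g = rg k then v (iv g \<odot> k) else 0)"

lemma w_at_rep:
  assumes "k \<in> Gx" "C \<in> cosets"
  shows "w k (rep C) = (if C = {l \<in> Gx. rg l = rg k} then v (iv (rep C) \<odot> k) else 0)"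
proof -
  have "rg (rep C) = rg k \<longleftrightarrow> C = {l \<in> Gx. rg l = rg k}"
    using coset_rep(3)[OF assms(2)] coset_of(2)[OF assms(1)] by metis
  then show ?thesis using assms(1) coset_rep(2)[OF assms(2)] by (simp add: w_def)
qed

lemma w_IS:
  assumes k: "k \<in> Gx" shows "w k \<in> IS"
  unfolding IS_iff
proof (intro conjI allI impI ballI)
  show "w k g = 0" if "g \<notin> Gx" for g using that by (simp add: w_def)
  show "w k g \<in> H" for g
    using Gx_quot[OF _ k] by (auto simp: w_def H_closed)
  show "w k (g \<odot> h) = \<pi> (iv h) (w k g)" if g: "g \<in> Gx" and h: "h \<in> \<Gamma> x" for g h
  proof (cases "rg g = rg k")
    case True
    note A = GxD[OF g] GxD[OF k] isotropyD[OF h]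
    have "iv (g \<odot> h) \<odot> k = iv h \<odot> (iv g \<odot> k)"
      using A True mult_assoc[of "iv h" "iv g" k] by simp
    then show ?thesis
      using True g h k Gx_mult[OF g h] \<pi>(2)[OF isotropy_closed(2)[OF h] Gx_quot[OF g k True]]
      by (simp add: w_def)
  next
    case False
    have "\<pi> (iv h) 0 = 0" using \<pi>_simps(2)[OF isotropy_closed(2)[OF h] H_closed(2)] by simp
    then show ?thesis using False Gx_mult[OF g h] by (simp add: w_def)
  qed
  show "sqs (w k)"
  proof -
    have "(\<lambda>C. (norm (w k (rep C)))\<^sup>2) summable_on {{l \<in> Gx. rg l = rg k}}" by simp
    then show ?thesis
      unfolding sqs_def
      by (rule summable_on_cong_neutral[THEN iffD1, rotated -1])
        (use w_at_rep[OF k] coset_of(1)[OF k] in auto)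
  qed
qed

lemma cinner_J_w:
  assumes k: "k \<in> Gx" and l: "l \<in> Gx"
  shows "cinner (J (w k)) (J (w l)) = \<kappa> k l"
proof -
  let ?C = "{g \<in> Gx. rg g = rg k}"
  let ?f = "\<lambda>C. cinner (w k (rep C)) (w l (rep C))"
  have C: "?C \<in> cosets" by (rule coset_of[OF k])
  have "cinner (J (w k)) (J (w l)) = infsum ?f cosets"
    using J_inner[OF ISD(4)[OF w_IS[OF k]] ISD(4)[OF w_IS[OF l]]] by (simp add: ind_inner_def)
  also have "\<dots> = infsum ?f {?C}"
    by (rule infsum_cong_neutral) (use w_at_rep[OF k] C in auto)
  also have "\<dots> = \<kappa> k l"
  proof (cases "rg k = rg l")
    case True
    let ?r = "rep ?C"
    have r: "?r \<in> Gx" "rg ?r = rg k" using coset_rep(2)[OF C] coset_of(2)[OF k] by auto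
    note A = GxD[OF r(1)] GxD[OF k] GxD[OF l]
    have q: "iv ?r \<odot> k \<in> \<Gamma> x" "iv ?r \<odot> l \<in> \<Gamma> x" using Gx_quot r k l True by simp_all
    have "iv (iv ?r \<odot> k) \<odot> (iv ?r \<odot> l) = iv k \<odot> l"
      using A r(2) True mult_assoc[of "iv k" ?r "iv ?r \<odot> l"] by simp
    then have "cinner (v (iv ?r \<odot> k)) (v (iv ?r \<odot> l)) = \<psi> (iv k \<odot> l)"
      using q by (simp add: cinner_v kern_def)
    then show ?thesis using w_at_rep[OF k C] w_at_rep[OF l C] True by (simp add: \<kappa>_def)
  next
    case False
    have "rg (rep ?C) = rg k" by (rule coset_of(2)[OF k])
    then have "w l (rep ?C) = 0" using False by (simp add: w_def)
    then show ?thesis using False by (simp add: \<kappa>_def)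
  qed
  finally show ?thesis .
qed

definition xi :: "('g \<Rightarrow> complex) \<Rightarrow> 'g \<Rightarrow> ('g \<times> nat) ell2" where
  "xi c g = lincomb c (\<lambda>k. w k g)"

lemma xi_IS:
  assumes c: "c \<in> finitely_supported Gx"
  shows "xi c \<in> IS" "J (xi c) = lincomb c (\<lambda>k. J (w k))"
proof -
  have fin: "finite {k. c k \<noteq> 0}" and sub: "{k. c k \<noteq> 0} \<subseteq> Gx" using c by (simp_all add: finitely_supported_def)
  have "(\<lambda>g. \<Sum>k\<in>T. cscale (c k) (w k g)) \<in> IS \<and>
      J (\<lambda>g. \<Sum>k\<in>T. cscale (c k) (w k g)) = (\<Sum>k\<in>T. cscale (c k) (J (w k)))" if "T \<subseteq> {k. c k \<noteq> 0}" for T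
    using finite_subset[OF that fin] that
  proof (induction T rule: finite_induct)
    case empty
    then show ?case by (simp add: IS_zero)
  next
    case (insert k T)
    then have k: "w k \<in> IS" using sub by (intro w_IS) blast
    have IH: "(\<lambda>g. \<Sum>k\<in>T. cscale (c k) (w k g)) \<in> IS"
      "J (\<lambda>g. \<Sum>k\<in>T. cscale (c k) (w k g)) = (\<Sum>k\<in>T. cscale (c k) (J (w k)))" using insert by auto
    show ?case
      using IS_add[OF IS_scale[OF k, of "c k"] IH(1)] IH(2) insert.hyps
        J_add[OF ISD(4)[OF IS_scale[OF k, of "c k"]] ISD(4)[OF IH(1)]] J_scale[OF ISD(4)[OF k], of "c k"]
      by simp
  qed
  from this[of "{k. c k \<noteq> 0}"] show "xi c \<in> IS" "J (xi c) = lincomb c (\<lambda>k. J (w k))"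
    by (simp_all add: xi_def[abs_def] lincomb_def)
qed

definition cut :: "('g \<Rightarrow> complex) \<Rightarrow> 'g \<Rightarrow> complex" where
  "cut b g = (if g \<in> Gx then b g else 0)"

lemma cut_supp: "{k. cut b k \<noteq> 0} = {k. k \<in> Gx \<and> b k \<noteq> 0}"
  by (auto simp: cut_def)

lemma cut_fs: "b \<in> Cc G \<Longrightarrow> cut b \<in> finitely_supported Gx"
  unfolding finitely_supported_def mem_Collect_eq cut_supp
  using Cc_finite_source[of b x] by simp

text \<open>Identifies the vectors \<open>xi (cut b)\<close> with those of the Gelfand-Naimark-Segal
  representation of \<Phi> on \<open>Cc G\<close>; estimates for \<phi> become estimates in the
  induced space.\<close>

lemma cinner_J_xi:
  assumes "b \<in> Cc G" "b' \<in> Cc G"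
  shows "cinner (J (xi (cut b))) (J (xi (cut b'))) = \<Phi> (rho_sum G (star b) o\<^sub>L rho_sum G b')"
  unfolding \<Phi>_star_conv[OF assms] xi_IS(2)[OF cut_fs[OF assms(1)]] xi_IS(2)[OF cut_fs[OF assms(2)]]
    cinner_lincomb cut_supp
  by (intro sum.cong refl) (simp add: cinner_J_w cut_def)

text \<open>An arrow h moves w k to w (h k): the value of w k at h^{-1} g and that of w (h k) at g
  are both v at g^{-1} h k. So f acts on the vectors coming from \<open>Cc G\<close> by
  convolution.\<close>

lemma ind_rep_xi:
  assumes f: "f \<in> Cc G" and b: "b \<in> Cc G"
  shows "ind_rep G x f (xi (cut b)) = xi (cut (conv f b))"
proof
  fix g
  show "ind_rep G x f (xi (cut b)) g = xi (cut (conv f b)) g"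
  proof (cases "g \<in> Gx")
    case False
    then have "w k g = 0" for k by (simp add: w_def)
    then show ?thesis using False by (simp add: ind_rep_def xi_def lincomb_def)
  next
    case g: True
    let ?R = "{h. h \<in> range_fibre G (rg g) \<and> f h \<noteq> 0}" and ?S = "{k. k \<in> Gx \<and> b k \<noteq> 0}"
    let ?F = "conv f b" and ?L = "{l. l \<in> Gx \<and> conv f b l \<noteq> 0}"
    have finR: "finite ?R" and finS: "finite ?S" and finL: "finite ?L"
      using Cc_finite_range[OF f] Cc_finite_source[OF b] Cc_finite_source[OF conv_Cc[OF f b]] by simp_all
    note gA = GxD[OF g]
    have R: "h \<in> Arr" "rg h = rg g" if "h \<in> ?R" for h using that by (auto simp: range_fibre_def)
    have S: "k \<in> Arr" "sc k = x" "k \<in> Gx" if k: "k \<in> ?S" for k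
    proof -
      show kG: "k \<in> Gx" using k by simp
      show "k \<in> Arr" "sc k = x" by (rule GxD[OF kG])+
    qed
    \<comment> \<open>The products h k that can contribute at g. For fixed k the substitution l = h
      k turns the convolution sum over l into the sum over h defining
      \<open>ind_rep\<close>.\<close>
    define M where "M = (\<lambda>(h, k). h \<odot> k) ` {(h, k) \<in> ?R \<times> ?S. sc h = rg k}"
    have finM: "finite M" unfolding M_def
      by (intro finite_imageI) (rule finite_subset[of _ "?R \<times> ?S"], use finR finS in auto)
    have MG: "l \<in> Gx" "rg l = rg g" if l: "l \<in> M" for l
    proof -
      obtain h k where "h \<in> ?R" "k \<in> ?S" "sc h = rg k" "l = h \<odot> k" using l by (auto simp: M_def)
      then have hk: "h \<in> ?R" "k \<in> ?S" "sc h = rg k" "l = h \<odot> k" by blast+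
      note A = R[OF hk(1)] S(1,2)[OF hk(2)] hk(3)
      have "l \<in> Arr" "sc l = x" using A unfolding hk(4) by simp_all
      then show "l \<in> Gx" by (rule GxI)
      show "rg l = rg g" using A unfolding hk(4) by simp
    qed
    have Fl: "?F l = (\<Sum>k\<in>?S. f (l \<odot> iv k) * b k)" if "l \<in> Gx" for l
      unfolding conv_def GxD(2)[OF that] if_P[OF GxD(1)[OF that]] ..
    have "xi (cut ?F) g = (\<Sum>l\<in>?L. cscale (?F l) (w l g))"
      unfolding xi_def lincomb_def cut_supp by (intro sum.cong refl) (simp add: cut_def)
    also have "\<dots> = (\<Sum>l\<in>?L \<union> M. cscale (?F l) (w l g))"
      by (rule sum.mono_neutral_left) (use finL finM MG in auto)
    also have "\<dots> = (\<Sum>l\<in>M. cscale (?F l) (w l g))"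
    proof (rule sum.mono_neutral_right)
      show "\<forall>l\<in>?L \<union> M - M. cscale (?F l) (w l g) = 0"
      proof
        fix l assume l: "l \<in> ?L \<union> M - M"
        have "rg l \<noteq> rg g"
        proof
          assume r: "rg l = rg g"
          have lG: "l \<in> Gx" using l MG by blast
          note lA = GxD[OF lG]
          have "(\<Sum>k\<in>?S. f (l \<odot> iv k) * b k) \<noteq> 0" using l Fl[OF lG] by auto
          then obtain k where k: "k \<in> ?S" "f (l \<odot> iv k) \<noteq> 0"
            by (rule sum.not_neutral_contains_not_neutral) auto
          have "l \<odot> iv k \<in> ?R" using k lA S[OF k(1)] r by (simp add: range_fibre_def)
          moreover have "sc (l \<odot> iv k) = rg k" "l \<odot> iv k \<odot> k = l" using lA S[OF k(1)] by simp_all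
          ultimately have "l \<in> M" unfolding M_def using k(1) by (intro image_eqI[of _ _ "(l \<odot> iv k, k)"]) auto
          then show False using l by blast
        qed
        then show "cscale (?F l) (w l g) = 0" by (simp add: w_def)
      qed
    qed (use finL finM in auto)
    also have "\<dots> = (\<Sum>l\<in>M. \<Sum>k\<in>?S. cscale (f (l \<odot> iv k) * b k) (v (iv g \<odot> l)))"
    proof (rule sum.cong[OF refl])
      fix l assume l: "l \<in> M"
      show "cscale (?F l) (w l g) = (\<Sum>k\<in>?S. cscale (f (l \<odot> iv k) * b k) (v (iv g \<odot> l)))"
        using MG[OF l] g by (simp add: Fl cscale_sum_left w_def)
    qed
    also have "\<dots> = (\<Sum>k\<in>?S. \<Sum>l\<in>M. cscale (f (l \<odot> iv k) * b k) (v (iv g \<odot> l)))"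
      by (rule sum.swap)
    also have "\<dots> = (\<Sum>k\<in>?S. \<Sum>h\<in>?R. cscale (f h * b k) (w k (iv h \<odot> g)))"
    proof (rule sum.cong[OF refl])
      fix k assume k: "k \<in> ?S"
      note kA = S[OF k]
      have "(\<Sum>l\<in>M. cscale (f (l \<odot> iv k) * b k) (v (iv g \<odot> l)))
          = (\<Sum>l\<in>{l \<in> M. f (l \<odot> iv k) \<noteq> 0}. cscale (f (l \<odot> iv k) * b k) (v (iv g \<odot> l)))"
        by (rule sum.mono_neutral_right) (use finM in auto)
      also have "\<dots> = (\<Sum>h\<in>{h \<in> ?R. sc h = rg k}. cscale (f h * b k) (v (iv g \<odot> (h \<odot> k))))"
      proof (rule sum.reindex_bij_witness[of _ "\<lambda>h. h \<odot> k" "\<lambda>l. l \<odot> iv k"])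
        fix l assume l: "l \<in> {l \<in> M. f (l \<odot> iv k) \<noteq> 0}"
        then have lM: "l \<in> M" by simp
        note lA = GxD[OF MG(1)[OF lM]] MG(2)[OF lM]
        show e: "l \<odot> iv k \<odot> k = l" using lA kA by simp
        show "l \<odot> iv k \<in> {h \<in> ?R. sc h = rg k}" using l lA kA by (simp add: range_fibre_def)
        show "cscale (f (l \<odot> iv k) * b k) (v (iv g \<odot> (l \<odot> iv k \<odot> k))) = cscale (f (l \<odot> iv k) * b k) (v (iv g \<odot> l))"
          by (simp only: e)
      next
        fix h assume h: "h \<in> {h \<in> ?R. sc h = rg k}"
        then have hk: "h \<in> ?R" "sc h = rg k" by blast+
        note hA = R(1)[OF hk(1)] hk(2)
        show e: "h \<odot> k \<odot> iv k = h" using hA kA by simp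
        have "h \<odot> k \<in> M" unfolding M_def using hk k by (intro image_eqI[of _ _ "(h, k)"]) simp_all
        then show "h \<odot> k \<in> {l \<in> M. f (l \<odot> iv k) \<noteq> 0}" using hk(1) unfolding mem_Collect_eq e by blast
      qed
      also have "\<dots> = (\<Sum>h\<in>{h \<in> ?R. sc h = rg k}. cscale (f h * b k) (w k (iv h \<odot> g)))"
      proof (rule sum.cong[OF refl])
        fix h assume h: "h \<in> {h \<in> ?R. sc h = rg k}"
        then have hk: "h \<in> ?R" "sc h = rg k" by blast+
        note hA = R(1)[OF hk(1)] hk(2) R(2)[OF hk(1)]
        have "iv h \<odot> g \<in> Arr" "sc (iv h \<odot> g) = x" "rg (iv h \<odot> g) = rg k" using hA gA by simp_all
        then have "iv h \<odot> g \<in> Gx" "rg (iv h \<odot> g) = rg k" by (simp_all only: GxI)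
        moreover have "iv (iv h \<odot> g) \<odot> k = iv g \<odot> (h \<odot> k)"
          using hA gA kA mult_assoc[of "iv g" h k] by simp
        ultimately show "cscale (f h * b k) (v (iv g \<odot> (h \<odot> k))) = cscale (f h * b k) (w k (iv h \<odot> g))"
          using kA by (simp add: w_def)
      qed
      also have "\<dots> = (\<Sum>h\<in>?R. cscale (f h * b k) (w k (iv h \<odot> g)))"
      proof (rule sum.mono_neutral_left)
        show "\<forall>h\<in>?R - {h \<in> ?R. sc h = rg k}. cscale (f h * b k) (w k (iv h \<odot> g)) = 0"
        proof
          fix h assume h: "h \<in> ?R - {h \<in> ?R. sc h = rg k}"
          then have "h \<in> ?R" "sc h \<noteq> rg k" by blast+
          then have "rg (iv h \<odot> g) \<noteq> rg k" using R[OF \<open>h \<in> ?R\<close>] gA by simp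
          then show "cscale (f h * b k) (w k (iv h \<odot> g)) = 0" by (simp add: w_def)
        qed
      qed (use finR in auto)
      finally show "(\<Sum>l\<in>M. cscale (f (l \<odot> iv k) * b k) (v (iv g \<odot> l)))
          = (\<Sum>h\<in>?R. cscale (f h * b k) (w k (iv h \<odot> g)))" .
    qed
    also have "\<dots> = (\<Sum>h\<in>?R. \<Sum>k\<in>?S. cscale (f h * b k) (w k (iv h \<odot> g)))"
      by (rule sum.swap)
    also have "\<dots> = (\<Sum>h\<in>?R. cscale (f h) (xi (cut b) (iv h \<odot> g)))"
    proof (rule sum.cong[OF refl])
      fix h
      have "xi (cut b) (iv h \<odot> g) = (\<Sum>k\<in>?S. cscale (b k) (w k (iv h \<odot> g)))"
        unfolding xi_def lincomb_def cut_supp by (intro sum.cong refl) (simp add: cut_def)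
      then show "(\<Sum>k\<in>?S. cscale (f h * b k) (w k (iv h \<odot> g))) = cscale (f h) (xi (cut b) (iv h \<odot> g))"
        by (simp add: cscale_sum)
    qed
    finally show ?thesis using g by (simp add: ind_rep_def)
  qed
qed

text \<open>Embeds H as the functions on a single coset, with value u at its representative. For u =
  v s the result is w at the representative times s, so all of H lands in the closed span.\<close>

lemma coset_component:
  assumes C: "C \<in> cosets"
  obtains T :: "('g \<times> nat) ell2 \<Rightarrow>\<^sub>L ('g set \<times> 'g \<times> nat) ell2" where "clinear_op T"
    "\<And>u C' i. Rep_ell2 (T u) (C', i) = (if C' = C then Rep_ell2 u i else 0)"
    "\<And>u. u \<in> H \<Longrightarrow> T u \<in> closed_cspan Gx (\<lambda>k. J (w k))"
proof -
  obtain T :: "('g \<times> nat) ell2 \<Rightarrow>\<^sub>L ('g set \<times> 'g \<times> nat) ell2" where T: "clinear_op T" "norm T \<le> 1"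
    "\<And>u p. Rep_ell2 (T u) p = (if fst p = C then 1 else 0) * Rep_ell2 u (snd p)"
    by (rule weighted_injection_op[of snd "\<lambda>p. if fst p = C then 1 else 0" 1])
      (auto simp: inj_on_def prod_eq_iff)
  have Tv: "T (v s) = J (w (rep C \<odot> s))" if s: "s \<in> \<Gamma> x" for s
  proof (rule Rep_ell2_cong)
    fix p :: "'g set \<times> 'g \<times> nat"
    obtain C' i where p: "p = (C', i)" by (cases p)
    let ?k = "rep C \<odot> s"
    note r = coset_rep(2)[OF C]
    have k: "?k \<in> Gx" "rg ?k = rg (rep C)" by (rule Gx_mult[OF r s])+
    have CC: "{l \<in> Gx. rg l = rg ?k} = C" using coset_rep(3)[OF C] k(2) by simp
    have "iv (rep C) \<odot> ?k = s" using GxD[OF r] isotropyD[OF s] by simp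
    then show "Rep_ell2 (T (v s)) p = Rep_ell2 (J (w ?k)) p"
      using w_at_rep[OF k(1)] C unfolding CC p
      by (auto simp: T(3) Rep_J ISD(4)[OF w_IS[OF k(1)]] Rep_ell2_simps)
  qed
  show thesis
  proof (rule that[OF T(1)])
    show "Rep_ell2 (T u) (C', i) = (if C' = C then Rep_ell2 u i else 0)" for u C' i by (simp add: T(3))
    fix u assume "u \<in> H"
    then have u: "u \<in> closed_cspan (\<Gamma> x) v" by (simp add: H_def)
    show "T u \<in> closed_cspan Gx (\<lambda>k. J (w k))"
    proof (rule closed_cspan_closedI[OF _ closed_closed_cspan _ u])
      show "continuous_on UNIV (blinfun_apply T)"
        by (intro linear_continuous_on blinfun.bounded_linear_right)
      fix c assume c: "c \<in> finitely_supported (\<Gamma> x)"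
      have "T (lincomb c v) = (\<Sum>s | c s \<noteq> 0. cscale (c s) (T (v s)))"
        by (simp add: lincomb_def blinfun.sum_right clinear_op_cscale[OF T(1)])
      also have "\<dots> \<in> closed_cspan Gx (\<lambda>k. J (w k))"
      proof (rule closed_cspan_sum)
        show "finite {s. c s \<noteq> 0}" using c by (simp add: finitely_supported_def)
        fix s assume "s \<in> {s. c s \<noteq> 0}"
        then have s: "s \<in> \<Gamma> x" using c by (auto simp: finitely_supported_def)
        show "cscale (c s) (T (v s)) \<in> closed_cspan Gx (\<lambda>k. J (w k))"
          unfolding Tv[OF s]
          by (intro closed_cspan_scale closed_cspan_base Gx_mult[OF coset_rep(2)[OF C] s])
      qed
      finally show "T (lincomb c v) \<in> closed_cspan Gx (\<lambda>k. J (w k))" .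
    qed
  qed
qed

text \<open>Finitely many cosets contribute a sum of coset components. What is left out is the
  restriction, to the other cosets, of the error of a finite basis expansion, and so is no larger
  than that error.\<close>

lemma J_in_closed_cspan:
  assumes \<xi>: "\<xi> \<in> IS" shows "J \<xi> \<in> closed_cspan Gx (\<lambda>k. J (w k))"
proof -
  let ?M = "closed_cspan Gx (\<lambda>k. J (w k))"
  have "\<exists>y\<in>?M. dist y (J \<xi>) < e" if e: "0 < e" for e
  proof -
    obtain E where E: "finite E" "norm (J \<xi> - (\<Sum>p\<in>E. cscale (Rep_ell2 (J \<xi>) p) (delta p))) < e"
      using ell2_basis_expansion[OF e] by blast
    define F where "F = fst ` E \<inter> cosets"
    have finF: "finite F" using E(1) by (simp add: F_def)
    have "\<exists>T :: ('g \<times> nat) ell2 \<Rightarrow>\<^sub>L ('g set \<times> 'g \<times> nat) ell2.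
        (\<forall>u C' i. Rep_ell2 (T u) (C', i) = (if C' = C then Rep_ell2 u i else 0)) \<and> (\<forall>u\<in>H. T u \<in> ?M)"
      if "C \<in> cosets" for C
      by (rule coset_component[OF that]) blast
    then obtain T :: "'g set \<Rightarrow> ('g \<times> nat) ell2 \<Rightarrow>\<^sub>L ('g set \<times> 'g \<times> nat) ell2" where
      T: "\<And>C u C' i. C \<in> cosets \<Longrightarrow> Rep_ell2 (T C u) (C', i) = (if C' = C then Rep_ell2 u i else 0)"
        "\<And>C u. C \<in> cosets \<Longrightarrow> u \<in> H \<Longrightarrow> T C u \<in> ?M"
      by metis
    define y where "y = (\<Sum>C\<in>F. T C (\<xi> (rep C)))"
    have yM: "y \<in> ?M" unfolding y_def
      by (rule closed_cspan_sum[OF finF]) (use ISD(2)[OF \<xi>] T(2) in \<open>simp add: F_def\<close>)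
    let ?P = "restrict_op {p :: 'g set \<times> 'g \<times> nat. fst p \<notin> F}"
    have eq: "J \<xi> - y = ?P (J \<xi> - (\<Sum>p\<in>E. cscale (Rep_ell2 (J \<xi>) p) (delta p)))"
    proof (rule Rep_ell2_cong)
      fix q :: "'g set \<times> 'g \<times> nat"
      obtain C i where q: "q = (C, i)" by (cases q)
      have "Rep_ell2 y q = (\<Sum>D\<in>F. if C = D then Rep_ell2 (\<xi> (rep D)) i else 0)"
        unfolding y_def Rep_ell2_sum q by (intro sum.cong refl) (simp add: T(1) F_def)
      also have "\<dots> = (if C \<in> F then Rep_ell2 (\<xi> (rep C)) i else 0)" using finF by simp
      finally have y: "Rep_ell2 y q = (if C \<in> F then Rep_ell2 (\<xi> (rep C)) i else 0)" .
      have s: "Rep_ell2 (\<Sum>p\<in>E. cscale (Rep_ell2 (J \<xi>) p) (delta p)) q = (if q \<in> E then Rep_ell2 (J \<xi>) q else 0)"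
        using E(1) by (simp add: Rep_ell2_simps if_distrib[of "\<lambda>z. _ * z"] cong: if_cong)
      have Jq: "Rep_ell2 (J \<xi>) q = (if C \<in> cosets then Rep_ell2 (\<xi> (rep C)) i else 0)"
        unfolding q by (rule Rep_J[OF ISD(4)[OF \<xi>]])
      have "C \<in> F" if "q \<in> E" "C \<in> cosets" using that by (force simp: F_def q)
      moreover have "C \<in> cosets" if "C \<in> F" using that by (simp add: F_def)
      ultimately show "Rep_ell2 (J \<xi> - y) q = Rep_ell2 (?P (J \<xi> - (\<Sum>p\<in>E. cscale (Rep_ell2 (J \<xi>) p) (delta p)))) q"
        unfolding Rep_restrict_op minus_ell2.rep_eq s y Jq by (auto simp: q)
    qed
    have "norm (J \<xi> - y) \<le> norm ?P * norm (J \<xi> - (\<Sum>p\<in>E. cscale (Rep_ell2 (J \<xi>) p) (delta p)))"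
      unfolding eq by (rule norm_blinfun)
    also have "\<dots> \<le> 1 * norm (J \<xi> - (\<Sum>p\<in>E. cscale (Rep_ell2 (J \<xi>) p) (delta p)))"
      by (intro mult_right_mono norm_restrict_op) simp
    also have "\<dots> < e" using E(2) by simp
    finally show ?thesis using yM by (intro bexI[of _ y]) (simp_all add: dist_norm norm_minus_commute)
  qed
  then have "J \<xi> \<in> closure ?M" unfolding closure_approachable by blast
  then show ?thesis by simp
qed

lemma xi_dense:
  assumes \<xi>: "\<xi> \<in> IS"
  obtains b where "\<And>n. b n \<in> Cc G" "(\<lambda>n. J (xi (cut (b n)))) \<longlonglongrightarrow> J \<xi>" "\<And>g. (\<lambda>n. xi (cut (b n)) g) \<longlonglongrightarrow> \<xi> g"
proof -
  obtain f where f: "\<And>n. f n \<in> (\<lambda>c. lincomb c (\<lambda>k. J (w k))) ` finitely_supported Gx" "f \<longlonglongrightarrow> J \<xi>"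
    by (rule closure_sequenceE[OF J_in_closed_cspan[OF \<xi>, unfolded closed_cspan_def]]) (rule that)
  have "\<exists>b. b \<in> Cc G \<and> f n = J (xi (cut b))" for n
  proof -
    obtain c where c: "c \<in> finitely_supported Gx" "f n = lincomb c (\<lambda>k. J (w k))" using f(1)[of n] by blast
    obtain b where b: "b \<in> Cc G" "\<And>g. g \<in> Gx \<Longrightarrow> b g = c g"
      by (rule finitely_supported_extend[OF c(1)]) (rule that)
    have "cut b = c" using b(2) c(1) by (auto simp: cut_def finitely_supported_def fun_eq_iff)
    then show ?thesis using b(1) c xi_IS(2)[OF c(1)] by (intro exI[of _ b]) simp
  qed
  then have "\<forall>n. \<exists>b. b \<in> Cc G \<and> f n = J (xi (cut b))" ..
  from choice[OF this] obtain b where b: "\<forall>n. b n \<in> Cc G \<and> f n = J (xi (cut (b n)))" ..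
  then have bC: "b n \<in> Cc G" for n by simp
  have fe: "f = (\<lambda>n. J (xi (cut (b n))))" using b by auto
  have 1: "(\<lambda>n. J (xi (cut (b n)))) \<longlonglongrightarrow> J \<xi>" using f(2) unfolding fe .
  have 2: "(\<lambda>n. xi (cut (b n)) g) \<longlonglongrightarrow> \<xi> g" for g
  proof (rule LIM_zero_cancel, rule Lim_null_comparison)
    show "(\<lambda>n. norm (J (xi (cut (b n))) - J \<xi>)) \<longlonglongrightarrow> 0"
      by (rule tendsto_norm_zero[OF LIM_zero[OF 1]])
    have "norm (xi (cut (b n)) g - \<xi> g) \<le> norm (J (xi (cut (b n))) - J \<xi>)" for n
      using IS_pointwise[OF IS_diff[OF xi_IS(1)[OF cut_fs[OF bC]] \<xi>], of n g]
        J_diff[OF xi_IS(1)[OF cut_fs[OF bC]] \<xi>, of n] by simp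
    then show "\<forall>\<^sub>F n in sequentially. norm (xi (cut (b n)) g - \<xi> g) \<le> norm (J (xi (cut (b n))) - J \<xi>)"
      by simp
  qed
  show thesis by (rule that[of b, OF bC 1 2])
qed

lemma ind_rep_tendsto:
  assumes "\<And>g. (\<lambda>n. \<xi> n g) \<longlonglongrightarrow> \<eta> g"
  shows "(\<lambda>n. ind_rep G x f (\<xi> n) g) \<longlonglongrightarrow> ind_rep G x f \<eta> g"
proof (cases "g \<in> Gx")
  case True
  show ?thesis
    unfolding ind_rep_def if_P[OF True] by (rule tendsto_sum, rule tendsto_cscale, rule assms)
next
  case False
  show ?thesis unfolding ind_rep_def if_not_P[OF False] by (rule tendsto_const)
qed

text \<open>With |f| the norm of the operator of f, the operator |f|^2 b* b - (f b)* (f b) has a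
  non-negative quadratic form. Positivity of \<phi> then gives the bound by the reduced norm on
  which the whole extension rests.\<close>

lemma norm_J_xi_conv:
  assumes f: "f \<in> Cc G" and b: "b \<in> Cc G"
  shows "norm (J (xi (cut (conv f b)))) \<le> norm (rho_sum G f) * norm (J (xi (cut b)))"
proof -
  let ?f = "rho_sum G f" and ?b = "rho_sum G b"
  have nrm: "(norm (J (xi (cut c))))\<^sup>2 = \<phi> (rho_sum G (star c) o\<^sub>L rho_sum G c)" if "c \<in> Cc G" for c
    using cinner_J_xi[OF that that] by (metis Re_\<Phi> norm_sq_cinner)
  let ?A = "rho_sum G (star b) o\<^sub>L ?b" and ?B = "rho_sum G (star (conv f b)) o\<^sub>L rho_sum G (conv f b)"
  have "0 \<le> \<phi> ((norm ?f)\<^sup>2 *\<^sub>R ?A - ?B)"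
  proof (rule \<phi>_accretive)
    fix u
    have "inner u (?A u) = (norm (?b u))\<^sup>2"
      by (simp add: Re_cinner[symmetric] adjoint_pairD[OF adjoint_rho_sum[OF b], symmetric] cinner_self)
    moreover have "inner u (?B u) = (norm (?f (?b u)))\<^sup>2"
    proof -
      have "cinner u (?B u) = cinner (rho_sum G (conv f b) u) (rho_sum G (conv f b) u)"
        using adjoint_pairD[OF adjoint_rho_sum[OF conv_Cc[OF f b]], of u "rho_sum G (conv f b) u"] by simp
      also have "\<dots> = of_real ((norm (?f (?b u)))\<^sup>2)"
        unfolding cinner_self rho_sum_conv[OF f b] by simp
      finally have "Re (cinner u (?B u)) = (norm (?f (?b u)))\<^sup>2" by (simp only: Re_complex_of_real)
      then show ?thesis by (simp only: Re_cinner)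
    qed
    moreover have "(norm (?f (?b u)))\<^sup>2 \<le> (norm ?f)\<^sup>2 * (norm (?b u))\<^sup>2"
      unfolding power_mult_distrib[symmetric] by (intro power_mono norm_blinfun) simp
    ultimately show "0 \<le> inner u (((norm ?f)\<^sup>2 *\<^sub>R ?A - ?B) u)"
      by (simp only: blinfun.diff_left blinfun.scaleR_left inner_diff_right inner_scaleR_right)
  qed
  then have "(norm (J (xi (cut (conv f b)))))\<^sup>2 \<le> (norm ?f * norm (J (xi (cut b))))\<^sup>2"
    by (simp add: nrm b conv_Cc f power_mult_distrib linear_diff[OF lin] linear_cmul[OF lin])
  then show ?thesis by (rule power2_le_imp_le) simp
qed

text \<open>At each arrow \<open>ind_rep\<close> is a finite sum, hence continuous for pointwise
  convergence. The bound on the dense vectors \<open>xi (cut b)\<close> therefore reaches the whole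
  space through \<open>IS_limit\<close>.\<close>

theorem ind_rep_bound:
  assumes f: "f \<in> Cc G" and \<xi>: "\<xi> \<in> IS"
  shows "ind_rep G x f \<xi> \<in> IS" "norm (J (ind_rep G x f \<xi>)) \<le> norm (rho_sum G f) * norm (J \<xi>)"
proof -
  obtain b where b: "\<And>n. b n \<in> Cc G" "(\<lambda>n. J (xi (cut (b n)))) \<longlonglongrightarrow> J \<xi>" "\<And>g. (\<lambda>n. xi (cut (b n)) g) \<longlonglongrightarrow> \<xi> g"
    by (rule xi_dense[OF \<xi>]) (rule that)
  have 1: "xi (cut (conv f (b n))) \<in> IS" for n by (intro xi_IS cut_fs conv_Cc f b)
  have 2: "(\<lambda>n. xi (cut (conv f (b n))) g) \<longlonglongrightarrow> ind_rep G x f \<xi> g" for g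
    using ind_rep_tendsto[of "\<lambda>n. xi (cut (b n))" \<xi> f g, OF b(3)] by (simp add: ind_rep_xi f b(1))
  have 3: "(\<lambda>n. norm (rho_sum G f) * norm (J (xi (cut (b n))))) \<longlonglongrightarrow> norm (rho_sum G f) * norm (J \<xi>)"
    by (intro tendsto_intros b(2))
  from IS_limit[of "\<lambda>n. xi (cut (conv f (b n)))", OF 1 2 norm_J_xi_conv[OF f b(1)] 3]
  show "ind_rep G x f \<xi> \<in> IS" "norm (J (ind_rep G x f \<xi>)) \<le> norm (rho_sum G f) * norm (J \<xi>)" .
qed

end

subsection \<open>Extension of the induced representation\<close>

lemma blinfun_compose_assoc: "(S o\<^sub>L T) o\<^sub>L U = S o\<^sub>L (T o\<^sub>L U)"
  by (rule blinfun_eqI) simp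

context unit_state
begin

lemma ind_rep_superset:
  assumes "g \<in> Gx" "finite F" "{h. h \<in> range_fibre G (rg g) \<and> f h \<noteq> 0} \<subseteq> F" "F \<subseteq> range_fibre G (rg g)"
  shows "ind_rep G x f \<xi> g = (\<Sum>h\<in>F. cscale (f h) (\<xi> (iv h \<odot> g)))"
  unfolding ind_rep_def if_P[OF assms(1)]
  by (rule sum.mono_neutral_left[OF assms(2,3)]) (use assms(4) in auto)

lemma ind_rep_add:
  assumes "f \<in> Cc G" "f' \<in> Cc G"
  shows "ind_rep G x (\<lambda>h. f h + f' h) \<xi> g = ind_rep G x f \<xi> g + ind_rep G x f' \<xi> g"
proof (cases "g \<in> Gx")
  case True
  let ?R = "range_fibre G (rg g)"
  let ?F = "{h \<in> ?R. f h \<noteq> 0} \<union> {h \<in> ?R. f' h \<noteq> 0}"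
  have fin: "finite ?F" by (intro finite_UnI Cc_finite_range assms)
  have "ind_rep G x f \<xi> g = (\<Sum>h\<in>?F. cscale (f h) (\<xi> (iv h \<odot> g)))"
    "ind_rep G x f' \<xi> g = (\<Sum>h\<in>?F. cscale (f' h) (\<xi> (iv h \<odot> g)))"
    "ind_rep G x (\<lambda>h. f h + f' h) \<xi> g = (\<Sum>h\<in>?F. cscale (f h + f' h) (\<xi> (iv h \<odot> g)))"
    by (rule ind_rep_superset[OF True fin]; auto)+
  then show ?thesis by (simp add: cscale_add_left sum.distrib)
next
  case False
  then show ?thesis by (simp add: ind_rep_def)
qed

lemma ind_rep_scale:
  assumes "f \<in> Cc G"
  shows "ind_rep G x (\<lambda>h. c * f h) \<xi> g = cscale c (ind_rep G x f \<xi> g)"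
proof (cases "g \<in> Gx")
  case True
  let ?F = "{h \<in> range_fibre G (rg g). f h \<noteq> 0}"
  have fin: "finite ?F" by (rule Cc_finite_range[OF assms])
  have "ind_rep G x f \<xi> g = (\<Sum>h\<in>?F. cscale (f h) (\<xi> (iv h \<odot> g)))"
    "ind_rep G x (\<lambda>h. c * f h) \<xi> g = (\<Sum>h\<in>?F. cscale (c * f h) (\<xi> (iv h \<odot> g)))"
    by (rule ind_rep_superset[OF True fin]; auto)+
  then show ?thesis by (simp add: cscale_sum)
next
  case False
  then show ?thesis by (simp add: ind_rep_def)
qed

lemma ind_rep_diff:
  "f \<in> Cc G \<Longrightarrow> f' \<in> Cc G \<Longrightarrow>
    ind_rep G x (\<lambda>h. f h - f' h) \<xi> g = ind_rep G x f \<xi> g - ind_rep G x f' \<xi> g"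
  using ind_rep_add[OF _ Cc_scale[of f' "-1"], of f \<xi> g] ind_rep_scale[of f' "-1" \<xi> g] by simp

lemma ind_rep_add_right:
  "ind_rep G x f (\<lambda>g. \<xi> g + \<eta> g) = (\<lambda>g. ind_rep G x f \<xi> g + ind_rep G x f \<eta> g)"
  by (rule ext) (simp add: ind_rep_def cscale_add sum.distrib)

lemma ind_rep_scale_right:
  "ind_rep G x f (\<lambda>g. cscale c (\<xi> g)) = (\<lambda>g. cscale c (ind_rep G x f \<xi> g))"
  by (rule ext) (simp add: ind_rep_def cscale_sum mult.commute)

lemma ind_rep_diff_right:
  "ind_rep G x f (\<lambda>g. \<xi> g - \<eta> g) = (\<lambda>g. ind_rep G x f \<xi> g - ind_rep G x f \<eta> g)"
  using ind_rep_add_right[of f \<xi> "\<lambda>g. cscale (-1) (\<eta> g)"] ind_rep_scale_right[of f "-1" \<eta>] by simp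

lemma J_ind_rep_diff:
  assumes "f \<in> Cc G" "\<xi> \<in> IS" "\<eta> \<in> IS"
  shows "norm (J (ind_rep G x f \<xi>) - J (ind_rep G x f \<eta>)) \<le> norm (rho_sum G f) * norm (J \<xi> - J \<eta>)"
  using ind_rep_bound(2)[OF assms(1) IS_diff[OF assms(2,3)]]
  by (simp add: ind_rep_diff_right J_diff ind_rep_bound(1) assms)

lemma norm_ind_rep_le:
  assumes "f \<in> Cc G" "\<xi> \<in> IS"
  shows "norm (ind_rep G x f \<xi> g) \<le> norm (rho_sum G f) * norm (J \<xi>)"
  by (rule order_trans[OF IS_pointwise[OF ind_rep_bound(1)[OF assms]] ind_rep_bound(2)[OF assms]])

text \<open>Composition of operators is associative, and a function in \<open>Cc G\<close> is
  recovered from its operator.\<close>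

lemma conv_assoc:
  assumes "f \<in> Cc G" "f' \<in> Cc G" "f'' \<in> Cc G"
  shows "conv (conv f f') f'' = conv f (conv f' f'')"
proof
  fix g
  have eq: "rho_sum G (conv (conv f f') f'') = rho_sum G (conv f (conv f' f''))"
    by (simp add: rho_sum_conv conv_Cc assms blinfun_compose_assoc)
  show "conv (conv f f') f'' g = conv f (conv f' f'') g"
  proof (cases "g \<in> Arr")
    case True
    then show ?thesis
      using rho_sum_delta_unit[of "conv (conv f f') f''" g] rho_sum_delta_unit[of "conv f (conv f' f'')" g] eq
      by (simp add: conv_Cc assms)
  next
    case False
    then show ?thesis by (simp add: conv_def)
  qed
qed

lemma ind_rep_conv:
  assumes f: "f \<in> Cc G" "f' \<in> Cc G" and \<xi>: "\<xi> \<in> IS"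
  shows "ind_rep G x (conv f f') \<xi> = ind_rep G x f (ind_rep G x f' \<xi>)"
proof
  fix g
  obtain b where b: "\<And>n. b n \<in> Cc G" "\<And>g. (\<lambda>n. xi (cut (b n)) g) \<longlonglongrightarrow> \<xi> g"
    by (rule xi_dense[OF \<xi>]) (rule that)
  have "(\<lambda>n. ind_rep G x (conv f f') (xi (cut (b n))) g) \<longlonglongrightarrow> ind_rep G x (conv f f') \<xi> g"
    by (rule ind_rep_tendsto[OF b(2)])
  moreover have "(\<lambda>n. ind_rep G x f (ind_rep G x f' (xi (cut (b n)))) g) \<longlonglongrightarrow> ind_rep G x f (ind_rep G x f' \<xi>) g"
    by (rule ind_rep_tendsto[OF ind_rep_tendsto[OF b(2)]])
  moreover have "ind_rep G x (conv f f') (xi (cut (b n))) = ind_rep G x f (ind_rep G x f' (xi (cut (b n))))" for n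
    by (simp add: ind_rep_xi conv_Cc f b(1) conv_assoc)
  ultimately show "ind_rep G x (conv f f') \<xi> g = ind_rep G x f (ind_rep G x f' \<xi>) g"
    by (metis (no_types, lifting) LIMSEQ_unique ext)
qed

lemma J_xi_dense:
  assumes \<xi>: "\<xi> \<in> IS"
  obtains b where "\<And>n. b n \<in> Cc G" "(\<lambda>n. J (xi (cut (b n)))) \<longlonglongrightarrow> J \<xi>"
    "\<And>f. f \<in> Cc G \<Longrightarrow> (\<lambda>n. J (xi (cut (conv f (b n))))) \<longlonglongrightarrow> J (ind_rep G x f \<xi>)"
proof -
  obtain b where b: "\<And>n. b n \<in> Cc G" "(\<lambda>n. J (xi (cut (b n)))) \<longlonglongrightarrow> J \<xi>"
    by (rule xi_dense[OF \<xi>]) (rule that)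
  have "(\<lambda>n. J (xi (cut (conv f (b n))))) \<longlonglongrightarrow> J (ind_rep G x f \<xi>)" if f: "f \<in> Cc G" for f
  proof (rule LIM_zero_cancel, rule Lim_null_comparison)
    show "(\<lambda>n. norm (rho_sum G f) * norm (J (xi (cut (b n))) - J \<xi>)) \<longlonglongrightarrow> 0"
      by (rule tendsto_mult_right_zero[OF tendsto_norm_zero[OF LIM_zero[OF b(2)]]])
    have "norm (J (xi (cut (conv f (b n)))) - J (ind_rep G x f \<xi>)) \<le> norm (rho_sum G f) * norm (J (xi (cut (b n))) - J \<xi>)" for n
      using J_ind_rep_diff[OF f xi_IS(1)[OF cut_fs[OF b(1)]] \<xi>, of n] by (simp add: ind_rep_xi f b(1))
    then show "\<forall>\<^sub>F n in sequentially. norm (J (xi (cut (conv f (b n)))) - J (ind_rep G x f \<xi>))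
        \<le> norm (rho_sum G f) * norm (J (xi (cut (b n))) - J \<xi>)" by simp
  qed
  then show thesis using b that by blast
qed

lemma rho_sum_star_conv:
  assumes "f \<in> Cc G" "b \<in> Cc G"
  shows "rho_sum G (star (conv f b)) = rho_sum G (star b) o\<^sub>L rho_sum G (star f)"
proof (rule adjoint_pair_unique)
  show "adjoint_pair (rho_sum G (conv f b)) (rho_sum G (star (conv f b)))"
    by (rule adjoint_rho_sum[OF conv_Cc[OF assms]])
  show "adjoint_pair (rho_sum G (conv f b)) (rho_sum G (star b) o\<^sub>L rho_sum G (star f))"
    unfolding rho_sum_conv[OF assms] by (intro adjoint_pair_compose adjoint_rho_sum assms)
qed

lemma ind_rep_adjoint:
  assumes f: "f \<in> Cc G" and \<xi>: "\<xi> \<in> IS" and \<eta>: "\<eta> \<in> IS"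
  shows "cinner (J (ind_rep G x f \<xi>)) (J \<eta>) = cinner (J \<xi>) (J (ind_rep G x (star f) \<eta>))"
proof -
  obtain b where b: "\<And>n. b n \<in> Cc G" "(\<lambda>n. J (xi (cut (b n)))) \<longlonglongrightarrow> J \<xi>"
    "\<And>f. f \<in> Cc G \<Longrightarrow> (\<lambda>n. J (xi (cut (conv f (b n))))) \<longlonglongrightarrow> J (ind_rep G x f \<xi>)"
    by (rule J_xi_dense[OF \<xi>]) (rule that)
  obtain b' where b': "\<And>n. b' n \<in> Cc G" "(\<lambda>n. J (xi (cut (b' n)))) \<longlonglongrightarrow> J \<eta>"
    "\<And>f. f \<in> Cc G \<Longrightarrow> (\<lambda>n. J (xi (cut (conv f (b' n))))) \<longlonglongrightarrow> J (ind_rep G x f \<eta>)"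
    by (rule J_xi_dense[OF \<eta>]) (rule that)
  have "cinner (J (xi (cut (conv f (b n))))) (J (xi (cut (b' n))))
      = cinner (J (xi (cut (b n)))) (J (xi (cut (conv (star f) (b' n)))))" for n
    by (simp add: cinner_J_xi conv_Cc f b(1) b'(1) star_Cc rho_sum_star_conv rho_sum_conv blinfun_compose_assoc)
  then have "(\<lambda>n. cinner (J (xi (cut (conv f (b n))))) (J (xi (cut (b' n)))))
      \<longlonglongrightarrow> cinner (J \<xi>) (J (ind_rep G x (star f) \<eta>))"
    using tendsto_cinner[OF b(2) b'(3)[OF star_Cc[OF f]]] by simp
  with tendsto_cinner[OF b(3)[OF f] b'(2)] show ?thesis by (rule LIMSEQ_unique)
qed

definition approx :: "('g ell2 \<Rightarrow>\<^sub>L 'g ell2) \<Rightarrow> nat \<Rightarrow> 'g \<Rightarrow> complex" where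
  "approx a = (SOME f. (\<forall>n. f n \<in> Cc G) \<and> (\<lambda>n. rho_sum G (f n)) \<longlonglongrightarrow> a)"

lemma approx:
  assumes "a \<in> \<A>" shows "approx a n \<in> Cc G" "(\<lambda>n. rho_sum G (approx a n)) \<longlonglongrightarrow> a"
proof -
  have "\<exists>f. (\<forall>n. f n \<in> Cc G) \<and> (\<lambda>n. rho_sum G (f n)) \<longlonglongrightarrow> a"
    by (rule reduced_Cstar_sequence[OF assms]) blast
  from someI_ex[OF this] show "approx a n \<in> Cc G" "(\<lambda>n. rho_sum G (approx a n)) \<longlonglongrightarrow> a"
    unfolding approx_def by blast+
qed

text \<open>The limit is taken at each arrow separately. The bound by the reduced norm makes the
  values a Cauchy sequence, and \<open>ind_ext_tendsto\<close> shows that every approximating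
  sequence leads to the same value.\<close>

definition ind_ext :: "('g ell2 \<Rightarrow>\<^sub>L 'g ell2) \<Rightarrow> ('g \<Rightarrow> ('g \<times> nat) ell2) \<Rightarrow> 'g \<Rightarrow> ('g \<times> nat) ell2" where
  "ind_ext a \<xi> g = lim (\<lambda>n. ind_rep G x (approx a n) \<xi> g)"

lemma ind_ext_tendsto:
  assumes f: "\<And>n. f n \<in> Cc G" "(\<lambda>n. rho_sum G (f n)) \<longlonglongrightarrow> a" and \<xi>: "\<xi> \<in> IS"
  shows "(\<lambda>n. ind_rep G x (f n) \<xi> g) \<longlonglongrightarrow> ind_ext a \<xi> g"
proof -
  have a: "a \<in> \<A>" by (rule reduced_Cstar_limit[OF f])
  have le: "norm (ind_rep G x h \<xi> g - ind_rep G x k \<xi> g) \<le> norm (rho_sum G h - rho_sum G k) * norm (J \<xi>)"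
    if "h \<in> Cc G" "k \<in> Cc G" for h k
    using norm_ind_rep_le[OF Cc_diff[OF that] \<xi>, of g] by (simp add: ind_rep_diff rho_sum_diff that)
  let ?s = "approx a"
  have "Cauchy (\<lambda>n. ind_rep G x (?s n) \<xi> g)"
  proof (rule metric_CauchyI)
    fix e :: real assume e: "0 < e"
    have pos: "0 < norm (J \<xi>) + 1" by (rule add_nonneg_pos) simp_all
    then have "0 < e / (norm (J \<xi>) + 1)" using e by simp
    then obtain M where M: "\<And>m n. m \<ge> M \<Longrightarrow> n \<ge> M \<Longrightarrow>
        dist (rho_sum G (?s m)) (rho_sum G (?s n)) < e / (norm (J \<xi>) + 1)"
      using LIMSEQ_imp_Cauchy[OF approx(2)[OF a]] unfolding Cauchy_def by metis
    have "dist (ind_rep G x (?s m) \<xi> g) (ind_rep G x (?s n) \<xi> g) < e" if mn: "m \<ge> M" "n \<ge> M" for m n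
    proof -
      have "dist (ind_rep G x (?s m) \<xi> g) (ind_rep G x (?s n) \<xi> g)
          \<le> dist (rho_sum G (?s m)) (rho_sum G (?s n)) * norm (J \<xi>)"
        unfolding dist_norm by (rule le[OF approx(1)[OF a] approx(1)[OF a]])
      also have "\<dots> \<le> dist (rho_sum G (?s m)) (rho_sum G (?s n)) * (norm (J \<xi>) + 1)"
        by (rule mult_left_mono) simp_all
      also have "\<dots> < e" using M[OF mn] pos by (simp add: pos_less_divide_eq)
      finally show ?thesis .
    qed
    then show "\<exists>M. \<forall>m\<ge>M. \<forall>n\<ge>M. dist (ind_rep G x (?s m) \<xi> g) (ind_rep G x (?s n) \<xi> g) < e" by blast
  qed
  then have s: "(\<lambda>n. ind_rep G x (?s n) \<xi> g) \<longlonglongrightarrow> ind_ext a \<xi> g"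
    unfolding ind_ext_def Cauchy_convergent_iff convergent_LIMSEQ_iff .
  have "(\<lambda>n. ind_rep G x (f n) \<xi> g - ind_rep G x (?s n) \<xi> g) \<longlonglongrightarrow> 0"
  proof (rule Lim_null_comparison)
    show "(\<lambda>n. norm (rho_sum G (f n) - rho_sum G (?s n)) * norm (J \<xi>)) \<longlonglongrightarrow> 0"
      using tendsto_mult_left_zero[OF tendsto_norm_zero[of "\<lambda>n. rho_sum G (f n) - rho_sum G (?s n)"]]
        tendsto_diff[OF f(2) approx(2)[OF a]] by simp
    show "\<forall>\<^sub>F n in sequentially. norm (ind_rep G x (f n) \<xi> g - ind_rep G x (?s n) \<xi> g)
        \<le> norm (rho_sum G (f n) - rho_sum G (?s n)) * norm (J \<xi>)"
      by (intro always_eventually allI le f approx a)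
  qed
  from tendsto_add[OF this s] show ?thesis by simp
qed

lemma ind_ext_IS:
  assumes a: "a \<in> \<A>" and \<xi>: "\<xi> \<in> IS"
  shows "ind_ext a \<xi> \<in> IS" "norm (J (ind_ext a \<xi>)) \<le> norm a * norm (J \<xi>)"
proof -
  note s = approx[OF a]
  have B: "(\<lambda>n. norm (rho_sum G (approx a n)) * norm (J \<xi>)) \<longlonglongrightarrow> norm a * norm (J \<xi>)"
    by (intro tendsto_intros s)
  from IS_limit[of "\<lambda>n. ind_rep G x (approx a n) \<xi>", OF ind_rep_bound(1)[OF s(1) \<xi>]
      ind_ext_tendsto[of "approx a", OF s \<xi>] ind_rep_bound(2)[OF s(1) \<xi>] B]
  show "ind_ext a \<xi> \<in> IS" "norm (J (ind_ext a \<xi>)) \<le> norm a * norm (J \<xi>)" .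
qed

lemma ind_ext_eqI:
  assumes "\<And>n. f n \<in> Cc G" "(\<lambda>n. rho_sum G (f n)) \<longlonglongrightarrow> a" "\<xi> \<in> IS"
    "(\<lambda>n. ind_rep G x (f n) \<xi> g) \<longlonglongrightarrow> u"
  shows "ind_ext a \<xi> g = u"
  by (rule LIMSEQ_unique[OF ind_ext_tendsto[of f, OF assms(1-3)] assms(4)])

lemma ind_ext_rho_sum:
  assumes "f \<in> Cc G" "\<xi> \<in> IS" shows "ind_ext (rho_sum G f) \<xi> = ind_rep G x f \<xi>"
  by (rule ext, rule ind_ext_eqI[of "\<lambda>_. f"]) (simp_all add: assms)

lemma ind_ext_add:
  assumes "a \<in> \<A>" "b \<in> \<A>" "\<xi> \<in> IS" shows "ind_ext (a + b) \<xi> = (\<lambda>g. ind_ext a \<xi> g + ind_ext b \<xi> g)"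
proof (rule ext, rule ind_ext_eqI[of "\<lambda>n h. approx a n h + approx b n h"])
  fix g
  show "(\<lambda>n. rho_sum G (\<lambda>h. approx a n h + approx b n h)) \<longlonglongrightarrow> a + b"
    using tendsto_add[OF approx(2) approx(2), OF assms(1,2)] by (simp add: rho_sum_add approx(1) assms)
  show "(\<lambda>n. ind_rep G x (\<lambda>h. approx a n h + approx b n h) \<xi> g) \<longlonglongrightarrow> ind_ext a \<xi> g + ind_ext b \<xi> g"
    using tendsto_add[OF ind_ext_tendsto[of "approx a", OF approx[OF assms(1)] assms(3)]
        ind_ext_tendsto[of "approx b", OF approx[OF assms(2)] assms(3)], of g g]
    by (simp add: ind_rep_add approx(1) assms)
qed (simp_all add: approx(1) Cc_add assms)

lemma ind_ext_cmult:
  assumes "a \<in> \<A>" "\<xi> \<in> IS" shows "ind_ext (cmult c a) \<xi> = (\<lambda>g. cscale c (ind_ext a \<xi> g))"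
proof (rule ext, rule ind_ext_eqI[of "\<lambda>n h. c * approx a n h"])
  fix g
  show "(\<lambda>n. rho_sum G (\<lambda>h. c * approx a n h)) \<longlonglongrightarrow> cmult c a"
    using tendsto_cmult[OF approx(2)[OF assms(1)]] by (simp add: rho_sum_scale approx(1) assms)
  show "(\<lambda>n. ind_rep G x (\<lambda>h. c * approx a n h) \<xi> g) \<longlonglongrightarrow> cscale c (ind_ext a \<xi> g)"
    using tendsto_cscale[OF ind_ext_tendsto[of "approx a", OF approx[OF assms(1)] assms(2)], of c g]
    by (simp add: ind_rep_scale approx(1) assms)
qed (simp_all add: approx(1) Cc_scale assms)

lemma J_ind_rep_ext_diff:
  assumes f: "f \<in> Cc G" and a: "a \<in> \<A>" and \<xi>: "\<xi> \<in> IS"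
  shows "norm (J (ind_rep G x f \<xi>) - J (ind_ext a \<xi>)) \<le> norm (rho_sum G f - a) * norm (J \<xi>)"
proof -
  have m: "cmult (-1) a \<in> \<A>" by (rule reduced_Cstar_cmult[OF a])
  have eq: "rho_sum G f - a = rho_sum G f + cmult (-1) a" by simp
  have d: "rho_sum G f - a \<in> \<A>"
    unfolding eq by (intro reduced_Cstar_add rho_sum_in_reduced f m)
  have "ind_ext (rho_sum G f - a) \<xi> = (\<lambda>g. ind_rep G x f \<xi> g - ind_ext a \<xi> g)"
    unfolding eq ind_ext_add[OF rho_sum_in_reduced[OF f] m \<xi>] ind_ext_cmult[OF a \<xi>] ind_ext_rho_sum[OF f \<xi>]
    by simp
  then show ?thesis
    using ind_ext_IS(2)[OF d \<xi>] by (simp add: J_diff ind_rep_bound(1) f \<xi> ind_ext_IS(1) a)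
qed

lemma J_ind_rep_tendsto:
  assumes f: "\<And>n. f n \<in> Cc G" "(\<lambda>n. rho_sum G (f n)) \<longlonglongrightarrow> a" and \<xi>: "\<xi> \<in> IS"
  shows "(\<lambda>n. J (ind_rep G x (f n) \<xi>)) \<longlonglongrightarrow> J (ind_ext a \<xi>)"
proof (rule LIM_zero_cancel, rule Lim_null_comparison)
  show "\<forall>\<^sub>F n in sequentially. norm (J (ind_rep G x (f n) \<xi>) - J (ind_ext a \<xi>)) \<le> norm (rho_sum G (f n) - a) * norm (J \<xi>)"
    by (intro always_eventually allI J_ind_rep_ext_diff f \<xi> reduced_Cstar_limit[of f, OF f])
  show "(\<lambda>n. norm (rho_sum G (f n) - a) * norm (J \<xi>)) \<longlonglongrightarrow> 0"
    by (rule tendsto_mult_left_zero[OF tendsto_norm_zero[OF LIM_zero[OF f(2)]]])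
qed

lemma ind_ext_mult:
  assumes a: "a \<in> \<A>" and b: "b \<in> \<A>" and \<xi>: "\<xi> \<in> IS"
  shows "ind_ext (a o\<^sub>L b) \<xi> = ind_ext a (ind_ext b \<xi>)"
proof (rule ext, rule ind_ext_eqI[of "\<lambda>n. conv (approx a n) (approx b n)"])
  fix g
  note A = approx[OF a] and B = approx[OF b]
  note \<eta> = ind_ext_IS(1)[OF b \<xi>]
  show "(\<lambda>n. rho_sum G (conv (approx a n) (approx b n))) \<longlonglongrightarrow> (a o\<^sub>L b)"
    using tendsto_blinfun_compose[OF A(2) B(2)] by (simp add: rho_sum_conv A(1) B(1))
  \<comment> \<open>The inner approximation is removed first: its error is at most the convergent
    norm of the outer approximant times a null sequence.\<close>
  have "(\<lambda>n. ind_rep G x (approx a n) (ind_rep G x (approx b n) \<xi>) g - ind_rep G x (approx a n) (ind_ext b \<xi>) g) \<longlonglongrightarrow> 0"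
  proof (rule Lim_null_comparison)
    show "(\<lambda>n. norm (rho_sum G (approx a n)) * norm (J (ind_rep G x (approx b n) \<xi>) - J (ind_ext b \<xi>))) \<longlonglongrightarrow> 0"
      using tendsto_mult[OF tendsto_norm[OF A(2)] tendsto_norm_zero[OF LIM_zero[OF J_ind_rep_tendsto[of "approx b", OF B \<xi>]]]]
      by simp
    have "norm (ind_rep G x (approx a n) (ind_rep G x (approx b n) \<xi>) g - ind_rep G x (approx a n) (ind_ext b \<xi>) g)
        \<le> norm (rho_sum G (approx a n)) * norm (J (ind_rep G x (approx b n) \<xi>) - J (ind_ext b \<xi>))" for n
    proof -
      note \<zeta> = ind_rep_bound(1)[OF B(1)[of n] \<xi>]
      show ?thesis
        using norm_ind_rep_le[OF A(1)[of n] IS_diff[OF \<zeta> \<eta>], of g]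
        unfolding ind_rep_diff_right J_diff[OF \<zeta> \<eta>] .
    qed
    then show "\<forall>\<^sub>F n in sequentially. norm (ind_rep G x (approx a n) (ind_rep G x (approx b n) \<xi>) g - ind_rep G x (approx a n) (ind_ext b \<xi>) g)
        \<le> norm (rho_sum G (approx a n)) * norm (J (ind_rep G x (approx b n) \<xi>) - J (ind_ext b \<xi>))"
      by (rule always_eventually[OF allI])
  qed
  from tendsto_add[OF this ind_ext_tendsto[of "approx a", OF A \<eta>, of g]]
  show "(\<lambda>n. ind_rep G x (conv (approx a n) (approx b n)) \<xi> g) \<longlonglongrightarrow> ind_ext a (ind_ext b \<xi>) g"
    by (simp add: ind_rep_conv A(1) B(1) \<xi>)
qed (simp_all add: conv_Cc approx(1) assms)

text \<open>Passing to adjoints does not increase the norm, so the stars of the approximants of a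
  approximate its adjoint b.\<close>

lemma ind_ext_adjoint:
  assumes a: "a \<in> \<A>" and ab: "adjoint_pair a b" and \<xi>: "\<xi> \<in> IS" and \<eta>: "\<eta> \<in> IS"
  shows "cinner (J (ind_ext a \<xi>)) (J \<eta>) = cinner (J \<xi>) (J (ind_ext b \<eta>))"
proof -
  note A = approx[OF a]
  have S: "star (approx a n) \<in> Cc G" for n by (rule star_Cc[OF A(1)])
  have "(\<lambda>n. rho_sum G (star (approx a n))) \<longlonglongrightarrow> b"
  proof (rule LIM_zero_cancel, rule Lim_null_comparison)
    show "(\<lambda>n. norm (rho_sum G (approx a n) - a)) \<longlonglongrightarrow> 0" by (rule tendsto_norm_zero[OF LIM_zero[OF A(2)]])
    show "\<forall>\<^sub>F n in sequentially. norm (rho_sum G (star (approx a n)) - b) \<le> norm (rho_sum G (approx a n) - a)"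
      by (intro always_eventually allI adjoint_pair_norm_le adjoint_pair_diff adjoint_rho_sum A ab)
  qed
  note B = J_ind_rep_tendsto[of "\<lambda>n. star (approx a n)", OF S this \<eta>]
  have "(\<lambda>n. cinner (J (ind_rep G x (approx a n) \<xi>)) (J \<eta>)) \<longlonglongrightarrow> cinner (J \<xi>) (J (ind_ext b \<eta>))"
    using tendsto_cinner[OF tendsto_const[of "J \<xi>"] B] by (simp add: ind_rep_adjoint A(1) \<xi> \<eta>)
  with tendsto_cinner[OF J_ind_rep_tendsto[of "approx a", OF A \<xi>] tendsto_const[of "J \<eta>"]]
  show ?thesis by (rule LIMSEQ_unique)
qed

lemma ind_bounded_op_ind_ext:
  assumes a: "a \<in> \<A>" shows "ind_bounded_op G x H \<pi> (ind_ext a)"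
  unfolding ind_bounded_op_def
proof (intro conjI ballI allI)
  fix \<xi> assume \<xi>: "\<xi> \<in> IS"
  note A = approx[OF a]
  show "ind_ext a \<xi> \<in> IS" by (rule ind_ext_IS(1)[OF a \<xi>])
  show "ind_ext a (\<lambda>g. \<xi> g + \<eta> g) = (\<lambda>g. ind_ext a \<xi> g + ind_ext a \<eta> g)" if \<eta>: "\<eta> \<in> IS" for \<eta>
  proof (rule ext, rule ind_ext_eqI[of "approx a", OF A IS_add[OF \<xi> \<eta>]])
    show "(\<lambda>n. ind_rep G x (approx a n) (\<lambda>g. \<xi> g + \<eta> g) g) \<longlonglongrightarrow> ind_ext a \<xi> g + ind_ext a \<eta> g" for g
      unfolding ind_rep_add_right by (intro tendsto_add ind_ext_tendsto A \<xi> \<eta>)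
  qed
  show "ind_ext a (\<lambda>g. cscale c (\<xi> g)) = (\<lambda>g. cscale c (ind_ext a \<xi> g))" for c
  proof (rule ext, rule ind_ext_eqI[of "approx a", OF A IS_scale[OF \<xi>]])
    show "(\<lambda>n. ind_rep G x (approx a n) (\<lambda>g. cscale c (\<xi> g)) g) \<longlonglongrightarrow> cscale c (ind_ext a \<xi> g)" for g
      unfolding ind_rep_scale_right by (intro tendsto_cscale ind_ext_tendsto A \<xi>)
  qed
next
  show "\<exists>B. \<forall>\<xi>\<in>IS. ind_norm G x (ind_ext a \<xi>) \<le> B * ind_norm G x \<xi>"
  proof (intro exI[of _ "norm a"] ballI)
    fix \<xi> assume \<xi>: "\<xi> \<in> IS"
    show "ind_norm G x (ind_ext a \<xi>) \<le> norm a * ind_norm G x \<xi>"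
      unfolding ind_norm_J[OF ISD(4)[OF \<xi>]] ind_norm_J[OF ISD(4)[OF ind_ext_IS(1)[OF a \<xi>]]]
      by (rule ind_ext_IS(2)[OF a \<xi>])
  qed
qed

theorem ind_extends_\<pi>: "ind_extends G x H \<pi>"
  unfolding ind_extends_def
proof (intro exI[of _ ind_ext] conjI ballI allI impI)
  fix a assume a: "a \<in> \<A>"
  show "ind_bounded_op G x H \<pi> (ind_ext a)" by (rule ind_bounded_op_ind_ext[OF a])
  show "ind_ext (op_scale c a) \<xi> = (\<lambda>g. cscale c (ind_ext a \<xi> g))" if "\<xi> \<in> IS" for c \<xi>
    using ind_ext_cmult[OF a that] by (simp add: op_scale_eq[OF reduced_Cstar_clinear[OF a]])
  fix b assume b: "b \<in> \<A>"
  fix \<xi> assume \<xi>: "\<xi> \<in> IS"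
  show "ind_ext (a + b) \<xi> = (\<lambda>g. ind_ext a \<xi> g + ind_ext b \<xi> g)" by (rule ind_ext_add[OF a b \<xi>])
  show "ind_ext (a o\<^sub>L b) \<xi> = ind_ext a (ind_ext b \<xi>)" by (rule ind_ext_mult[OF a b \<xi>])
  fix \<eta> assume "adjoint_pair a b" and \<eta>: "\<eta> \<in> IS"
  then show "ind_inner G x (ind_ext a \<xi>) \<eta> = ind_inner G x \<xi> (ind_ext b \<eta>)"
    using ind_ext_adjoint[OF a _ \<xi> \<eta>] J_inner ISD(4) ind_ext_IS(1) a b \<xi> \<eta> by metis
next
  show "ind_ext (rho_sum G f) \<xi> = ind_rep G x f \<xi>" if "f \<in> Cc G" "\<xi> \<in> IS" for f \<xi>
    by (rule ind_ext_rho_sum[OF that])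
qed

end

section \<open>Compressions of ideals\<close>

context etale_groupoid
begin

text \<open>Values are prescribed on all arrows with at least one end at x, not only on the source
  fibre: f vanishes on those with exactly one end at x.\<close>

lemma finitely_supported_extend_isotropy:
  assumes "c \<in> finitely_supported (\<Gamma> x)"
  obtains f where "f \<in> Cc G" "\<And>g. sc g = x \<or> rg g = x \<Longrightarrow> f g = c g"
proof -
  let ?S = "{g. c g \<noteq> 0}"
  have fin: "finite ?S" and sub: "?S \<subseteq> \<Gamma> x" using assms by (auto simp: finitely_supported_def)
  have "(\<lambda>h. \<Sum>g\<in>T. c g * bump g h) \<in> Cc G" if "T \<subseteq> ?S" for T
    using finite_subset[OF that fin] that
  proof (induction T rule: finite_induct)
    case (insert g T)
    then have "g \<in> Arr" using sub by (intro isotropyD(1)) blast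
    with insert show ?case by (simp add: Cc_add Cc_scale bump_Cc)
  qed (simp add: zero_in_Cc)
  then have "(\<lambda>h. \<Sum>g\<in>?S. c g * bump g h) \<in> Cc G" by blast
  moreover have "(\<Sum>g\<in>?S. c g * bump g h) = c h" if h: "sc h = x \<or> rg h = x" for h
  proof -
    have "(\<Sum>g\<in>?S. c g * bump g h) = (\<Sum>g\<in>?S. if g = h then c g else 0)"
    proof (rule sum.cong[OF refl])
      fix g assume "g \<in> ?S"
      then have g: "g \<in> \<Gamma> x" using sub by blast
      have "bump g h = (if h = g then 1 else 0)"
        by (rule bump_source[OF isotropyD(1)[OF g]]) (use isotropyD(2,3)[OF g] h in simp)
      then show "c g * bump g h = (if g = h then c g else 0)" by auto
    qed
    then show ?thesis using fin by simp
  qed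
  ultimately show thesis by (rule that)
qed

text \<open>Compression is not multiplicative in general. An f that vanishes on arrows with exactly
  one end at x satisfies P f P = P f = f P for the projection P onto the isotropy group, so products
  with such an f may be compressed factor by factor.\<close>

lemma group_algebra_operator:
  assumes c: "c \<in> group_algebra (isotropy G x)"
  obtains f where "f \<in> Cc G" "left_regular (isotropy G x) c = compress x (rho_sum G f)"
    "\<And>a. compress x (rho_sum G f) o\<^sub>L compress x a = compress x (rho_sum G f o\<^sub>L a)"
    "\<And>a. compress x a o\<^sub>L compress x (rho_sum G f) = compress x (a o\<^sub>L rho_sum G f)"
proof -
  have c': "c \<in> finitely_supported (\<Gamma> x)" using c by (simp add: group_algebra_eq)
  then have c0: "c g = 0" if "g \<notin> \<Gamma> x" for g using that by (auto simp: finitely_supported_def)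
  obtain f where f: "f \<in> Cc G" "\<And>g. sc g = x \<or> rg g = x \<Longrightarrow> f g = c g"
    by (rule finitely_supported_extend_isotropy[OF c']) (rule that)
  let ?P = "restrict_op (\<Gamma> x)" and ?f = "rho_sum G f"
  note k = has_kernel_apply[OF rho_sum_kernel[OF f(1)]]
  have PP: "?P o\<^sub>L ?P = ?P" by (simp add: restrict_op_compose)
  have "(\<lambda>g. if g \<in> \<Gamma> x then f g else 0) = c"
  proof
    fix g show "(if g \<in> \<Gamma> x then f g else 0) = c g"
      using f(2)[of g] isotropyD(2)[of g x] c0[of g] by (cases "g \<in> \<Gamma> x") simp_all
  qed
  then have L: "left_regular (isotropy G x) c = compress x ?f"
    using compress_rho_sum[OF f(1), of x] by simp
  have left: "?P o\<^sub>L ?f o\<^sub>L ?P = ?P o\<^sub>L ?f"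
  proof (rule clinear_op_eqI)
    fix g
    have "Rep_ell2 (?P (?f (delta g))) k = 0" if g: "g \<notin> \<Gamma> x" for k
    proof (cases "k \<in> \<Gamma> x \<and> g \<in> Arr \<and> sc g = x")
      case True
      note kA = isotropyD[of k x]
      have "k \<odot> iv g \<notin> \<Gamma> x"
      proof
        assume h: "k \<odot> iv g \<in> \<Gamma> x"
        have "rg g = sc (k \<odot> iv g)" using True kA by simp
        then show False using isotropyD(2)[OF h] True g by (simp add: isotropy_iff)
      qed
      moreover have "rg (k \<odot> iv g) = x" using True kA by simp
      ultimately have "f (k \<odot> iv g) = 0" using f(2) c0 by simp
      then show ?thesis by (simp add: Rep_restrict_op k)
    next
      case False
      have "sc k = x" if "k \<in> \<Gamma> x" using isotropyD(2)[OF that] .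
      then show ?thesis using False by (auto simp: Rep_restrict_op k)
    qed
    then have "?P (?f (delta g)) = 0" if "g \<notin> \<Gamma> x"
      using that by (intro Rep_ell2_cong) (simp add: Rep_ell2_simps)
    then show "(?P o\<^sub>L ?f o\<^sub>L ?P) (delta g) = (?P o\<^sub>L ?f) (delta g)"
      by (simp add: restrict_op_delta)
  qed (intro clinear_op_compose clinear_op_restrict_op clinear_op_rho_sum f(1))+
  have right: "?P o\<^sub>L ?f o\<^sub>L ?P = ?f o\<^sub>L ?P"
  proof (rule clinear_op_eqI)
    fix g
    have "Rep_ell2 (?f (delta g)) k = 0" if g: "g \<in> \<Gamma> x" and kn: "k \<notin> \<Gamma> x" for k
    proof (cases "k \<in> Arr \<and> sc k = x")
      case True
      note gA = isotropyD[OF g]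
      have "k \<odot> iv g \<notin> \<Gamma> x"
      proof
        assume h: "k \<odot> iv g \<in> \<Gamma> x"
        have "rg k = rg (k \<odot> iv g)" using True gA by simp
        then show False using isotropyD(3)[OF h] True kn by (simp add: isotropy_iff)
      qed
      moreover have "sc (k \<odot> iv g) = x" using True gA by simp
      ultimately have "f (k \<odot> iv g) = 0" using f(2) c0 by simp
      then show ?thesis by (simp add: k)
    next
      case False
      then show ?thesis using isotropyD(2)[OF g] by (auto simp: k)
    qed
    then have "?P (?f (delta g)) = ?f (delta g)" if "g \<in> \<Gamma> x"
      using that by (intro Rep_ell2_cong) (simp add: Rep_restrict_op)
    then show "(?P o\<^sub>L ?f o\<^sub>L ?P) (delta g) = (?f o\<^sub>L ?P) (delta g)"
      by (simp add: restrict_op_delta)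
  qed (intro clinear_op_compose clinear_op_restrict_op clinear_op_rho_sum f(1))+
  show thesis
  proof (rule that[OF f(1) L])
    fix a
    have "compress x ?f o\<^sub>L compress x a = ?P o\<^sub>L ?f o\<^sub>L (?P o\<^sub>L ?P) o\<^sub>L a o\<^sub>L ?P"
      by (simp only: compress_def blinfun_compose_assoc)
    also have "\<dots> = compress x (?f o\<^sub>L a)"
      by (simp only: PP left) (simp only: compress_def blinfun_compose_assoc)
    finally show "compress x ?f o\<^sub>L compress x a = compress x (?f o\<^sub>L a)" .
    have "compress x a o\<^sub>L compress x ?f = ?P o\<^sub>L a o\<^sub>L (?P o\<^sub>L ?P o\<^sub>L ?f o\<^sub>L ?P)"
      by (simp only: compress_def blinfun_compose_assoc)
    also have "\<dots> = compress x (a o\<^sub>L ?f)"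
      by (simp only: PP right) (simp only: compress_def blinfun_compose_assoc)
    finally show "compress x a o\<^sub>L compress x ?f = compress x (a o\<^sub>L ?f)" .
  qed
qed

lemma tendsto_compress:
  assumes "T \<longlonglongrightarrow> a" shows "(\<lambda>n. compress x (T n)) \<longlonglongrightarrow> compress x a"
  unfolding compress_def by (intro tendsto_blinfun_compose tendsto_const assms)

lemma compress_in_reduced_group_Cstar:
  assumes a: "a \<in> \<A>" shows "compress x a \<in> reduced_group_Cstar (isotropy G x)"
proof -
  obtain f where f: "\<And>n. f n \<in> Cc G" "(\<lambda>n. rho_sum G (f n)) \<longlonglongrightarrow> a"
    by (rule reduced_Cstar_sequence[OF a]) (rule that)
  have "compress x (rho_sum G (f n)) \<in> left_regular (isotropy G x) ` group_algebra (isotropy G x)" for n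
    unfolding compress_rho_sum[OF f(1), symmetric] group_algebra_eq
    by (intro imageI Cc_restrict_isotropy f(1))
  then show ?thesis
    unfolding reduced_group_Cstar_def closure_sequential
    using tendsto_compress[OF f(2), of x] by (intro exI[of _ "\<lambda>n. compress x (rho_sum G (f n))"]) simp
qed

text \<open>Multiplying a compressed element of I by an element of the group algebra gives a
  compressed element of I again, by \<open>group_algebra_operator\<close>. Both factors of a general
  product are limits of such elements.\<close>

lemma closed_ideal_compress:
  assumes I: "closed_ideal \<A> I"
  shows "closed_ideal (reduced_group_Cstar (isotropy G x)) (closure (compress x ` I))"
proof -
  let ?R = "reduced_group_Cstar (isotropy G x)" and ?J = "closure (compress x ` I)"
  have IA: "a \<in> I \<Longrightarrow> a \<in> \<A>" and I0: "0 \<in> I" and Ia: "a \<in> I \<Longrightarrow> b \<in> I \<Longrightarrow> a + b \<in> I"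
    and Im: "a \<in> \<A> \<Longrightarrow> b \<in> I \<Longrightarrow> (a o\<^sub>L b) \<in> I \<and> (b o\<^sub>L a) \<in> I" for a b
    using I by (auto simp: closed_ideal_def)
  have R: "closed ?R" by (simp add: reduced_group_Cstar_def)
  have J: "closed ?J" by simp
  have base: "compress x a \<in> ?J" if "a \<in> I" for a
    using that closure_subset[of "compress x ` I"] by blast
  have seq: "\<exists>a. (\<forall>n. a n \<in> I) \<and> (\<lambda>n. compress x (a n)) \<longlonglongrightarrow> T" if T: "T \<in> ?J" for T
  proof -
    obtain t where t: "\<And>n. t n \<in> compress x ` I" "t \<longlonglongrightarrow> T" by (rule closure_sequenceE[OF T]) (rule that)
    from t(1) have "\<forall>n. \<exists>a. a \<in> I \<and> t n = compress x a" by blast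
    from choice[OF this] obtain a where a: "\<forall>n. a n \<in> I \<and> t n = compress x (a n)" ..
    then have "t = (\<lambda>n. compress x (a n))" by auto
    then show ?thesis using a t(2) by auto
  qed
  have sub: "?J \<subseteq> ?R"
    by (rule closure_minimal[OF _ R]) (use compress_in_reduced_group_Cstar IA in blast)
  have add: "S + T \<in> ?J" if ST: "S \<in> ?J" "T \<in> ?J" for S T
  proof -
    obtain a where a: "\<forall>n. a n \<in> I" "(\<lambda>n. compress x (a n)) \<longlonglongrightarrow> S" using seq[OF ST(1)] by blast
    obtain b where b: "\<forall>n. b n \<in> I" "(\<lambda>n. compress x (b n)) \<longlonglongrightarrow> T" using seq[OF ST(2)] by blast
    show ?thesis
    proof (rule closed_sequentially[OF J])
      show "compress x (a n + b n) \<in> ?J" for n by (intro base Ia) (use a b in simp_all)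
      show "(\<lambda>n. compress x (a n + b n)) \<longlonglongrightarrow> S + T"
        unfolding compress_simps by (intro tendsto_add a b)
    qed
  qed
  have scale: "op_scale c T \<in> ?J" if T: "T \<in> ?J" for c T
  proof -
    obtain a where a: "\<forall>n. a n \<in> I" "(\<lambda>n. compress x (a n)) \<longlonglongrightarrow> T" using seq[OF T] by blast
    have "clinear_op T"
      by (rule clinear_op_limit[OF clinear_op_compress[OF reduced_Cstar_clinear[OF IA]] a(2)]) (use a in simp)
    moreover have "cmult c T \<in> ?J"
    proof (rule closed_sequentially[OF J])
      show "compress x (cmult c (a n)) \<in> ?J" for n by (intro base ideal_cmult[OF I]) (use a in simp)
      show "(\<lambda>n. compress x (cmult c (a n))) \<longlonglongrightarrow> cmult c T"
        unfolding compress_simps by (rule tendsto_cmult[OF a(2)])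
    qed
    ultimately show ?thesis by (simp add: op_scale_eq)
  qed
  have mult: "(S o\<^sub>L T) \<in> ?J \<and> (T o\<^sub>L S) \<in> ?J" if S: "S \<in> ?R" and T: "T \<in> ?J" for S T
  proof -
    obtain a where a: "\<forall>n. a n \<in> I" "(\<lambda>n. compress x (a n)) \<longlonglongrightarrow> T" using seq[OF T] by blast
    obtain s where s: "\<And>n. s n \<in> left_regular (isotropy G x) ` group_algebra (isotropy G x)" "s \<longlonglongrightarrow> S"
      by (rule closure_sequenceE[OF S[unfolded reduced_group_Cstar_def]]) (rule that)
    have "(s n o\<^sub>L compress x (a n)) \<in> ?J \<and> (compress x (a n) o\<^sub>L s n) \<in> ?J" for n
    proof -
      obtain c where c: "c \<in> group_algebra (isotropy G x)" "s n = left_regular (isotropy G x) c"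
        using s(1)[of n] by blast
      obtain f where f: "f \<in> Cc G" "left_regular (isotropy G x) c = compress x (rho_sum G f)"
        "\<And>a. compress x (rho_sum G f) o\<^sub>L compress x a = compress x (rho_sum G f o\<^sub>L a)"
        "\<And>a. compress x a o\<^sub>L compress x (rho_sum G f) = compress x (a o\<^sub>L rho_sum G f)"
        by (rule group_algebra_operator[OF c(1)]) (rule that)
      have an: "a n \<in> I" using a(1) by blast
      show ?thesis
        unfolding c(2) f(2) f(3) f(4) using Im[OF rho_sum_in_reduced[OF f(1)] an] base by blast
    qed
    then have st: "(s n o\<^sub>L compress x (a n)) \<in> ?J" "(compress x (a n) o\<^sub>L s n) \<in> ?J" for n by blast+
    show ?thesis
      by (intro conjI closed_sequentially[OF J st(1) tendsto_blinfun_compose[OF s(2) a(2)]]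
          closed_sequentially[OF J st(2) tendsto_blinfun_compose[OF a(2) s(2)]])
  qed
  have "0 \<in> ?J" using base[OF I0] by (simp add: compress_simps)
  then show ?thesis unfolding closed_ideal_def using sub J add scale mult by blast
qed

text \<open>The vector a \<delta> at x may have no coordinate in the isotropy group. Multiplying by
  the star of the bump function at an arrow g of its support moves the coordinate at g to x and
  stays in I.\<close>

lemma compress_nonzero:
  assumes I: "closed_ideal \<A> I" and a: "a \<in> I" "a (delta x) \<noteq> 0" and x: "x \<in> Obj"
  obtains b where "b \<in> I" "compress x b \<noteq> 0"
proof -
  have aA: "a \<in> \<A>" using I a(1) by (auto simp: closed_ideal_def)
  have "\<exists>g. Rep_ell2 (a (delta x)) g \<noteq> 0"
    using a(2) Rep_ell2_cong[of "a (delta x)" 0] by (auto simp: Rep_ell2_simps)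
  then obtain g where g: "Rep_ell2 (a (delta x)) g \<noteq> 0" ..
  note gA = reduced_Cstar_support[OF aA g]
  have xu: "sc x = x" "rg x = x" using isotropyD[OF isotropy_one[OF x]] by simp_all
  note C = bump_Cc[OF gA(2)]
  let ?b = "rho_sum G (star (bump g)) o\<^sub>L a"
  have "rho_sum G (bump g) (delta x) = delta g"
  proof (rule Rep_ell2_cong)
    fix k
    have "k \<odot> iv x = k" if "k \<in> Arr" "sc k = x"
      using that unit_inv[OF x] mult_source[of k] by simp
    moreover have "bump g k = (if k = g then 1 else 0)" if "sc k = x"
      using bump_source[OF gA(2), of k] that gA(3) xu by simp
    ultimately show "Rep_ell2 (rho_sum G (bump g) (delta x)) k = Rep_ell2 (delta g) k"
      using gA xu by (auto simp: has_kernel_apply[OF rho_sum_kernel[OF C]] Rep_ell2_simps)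
  qed
  then have "Rep_ell2 (?b (delta x)) x = Rep_ell2 (a (delta x)) g"
    using adjoint_pairD[OF adjoint_rho_sum[OF C], of "delta x" "a (delta x)"]
    by (simp add: cinner_delta_left)
  then have "Rep_ell2 (compress x ?b (delta x)) x \<noteq> 0"
    using g isotropy_one[OF x] by (simp add: Rep_compress_delta)
  then have "compress x ?b \<noteq> 0" by (auto simp: Rep_ell2_simps)
  moreover have "?b \<in> I"
    using I a(1) rho_sum_in_reduced[OF star_Cc[OF C]] by (auto simp: closed_ideal_def)
  ultimately show thesis by (rule that[rotated])
qed

end

section \<open>Lower bounds for the exotic norm\<close>

lemma unitary_rep_sum_le:
  assumes "unitary_rep \<Gamma> H \<pi>" "c \<in> group_algebra \<Gamma>" "u \<in> H" "norm u \<le> 1"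
  shows "norm (\<Sum>\<gamma> | c \<gamma> \<noteq> 0. cscale (c \<gamma>) (\<pi> \<gamma> u)) \<le> (\<Sum>\<gamma> | c \<gamma> \<noteq> 0. cmod (c \<gamma>))"
proof (rule sum_norm_le)
  fix \<gamma> assume "\<gamma> \<in> {\<gamma>. c \<gamma> \<noteq> 0}"
  then have "\<gamma> \<in> carrier \<Gamma>" using assms(2) by (auto simp: group_algebra_def)
  then have "norm (\<pi> \<gamma> u) = norm u" using assms(1,3) by (simp add: unitary_rep_def)
  then show "norm (cscale (c \<gamma>) (\<pi> \<gamma> u)) \<le> cmod (c \<gamma>)"
    using mult_left_mono[OF assms(4), of "cmod (c \<gamma>)"] by simp
qed

text \<open>The sum of the moduli of the coefficients bounds the set from above; without such a
  bound the real \<open>Sup\<close> would say nothing. The same constant serves for every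
  representation and hence for the exotic norm.\<close>

lemma rep_norm_ge:
  assumes "unitary_rep \<Gamma> H \<pi>" "c \<in> group_algebra \<Gamma>" "u \<in> H" "norm u \<le> 1"
  shows "norm (\<Sum>\<gamma> | c \<gamma> \<noteq> 0. cscale (c \<gamma>) (\<pi> \<gamma> u)) \<le> rep_norm H \<pi> c"
  unfolding rep_norm_def
  by (rule cSup_upper, use assms(3,4) in blast,
      rule bdd_aboveI[of _ "\<Sum>\<gamma> | c \<gamma> \<noteq> 0. cmod (c \<gamma>)"], use unitary_rep_sum_le[OF assms(1,2)] in blast)

lemma rep_norm_le:
  assumes r: "unitary_rep \<Gamma> H \<pi>" and c: "c \<in> group_algebra \<Gamma>"
  shows "rep_norm H \<pi> c \<le> (\<Sum>\<gamma> | c \<gamma> \<noteq> 0. cmod (c \<gamma>))"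
proof -
  have "0 \<in> H" using r by (simp add: unitary_rep_def)
  then have "{norm (\<Sum>\<gamma> | c \<gamma> \<noteq> 0. cscale (c \<gamma>) (\<pi> \<gamma> v)) | v. v \<in> H \<and> norm v \<le> 1} \<noteq> {}" by force
  then show ?thesis
    unfolding rep_norm_def by (rule cSup_least) (use unitary_rep_sum_le[OF r c] in blast)
qed

lemma exotic_norm_ge:
  fixes G :: "'g top_groupoid" and H :: "('g \<times> nat) ell2 set"
  assumes \<pi>: "unitary_rep (isotropy G x) H \<pi>" "ind_extends G x H \<pi>"
    and c: "c \<in> group_algebra (isotropy G x)" and u: "u \<in> H" "norm u \<le> 1"
  shows "norm (\<Sum>\<gamma> | c \<gamma> \<noteq> 0. cscale (c \<gamma>) (\<pi> \<gamma> u)) \<le> exotic_norm G x c"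
proof (rule order_trans[OF rep_norm_ge[OF \<pi>(1) c u]])
  show "rep_norm H \<pi> c \<le> exotic_norm G x c"
    unfolding exotic_norm_def
    by (rule cSup_upper, use \<pi> in blast,
      rule bdd_aboveI[of _ "\<Sum>\<gamma> | c \<gamma> \<noteq> 0. cmod (c \<gamma>)"], use rep_norm_le[OF _ c] in blast)
qed

context unit_state
begin

text \<open>A substitute for a unit of the reduced algebra: a function equal to 1 near x. Locality
  gives it the same value of \<phi> as the identity, and its compression is the unit of the group
  algebra.\<close>

lemma unit_near:
  obtains u where "u \<in> Cc G" "\<phi> (rho_sum G u) = 1" "\<Phi> (rho_sum G u) = \<psi> x"
    "compress x (rho_sum G u) = restrict_op (\<Gamma> x)"
proof -
  have xA: "x \<in> Arr" "sc x = x" "rg x = x" using isotropyD[OF isotropy_one[OF x]] by simp_all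
  have A: "openin X Arr" using openin_topspace[of X] by simp
  obtain F :: "'g \<Rightarrow> real" and K N where F:
    "continuous_map (unit_space G) euclideanreal F" "compactin X K" "K \<subseteq> Arr \<inter> Obj"
    "\<And>y. y \<notin> K \<Longrightarrow> F y = 0" "openin X N" "x \<in> N" "\<And>y. y \<in> N \<Longrightarrow> F y = 1"
    by (rule unit_bump[OF A xA(1) x]) (rule that)
  define u where "u y = complex_of_real (F y)" for y
  have u: "cc_on Obj u" unfolding u_def using F(3) by (intro unit_function(2)[OF F(1,2) _ F(4)]) auto
  have uC: "u \<in> Cc G" by (rule cc_on_in_Cc[OF u])
  have u1: "u x = 1" by (simp add: u_def F(6,7))
  note d = unit_operator_delta[OF u]
  have "\<phi> (rho_sum G u - id_blinfun) = 0"
  proof (rule \<phi>_local)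
    fix e :: real assume "0 < e"
    have "corner N (rho_sum G u) = corner N id_blinfun"
      by (intro clinear_op_eqI clinear_op_compose clinear_op_restrict_op clinear_op_rho_sum[OF uC] clinear_op_id)
        (auto simp: restrict_op_delta d u_def F(7) clinear_op_cscale)
    then have "corner N (rho_sum G u - id_blinfun) = 0" by (simp only: corner_linear diff_self)
    then show "\<exists>N. openin X N \<and> x \<in> N \<and> norm (corner N (rho_sum G u - id_blinfun)) \<le> e"
      using F(5,6) \<open>0 < e\<close> by (intro exI[of _ N]) simp
  qed
  then have 1: "\<phi> (rho_sum G u) = 1" by (simp add: linear_diff[OF lin] \<phi>_id)
  have "{\<gamma>. \<gamma> \<in> \<Gamma> x \<and> u \<gamma> \<noteq> 0} = {x}"
  proof -
    have "\<gamma> = x" if \<gamma>: "\<gamma> \<in> \<Gamma> x" "u \<gamma> \<noteq> 0" for \<gamma>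
      using unit_source[OF cc_on_subset[OF u \<gamma>(2)]] isotropyD(2)[OF \<gamma>(1)] by simp
    then show ?thesis using isotropy_one[OF x] u1 by auto
  qed
  then have 2: "\<Phi> (rho_sum G u) = \<psi> x" by (simp add: \<Phi>_Cc[OF uC] u1)
  have 3: "compress x (rho_sum G u) = restrict_op (\<Gamma> x)"
  proof (rule clinear_op_eqI)
    show "compress x (rho_sum G u) (delta g) = restrict_op (\<Gamma> x) (delta g)" for g
      using isotropyD(1)[of g x] isotropyD(3)[of g x] by (simp add: compress_def restrict_op_delta d u1)
  qed (simp_all add: clinear_op_compress clinear_op_rho_sum uC)
  show thesis by (rule that[OF uC 1 2 3])
qed

lemma norm_v_unit: "norm (v x) = 1"
proof -
  have xA: "x \<in> Arr" "sc x = x" "rg x = x" using isotropyD[OF isotropy_one[OF x]] by simp_all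
  obtain u where u: "\<phi> (rho_sum G u) = 1" "\<Phi> (rho_sum G u) = \<psi> x" by (rule unit_near) (rule that)
  have "iv x \<odot> x = x" using xA by (simp add: inv_mult)
  then have "complex_of_real ((norm (v x))\<^sup>2) = \<psi> x"
    using cinner_v[of x x] isotropy_one[OF x] by (simp add: cinner_self kern_def)
  then have "(norm (v x))\<^sup>2 = 1" using u by (metis Re_\<Phi> Re_complex_of_real)
  then show ?thesis using power2_eq_iff_nonneg[of "norm (v x)" 1] by simp
qed

text \<open>\<phi> is the real part of the vector functional of the unit vector v x in the
  representation \<pi>, evaluated at the restriction of f. Since the induced representation of \<pi>
  extends, the exotic norm of the restriction bounds it, and this equals the norm of the
  compression.\<close>

lemma \<phi>_le_compress:
  assumes e: "exotic_eq_reduced G x" and f: "f \<in> Cc G"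
  shows "\<phi> (rho_sum G f) \<le> norm (compress x (rho_sum G f))"
proof -
  have xA: "x \<in> Arr" "sc x = x" "rg x = x" using isotropyD[OF isotropy_one[OF x]] by simp_all
  define c where "c g = (if g \<in> \<Gamma> x then f g else 0)" for g
  have c: "c \<in> group_algebra (isotropy G x)"
    unfolding c_def group_algebra_eq by (rule Cc_restrict_isotropy[OF f])
  have supp: "{\<gamma>. c \<gamma> \<noteq> 0} = {\<gamma>. \<gamma> \<in> \<Gamma> x \<and> f \<gamma> \<noteq> 0}" by (auto simp: c_def)
  let ?s = "\<Sum>\<gamma> | c \<gamma> \<noteq> 0. cscale (c \<gamma>) (\<pi> \<gamma> (v x))"
  have "\<Phi> (rho_sum G f) = cinner (v x) ?s"
    unfolding \<Phi>_Cc[OF f] cinner_sum_right supp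
  proof (rule sum.cong[OF refl])
    fix \<gamma> assume "\<gamma> \<in> {\<gamma>. \<gamma> \<in> \<Gamma> x \<and> f \<gamma> \<noteq> 0}"
    then have \<gamma>: "\<gamma> \<in> \<Gamma> x" by blast
    have "\<gamma> \<odot> x = \<gamma>" using isotropyD[OF \<gamma>] mult_source[of \<gamma>] by simp
    moreover have "iv x \<odot> \<gamma> = \<gamma>"
      using isotropyD[OF \<gamma>] xA range_mult[of \<gamma>] cancel(1)[of x \<gamma>] by simp
    ultimately have "cinner (v x) (\<pi> \<gamma> (v x)) = \<psi> \<gamma>"
      using \<pi>(2)[OF \<gamma> isotropy_one[OF x]] \<gamma> isotropy_one[OF x] by (simp add: cinner_v kern_def)
    then show "f \<gamma> * \<psi> \<gamma> = cinner (v x) (cscale (c \<gamma>) (\<pi> \<gamma> (v x)))"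
      using \<gamma> by (simp add: cinner_cscale_right c_def)
  qed
  then have "\<phi> (rho_sum G f) = Re (cinner (v x) ?s)" by (metis Re_\<Phi>)
  also have "\<dots> \<le> norm (v x) * norm ?s"
    by (rule order_trans[OF complex_Re_le_cmod norm_cinner_le])
  also have "\<dots> \<le> exotic_norm G x c"
    unfolding norm_v_unit mult_1
    by (rule exotic_norm_ge[OF unitary_rep_\<pi> ind_extends_\<pi> c])
      (simp_all add: norm_v_unit H_closed(6) isotropy_one[OF x])
  also have "\<dots> = norm (left_regular (isotropy G x) c)"
    using e c by (simp add: exotic_eq_reduced_def)
  also have "\<dots> = norm (compress x (rho_sum G f))"
    unfolding c_def compress_rho_sum[OF f] ..
  finally show ?thesis .
qed

text \<open>If the compression of \<open>I\<close> is not zero, then by simplicity it comes close to the unit of the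
  reduced group algebra. But \<open>\<phi>\<close> vanishes on \<open>I\<close>, takes the value \<open>1\<close> at a function that is \<open>1\<close>
  near \<open>x\<close>, and is bounded by the norm of the compression.\<close>

lemma ideal_vanishes:
  assumes I: "closed_ideal \<A> I" "\<And>a. a \<in> I \<Longrightarrow> \<phi> a = 0"
    and simple: "Cstar_simple (isotropy G x)" and e: "exotic_eq_reduced G x" and a: "a \<in> I"
  shows "a (delta x) = 0"
proof (rule ccontr)
  assume nz: "a (delta x) \<noteq> 0"
  let ?J = "closure (compress x ` I)" and ?R = "reduced_group_Cstar (isotropy G x)"
  obtain b where b: "b \<in> I" "compress x b \<noteq> 0" by (rule compress_nonzero[OF I(1) a nz x]) (rule that)
  have "compress x b \<in> ?J" using b(1) closure_subset[of "compress x ` I"] by blast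
  then have "?J \<noteq> {0}" using b(2) by blast
  then have J: "?J = ?R"
    using simple closed_ideal_compress[OF I(1), of x] unfolding Cstar_simple_def simple_algebra_def by blast
  obtain u where u: "u \<in> Cc G" "\<phi> (rho_sum G u) = 1" "compress x (rho_sum G u) = restrict_op (\<Gamma> x)"
    by (rule unit_near) (rule that)
  have "compress x (rho_sum G u) \<in> ?J"
    unfolding J by (rule compress_in_reduced_group_Cstar[OF rho_sum_in_reduced[OF u(1)]])
  \<comment> \<open>Two errors below 1/3, one for the compressed ideal element and one for its
    approximation by a function, would leave \<phi> above 2/3 on a function whose compression has
    norm below 2/3.\<close>
  then obtain T where T: "T \<in> compress x ` I" "dist T (compress x (rho_sum G u)) < 1/3"
    unfolding closure_approachable by (meson zero_less_divide_1_iff zero_less_numeral)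
  then obtain d where d: "d \<in> I" "norm (compress x d - compress x (rho_sum G u)) < 1/3"
    by (auto simp: dist_norm)
  have dA: "d \<in> \<A>" using I(1) d(1) by (auto simp: closed_ideal_def)
  \<comment> \<open>\<open>\<phi>_le_compress\<close> speaks of functions in \<open>Cc G\<close>, so
    the ideal element d is replaced by a nearby one.\<close>
  obtain f where f: "f \<in> Cc G" "norm (d - rho_sum G f) < 1/3"
    by (rule reduced_Cstar_approx[OF dA, of "1/3"]) (use that in auto)
  have "\<phi> (rho_sum G f - d) \<le> norm (d - rho_sum G f)"
    using \<phi>_le[of "rho_sum G f - d"] by (simp add: norm_minus_commute)
  then have "\<phi> (rho_sum G f) < 1/3" using f(2) I(2)[OF d(1)] by (simp add: linear_diff[OF lin])
  then have "2/3 < \<phi> (rho_sum G (\<lambda>g. u g - f g))"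
    by (simp add: rho_sum_diff u f linear_diff[OF lin])
  also have "\<dots> \<le> norm (compress x (rho_sum G (\<lambda>g. u g - f g)))"
    by (rule \<phi>_le_compress[OF e Cc_diff[OF u(1) f(1)]])
  also have "\<dots> = norm ((compress x (rho_sum G u) - compress x d) + compress x (d - rho_sum G f))"
    by (simp add: rho_sum_diff u(1) f(1) compress_simps)
  also have "\<dots> \<le> norm (compress x (rho_sum G u) - compress x d) + norm (compress x (d - rho_sum G f))"
    by (rule norm_triangle_ineq)
  also have "\<dots> < 1/3 + 1/3"
    using d(2) f(2) norm_compress[of x "d - rho_sum G f"] by (simp add: norm_minus_commute)
  finally show False by simp
qed

end

theorem theorem4p3:
  fixes G :: "'g top_groupoid" and I :: "('g ell2 \<Rightarrow>\<^sub>L 'g ell2) set"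
  assumes "locally_compact_etale_groupoid G"
    and "Hausdorff_space (gtop G) \<or> countable_open_bisection_cover G"
    and "unit_space G closure_of
           {x \<in> gunits G. Cstar_simple (isotropy G x) \<and> exotic_eq_reduced G x} = gunits G"
    and "closed_ideal (reduced_Cstar G) I"
    and "C0_units G \<inter> I = {0}"
  shows "I \<subseteq> singular_ideal G"
proof
  fix a assume a: "a \<in> I"
  interpret etale_groupoid G by unfold_locales (rule assms(1))
  have "a \<in> reduced_Cstar G" using a assms(4) by (auto simp: closed_ideal_def)
  then show "a \<in> singular_ideal G"
  proof (rule singular_ideal_criterion[OF assms(2) _ assms(3)])
    fix x assume "x \<in> {x \<in> gunits G. Cstar_simple (isotropy G x) \<and> exotic_eq_reduced G x}"
    then have x: "x \<in> gunits G" "Cstar_simple (isotropy G x)" "exotic_eq_reduced G x" by auto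
    show "a (delta x) = 0"
    proof (rule local_state[OF assms(4,5) x(1)])
      fix \<phi> :: "('g ell2 \<Rightarrow>\<^sub>L 'g ell2) \<Rightarrow> real"
      assume \<phi>: "linear \<phi>" "\<And>T. \<phi> T \<le> norm T" "\<phi> id_blinfun = 1"
        "\<And>a. a \<in> I \<Longrightarrow> \<phi> a = 0"
        "\<And>T. (\<And>e. 0 < e \<Longrightarrow> \<exists>N. openin X N \<and> x \<in> N \<and> norm (corner N T) \<le> e) \<Longrightarrow> \<phi> T = 0"
      have "unit_state G x \<phi>"
        by (rule unit_state.intro[OF etale_groupoid_axioms unit_state_axioms.intro[OF x(1) \<phi>(1,2,3,5)]])
      then show "a (delta x) = 0"
        by (rule unit_state.ideal_vanishes[OF _ assms(4) \<phi>(4) x(2,3) a])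
    qed
  qed
qed

end
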